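(* Let $n\in\mathbb N$, $\tau>0$ and (no inertial term) $\mu=0$. Let $$A(D):=\begin{pmatrix}0&1&0&0\\-\Delta^2&0&-\Delta&0\\0&\Delta&0&-\operatorname{div}\\0&0&-\frac1\tau\nabla&-\frac1\tau\end{pmatrix},$$ and for $p\in(1,\infty)$ let $X_p:=W_p^2(\mathbb R^n)\times L^p(\mathbb R^n)\times L^p(\mathbb R^n)\times L^p(\mathbb R^n;\mathbb C^n)$ and let $A_p$ be the operator in $X_p$ with maximal domain $D(A_p):=\{U\in X_p:A(D)U\in X_p\}$ and $A_pU:=A(D)U$. a) Let $p=2$. Then the operator $A_2$ generates a $C_0$-semigroup in $X_2$ but no analytic semigroup. b) Let $p\in(1,\infty)\setminus\{2\}$. Then $A_p$ does not generate a $C_0$-semigroup in $X_p$.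
   Context: $A(D)$ acts on $U=(u,v,\theta,q)^\top$, with $u,v,\theta$ scalar and $q$ a $\mathbb C^n$-valued tempered distribution on $\mathbb R^n$. $W_p^k(\mathbb R^n)$ are the usual (complex-valued) Sobolev spaces. The system arises from the thermoelastic plate equation with Cattaneo–Maxwell heat conduction, $u_{tt}+\Delta^2u+\Delta\theta=0$, $\theta_t+\operatorname{div}q-\Delta u_t=0$, $\tau q_t+q+\nabla\theta=0$, with $v=u_t$. *)

theory Defs
  imports "HOL-Analysis.Analysis"
begin

section \<open>Complex vector spaces\<close>

class complex_vector = ab_group_add +
  fixes scaleC :: "complex \<Rightarrow> 'a \<Rightarrow> 'a"  (infixr "*\<^sub>C" 75)
  assumes scaleC_add_right: "a *\<^sub>C (x + y) = a *\<^sub>C x + a *\<^sub>C y"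
    and scaleC_add_left: "(a + b) *\<^sub>C x = a *\<^sub>C x + b *\<^sub>C x"
    and scaleC_scaleC: "a *\<^sub>C (b *\<^sub>C x) = (a * b) *\<^sub>C x"
    and scaleC_one: "1 *\<^sub>C x = x"

instantiation prod :: (complex_vector, complex_vector) complex_vector
begin

definition scaleC_prod_def: "c *\<^sub>C x = (c *\<^sub>C fst x, c *\<^sub>C snd x)"

instance
  by standard
    (simp_all add: scaleC_prod_def scaleC_add_right scaleC_add_left scaleC_scaleC scaleC_one)

end

instantiation vec :: (complex_vector, finite) complex_vector
begin

definition scaleC_vec_def: "c *\<^sub>C x = (\<chi> i. c *\<^sub>C (x $ i))"

instance
  by standard
    (simp_all add: scaleC_vec_def vec_eq_iff scaleC_add_right scaleC_add_left scaleC_scaleC scaleC_one)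

end


section \<open>Generators of semigroups\<close>

text \<open>
  A Banach space is given here by a subspace \<open>X\<close> of an ambient complex vector space together with
  a norm \<open>nrm\<close> on \<open>X\<close> (whose values outside \<open>X\<close> are irrelevant), since the spaces used below
  depend on a real exponent. An operator in \<open>X\<close> is given by its domain \<open>D\<close> and a map \<open>A\<close> whose
  values outside \<open>D\<close> are irrelevant.
\<close>

definition bounded_operator_on :: "'b::complex_vector set \<Rightarrow> ('b \<Rightarrow> real) \<Rightarrow> ('b \<Rightarrow> 'b) \<Rightarrow> bool" where
  "bounded_operator_on X nrm T \<longleftrightarrow>
     (\<forall>x\<in>X. T x \<in> X) \<and>
     (\<forall>x\<in>X. \<forall>y\<in>X. T (x + y) = T x + T y) \<and>
     (\<forall>c. \<forall>x\<in>X. T (c *\<^sub>C x) = c *\<^sub>C T x) \<and>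
     (\<exists>C. \<forall>x\<in>X. nrm (T x) \<le> C * nrm x)"

definition C0_semigroup_on :: "'b::complex_vector set \<Rightarrow> ('b \<Rightarrow> real) \<Rightarrow> (real \<Rightarrow> 'b \<Rightarrow> 'b) \<Rightarrow> bool" where
  "C0_semigroup_on X nrm T \<longleftrightarrow>
     (\<forall>t\<ge>0. bounded_operator_on X nrm (T t)) \<and>
     (\<forall>x\<in>X. T 0 x = x) \<and>
     (\<forall>s\<ge>0. \<forall>t\<ge>0. \<forall>x\<in>X. T (s + t) x = T s (T t x)) \<and>
     (\<forall>x\<in>X. ((\<lambda>t. nrm (T t x - x)) \<longlongrightarrow> 0) (at_right 0))"

definition has_generator_value ::
    "('b::complex_vector \<Rightarrow> real) \<Rightarrow> (real \<Rightarrow> 'b \<Rightarrow> 'b) \<Rightarrow> 'b \<Rightarrow> 'b \<Rightarrow> bool" where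
  "has_generator_value nrm T x y \<longleftrightarrow>
     ((\<lambda>h. nrm (complex_of_real (1 / h) *\<^sub>C (T h x - x) - y)) \<longlongrightarrow> 0) (at_right 0)"

definition is_generator_of ::
    "'b::complex_vector set \<Rightarrow> ('b \<Rightarrow> real) \<Rightarrow> (real \<Rightarrow> 'b \<Rightarrow> 'b) \<Rightarrow> 'b set \<Rightarrow> ('b \<Rightarrow> 'b) \<Rightarrow> bool" where
  "is_generator_of X nrm T D A \<longleftrightarrow>
     D = {x \<in> X. \<exists>y\<in>X. has_generator_value nrm T x y} \<and>
     (\<forall>x\<in>D. A x \<in> X \<and> has_generator_value nrm T x (A x))"

definition generates_C0_semigroup ::
    "'b::complex_vector set \<Rightarrow> ('b \<Rightarrow> real) \<Rightarrow> 'b set \<Rightarrow> ('b \<Rightarrow> 'b) \<Rightarrow> bool" where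
  "generates_C0_semigroup X nrm D A \<longleftrightarrow>
     (\<exists>T. C0_semigroup_on X nrm T \<and> is_generator_of X nrm T D A)"

definition sector :: "real \<Rightarrow> complex set" where
  "sector \<delta> = {z. z \<noteq> 0 \<and> \<bar>Arg z\<bar> < \<delta>}"

text \<open>Complex differentiability of an operator-valued map, with respect to the operator norm.\<close>

definition operator_differentiable_at ::
    "'b::complex_vector set \<Rightarrow> ('b \<Rightarrow> real) \<Rightarrow> (complex \<Rightarrow> 'b \<Rightarrow> 'b) \<Rightarrow> complex \<Rightarrow> bool" where
  "operator_differentiable_at X nrm T z \<longleftrightarrow>
     (\<exists>L. bounded_operator_on X nrm L \<and>
        (\<forall>\<epsilon>>0. \<forall>\<^sub>F h in at 0. \<forall>x\<in>X.
           nrm ((1 / h) *\<^sub>C (T (z + h) x - T z x) - L x) \<le> \<epsilon> * nrm x))"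

definition analytic_semigroup_on ::
    "'b::complex_vector set \<Rightarrow> ('b \<Rightarrow> real) \<Rightarrow> real \<Rightarrow> (complex \<Rightarrow> 'b \<Rightarrow> 'b) \<Rightarrow> bool" where
  "analytic_semigroup_on X nrm \<delta> T \<longleftrightarrow>
     (\<forall>z\<in>insert 0 (sector \<delta>). bounded_operator_on X nrm (T z)) \<and>
     (\<forall>x\<in>X. T 0 x = x) \<and>
     (\<forall>z\<in>sector \<delta>. \<forall>w\<in>sector \<delta>. \<forall>x\<in>X. T (z + w) x = T z (T w x)) \<and>
     (\<forall>z\<in>sector \<delta>. operator_differentiable_at X nrm T z) \<and>
     (\<forall>\<delta>'\<in>{0<..<\<delta>}. \<forall>x\<in>X. ((\<lambda>z. nrm (T z x - x)) \<longlongrightarrow> 0) (at 0 within sector \<delta>'))"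

text \<open>
  The angle is at most \<open>\<pi>/2\<close>, so that the sector is closed under addition. The generator is that of
  the restriction to the positive half-line, which is a \<open>C\<^sub>0\<close>-semigroup.
\<close>

definition generates_analytic_semigroup ::
    "'b::complex_vector set \<Rightarrow> ('b \<Rightarrow> real) \<Rightarrow> 'b set \<Rightarrow> ('b \<Rightarrow> 'b) \<Rightarrow> bool" where
  "generates_analytic_semigroup X nrm D A \<longleftrightarrow>
     (\<exists>\<delta>\<in>{0<..pi / 2}. \<exists>T. analytic_semigroup_on X nrm \<delta> T \<and>
        is_generator_of X nrm (\<lambda>t. T (complex_of_real t)) D A)"


section \<open>Schwartz functions\<close>

definition partial_deriv :: "'n::finite \<Rightarrow> (real^'n \<Rightarrow> complex) \<Rightarrow> real^'n \<Rightarrow> complex" where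
  "partial_deriv i f x = frechet_derivative f (at x) (axis i 1)"

text \<open>
  Higher derivatives are indexed by words of coordinates rather than by multi-indices: the word
  \<open>[i\<^sub>1, \<dots>, i\<^sub>k]\<close> stands for \<open>\<partial>\<^bsub>i\<^sub>1\<^esub> \<dots> \<partial>\<^bsub>i\<^sub>k\<^esub>\<close>, a derivative of order \<open>k\<close>.
\<close>

abbreviation words_upto :: "nat \<Rightarrow> 'n list set" where
  "words_upto N \<equiv> {is. length is \<le> N}"

definition is_schwartz :: "(real^'n::finite \<Rightarrow> complex) \<Rightarrow> bool" where
  "is_schwartz f \<longleftrightarrow>
     (\<forall>is x. foldr partial_deriv is f differentiable (at x)) \<and>
     (\<forall>is N. bounded (range (\<lambda>x. (1 + norm x) ^ N *\<^sub>R foldr partial_deriv is f x)))"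

lemma partial_deriv_zero: "partial_deriv i (\<lambda>x. 0) = (\<lambda>x. 0)"
  by (auto simp: partial_deriv_def fun_eq_iff)

lemma foldr_partial_deriv_zero: "foldr partial_deriv is (\<lambda>x. 0) = (\<lambda>x. 0)"
  by (induction "is") (auto simp: partial_deriv_zero)

lemma foldr_partial_deriv_add:
  assumes "is_schwartz f" "is_schwartz g"
  shows "foldr partial_deriv is (\<lambda>x. f x + g x)
     = (\<lambda>x. foldr partial_deriv is f x + foldr partial_deriv is g x)"
proof (induction "is")
  case (Cons i "is")
  have "frechet_derivative (\<lambda>x. foldr partial_deriv is f x + foldr partial_deriv is g x) (at x)
      = (\<lambda>h. frechet_derivative (foldr partial_deriv is f) (at x) h
           + frechet_derivative (foldr partial_deriv is g) (at x) h)" for x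
    using assms unfolding is_schwartz_def
    by (intro frechet_derivative_at[symmetric] has_derivative_add)
       (auto simp: frechet_derivative_works[symmetric])
  then have "partial_deriv i (\<lambda>x. foldr partial_deriv is f x + foldr partial_deriv is g x)
      = (\<lambda>x. partial_deriv i (foldr partial_deriv is f) x + partial_deriv i (foldr partial_deriv is g) x)"
    by (intro ext) (simp only: partial_deriv_def[of i])
  then show ?case by (simp add: Cons)
qed simp

lemma foldr_partial_deriv_mult:
  assumes "is_schwartz f"
  shows "foldr partial_deriv is (\<lambda>x. c * f x) = (\<lambda>x. c * foldr partial_deriv is f x)"
proof (induction "is")
  case (Cons i "is")
  have "frechet_derivative (\<lambda>x. c * foldr partial_deriv is f x) (at x)
      = (\<lambda>h. c * frechet_derivative (foldr partial_deriv is f) (at x) h)" for x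
    using assms unfolding is_schwartz_def
    by (intro frechet_derivative_at[symmetric] has_derivative_mult_right)
       (auto simp: frechet_derivative_works[symmetric])
  then have "partial_deriv i (\<lambda>x. c * foldr partial_deriv is f x)
      = (\<lambda>x. c * partial_deriv i (foldr partial_deriv is f) x)"
    by (intro ext) (simp only: partial_deriv_def[of i])
  then show ?case by (simp add: Cons)
qed simp

lemma is_schwartz_zero: "is_schwartz (\<lambda>x. 0)"
  by (auto simp: is_schwartz_def foldr_partial_deriv_zero)

lemma is_schwartz_add: "is_schwartz f \<Longrightarrow> is_schwartz g \<Longrightarrow> is_schwartz (\<lambda>x. f x + g x)"
  by (subst is_schwartz_def)
     (auto simp: foldr_partial_deriv_add is_schwartz_def scaleR_add_right intro!: bounded_plus_comp)

lemma is_schwartz_mult: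
  assumes "is_schwartz f" shows "is_schwartz (\<lambda>x. c * f x)"
proof -
  have "bounded ((\<lambda>y. c * y) ` range (\<lambda>x. (1 + norm x) ^ N *\<^sub>R foldr partial_deriv is f x))" for N "is"
    by (rule bounded_linear_image[OF _ bounded_linear_mult_right]) (use assms in \<open>auto simp: is_schwartz_def\<close>)
  then show ?thesis
    using assms by (subst is_schwartz_def)
      (auto simp: foldr_partial_deriv_mult is_schwartz_def image_image mult_scaleR_right)
qed

lemma is_schwartz_partial_deriv:
  assumes "is_schwartz f" shows "is_schwartz (partial_deriv i f)"
proof -
  have "foldr partial_deriv is (partial_deriv i f) = foldr partial_deriv (is @ [i]) f" for "is"
    by simp
  then show ?thesis using assms by (simp add: is_schwartz_def del: foldr_append)
qed

typedef 'n::finite schwartz = "{f :: real^'n \<Rightarrow> complex. is_schwartz f}"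
  morphisms schwartz_fun Schwartz
  using is_schwartz_zero by blast

setup_lifting type_definition_schwartz

instantiation schwartz :: (finite) complex_vector
begin

lift_definition zero_schwartz :: "'a schwartz" is "\<lambda>x. 0" by (rule is_schwartz_zero)
lift_definition plus_schwartz :: "'a schwartz \<Rightarrow> 'a schwartz \<Rightarrow> 'a schwartz" is "\<lambda>f g x. f x + g x"
  by (rule is_schwartz_add)
lift_definition uminus_schwartz :: "'a schwartz \<Rightarrow> 'a schwartz" is "\<lambda>f x. - f x"
  using is_schwartz_mult[where c = "-1"] by simp
lift_definition minus_schwartz :: "'a schwartz \<Rightarrow> 'a schwartz \<Rightarrow> 'a schwartz" is "\<lambda>f g x. f x - g x"
  using is_schwartz_add is_schwartz_mult[where c = "-1"] by fastforce
lift_definition scaleC_schwartz :: "complex \<Rightarrow> 'a schwartz \<Rightarrow> 'a schwartz" is "\<lambda>c f x. c * f x"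
  by (rule is_schwartz_mult)

instance
  by standard (transfer; auto simp: fun_eq_iff algebra_simps)+

end

lift_definition schwartz_deriv :: "'n::finite \<Rightarrow> 'n schwartz \<Rightarrow> 'n schwartz" is partial_deriv
  by (rule is_schwartz_partial_deriv)

text \<open>
  An increasing sequence of norms that generates the usual locally convex topology of the Schwartz
  space; the supremum is finite.
\<close>

definition schwartz_norm :: "nat \<Rightarrow> 'n::finite schwartz \<Rightarrow> real" where
  "schwartz_norm N \<phi> =
     (SUP (is, x) \<in> words_upto N \<times> UNIV. (1 + norm x) ^ N * norm (foldr partial_deriv is (schwartz_fun \<phi>) x))"

lemma finite_words_upto: "finite (words_upto N :: 'n::finite list set)"
  using finite_lists_length_le[of "UNIV :: 'n set" N] by simp

lemma bdd_above_schwartz_norm: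
  "bdd_above ((\<lambda>(is, x). (1 + norm x) ^ M * norm (foldr partial_deriv is (schwartz_fun (\<phi> :: 'n::finite schwartz)) x))
     ` (words_upto N \<times> UNIV))"
proof -
  have "is_schwartz (schwartz_fun \<phi>)" using schwartz_fun by blast
  then have "bdd_above (range (\<lambda>x. (1 + norm x) ^ M * norm (foldr partial_deriv is (schwartz_fun \<phi>) x)))" for "is"
    unfolding is_schwartz_def bounded_iff bdd_above_def by force
  then have "bdd_above (\<Union>is \<in> words_upto N. range (\<lambda>x. (1 + norm x) ^ M * norm (foldr partial_deriv is (schwartz_fun \<phi>) x)))"
    by (simp add: finite_words_upto)
  then show ?thesis by (rule bdd_above_mono) auto
qed

lemma le_schwartz_norm:
  assumes "length is \<le> N"
  shows "(1 + norm x) ^ N * norm (foldr partial_deriv is (schwartz_fun \<phi>) x) \<le> schwartz_norm N \<phi>"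
  unfolding schwartz_norm_def
  by (rule cSUP_upper2[OF bdd_above_schwartz_norm, where x = "(is, x)"]) (use assms in auto)

lemma schwartz_norm_leI:
  assumes "\<And>is x. length is \<le> N \<Longrightarrow> (1 + norm x) ^ N * norm (foldr partial_deriv is (schwartz_fun \<phi>) x) \<le> B"
  shows "schwartz_norm N \<phi> \<le> B"
  unfolding schwartz_norm_def by (rule cSUP_least) (use assms in \<open>auto intro: exI[of _ "[]"]\<close>)

lemma schwartz_norm_nonneg: "0 \<le> schwartz_norm N \<phi>"
  by (rule order_trans[OF _ le_schwartz_norm[of "[]" _ 0]]) auto

lemma schwartz_norm_mono:
  assumes "M \<le> N" shows "schwartz_norm M \<phi> \<le> schwartz_norm N \<phi>"
proof (rule schwartz_norm_leI)
  fix "is" :: "'a list" and x assume "length is \<le> M"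
  then show "(1 + norm x) ^ M * norm (foldr partial_deriv is (schwartz_fun \<phi>) x) \<le> schwartz_norm N \<phi>"
    using assms by (intro order_trans[OF _ le_schwartz_norm[of "is" N x]] mult_right_mono power_increasing) auto
qed

lemma schwartz_norm_deriv_le: "schwartz_norm N (schwartz_deriv i \<phi>) \<le> schwartz_norm (Suc N) \<phi>"
proof (rule schwartz_norm_leI)
  fix "is" :: "'a list" and x assume *: "length is \<le> N"
  have "foldr partial_deriv is (schwartz_fun (schwartz_deriv i \<phi>))
      = foldr partial_deriv (is @ [i]) (schwartz_fun \<phi>)"
    by (simp add: schwartz_deriv.rep_eq)
  moreover have "(1 + norm x) ^ N * norm (foldr partial_deriv (is @ [i]) (schwartz_fun \<phi>) x) \<le> schwartz_norm (Suc N) \<phi>"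
    using * by (intro order_trans[OF _ le_schwartz_norm[of "is @ [i]" "Suc N" x]] mult_right_mono power_increasing) auto
  ultimately show "(1 + norm x) ^ N * norm (foldr partial_deriv is (schwartz_fun (schwartz_deriv i \<phi>)) x)
      \<le> schwartz_norm (Suc N) \<phi>" by simp
qed

lemma schwartz_deriv_add: "schwartz_deriv i (\<phi> + \<psi>) = schwartz_deriv i \<phi> + schwartz_deriv i \<psi>"
  by transfer (use foldr_partial_deriv_add[of _ _ "[i]" for i] in simp)

lemma schwartz_deriv_scaleC: "schwartz_deriv i (c *\<^sub>C \<phi>) = c *\<^sub>C schwartz_deriv i \<phi>"
  by transfer (use foldr_partial_deriv_mult[of _ "[i]" for i] in simp)


section \<open>Tempered distributions\<close>

definition is_tempered :: "('n::finite schwartz \<Rightarrow> complex) \<Rightarrow> bool" where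
  "is_tempered T \<longleftrightarrow>
     (\<forall>\<phi> \<psi>. T (\<phi> + \<psi>) = T \<phi> + T \<psi>) \<and>
     (\<forall>c \<phi>. T (c *\<^sub>C \<phi>) = c * T \<phi>) \<and>
     (\<exists>C N. \<forall>\<phi>. norm (T \<phi>) \<le> C * schwartz_norm N \<phi>)"

lemma is_tempered_zero: "is_tempered (\<lambda>\<phi>. 0)"
  by (auto simp: is_tempered_def intro: exI[of _ 0])

lemma is_tempered_add:
  assumes "is_tempered S" "is_tempered T" shows "is_tempered (\<lambda>\<phi>. S \<phi> + T \<phi>)"
proof -
  from assms obtain C1 N1 C2 N2 where
    1: "\<And>\<phi>. norm (S \<phi>) \<le> C1 * schwartz_norm N1 \<phi>" and 2: "\<And>\<phi>. norm (T \<phi>) \<le> C2 * schwartz_norm N2 \<phi>"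
    unfolding is_tempered_def by blast
  have "norm (S \<phi> + T \<phi>) \<le> (\<bar>C1\<bar> + \<bar>C2\<bar>) * schwartz_norm (max N1 N2) \<phi>" for \<phi>
  proof -
    have "C1 * schwartz_norm N1 \<phi> \<le> \<bar>C1\<bar> * schwartz_norm (max N1 N2) \<phi>"
      by (intro mult_mono schwartz_norm_mono schwartz_norm_nonneg) auto
    moreover have "C2 * schwartz_norm N2 \<phi> \<le> \<bar>C2\<bar> * schwartz_norm (max N1 N2) \<phi>"
      by (intro mult_mono schwartz_norm_mono schwartz_norm_nonneg) auto
    ultimately show ?thesis
      using norm_triangle_ineq[of "S \<phi>" "T \<phi>"] 1[of \<phi>] 2[of \<phi>] by (simp add: distrib_right)
  qed
  then have "\<exists>C N. \<forall>\<phi>. norm (S \<phi> + T \<phi>) \<le> C * schwartz_norm N \<phi>" by blast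
  then show ?thesis using assms unfolding is_tempered_def by (simp add: distrib_left)
qed

lemma is_tempered_mult:
  assumes "is_tempered T" shows "is_tempered (\<lambda>\<phi>. c * T \<phi>)"
proof -
  from assms obtain C N where *: "\<And>\<phi>. norm (T \<phi>) \<le> C * schwartz_norm N \<phi>"
    unfolding is_tempered_def by blast
  have "norm (c * T \<phi>) \<le> (norm c * C) * schwartz_norm N \<phi>" for \<phi>
    using mult_left_mono[OF *[of \<phi>], of "norm c"] by (simp add: norm_mult mult_ac)
  then have "\<exists>C N. \<forall>\<phi>. norm (c * T \<phi>) \<le> C * schwartz_norm N \<phi>" by blast
  then show ?thesis using assms unfolding is_tempered_def by (simp add: distrib_left mult.left_commute)
qed

typedef 'n::finite tempdist = "{T :: 'n schwartz \<Rightarrow> complex. is_tempered T}"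
  morphisms pairing Tempdist
  using is_tempered_zero by blast

setup_lifting type_definition_tempdist

instantiation tempdist :: (finite) complex_vector
begin

lift_definition zero_tempdist :: "'a tempdist" is "\<lambda>\<phi>. 0" by (rule is_tempered_zero)
lift_definition plus_tempdist :: "'a tempdist \<Rightarrow> 'a tempdist \<Rightarrow> 'a tempdist" is "\<lambda>S T \<phi>. S \<phi> + T \<phi>"
  by (rule is_tempered_add)
lift_definition uminus_tempdist :: "'a tempdist \<Rightarrow> 'a tempdist" is "\<lambda>T \<phi>. - T \<phi>"
  using is_tempered_mult[where c = "-1"] by simp
lift_definition minus_tempdist :: "'a tempdist \<Rightarrow> 'a tempdist \<Rightarrow> 'a tempdist" is "\<lambda>S T \<phi>. S \<phi> - T \<phi>"
  using is_tempered_add is_tempered_mult[where c = "-1"] by fastforce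
lift_definition scaleC_tempdist :: "complex \<Rightarrow> 'a tempdist \<Rightarrow> 'a tempdist" is "\<lambda>c T \<phi>. c * T \<phi>"
  by (rule is_tempered_mult)

instance
  by standard (transfer; auto simp: fun_eq_iff algebra_simps)+

end

lift_definition dist_deriv :: "'n::finite \<Rightarrow> 'n tempdist \<Rightarrow> 'n tempdist"
  is "\<lambda>i T \<phi>. - T (schwartz_deriv i \<phi>)"
proof -
  fix i and T :: "'n schwartz \<Rightarrow> complex" assume T: "is_tempered T"
  then obtain C N where *: "\<And>\<phi>. norm (T \<phi>) \<le> C * schwartz_norm N \<phi>"
    unfolding is_tempered_def by blast
  have "norm (- T (schwartz_deriv i \<phi>)) \<le> \<bar>C\<bar> * schwartz_norm (Suc N) \<phi>" for \<phi>
  proof -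
    have "C * schwartz_norm N (schwartz_deriv i \<phi>) \<le> \<bar>C\<bar> * schwartz_norm (Suc N) \<phi>"
      by (intro mult_mono schwartz_norm_deriv_le schwartz_norm_nonneg) auto
    then show ?thesis using *[of "schwartz_deriv i \<phi>"] by simp
  qed
  then show "is_tempered (\<lambda>\<phi>. - T (schwartz_deriv i \<phi>))"
    using T unfolding is_tempered_def by (auto simp: schwartz_deriv_add schwartz_deriv_scaleC)
qed

definition dist_laplacian :: "'n::finite tempdist \<Rightarrow> 'n tempdist" where
  "dist_laplacian u = (\<Sum>i\<in>UNIV. dist_deriv i (dist_deriv i u))"

definition dist_grad :: "'n::finite tempdist \<Rightarrow> 'n tempdist^'n" where
  "dist_grad u = (\<chi> i. dist_deriv i u)"

definition dist_div :: "'n::finite tempdist^'n \<Rightarrow> 'n tempdist" where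
  "dist_div q = (\<Sum>i\<in>UNIV. dist_deriv i (q $ i))"


section \<open>Lebesgue and Sobolev spaces as spaces of tempered distributions\<close>

text \<open>
  \<open>u\<close> is the regular distribution given by the function \<open>f\<close>. Such an \<open>f\<close> is locally integrable and
  unique up to equality almost everywhere, so the norms below do not depend on the choice of \<open>f\<close>.
\<close>

definition represented_by :: "'n::finite tempdist \<Rightarrow> (real^'n \<Rightarrow> complex) \<Rightarrow> bool" where
  "represented_by u f \<longleftrightarrow> f \<in> borel_measurable lborel \<and>
     (\<forall>\<phi>. integrable lborel (\<lambda>x. f x * schwartz_fun \<phi> x) \<and>
          pairing u \<phi> = (\<integral>x. f x * schwartz_fun \<phi> x \<partial>lborel))"

definition Lp :: "real \<Rightarrow> 'n::finite tempdist set" where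
  "Lp p = {u. \<exists>f. represented_by u f \<and> integrable lborel (\<lambda>x. norm (f x) powr p)}"

definition Lp_norm :: "real \<Rightarrow> 'n::finite tempdist \<Rightarrow> real" where
  "Lp_norm p u = (\<integral>x. norm ((SOME f. represented_by u f) x) powr p \<partial>lborel) powr (1 / p)"

definition represented_by_vec :: "'n::finite tempdist^'n \<Rightarrow> (real^'n \<Rightarrow> complex^'n) \<Rightarrow> bool" where
  "represented_by_vec q f \<longleftrightarrow> (\<forall>i. represented_by (q $ i) (\<lambda>x. f x $ i))"

definition Lp_vec :: "real \<Rightarrow> ('n::finite tempdist^'n) set" where
  "Lp_vec p = {q. \<exists>f. represented_by_vec q f \<and> integrable lborel (\<lambda>x. norm (f x) powr p)}"

definition Lp_vec_norm :: "real \<Rightarrow> 'n::finite tempdist^'n \<Rightarrow> real" where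
  "Lp_vec_norm p q = (\<integral>x. norm ((SOME f. represented_by_vec q f) x) powr p \<partial>lborel) powr (1 / p)"

definition Sobolev :: "nat \<Rightarrow> real \<Rightarrow> 'n::finite tempdist set" where
  "Sobolev k p = {u. \<forall>is \<in> words_upto k. foldr dist_deriv is u \<in> Lp p}"

text \<open>
  Summing over words counts a mixed derivative once for each order of differentiation; this changes
  the usual Sobolev norm only to an equivalent one.
\<close>

definition Sobolev_norm :: "nat \<Rightarrow> real \<Rightarrow> 'n::finite tempdist \<Rightarrow> real" where
  "Sobolev_norm k p u = (\<Sum>is \<in> words_upto k. Lp_norm p (foldr dist_deriv is u) powr p) powr (1 / p)"


section \<open>The thermoelastic plate operator with Cattaneo--Maxwell heat conduction\<close>

type_synonym 'n state = "'n tempdist \<times> 'n tempdist \<times> 'n tempdist \<times> ('n tempdist^'n)"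

definition plate_operator :: "real \<Rightarrow> 'n::finite state \<Rightarrow> 'n state" where
  "plate_operator \<tau> = (\<lambda>(u, v, \<theta>, q).
     (v,
      - dist_laplacian (dist_laplacian u) - dist_laplacian \<theta>,
      dist_laplacian v - dist_div q,
      - (complex_of_real (1 / \<tau>) *\<^sub>C dist_grad \<theta>) - complex_of_real (1 / \<tau>) *\<^sub>C q))"

definition plate_space :: "real \<Rightarrow> 'n::finite state set" where
  "plate_space p = Sobolev 2 p \<times> Lp p \<times> Lp p \<times> Lp_vec p"

definition plate_norm :: "real \<Rightarrow> 'n::finite state \<Rightarrow> real" where
  "plate_norm p = (\<lambda>(u, v, \<theta>, q). Sobolev_norm 2 p u + Lp_norm p v + Lp_norm p \<theta> + Lp_vec_norm p q)"

definition plate_domain :: "real \<Rightarrow> real \<Rightarrow> 'n::finite state set" where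
  "plate_domain \<tau> p = {U \<in> plate_space p. plate_operator \<tau> U \<in> plate_space p}"

end

theory Submission
  imports Defs "HOL-Complex_Analysis.Complex_Analysis"
begin

text \<open>
Why the theorem holds. Without heat the plate equation is a pair of Schroedinger equations, and the
heat equation of Fourier type would make the system parabolic. Cattaneo's law destroys this: at high
frequencies the flux \<open>q\<close> decouples from \<open>(u, v, \<theta>)\<close>, and what remains is the conservative system
\<open>u' = v\<close>, \<open>v' = - \<Delta>\<^sup>2 u - \<Delta> \<theta>\<close>, \<open>\<theta>' = \<Delta> v\<close>, which is of Schroedinger type. Such a system has a
semigroup on \<open>L\<^sup>2\<close>, without any smoothing, and none on the other \<open>L\<^sup>p\<close> spaces.

The negative statements rest on explicit functions rather than on Fourier multipliers. Let \<open>g z\<close> be the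
heat kernel at complex time \<open>z\<close>, so that its derivative in \<open>z\<close> is its Laplacian in \<open>x\<close>, and let
\<open>\<lambda> = \<i> \<surd>2\<close>. Then \<open>(u, v, \<theta>, q) = (g z, \<lambda> \<Delta> g z, \<Delta> g z, 0)\<close>, taken along \<open>z = z\<^sub>0 + \<lambda> t\<close>, solves the
conservative system exactly, and fails the full one only by the term \<open>\<nabla> \<Delta> g z / \<tau>\<close> in the last
component (\<open>wave_equation\<close>). Put \<open>z = a (1 + \<i> \<sigma>)\<close> with a small \<open>a > 0\<close>. By homogeneity the norm of
the wave is a power of \<open>a\<close> times a function of \<open>\<sigma>\<close>, up to a relative error of order \<open>\<surd>a\<close>, and the
passage from \<open>\<sigma>\<^sub>0\<close> to \<open>\<sigma>\<^sub>1\<close> takes a time of order \<open>a\<close>, in which the residual contributes again a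
relative error of order \<open>\<surd>a\<close>, by Duhamel's principle (\<open>approximate_orbit\<close>). A semigroup is bounded for
small times, by a constant that does not depend on \<open>\<sigma>\<^sub>0\<close> and \<open>\<sigma>\<^sub>1\<close>; letting \<open>a\<close> tend to 0 one finds
that the wave at \<open>\<sigma>\<^sub>1\<close> is at most a constant times as large as the wave at \<open>\<sigma>\<^sub>0 \<le> \<sigma>\<^sub>1\<close>
(\<open>beam_inequality\<close>). But the \<open>L\<^sup>p\<close> norm of \<open>\<Delta> g (1 + \<i> \<sigma>)\<close> is comparable to the power
\<open>n / p - n / 2\<close> of the modulus of \<open>1 + \<i> \<sigma>\<close> (\<open>beam_size\<close>): for \<open>p < 2\<close> a beam that spreads contradicts
the inequality, for \<open>p > 2\<close> one that focuses.

For \<open>p = 2\<close> the same waves exclude analyticity. Start at \<open>\<sigma> = - S\<close> with a large \<open>S\<close>. Between \<open>\<sigma> = 0\<close>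
and \<open>\<sigma> = 1\<close> the third component moves by a fixed fraction of its size (\<open>beam_moves\<close>), although the
elapsed time has increased only by the factor \<open>1 + 1 / S\<close>. The derivative of an analytic semigroup is
bounded by a multiple of \<open>1 / t\<close>, so that its orbits can move only by a multiple of \<open>1 / S\<close> in such a
period (\<open>analytic_orbit_slow\<close>).

Generation on \<open>L\<^sup>2\<close> is proved by regularisation. Convolution with the real heat kernel at time
\<open>1 / (m + 1)\<^sup>2\<close> gives bounded operators that commute with the plate operator and turn it into a bounded
operator \<open>B\<^sub>m\<close>. In the energy that contains the full Hessian of \<open>u\<close>, all terms of top order cancel, so
that the \<open>B\<^sub>m\<close> are dissipative up to a multiple of the energy that is independent of \<open>m\<close>
(\<open>energy_dissipative\<close>); the Hessian in place of the Laplacian makes the energy equivalent to the given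
norm without elliptic regularity. The exponentials of \<open>B\<^sub>m\<close> converge, and the limit has the plate
operator on its maximal domain as generator (\<open>regularised_operator\<close>), since the operator is closed and
commutes with the regularisation.
\<close>

section \<open>Schwartz functions\<close>

text \<open>
The definition speaks of all iterated derivatives; coinduction replaces them by a class of
functions that is closed under differentiation.
\<close>

lemma is_schwartz_coinduct:
 assumes "f \<in> C"
  and "!!f x. f \<in> C ==> f differentiable (at x)"
  and "!!f N. f \<in> C ==> bounded (range (%x. (1 + norm x) ^ N *\<^sub>R f x))"
  and "!!f i. f \<in> C ==> partial_deriv i f \<in> C"
 shows "is_schwartz f"
proof -
 have "foldr partial_deriv is f \<in> C" for "is" by (induction "is") (use assms in auto)
 then show ?thesis unfolding is_schwartz_def using assms by blast
qed

lemma partial_derivI: "(f has_derivative f') (at x) ==> partial_deriv i f x = f' (axis i 1)"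
 unfolding partial_deriv_def by (metis frechet_derivative_at)

lemma bounded_weighted_iff:
 fixes f :: "real^'n::finite => complex"
 shows "bounded (range (%x. (1 + norm x) ^ N *\<^sub>R f x)) \<longleftrightarrow> (\<exists>S\<ge>0. \<forall>x. (1 + norm x) ^ N * norm (f x) <= S)"
proof -
 have *: "norm ((1 + norm x) ^ N *\<^sub>R f x) = (1 + norm x) ^ N * norm (f x)" for x
  by (simp add: abs_of_nonneg)
 show ?thesis unfolding bounded_iff
 proof safe
  fix a assume "\<forall>x\<in>range (%x. (1 + norm x) ^ N *\<^sub>R f x). norm x <= a"
  then have a: "(1 + norm x) ^ N * norm (f x) <= a" for x unfolding * [symmetric] by blast
  then have "0 <= a" using order_trans[OF _ a[of 0]] by simp
  with a show "\<exists>S\<ge>0. \<forall>x. (1 + norm x) ^ N * norm (f x) <= S" by blast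
 next
  fix S assume "\<forall>x. (1 + norm x) ^ N * norm (f x) <= S"
  then show "\<exists>a. \<forall>x\<in>range (%x. (1 + norm x) ^ N *\<^sub>R f x). norm x <= a"
   using * by (intro exI[of _ S]) auto
 qed
qed

lemma schwartz_decay:
 assumes "is_schwartz f"
 obtains S where "S >= 0" "!!x. (1 + norm x) ^ N * norm (f x) <= S"
proof -
 have "bounded (range (%x. (1 + norm x) ^ N *\<^sub>R foldr partial_deriv [] f x))"
  using assms unfolding is_schwartz_def by blast
 then show ?thesis unfolding bounded_weighted_iff using that by auto
qed

lemma schwartz_has_derivative:
 assumes "is_schwartz f"
 shows "(f has_derivative (%h. \<Sum>i\<in>UNIV. h $ i *\<^sub>R partial_deriv i f x)) (at x)"
proof -
 define D where "D = frechet_derivative f (at x)"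
 have "foldr partial_deriv [] f differentiable (at x)" using assms unfolding is_schwartz_def by blast
 then have D: "(f has_derivative D) (at x)" by (simp add: D_def frechet_derivative_works)
 interpret D: linear D using D by (rule has_derivative_linear)
 have "D h = (\<Sum>i\<in>UNIV. h $ i *\<^sub>R partial_deriv i f x)" for h
 proof -
  have "D h = D (\<Sum>i\<in>UNIV. h $ i *\<^sub>R axis i 1)"
   by (simp add: basis_expansion scalar_mult_eq_scaleR[symmetric])
  also have "... = (\<Sum>i\<in>UNIV. h $ i *\<^sub>R D (axis i 1))" by (simp add: D.sum D.scale)
  finally show ?thesis by (simp add: partial_derivI[OF D])
 qed
 then show ?thesis by (intro has_derivative_eq_rhs[OF D] ext)
qed

lemma schwartz_continuous: "is_schwartz f ==> continuous_on UNIV f"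
 by (meson continuous_at_imp_continuous_on has_derivative_continuous schwartz_has_derivative)

lemma schwartz_measurable [measurable_dest]: "is_schwartz f ==> f \<in> borel_measurable borel"
 by (rule borel_measurable_continuous_onI[OF schwartz_continuous])

lemma is_schwartz_schwartz_fun [simp]: "is_schwartz (schwartz_fun \<phi>)"
 using schwartz_fun by blast

lemma measurable_schwartz_fun [measurable]: "schwartz_fun \<phi> \<in> borel_measurable borel"
 by (rule schwartz_measurable) simp

lemma norm_deriv_sum_le:
 fixes c :: "'n::finite => complex"
 assumes "!!i. norm (c i) <= B"
 shows "norm (\<Sum>i\<in>UNIV. (h::real^'n) $ i *\<^sub>R c i) <= real CARD('n) * B * norm h"
proof -
 have "norm (\<Sum>i\<in>UNIV. h $ i *\<^sub>R c i) <= (\<Sum>i\<in>UNIV. norm (h $ i *\<^sub>R c i))" by (rule norm_sum)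
 also have "... <= (\<Sum>i\<in>(UNIV::'n set). norm h * B)"
  using assms by (intro sum_mono) (simp add: mult_mono component_le_norm_cart)
 finally show ?thesis by (simp add: mult_ac)
qed

lemma schwartz_lipschitz_on:
 assumes f: "is_schwartz (f :: real^'n::finite => complex)" and "convex S" "x \<in> S" "y \<in> S"
  and B: "!!i z. z \<in> S ==> norm (partial_deriv i f z) <= B"
 shows "norm (f x - f y) <= real CARD('n) * B * norm (x - y)"
proof (rule differentiable_bound[OF \<open>convex S\<close> _ _ \<open>x \<in> S\<close> \<open>y \<in> S\<close>])
 show "(f has_derivative (%h. \<Sum>i\<in>UNIV. h $ i *\<^sub>R partial_deriv i f z)) (at z within S)" for z
  using schwartz_has_derivative[OF f] by (rule has_derivative_at_withinI)
 show "onorm (%h. \<Sum>i\<in>UNIV. h $ i *\<^sub>R partial_deriv i f z) <= real CARD('n) * B" if "z \<in> S" for z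
  by (rule onorm_le) (rule norm_deriv_sum_le[OF B[OF that]])
qed

lemma schwartz_taylor:
 assumes f: "is_schwartz (f :: real^'n::finite => complex)"
 obtains C where "C >= 0"
  "!!x h. norm (f (x + h) - f x - (\<Sum>i\<in>UNIV. h $ i *\<^sub>R partial_deriv i f x)) <= C * (norm h)\<^sup>2"
proof -
 have "\<exists>S\<ge>0. \<forall>x. norm (partial_deriv j (partial_deriv i f) x) <= S" for i j
  using schwartz_decay[OF is_schwartz_partial_deriv[OF is_schwartz_partial_deriv[OF f]], of 0 j i] by auto
 then have "\<forall>p. \<exists>S. 0 <= S & (\<forall>x. norm (partial_deriv (snd p) (partial_deriv (fst p) f) x) <= S)" by blast
 from choice[OF this] obtain S' where S': "!!p. 0 <= S' p & (\<forall>x. norm (partial_deriv (snd p) (partial_deriv (fst p) f) x) <= S' p)"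
  by blast
 define S where "S i j = S' (i, j)" for i j
 have S: "!!i j. S i j >= 0" "!!i j x. norm (partial_deriv j (partial_deriv i f) x) <= S i j"
  using S' unfolding S_def by force+
 define B where "B = (\<Sum>i\<in>UNIV. \<Sum>j\<in>UNIV. S i j)"
 have "S i j <= B" for i j unfolding B_def
  by (rule order_trans[OF member_le_sum[of j UNIV "S i"] member_le_sum[of i UNIV "%i. sum (S i) UNIV"]])
    (auto intro: S sum_nonneg)
 then have B: "norm (partial_deriv j (partial_deriv i f) x) <= B" for i j x using S(2) order_trans by blast
 have "B >= 0" unfolding B_def by (intro sum_nonneg S)
 define K where "K = real CARD('n) * (real CARD('n) * B)"
 show ?thesis
 proof (rule that[of K])
  show "K >= 0" using \<open>B >= 0\<close> by (simp add: K_def)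
  fix x h :: "real^'n"
  let ?D = "%z h. \<Sum>i\<in>UNIV. h $ i *\<^sub>R partial_deriv i f z"
  have "norm (f (x + h) - f x - ?D x (x + h - x)) <= norm (x + h - x) * (K * norm h)"
  proof (rule differentiable_bound_linearization[where S = "cball x (norm h)"])
   show "x + t *\<^sub>R (x + h - x) \<in> cball x (norm h)" if "t \<in> {0..1}" for t
    using that by (simp add: dist_norm mult_left_le_one_le)
   show "(f has_derivative ?D z) (at z within cball x (norm h))" for z
    using schwartz_has_derivative[OF f] by (rule has_derivative_at_withinI)
   show "onorm (?D z - ?D x) <= K * norm h" if z: "z \<in> cball x (norm h)" for z
   proof (rule onorm_le)
    fix k
    have "norm (partial_deriv i f z - partial_deriv i f x) <= real CARD('n) * B * norm h" for i
    proof -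
     have "norm (partial_deriv i f z - partial_deriv i f x) <= real CARD('n) * B * norm (z - x)"
      by (rule schwartz_lipschitz_on[OF is_schwartz_partial_deriv[OF f], of UNIV]) (use B in auto)
     also have "... <= real CARD('n) * B * norm h"
      using z \<open>B >= 0\<close> by (intro mult_left_mono) (auto simp: dist_norm norm_minus_commute)
     finally show ?thesis .
    qed
    then have "norm (\<Sum>i\<in>UNIV. k $ i *\<^sub>R (partial_deriv i f z - partial_deriv i f x))
      <= real CARD('n) * (real CARD('n) * B * norm h) * norm k"
     by (rule norm_deriv_sum_le)
    then show "norm ((?D z - ?D x) k) <= K * norm h * norm k"
     by (simp add: K_def scaleR_diff_right sum_subtractf mult_ac)
   qed
  qed auto
  then show "norm (f (x + h) - f x - ?D x h) <= K * (norm h)\<^sup>2" by (simp add: power2_eq_square mult_ac)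
 qed
qed

subsection \<open>Integration against rapidly decreasing weights\<close>

text \<open>
The exponent is chosen so that the weight is bounded by the product of the integrable functions
\<open>1 / (1 + \<bar>x\<^sub>i\<bar>)\<^sup>2\<close> of the coordinates.
\<close>

definition weight :: "real^'n::finite => real" where
 "weight x = 1 / (1 + norm x) ^ (2 * CARD('n))"

lemma weight_pos: "weight x > 0"
 by (simp add: weight_def add_pos_nonneg)

lemma measurable_weight [measurable]: "weight \<in> borel_measurable borel"
 unfolding weight_def by measurable

lemma nn_integral_inverse_square_weight: "(\<integral>\<^sup>+x. ennreal (1 / (1 + \<bar>x\<bar>)\<^sup>2) \<partial>lborel) < \<infinity>"
proof -
 have half: "(\<integral>\<^sup>+x. ennreal (1 / (1 + \<bar>x\<bar>)\<^sup>2) * indicator {0..} x \<partial>lborel) = 1"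
 proof -
  have "(\<integral>\<^sup>+x. ennreal (1 / (1 + \<bar>x\<bar>)\<^sup>2) * indicator {0..} x \<partial>lborel)
    = (\<integral>\<^sup>+x. ennreal (1 / (1 + x)\<^sup>2) * indicator {0..} x \<partial>lborel)"
   by (intro nn_integral_cong) (auto simp: indicator_def)
  also have "... = ennreal (0 - (- (1 / (1 + 0))))"
  proof (rule nn_integral_FTC_atLeast[where F = "%x. - (1 / (1 + x))"])
   show "((%x. - (1 / (1 + x))) has_real_derivative 1 / (1 + x)\<^sup>2) (at x)" if "0 <= x" for x :: real
    using that by (auto intro!: derivative_eq_intros simp: power2_eq_square)
   show "((%x::real. - (1 / (1 + x))) \<longlongrightarrow> 0) at_top" by real_asymp
  qed auto
  finally show ?thesis by simp
 qed
 have "(\<integral>\<^sup>+x. ennreal (1 / (1 + \<bar>x\<bar>)\<^sup>2) \<partial>lborel)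
   <= (\<integral>\<^sup>+x. ennreal (1 / (1 + \<bar>x\<bar>)\<^sup>2) * indicator {0..} x
      + ennreal (1 / (1 + \<bar>-x\<bar>)\<^sup>2) * indicator {0..} (- x) \<partial>lborel)"
  by (intro nn_integral_mono) (auto simp: indicator_def)
 also have "... = 1 + (\<integral>\<^sup>+x. ennreal (1 / (1 + \<bar>-x\<bar>)\<^sup>2) * indicator {0..} (- x) \<partial>lborel)"
  by (subst nn_integral_add) (auto simp: half)
 also have "(\<integral>\<^sup>+x. ennreal (1 / (1 + \<bar>-x\<bar>)\<^sup>2) * indicator {0..} (- x) \<partial>lborel)
   = (\<integral>\<^sup>+x. ennreal (1 / (1 + \<bar>x\<bar>)\<^sup>2) * indicator {0..} x \<partial>lborel)"
  by (subst (2) nn_integral_real_affine[where c = "-1" and t = 0]) auto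
 finally show ?thesis unfolding half by (simp add: le_less_trans)
qed

lemma integrable_weight: "integrable lborel (weight :: real^'n::finite => real)"
proof -
 have le: "weight x <= (\<Prod>b\<in>Basis. 1 / (1 + \<bar>x \<bullet> b\<bar>)\<^sup>2)" for x :: "real^'n"
 proof -
  have "(\<Prod>b\<in>(Basis :: (real^'n) set). (1 + \<bar>x \<bullet> b\<bar>)\<^sup>2) <= (\<Prod>b\<in>(Basis :: (real^'n) set). (1 + norm x)\<^sup>2)"
   by (intro prod_mono) (auto simp: Basis_le_norm)
  also have "... = (1 + norm x) ^ (2 * CARD('n))" by (simp add: power_mult)
  finally have "(\<Prod>b\<in>(Basis :: (real^'n) set). (1 + \<bar>x \<bullet> b\<bar>)\<^sup>2) <= (1 + norm x) ^ (2 * CARD('n))" .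
  moreover have "0 < (\<Prod>b\<in>(Basis :: (real^'n) set). (1 + \<bar>x \<bullet> b\<bar>)\<^sup>2)"
   by (intro prod_pos) (auto simp: add_pos_nonneg)
  ultimately show ?thesis unfolding weight_def prod_dividef by (simp add: frac_le)
 qed
 have "(\<integral>\<^sup>+x. ennreal (weight x) \<partial>(lborel :: (real^'n) measure))
   <= (\<integral>\<^sup>+x. (\<Prod>b\<in>Basis. ennreal (1 / (1 + \<bar>x \<bullet> b\<bar>)\<^sup>2)) \<partial>(lborel :: (real^'n) measure))"
 proof (rule nn_integral_mono)
  fix x :: "real^'n"
  have "(\<Prod>b\<in>(Basis :: (real^'n) set). ennreal (1 / (1 + \<bar>x \<bullet> b\<bar>)\<^sup>2))
    = ennreal (\<Prod>b\<in>(Basis :: (real^'n) set). 1 / (1 + \<bar>x \<bullet> b\<bar>)\<^sup>2)"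
   by (rule prod_ennreal) simp
  then show "ennreal (weight x) <= (\<Prod>b\<in>Basis. ennreal (1 / (1 + \<bar>x \<bullet> b\<bar>)\<^sup>2))"
   using le by (simp only: ennreal_leI)
 qed
 also have "... = (\<Prod>b\<in>(Basis :: (real^'n) set). \<integral>\<^sup>+x. ennreal (1 / (1 + \<bar>x\<bar>)\<^sup>2) \<partial>lborel)"
  by (rule nn_integral_lborel_prod) auto
 also have "... < \<infinity>"
  using nn_integral_inverse_square_weight by (simp add: power_less_top_ennreal)
 finally show ?thesis
  by (intro integrableI_nonneg) (auto intro: less_imp_le weight_pos)
qed

lemma schwartz_le_weight:
 assumes "is_schwartz (f :: real^'n::finite => complex)"
 obtains S where "S >= 0" "!!x. norm (f x) <= S * weight x" "!!x. (1 + norm x) ^ N * norm (f x) <= S * weight x"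
proof -
 obtain S where S: "S >= 0" "!!x. (1 + norm x) ^ (N + 2 * CARD('n)) * norm (f x) <= S"
  using schwartz_decay[OF assms, of "N + 2 * CARD('n)"] by blast
 have 1: "(1 + norm x) ^ N * norm (f x) <= S * weight x" for x
  using S(2)[of x] by (simp add: weight_def power_add field_simps add_pos_nonneg)
 have "1 * norm (f x) <= (1 + norm x) ^ N * norm (f x)" for x
  by (intro mult_right_mono) auto
 then have "norm (f x) <= S * weight x" for x using 1[of x] order_trans[OF _ 1] by (metis mult_1)
 with S(1) 1 show ?thesis using that by blast
qed

lemma schwartz_integrable_weighted:
 assumes "is_schwartz f" shows "integrable lborel (%x. (1 + norm x) ^ N *\<^sub>R f x)"
proof -
 obtain S where "S >= 0" "!!x. (1 + norm x) ^ N * norm (f x) <= S * weight x"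
  using schwartz_le_weight[OF assms] by metis
 moreover have [measurable]: "f \<in> borel_measurable borel" using assms by (rule schwartz_measurable)
 ultimately show ?thesis
  by (intro Bochner_Integration.integrable_bound[OF integrable_mult_right[OF integrable_weight, of S]])
    (auto intro!: AE_I2 simp: abs_of_nonneg weight_pos less_imp_le)
qed

lemma schwartz_integrable: "is_schwartz f ==> integrable lborel f"
 using schwartz_integrable_weighted[of f 0] by simp

subsection \<open>Closure properties\<close>

lemma partial_deriv_add:
 assumes "!!x. f differentiable (at x)" "!!x. g differentiable (at x)"
 shows "partial_deriv i (%x. f x + g x) = (%x. partial_deriv i f x + partial_deriv i g x)"
proof
 fix x
 have "((%x. f x + g x) has_derivative (%h. frechet_derivative f (at x) h + frechet_derivative g (at x) h)) (at x)"
  using assms by (intro has_derivative_add) (auto simp: frechet_derivative_works[symmetric])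
 from partial_derivI[OF this] show "partial_deriv i (%x. f x + g x) x = partial_deriv i f x + partial_deriv i g x"
  by (simp add: partial_deriv_def)
qed

lemma schwartz_sum_axis:
 "(\<Sum>j\<in>UNIV. axis i (1::real) $ j *\<^sub>R partial_deriv j f x) = partial_deriv i f x"
proof -
 have "(\<Sum>j\<in>UNIV. axis i (1::real) $ j *\<^sub>R partial_deriv j f x)
   = (\<Sum>j\<in>UNIV. if i = j then partial_deriv j f x else 0)"
  by (intro sum.cong) (auto simp: axis_def)
 then show ?thesis by simp
qed

lemma schwartz_has_derivative_mult:
 assumes "is_schwartz f" "is_schwartz g"
 shows "((%x. f x * g x) has_derivative (%h. f x * (\<Sum>i\<in>UNIV. h $ i *\<^sub>R partial_deriv i g x)
   + (\<Sum>i\<in>UNIV. h $ i *\<^sub>R partial_deriv i f x) * g x)) (at x)"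
 by (rule has_derivative_mult[OF schwartz_has_derivative[OF assms(1)] schwartz_has_derivative[OF assms(2)]])

lemma partial_deriv_mult:
 assumes "is_schwartz f" "is_schwartz g"
 shows "partial_deriv i (%x. f x * g x) = (%x. f x * partial_deriv i g x + partial_deriv i f x * g x)"
 by (rule ext) (simp add: partial_derivI[OF schwartz_has_derivative_mult[OF assms]] schwartz_sum_axis)

inductive_set schwartz_products :: "(real^'n::finite => complex) set" where
 prod: "is_schwartz f ==> is_schwartz g ==> (%x. f x * g x) \<in> schwartz_products"
| add: "F \<in> schwartz_products ==> G \<in> schwartz_products ==> (%x. F x + G x) \<in> schwartz_products"

lemma is_schwartz_prod:
 assumes "is_schwartz f" "is_schwartz g" shows "is_schwartz (%x. f x * g x)"
proof (rule is_schwartz_coinduct[where C = schwartz_products])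
 show "(%x. f x * g x) \<in> schwartz_products" using assms by (rule schwartz_products.prod)
next
 show diff: "F differentiable (at x)" if "F \<in> schwartz_products" for F :: "real^'a => complex" and x
  using that
  by (induction) (auto simp: differentiable_def intro: schwartz_has_derivative_mult has_derivative_add)
 show "partial_deriv i F \<in> schwartz_products" if "F \<in> schwartz_products" for F :: "real^'a => complex" and i
  using that
 proof induction
  case (prod f g)
  then show ?case unfolding partial_deriv_mult[OF prod]
   by (intro schwartz_products.add schwartz_products.prod is_schwartz_partial_deriv)
 next
  case (add F G)
  then show ?case by (subst partial_deriv_add) (auto intro: diff schwartz_products.add)
 qed
 fix F :: "real^'a => complex" and N assume "F \<in> schwartz_products"
 then show "bounded (range (%x. (1 + norm x) ^ N *\<^sub>R F x))"
 proof induction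
  case (prod f g)
  obtain S T where S: "S >= 0" "!!x. (1 + norm x) ^ N * norm (f x) <= S"
   and T: "!!x. (1 + norm x) ^ 0 * norm (g x) <= T"
   using schwartz_decay[OF prod(1)] schwartz_decay[OF prod(2)] by metis
  have "(1 + norm x) ^ N * norm (f x * g x) <= S * T" for x
   using mult_mono[OF S(2)[of x], of "norm (g x)" T] S(1) T[of x] by (simp add: norm_mult mult_ac)
  moreover have "0 <= S * T" using S(1) order_trans[OF norm_ge_zero, of "g 0" T] T[of 0] by simp
  ultimately show ?case unfolding bounded_weighted_iff by blast
 next
  case (add F G) then show ?case by (simp add: scaleR_add_right bounded_plus_comp)
 qed
qed

lemma is_schwartz_shift:
 assumes f: "is_schwartz f" and s: "\<bar>s\<bar> = 1"
 shows "is_schwartz (%x. f (a + s *\<^sub>R x))"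
  and "partial_deriv i (%x. f (a + s *\<^sub>R x)) = (%x. of_real s * partial_deriv i f (a + s *\<^sub>R x))"
proof -
 let ?C = "{%x. c * f (a + s *\<^sub>R x) |c f. is_schwartz f}"
 have der: "((%x. c * f (a + s *\<^sub>R x)) has_derivative
   (%h. c * (\<Sum>i\<in>UNIV. (s *\<^sub>R h) $ i *\<^sub>R partial_deriv i f (a + s *\<^sub>R x)))) (at x)"
  if "is_schwartz f" for c f x
  by (intro has_derivative_mult_right
    has_derivative_compose[of "%x. a + s *\<^sub>R x" _ _ _ f, OF _ schwartz_has_derivative[OF that]])
    (auto intro!: derivative_eq_intros)
 have pd: "partial_deriv i (%x. c * f (a + s *\<^sub>R x)) = (%x. (c * of_real s) * partial_deriv i f (a + s *\<^sub>R x))"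
  if "is_schwartz f" for c f i
  by (rule ext) (simp add: partial_derivI[OF der[OF that]] scaleR_scaleR[symmetric]
    scaleR_sum_right[symmetric] schwartz_sum_axis del: scaleR_scaleR, simp add: scaleR_conv_of_real)
 from pd[OF f, of i 1] show "partial_deriv i (%x. f (a + s *\<^sub>R x)) = (%x. of_real s * partial_deriv i f (a + s *\<^sub>R x))"
  by simp
 show "is_schwartz (%x. f (a + s *\<^sub>R x))"
 proof (rule is_schwartz_coinduct[where C = ?C])
  have "(%x. 1 * f (a + s *\<^sub>R x)) \<in> ?C" using f by blast
  then show "(%x. f (a + s *\<^sub>R x)) \<in> ?C" by simp
  show "g differentiable (at x)" if "g \<in> ?C" for g x using that der unfolding differentiable_def by blast
  show "partial_deriv i g \<in> ?C" if "g \<in> ?C" for g i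
   using that pd is_schwartz_partial_deriv by blast
  fix g N assume "g \<in> ?C"
  then obtain c f where g: "g = (%x. c * f (a + s *\<^sub>R x))" and f: "is_schwartz f" by blast
  obtain S where S: "S >= 0" "!!x. (1 + norm x) ^ N * norm (f x) <= S" using schwartz_decay[OF f] by metis
  have "(1 + norm x) ^ N * norm (g x) <= (1 + norm a) ^ N * norm c * S" for x
  proof -
   have "norm x = norm (s *\<^sub>R x)" using s by simp
   also have "... <= norm (a + s *\<^sub>R x) + norm a" by (metis add_diff_cancel_left' norm_triangle_ineq4)
   finally have "1 + norm x <= (1 + norm a) * (1 + norm (a + s *\<^sub>R x))" 
    unfolding distrib_left distrib_right mult_1_left mult_1_right
    using mult_nonneg_nonneg[OF norm_ge_zero[of a] norm_ge_zero[of "a + s *\<^sub>R x"]] by argo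
   then have "(1 + norm x) ^ N <= (1 + norm a) ^ N * (1 + norm (a + s *\<^sub>R x)) ^ N"
    by (metis add_nonneg_nonneg norm_ge_zero power_mono power_mult_distrib zero_le_one)
   then have "(1 + norm x) ^ N * norm (g x) <= (1 + norm a) ^ N * (1 + norm (a + s *\<^sub>R x)) ^ N * norm (g x)"
    by (rule mult_right_mono) simp
   also have "... = (1 + norm a) ^ N * norm c * ((1 + norm (a + s *\<^sub>R x)) ^ N * norm (f (a + s *\<^sub>R x)))"
    by (simp add: g norm_mult mult_ac)
   also have "... <= (1 + norm a) ^ N * norm c * S" by (intro mult_left_mono S) auto
   finally show ?thesis .
  qed
  moreover have "0 <= (1 + norm a) ^ N * norm c * S" using S(1) by simp
  ultimately show "bounded (range (%x. (1 + norm x) ^ N *\<^sub>R g x))" unfolding bounded_weighted_iff by blast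
 qed
qed

lemma is_schwartz_cnj:
 assumes f: "is_schwartz f" shows "is_schwartz (%x. cnj (f x))"
proof (rule is_schwartz_coinduct[where C = "{%x. cnj (f x) |f. is_schwartz f}"])
 have der: "((%x. cnj (f x)) has_derivative (%h. cnj (\<Sum>i\<in>UNIV. h $ i *\<^sub>R partial_deriv i f x))) (at x)"
  if "is_schwartz f" for f :: "real^'a => complex" and x
  by (rule bounded_linear.has_derivative[OF bounded_linear_cnj schwartz_has_derivative[OF that]])
 have pd: "partial_deriv i (%x. cnj (f x)) = (%x. cnj (partial_deriv i f x))" if "is_schwartz f"
  for f :: "real^'a => complex" and i
  by (rule ext) (simp add: partial_derivI[OF der[OF that]] schwartz_sum_axis)
 show "g differentiable (at x)" if "g \<in> {%x. cnj (f x) |f. is_schwartz f}" for g :: "real^'a => complex" and x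
  using that der unfolding differentiable_def by blast
 show "partial_deriv i g \<in> {%x. cnj (f x) |f. is_schwartz f}" if "g \<in> {%x. cnj (f x) |f. is_schwartz f}" for g :: "real^'a => complex" and i
  using that pd is_schwartz_partial_deriv by blast
 show "bounded (range (%x. (1 + norm x) ^ N *\<^sub>R g x))" if g': "g \<in> {%x. cnj (f x) |f. is_schwartz f}" for g :: "real^'a => complex" and N
 proof -
  obtain f where g: "g = (%x. cnj (f x))" and f: "is_schwartz f" using g' by blast
  show ?thesis unfolding bounded_weighted_iff g by (simp, rule schwartz_decay[OF f, of N]) blast
 qed
qed (use f in blast)

subsection \<open>Integration by parts\<close>

lemma distr_lborel_shift:
 fixes t :: "'a::euclidean_space"
 assumes "\<bar>s\<bar> = 1" shows "distr lborel borel (%x. t + s *\<^sub>R x) = lborel"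
proof -
 have "s ~= 0" using assms by auto
 from lborel_affine[OF this, of t] show ?thesis using assms by (simp add: density_1)
qed

lemma
 fixes t :: "'a::euclidean_space"
 assumes s: "\<bar>s\<bar> = 1" and f: "f \<in> borel_measurable borel"
 shows nn_integral_shift: "(\<integral>\<^sup>+x. f (t + s *\<^sub>R x) \<partial>lborel) = (\<integral>\<^sup>+x. f x \<partial>lborel)"
 by (subst (2) distr_lborel_shift[OF s, of t, symmetric], rule nn_integral_distr[symmetric]) (use f in auto)

lemma
 fixes t :: "'a::euclidean_space" and f :: "_ => 'b::{banach, second_countable_topology}"
 assumes s: "\<bar>s\<bar> = 1" and f: "f \<in> borel_measurable borel"
 shows integral_shift: "(LBINT x. f (t + s *\<^sub>R x)) = (LBINT x. f x)"
  and integrable_shift: "integrable lborel (%x. f (t + s *\<^sub>R x)) \<longleftrightarrow> integrable lborel f"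
proof -
 have [measurable]: "(%x. t + s *\<^sub>R x) \<in> borel_measurable lborel" by simp
 show "(LBINT x. f (t + s *\<^sub>R x)) = (LBINT x. f x)"
  using integral_distr[of "%x. t + s *\<^sub>R x" lborel borel f] f by (simp add: distr_lborel_shift[OF s])
 show "integrable lborel (%x. f (t + s *\<^sub>R x)) \<longleftrightarrow> integrable lborel f"
  using integrable_distr_eq[of "%x. t + s *\<^sub>R x" lborel borel f] f by (simp add: distr_lborel_shift[OF s])
qed

lemma weight_near:
 fixes x :: "real^'n::finite"
 assumes "norm (z - x) <= 1" shows "weight z <= 4 ^ CARD('n) * weight x"
proof -
 have "norm x <= norm z + norm (z - x)" by (metis norm_minus_commute norm_triangle_sub)
 then have "1 + norm x <= 2 * (1 + norm z)" using assms norm_ge_zero[of z] by argo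
 then have "(1 + norm x) ^ (2 * CARD('n)) <= (2 * (1 + norm z)) ^ (2 * CARD('n))" by (intro power_mono) auto
 also have "... = 4 ^ CARD('n) * (1 + norm z) ^ (2 * CARD('n))"
  unfolding power_mult_distrib by (simp add: power_mult)
 finally show ?thesis unfolding weight_def by (simp add: field_simps add_pos_nonneg)
qed

text \<open>
By translation invariance the difference quotients have integral zero, and they converge
dominatedly to the partial derivative.
\<close>

lemma schwartz_integral_partial_deriv:
 assumes f: "is_schwartz (f :: real^'n::finite => complex)"
 shows "(LBINT x. partial_deriv i f x) = 0"
proof -
 have [measurable]: "f \<in> borel_measurable borel" "partial_deriv i f \<in> borel_measurable borel"
  using f is_schwartz_partial_deriv by (auto intro: schwartz_measurable)
 define \<delta> where "\<delta> m = 1 / real (Suc m)" for m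
 have \<delta>: "\<delta> m > 0" "\<delta> m <= 1" for m by (auto simp: \<delta>_def)
 define s where "s m x = (1 / \<delta> m) *\<^sub>R (f (x + \<delta> m *\<^sub>R axis i 1) - f x)" for m x
 have [measurable]: "s m \<in> borel_measurable borel" for m unfolding s_def by measurable
 have "\<exists>S. S >= 0 & (\<forall>x. norm (partial_deriv j f x) <= S * weight x)" for j
  by (rule schwartz_le_weight[OF is_schwartz_partial_deriv[OF f, of j], of 0]) blast
 then obtain S where S: "!!j. S j >= 0" "!!j x. norm (partial_deriv j f x) <= S j * weight x" by metis
 define K where "K = sum S UNIV * 4 ^ CARD('n)"
 have lip: "norm (s m x) <= real CARD('n) * K * weight x" for m x
 proof -
  have "norm (f (x + \<delta> m *\<^sub>R axis i 1) - f x) <= real CARD('n) * (K * weight x) * norm ((x + \<delta> m *\<^sub>R axis i 1) - x)"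
  proof (rule schwartz_lipschitz_on[OF f, of "cball x 1"])
   fix j z assume "z \<in> cball x 1"
   then have "weight z <= 4 ^ CARD('n) * weight x" by (intro weight_near) (simp add: dist_norm norm_minus_commute)
   then have "S j * weight z <= sum S UNIV * (4 ^ CARD('n) * weight x)"
    by (intro mult_mono member_le_sum) (auto intro: S sum_nonneg less_imp_le weight_pos)
   then show "norm (partial_deriv j f z) <= K * weight x"
    using S(2)[of j z] by (simp add: K_def mult_ac)
  qed (use \<delta>[of m] in \<open>auto simp: dist_norm\<close>)
  also have "... = \<delta> m * (real CARD('n) * K * weight x)" using \<delta>[of m] by simp
  finally show ?thesis using \<delta>[of m] by (simp add: s_def pos_divide_le_eq mult_ac)
 qed
 obtain C where C: "C >= 0"
  "!!x h. norm (f (x + h) - f x - (\<Sum>i\<in>UNIV. h $ i *\<^sub>R partial_deriv i f x)) <= C * (norm h)\<^sup>2"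
  using schwartz_taylor[OF f] by blast
 have lim: "(%m. s m x) \<longlonglongrightarrow> partial_deriv i f x" for x
 proof (rule LIM_zero_cancel, rule tendsto_norm_zero_cancel, rule tendsto_sandwich[OF _ _ tendsto_const])
  show "\<forall>\<^sub>F m in sequentially. norm (s m x - partial_deriv i f x) <= C * \<delta> m"
  proof (intro always_eventually allI)
   fix m
   have "norm (f (x + \<delta> m *\<^sub>R axis i 1) - f x - \<delta> m *\<^sub>R partial_deriv i f x) <= C * (\<delta> m)\<^sup>2"
    using C(2)[of x "\<delta> m *\<^sub>R axis i 1"] \<delta>[of m]
    by (simp add: scaleR_scaleR[symmetric] scaleR_sum_right[symmetric] schwartz_sum_axis del: scaleR_scaleR)
   moreover have "norm (s m x - partial_deriv i f x)
     = norm (f (x + \<delta> m *\<^sub>R axis i 1) - f x - \<delta> m *\<^sub>R partial_deriv i f x) / \<delta> m"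
   proof -
    have "s m x - partial_deriv i f x = (1 / \<delta> m) *\<^sub>R (f (x + \<delta> m *\<^sub>R axis i 1) - f x - \<delta> m *\<^sub>R partial_deriv i f x)"
     using \<delta>[of m] by (simp add: s_def scaleR_diff_right)
    then show ?thesis using \<delta>[of m] by (simp add: abs_of_nonneg)
   qed
   ultimately show "norm (s m x - partial_deriv i f x) <= C * \<delta> m"
    using \<delta>[of m] by (simp add: pos_divide_le_eq power2_eq_square)
  qed
  show "(%m. C * \<delta> m) \<longlonglongrightarrow> 0" unfolding \<delta>_def by real_asymp
 qed auto
 have "(%m. \<integral>x. s m x \<partial>lborel) \<longlonglongrightarrow> (LBINT x. partial_deriv i f x)"
 proof (rule integral_dominated_convergence)
  show "integrable lborel (%x. real CARD('n) * K * weight x)" by (intro integrable_mult_right integrable_weight)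
 qed (use lip lim in auto)
 moreover have "(LBINT x. s m x) = 0" for m
 proof -
  have "integrable lborel (%x. f (\<delta> m *\<^sub>R axis i 1 + 1 *\<^sub>R x))"
   using schwartz_integrable[OF f] by (subst integrable_shift) auto
  moreover have "(LBINT x. f (\<delta> m *\<^sub>R axis i 1 + 1 *\<^sub>R x)) = (LBINT x. f x)"
   by (rule integral_shift) auto
  ultimately show ?thesis using schwartz_integrable[OF f] by (simp add: s_def add.commute)
 qed
 ultimately show ?thesis by (simp add: LIMSEQ_const_iff)
qed

lemma schwartz_integral_by_parts:
 assumes f: "is_schwartz f" and g: "is_schwartz g"
 shows "(LBINT x. partial_deriv i f x * g x) = - (LBINT x. f x * partial_deriv i g x)"
proof -
 have "integrable lborel (%x. partial_deriv i f x * g x)" "integrable lborel (%x. f x * partial_deriv i g x)"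
  using f g by (auto intro!: schwartz_integrable is_schwartz_prod is_schwartz_partial_deriv)
 then show ?thesis using schwartz_integral_partial_deriv[OF is_schwartz_prod[OF f g], of i]
  by (simp add: partial_deriv_mult[OF f g] add_eq_0_iff)
qed

section \<open>Convolution with Schwartz functions\<close>

lemma integrable_mult_bounded:
 fixes f g :: "'a => 'b::{real_normed_field, banach, second_countable_topology}"
 assumes f: "integrable M f" and [measurable]: "g \<in> borel_measurable M" and B: "!!x. norm (g x) <= B"
 shows "integrable M (%x. f x * g x)"
proof -
 have [measurable]: "f \<in> borel_measurable M" using f by auto
 show ?thesis
 proof (rule Bochner_Integration.integrable_bound[OF integrable_mult_right[OF integrable_norm[OF f], of B]])
  show "AE x in M. norm (f x * g x) <= norm (B * norm (f x))"
  proof (rule AE_I2)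
   fix x
   have "norm (f x) * norm (g x) <= norm (f x) * B" by (intro mult_left_mono B) simp
   then show "norm (f x * g x) <= norm (B * norm (f x))"
    using abs_ge_self[of "B * norm (f x)"] by (simp add: norm_mult mult.commute)
  qed
 qed measurable
qed

lemma schwartz_bounded:
 assumes "is_schwartz f" obtains B where "B >= 0" "!!x. norm (f x) <= B"
 using schwartz_decay[OF assms, of 0] by auto

text \<open>
The transpose of the convolution with \<open>k\<close>, hence the operation on test functions by
which a distribution is convolved with \<open>k\<close>.
\<close>

definition correlation :: "(real^'n::finite => complex) => (real^'n => complex) => real^'n => complex" where
 "correlation k f x = (LBINT y. k y * f (x + y))"

lemma correlation_integrable:
 assumes k: "is_schwartz k" and f: "is_schwartz f"
 shows "integrable lborel (%y. k y * f (x + y))"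
proof -
 have [measurable]: "f \<in> borel_measurable borel" using f by (rule schwartz_measurable)
 obtain B where "!!x. norm (f x) <= B" using schwartz_bounded[OF f] by blast
 then show ?thesis by (intro integrable_mult_bounded[OF schwartz_integrable[OF k]]) auto
qed

lemma correlation_has_derivative:
 assumes k: "is_schwartz k" and f: "is_schwartz f"
 shows "(correlation k f has_derivative (%h. \<Sum>i\<in>UNIV. h $ i *\<^sub>R correlation k (partial_deriv i f) x)) (at x)"
proof -
 let ?D = "%h. \<Sum>i\<in>UNIV. h $ i *\<^sub>R correlation k (partial_deriv i f) x"
 obtain C where C: "C >= 0"
  "!!x h. norm (f (x + h) - f x - (\<Sum>i\<in>UNIV. h $ i *\<^sub>R partial_deriv i f x)) <= C * (norm h)\<^sup>2"
  using schwartz_taylor[OF f] by blast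
 have int: "integrable lborel (%y. k y * f (x + y))" "integrable lborel (%y. k y * partial_deriv i f (x + y))" for x i
  using correlation_integrable[OF k] f is_schwartz_partial_deriv by auto
 define K where "K = (LBINT y. norm (k y)) * C"
 have bound: "norm (correlation k f (x + h) - correlation k f x - ?D h) <= K * (norm h)\<^sup>2" for h
 proof -
  let ?R = "%y. f (x + y + h) - f (x + y) - (\<Sum>i\<in>UNIV. h $ i *\<^sub>R partial_deriv i f (x + y))"
  have "?D h = (LBINT y. (\<Sum>i\<in>UNIV. h $ i *\<^sub>R (k y * partial_deriv i f (x + y))))"
   unfolding correlation_def by (subst Bochner_Integration.integral_sum) (auto intro: int)
  moreover have "integrable lborel (%y. \<Sum>i\<in>UNIV. h $ i *\<^sub>R (k y * partial_deriv i f (x + y)))"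
   by (intro Bochner_Integration.integrable_sum integrable_scaleR_right int)
  ultimately have "correlation k f (x + h) - correlation k f x - ?D h = (LBINT y. k y * f (x + h + y) - k y * f (x + y)
    - (\<Sum>i\<in>UNIV. h $ i *\<^sub>R (k y * partial_deriv i f (x + y))))"
   using int unfolding correlation_def by simp
  also have "... = (LBINT y. k y * ?R y)"
   by (intro Bochner_Integration.integral_cong refl)
     (simp add: algebra_simps sum_distrib_left)
  also have "norm ... <= (LBINT y. norm (k y) * (C * (norm h)\<^sup>2))"
  proof (rule Bochner_Integration.integral_norm_bound_integral)
   show "integrable lborel (%y. norm (k y) * (C * (norm h)\<^sup>2))"
    by (intro integrable_mult_left integrable_norm schwartz_integrable k)
   have [measurable]: "f \<in> borel_measurable borel" "!!i. partial_deriv i f \<in> borel_measurable borel"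
    using f is_schwartz_partial_deriv by (auto intro: schwartz_measurable)
   show "integrable lborel (%y. k y * ?R y)"
    by (rule integrable_mult_bounded[OF schwartz_integrable[OF k], of _ "C * (norm h)\<^sup>2"])
      (use C(2)[of "x + _" h] in \<open>auto simp: ac_simps\<close>)
   show "norm (k y * ?R y) <= norm (k y) * (C * (norm h)\<^sup>2)" for y
    unfolding norm_mult using C(2)[of "x + y" h] by (intro mult_left_mono) auto
  qed
  also have "... = K * (norm h)\<^sup>2" by (simp add: K_def)
  finally show ?thesis .
 qed
 show ?thesis
 proof (rule has_derivativeI_sandwich[of 1, where H = "%y. K * norm (y - x)"])
  show "bounded_linear ?D"
   by (intro bounded_linear_sum bounded_linear_compose[OF bounded_linear_scaleR_left] bounded_linear_vec_nth)
  show "norm (correlation k f y - correlation k f x - ?D (y - x)) / norm (y - x) <= K * norm (y - x)"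
   if "y ~= x" for y
   using bound[of "y - x"] that by (simp add: pos_divide_le_eq power2_eq_square)
  have "((%y. K * norm (y - x)) \<longlongrightarrow> K * norm (x - x)) (at x)" by (intro tendsto_intros)
  then show "((%y. K * norm (y - x)) \<longlongrightarrow> 0) (at x)" by simp
 qed auto
qed

lemma partial_deriv_correlation:
 assumes k: "is_schwartz k" and f: "is_schwartz f"
 shows "partial_deriv i (correlation k f) = correlation k (partial_deriv i f)"
proof
 fix x
 have "(\<Sum>j\<in>UNIV. axis i (1::real) $ j *\<^sub>R correlation k (partial_deriv j f) x)
   = (\<Sum>j\<in>UNIV. if i = j then correlation k (partial_deriv j f) x else 0)"
  by (intro sum.cong) (auto simp: axis_def)
 then show "partial_deriv i (correlation k f) x = correlation k (partial_deriv i f) x"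
  using partial_derivI[OF correlation_has_derivative[OF k f], of i x] by simp
qed

lemma correlation_decay:
 assumes k: "is_schwartz k" and f: "is_schwartz f" and S: "!!x. (1 + norm x) ^ N * norm (f x) <= S"
 shows "(1 + norm x) ^ N * norm (correlation k f x) <= (LBINT y. (1 + norm y) ^ N * norm (k y)) * S"
proof -
 have int: "integrable lborel (%y. (1 + norm y) ^ N * norm (k y))"
  using integrable_norm[OF schwartz_integrable_weighted[OF k, of N]] by (simp add: abs_of_nonneg)
 have "(1 + norm x) ^ N * norm (correlation k f x) = norm (LBINT y. (1 + norm x) ^ N *\<^sub>R (k y * f (x + y)))"
  by (simp add: correlation_def abs_of_nonneg)
 also have "... <= (LBINT y. ((1 + norm y) ^ N * norm (k y)) * S)"
 proof (rule Bochner_Integration.integral_norm_bound_integral)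
  show "integrable lborel (%y. (1 + norm x) ^ N *\<^sub>R (k y * f (x + y)))"
   using correlation_integrable[OF k f] by (rule integrable_scaleR_right)
  show "integrable lborel (%y. ((1 + norm y) ^ N * norm (k y)) * S)" using int by (rule integrable_mult_left)
  fix y
  have "norm x <= norm (x + y) + norm y" by (metis add_diff_cancel_right' norm_triangle_ineq4)
  then have "1 + norm x <= (1 + norm y) * (1 + norm (x + y))"
   unfolding distrib_left distrib_right mult_1_left mult_1_right
   using mult_nonneg_nonneg[OF norm_ge_zero[of y] norm_ge_zero[of "x + y"]] by argo
  then have "(1 + norm x) ^ N <= ((1 + norm y) * (1 + norm (x + y))) ^ N" by (intro power_mono) auto
  then have "(1 + norm x) ^ N * (norm (k y) * norm (f (x + y)))
    <= ((1 + norm y) * (1 + norm (x + y))) ^ N * (norm (k y) * norm (f (x + y)))"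
   by (rule mult_right_mono) simp
  also have "... = (1 + norm y) ^ N * norm (k y) * ((1 + norm (x + y)) ^ N * norm (f (x + y)))"
   by (simp add: power_mult_distrib)
  also have "... <= (1 + norm y) ^ N * norm (k y) * S" by (intro mult_left_mono S) auto
  finally show "norm ((1 + norm x) ^ N *\<^sub>R (k y * f (x + y))) <= ((1 + norm y) ^ N * norm (k y)) * S"
   by (simp add: norm_mult abs_of_nonneg)
 qed
 finally show ?thesis by simp
qed

lemma is_schwartz_correlation:
 assumes k: "is_schwartz k" and f: "is_schwartz f" shows "is_schwartz (correlation k f)"
proof (rule is_schwartz_coinduct[where C = "{correlation k f |f. is_schwartz f}"])
 show "g differentiable (at x)" if "g \<in> {correlation k f |f. is_schwartz f}" for g x
  using that correlation_has_derivative[OF k] unfolding differentiable_def by blast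
 show "partial_deriv i g \<in> {correlation k f |f. is_schwartz f}" if "g \<in> {correlation k f |f. is_schwartz f}" for g i
  using that partial_deriv_correlation[OF k] is_schwartz_partial_deriv by blast
 fix g N assume "g \<in> {correlation k f |f. is_schwartz f}"
 then obtain f where g: "g = correlation k f" and f: "is_schwartz f" by blast
 obtain S where S: "S >= 0" "!!x. (1 + norm x) ^ N * norm (f x) <= S" using schwartz_decay[OF f] by metis
 have "0 <= (LBINT y. (1 + norm y) ^ N * norm (k y)) * S" using S(1) by simp
 then show "bounded (range (%x. (1 + norm x) ^ N *\<^sub>R g x))"
  unfolding bounded_weighted_iff g using correlation_decay[OF k f S(2)] by blast
qed (use f in blast)

lemma foldr_partial_deriv_schwartz: "is_schwartz f ==> is_schwartz (foldr partial_deriv is f)"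
 by (induction "is") (auto intro: is_schwartz_partial_deriv)

lemma foldr_partial_deriv_correlation:
 assumes k: "is_schwartz k" and f: "is_schwartz f"
 shows "foldr partial_deriv is (correlation k f) = correlation k (foldr partial_deriv is f)"
 by (induction "is") (auto simp: partial_deriv_correlation[OF k foldr_partial_deriv_schwartz[OF f]])

lemma correlation_commute:
 assumes k: "is_schwartz k" and l: "is_schwartz l" and f: "is_schwartz f"
 shows "correlation k (correlation l f) = correlation l (correlation k f)"
proof
 fix x
 have [measurable]: "k \<in> borel_measurable borel" "l \<in> borel_measurable borel" "f \<in> borel_measurable borel"
  using assms by (auto intro: schwartz_measurable)
 obtain B where B: "!!x. norm (f x) <= B" using schwartz_bounded[OF f] by blast
 have "integrable (lborel \<Otimes>\<^sub>M lborel) (%(y, w). k y * l w)"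
 proof (rule lborel_pair.Fubini_integrable)
  show "integrable lborel (%y. \<integral>w. norm (case (y, w) of (y, w) => k y * l w) \<partial>lborel)"
   using schwartz_integrable[OF k] by (auto simp: norm_mult)
  show "AE y in lborel. integrable lborel (%w. case (y, w) of (y, w) => k y * l w)"
   using schwartz_integrable[OF l] by auto
 qed simp
 then have "integrable (lborel \<Otimes>\<^sub>M lborel) (%p. (case p of (y, w) => k y * l w) * f (x + fst p + snd p))"
  by (rule integrable_mult_bounded) (use B in auto)
 then have int: "integrable (lborel \<Otimes>\<^sub>M lborel) (%(y, w). k y * (l w * f (x + y + w)))"
  by (simp add: case_prod_unfold mult_ac)
 have "correlation k (correlation l f) x = (LBINT y. (LBINT w. k y * (l w * f (x + y + w))))"
  by (simp add: correlation_def)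
 also have "... = (LBINT w. (LBINT y. k y * (l w * f (x + y + w))))"
  using lborel_pair.Fubini_integral[OF int] by simp
 also have "... = correlation l (correlation k f) x"
  by (simp add: correlation_def mult_ac add_ac flip: integral_mult_right_zero)
 finally show "correlation k (correlation l f) x = correlation l (correlation k f) x" .
qed

lemma correlation_partial_deriv_kernel:
 assumes k: "is_schwartz k" and f: "is_schwartz f"
 shows "correlation (partial_deriv i k) f = (%x. - correlation k (partial_deriv i f) x)"
proof
 fix x
 have f': "is_schwartz (%y. f (x + y))" "partial_deriv i (%y. f (x + y)) = (%y. partial_deriv i f (x + y))"
  using is_schwartz_shift[OF f, where s = 1 and a = x] by auto
 show "correlation (partial_deriv i k) f x = - correlation k (partial_deriv i f) x"
  using schwartz_integral_by_parts[OF k f'(1), of i] by (simp add: correlation_def f'(2))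
qed

lift_definition schwartz_correlation :: "'n::finite schwartz => 'n schwartz => 'n schwartz" is correlation
 by (rule is_schwartz_correlation)

lemma schwartz_correlation_linear:
 "schwartz_correlation k (\<phi> + \<psi>) = schwartz_correlation k \<phi> + schwartz_correlation k \<psi>"
 "schwartz_correlation k (c *\<^sub>C \<phi>) = c *\<^sub>C schwartz_correlation k \<phi>"
proof -
 show "schwartz_correlation k (\<phi> + \<psi>) = schwartz_correlation k \<phi> + schwartz_correlation k \<psi>"
  by transfer (simp add: fun_eq_iff correlation_def distrib_left correlation_integrable)
 show "schwartz_correlation k (c *\<^sub>C \<phi>) = c *\<^sub>C schwartz_correlation k \<phi>"
  by transfer (simp add: fun_eq_iff correlation_def mult.left_commute)
qed

lemma schwartz_norm_correlation_le:
 "schwartz_norm N (schwartz_correlation k \<phi>) <= (LBINT y. (1 + norm y) ^ N * norm (schwartz_fun k y)) * schwartz_norm N \<phi>"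
proof (rule schwartz_norm_leI)
 fix "is" :: "'a list" and x assume "length is <= N"
 then show "(1 + norm x) ^ N * norm (foldr partial_deriv is (schwartz_fun (schwartz_correlation k \<phi>)) x)
   <= (LBINT y. (1 + norm y) ^ N * norm (schwartz_fun k y)) * schwartz_norm N \<phi>"
  unfolding schwartz_correlation.rep_eq
  by (subst foldr_partial_deriv_correlation)
    (auto intro!: correlation_decay foldr_partial_deriv_schwartz le_schwartz_norm)
qed

lemma schwartz_deriv_correlation:
 "schwartz_deriv i (schwartz_correlation k \<phi>) = schwartz_correlation k (schwartz_deriv i \<phi>)"
 by transfer (rule partial_deriv_correlation)

text \<open>
A derivative may be shifted to the kernel; this makes every derivative of a mollified distribution
a convolution, hence a bounded operation on square-integrable distributions.
\<close>

lemma schwartz_correlation_deriv_kernel: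
 "schwartz_correlation (schwartz_deriv i k) \<phi> = - schwartz_correlation k (schwartz_deriv i \<phi>)"
 by transfer (rule correlation_partial_deriv_kernel)

lemma schwartz_correlation_commute:
 "schwartz_correlation k (schwartz_correlation l \<phi>) = schwartz_correlation l (schwartz_correlation k \<phi>)"
 by transfer (rule correlation_commute)

lift_definition dist_conv :: "'n::finite schwartz => 'n tempdist => 'n tempdist"
 is "%k T \<phi>. T (schwartz_correlation k \<phi>)"
proof -
 fix k :: "'n schwartz" and T :: "'n schwartz => complex" assume T: "is_tempered T"
 then obtain C N where C: "!!\<phi>. norm (T \<phi>) <= C * schwartz_norm N \<phi>"
  unfolding is_tempered_def by blast
 define K where "K = (LBINT y. (1 + norm y) ^ N * norm (schwartz_fun k y))"
 have "norm (T (schwartz_correlation k \<phi>)) <= (\<bar>C\<bar> * K) * schwartz_norm N \<phi>" for \<phi>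
 proof -
  have "C * schwartz_norm N (schwartz_correlation k \<phi>) <= \<bar>C\<bar> * (K * schwartz_norm N \<phi>)"
   unfolding K_def by (intro mult_mono schwartz_norm_correlation_le schwartz_norm_nonneg) auto
  then show ?thesis using C[of "schwartz_correlation k \<phi>"] by (simp add: mult_ac)
 qed
 then show "is_tempered (%\<phi>. T (schwartz_correlation k \<phi>))"
  using T unfolding is_tempered_def schwartz_correlation_linear by blast
qed

lemma tempdist_eqI: "(!!\<phi>. pairing S \<phi> = pairing T \<phi>) ==> S = T"
 by (metis ext pairing_inject)

lemma is_tempered_pairing: "is_tempered (pairing T)"
 using pairing by blast

lemma pairing_test_linear:
 "pairing T (\<phi> + \<psi>) = pairing T \<phi> + pairing T \<psi>" "pairing T (c *\<^sub>C \<phi>) = c * pairing T \<phi>"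
 "pairing T (- \<phi>) = - pairing T \<phi>"
proof -
 show 1: "pairing T (\<phi> + \<psi>) = pairing T \<phi> + pairing T \<psi>" for \<phi> \<psi>
  using is_tempered_pairing[of T] unfolding is_tempered_def by blast
 show "pairing T (c *\<^sub>C \<phi>) = c * pairing T \<phi>"
  using is_tempered_pairing[of T] unfolding is_tempered_def by blast
 show "pairing T (- \<phi>) = - pairing T \<phi>"
  using 1[of \<phi> "- \<phi>"] 1[of 0 0] by (simp add: add_eq_0_iff)
qed

lemmas pairing_simps = plus_tempdist.rep_eq minus_tempdist.rep_eq uminus_tempdist.rep_eq
 zero_tempdist.rep_eq scaleC_tempdist.rep_eq dist_deriv.rep_eq dist_conv.rep_eq

lemma dist_deriv_linear:
 "dist_deriv i (S + T) = dist_deriv i S + dist_deriv i T" "dist_deriv i (S - T) = dist_deriv i S - dist_deriv i T"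
 "dist_deriv i (- T) = - dist_deriv i T" "dist_deriv i (c *\<^sub>C T) = c *\<^sub>C dist_deriv i T" "dist_deriv i 0 = 0"
 by (auto intro!: tempdist_eqI simp: pairing_simps)

lemma dist_conv_linear:
 "dist_conv k (S + T) = dist_conv k S + dist_conv k T" "dist_conv k (S - T) = dist_conv k S - dist_conv k T"
 "dist_conv k (- T) = - dist_conv k T" "dist_conv k (c *\<^sub>C T) = c *\<^sub>C dist_conv k T" "dist_conv k 0 = 0"
 by (auto intro!: tempdist_eqI simp: pairing_simps)

lemma dist_deriv_conv: "dist_deriv i (dist_conv k T) = dist_conv k (dist_deriv i T)"
 by (auto intro!: tempdist_eqI simp: pairing_simps schwartz_deriv_correlation)

lemma dist_conv_deriv_kernel: "dist_conv (schwartz_deriv i k) T = dist_conv k (dist_deriv i T)"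
 by (auto intro!: tempdist_eqI simp: pairing_simps schwartz_correlation_deriv_kernel pairing_test_linear schwartz_deriv_correlation)

lemma dist_conv_commute: "dist_conv k (dist_conv l T) = dist_conv l (dist_conv k T)"
 by (auto intro!: tempdist_eqI simp: pairing_simps schwartz_correlation_commute)

lemma dist_deriv_commute_sum: "dist_deriv i (sum f A) = (\<Sum>a\<in>A. dist_deriv i (f a))"
 by (induction A rule: infinite_finite_induct) (auto simp: dist_deriv_linear)

lemma dist_conv_sum: "dist_conv k (sum f A) = (\<Sum>a\<in>A. dist_conv k (f a))"
 by (induction A rule: infinite_finite_induct) (auto simp: dist_conv_linear)

section \<open>Spaces of p-integrable functions\<close>

definition lp_fun :: "'a measure => real => ('a => 'b::real_normed_vector) => bool" where
 "lp_fun M p f \<longleftrightarrow> f \<in> borel_measurable M & integrable M (%x. norm (f x) powr p)"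

definition lp_norm :: "'a measure => real => ('a => 'b::real_normed_vector) => real" where
 "lp_norm M p f = (\<integral>x. norm (f x) powr p \<partial>M) powr (1 / p)"

lemma lp_norm_nonneg [simp]: "0 <= lp_norm M p f"
 by (simp add: lp_norm_def)

lemma lp_norm_powr: "p > 0 ==> lp_norm M p f powr p = (\<integral>x. norm (f x) powr p \<partial>M)"
 by (simp add: lp_norm_def powr_powr powr_one' integral_nonneg_AE)

lemma lp_norm_cong_norm: "(!!x. x \<in> space M ==> norm (f x) = norm (g x)) ==> lp_norm M p f = lp_norm M p g"
 unfolding lp_norm_def by (intro arg_cong[where f = "%x. x powr _"] Bochner_Integration.integral_cong) auto

lemma lp_norm_cong_AE:
 assumes "AE x in M. f x = g x" "f \<in> borel_measurable M" "g \<in> borel_measurable M"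
 shows "lp_norm M p f = lp_norm M p g"
 unfolding lp_norm_def using assms by (intro arg_cong[where f = "%x. x powr _"] integral_cong_AE) auto

lemma lp_norm_scale:
 assumes "p > 0" "c >= 0" "!!x. norm (g x) = c * norm (f x)"
 shows "lp_norm M p g = c * lp_norm M p f"
proof -
 have "(\<integral>x. norm (g x) powr p \<partial>M) = c powr p * (\<integral>x. norm (f x) powr p \<partial>M)"
  using assms by (simp add: powr_mult)
 then show ?thesis
  using assms by (simp add: lp_norm_def powr_mult powr_powr powr_one')
qed

lemma lp_fun_scale:
 assumes "lp_fun M p f" "c >= 0" "!!x. norm (g x) = c * norm (f x)" "g \<in> borel_measurable M"
 shows "lp_fun M p g"
 using assms by (simp add: lp_fun_def powr_mult)

lemma lp_fun_bound:
 assumes "lp_fun M p f" "g \<in> borel_measurable M" "p > 0" "AE x in M. norm (g x) <= norm (f x)"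
 shows "lp_fun M p g" "lp_norm M p g <= lp_norm M p f"
proof -
 have le: "AE x in M. norm (g x) powr p <= norm (f x) powr p"
  using assms(4) by eventually_elim (use \<open>p > 0\<close> in \<open>auto intro: powr_mono2\<close>)
 have [measurable]: "g \<in> borel_measurable M" by fact
 have f: "integrable M (%x. norm (f x) powr p)" using assms(1) by (simp add: lp_fun_def)
 then have g: "integrable M (%x. norm (g x) powr p)"
  by (rule Bochner_Integration.integrable_bound) (use le in auto)
 then show "lp_fun M p g" using assms(2) by (simp add: lp_fun_def)
 show "lp_norm M p g <= lp_norm M p f"
  unfolding lp_norm_def by (rule powr_mono2) (use \<open>p > 0\<close> f g le in \<open>auto intro!: integral_mono_AE\<close>)
qed

lemma lp_norm_eq_0_iff:
 assumes "lp_fun M p f" "p > 0"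
 shows "lp_norm M p f = 0 \<longleftrightarrow> (AE x in M. f x = 0)"
proof -
 have "lp_norm M p f = 0 \<longleftrightarrow> (\<integral>x. norm (f x) powr p \<partial>M) = 0" by (simp add: lp_norm_def)
 also have "... \<longleftrightarrow> (AE x in M. norm (f x) powr p = 0)"
  using assms by (intro integral_nonneg_eq_0_iff_AE) (auto simp: lp_fun_def)
 finally show ?thesis by simp
qed

lemma powr_add_le:
 fixes x y p :: real
 assumes "x >= 0" "y >= 0" "p >= 0" shows "(x + y) powr p <= 2 powr p * (x powr p + y powr p)"
proof -
 have "(x + y) powr p <= (2 * max x y) powr p" using assms by (intro powr_mono2) auto
 also have "... = 2 powr p * max x y powr p" using assms by (simp add: powr_mult)
 also have "... <= 2 powr p * (x powr p + y powr p)" by (intro mult_left_mono) (auto simp: max_def)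
 finally show ?thesis .
qed

lemma lp_fun_add:
 fixes f g :: "'a => 'b::{real_normed_vector, second_countable_topology}"
 assumes "lp_fun M p f" "lp_fun M p g" "p > 0"
 shows "lp_fun M p (%x. f x + g x)"
proof -
 have [measurable]: "f \<in> borel_measurable M" "g \<in> borel_measurable M" using assms by (auto simp: lp_fun_def)
 have "integrable M (%x. 2 powr p * (norm (f x) powr p + norm (g x) powr p))"
  using assms by (auto simp: lp_fun_def)
 then have "integrable M (%x. norm (f x + g x) powr p)"
 proof (rule Bochner_Integration.integrable_bound)
  show "AE x in M. norm (norm (f x + g x) powr p) <= norm (2 powr p * (norm (f x) powr p + norm (g x) powr p))"
  proof (rule AE_I2)
   fix x
   have "norm (f x + g x) powr p <= (norm (f x) + norm (g x)) powr p"
    using \<open>p > 0\<close> by (intro powr_mono2 norm_triangle_ineq) auto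
   also have "... <= 2 powr p * (norm (f x) powr p + norm (g x) powr p)"
    using \<open>p > 0\<close> by (intro powr_add_le) auto
   finally show "norm (norm (f x + g x) powr p) <= norm (2 powr p * (norm (f x) powr p + norm (g x) powr p))"
    by simp
  qed
 qed measurable
 then show ?thesis by (simp add: lp_fun_def)
qed

text \<open>
Convexity of the power, in the form from which Minkowski's inequality follows.
\<close>

lemma powr_convex_combination:
 fixes s t u v p :: real
 assumes "s >= 0" "t >= 0" "s + t = 1" "u >= 0" "v >= 0" "p >= 1"
 shows "(s * u + t * v) powr p <= s * u powr p + t * v powr p"
proof -
 have half: "(s * u) powr p <= s * u powr p" if "0 <= s" "s <= 1" "u >= 0" for s u :: real
 proof (cases "s = 0")
  case False
  have "s powr p <= s powr 1" using that \<open>p >= 1\<close> False by (intro powr_mono') auto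
  then show ?thesis using that by (simp add: powr_mult mult_right_mono)
 qed simp
 consider "u = 0" | "v = 0" | "u > 0" "v > 0" using assms by linarith
 then show ?thesis
 proof cases
  case 3
  have "convex_on {0<..} (%x. x powr p)" using \<open>p >= 1\<close> by (rule powr_convex)
  from convex_onD[OF this, of t u v] 3 assms have "((1 - t) * u + t * v) powr p <= (1 - t) * u powr p + t * v powr p"
   by simp
  moreover have "s = 1 - t" using assms(3) by simp
  ultimately show ?thesis by simp
 qed (use half[of s u] half[of t v] assms in auto)
qed

text \<open>
Minkowski's inequality: \<open>f + g\<close> is a convex combination of the normalised functions,
up to the factor \<open>a + b\<close>, where \<open>a\<close> and \<open>b\<close> are the norms.
\<close>

lemma lp_norm_triangle:
 fixes f g :: "'a => 'b::{real_normed_vector, second_countable_topology}"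
 assumes f: "lp_fun M p f" and g: "lp_fun M p g" and p: "p >= 1"
 shows "lp_norm M p (%x. f x + g x) <= lp_norm M p f + lp_norm M p g"
proof -
 have [measurable]: "f \<in> borel_measurable M" "g \<in> borel_measurable M" using assms by (auto simp: lp_fun_def)
 have p0: "p > 0" using p by simp
 define a where "a = lp_norm M p f"
 define b where "b = lp_norm M p g"
 have ab: "a >= 0" "b >= 0" by (auto simp: a_def b_def)
 consider "a = 0" | "b = 0" | "a > 0" "b > 0" using ab by linarith
 then show ?thesis
 proof cases
  case 1
  then have "AE x in M. f x = 0" using lp_norm_eq_0_iff[OF f p0] by (simp add: a_def)
  then have "AE x in M. f x + g x = g x" by eventually_elim simp
  then have "lp_norm M p (%x. f x + g x) = b" unfolding b_def by (rule lp_norm_cong_AE) auto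
  then show ?thesis using ab by (simp add: a_def[symmetric] b_def[symmetric])
 next
  case 2
  then have "AE x in M. g x = 0" using lp_norm_eq_0_iff[OF g p0] by (simp add: b_def)
  then have "AE x in M. f x + g x = f x" by eventually_elim simp
  then have "lp_norm M p (%x. f x + g x) = a" unfolding a_def by (rule lp_norm_cong_AE) auto
  then show ?thesis using ab by (simp add: a_def[symmetric] b_def[symmetric])
 next
  case 3
  define s where "s = a / (a + b)"
  define t where "t = b / (a + b)"
  have st: "s >= 0" "t >= 0" "s + t = 1" using 3 by (auto simp: s_def t_def add_divide_distrib[symmetric])
  have int: "integrable M (%x. norm (f x) powr p)" "integrable M (%x. norm (g x) powr p)"
   using f g by (auto simp: lp_fun_def)
  have pw: "norm (f x + g x) powr p
    <= (a + b) powr p * (s * (norm (f x) powr p / a powr p) + t * (norm (g x) powr p / b powr p))" for x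
  proof -
   have "norm (f x + g x) powr p <= (norm (f x) + norm (g x)) powr p"
    using p by (intro powr_mono2 norm_triangle_ineq) auto
   also have "norm (f x) + norm (g x) = (a + b) * (s * (norm (f x) / a) + t * (norm (g x) / b))"
   proof -
    have "a + b ~= 0" using 3 by simp
    then have "(a + b) * (s * (norm (f x) / a)) = norm (f x)" "(a + b) * (t * (norm (g x) / b)) = norm (g x)"
     using 3 by (simp_all add: s_def t_def)
    then show ?thesis by (simp only: distrib_left)
   qed
   also have "... powr p = (a + b) powr p * (s * (norm (f x) / a) + t * (norm (g x) / b)) powr p"
    using 3 st by (intro powr_mult)
   also have "... <= (a + b) powr p * (s * (norm (f x) / a) powr p + t * (norm (g x) / b) powr p)"
    using 3 st p by (intro mult_left_mono powr_convex_combination) auto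
   finally show ?thesis using 3 by (simp add: powr_divide)
  qed
  have "(\<integral>x. norm (f x + g x) powr p \<partial>M)
    <= (\<integral>x. (a + b) powr p * (s * (norm (f x) powr p / a powr p) + t * (norm (g x) powr p / b powr p)) \<partial>M)"
   using lp_fun_add[OF f g p0] int pw by (intro integral_mono) (auto simp: lp_fun_def)
  also have "... = (a + b) powr p * (s * ((\<integral>x. norm (f x) powr p \<partial>M) / a powr p) + t * ((\<integral>x. norm (g x) powr p \<partial>M) / b powr p))"
   using int by simp
  also have "... = (a + b) powr p"
   unfolding lp_norm_powr[OF p0, symmetric] using 3 st by (simp add: a_def[symmetric] b_def[symmetric])
  finally have "lp_norm M p (%x. f x + g x) <= ((a + b) powr p) powr (1 / p)"
   unfolding lp_norm_def using p0 by (intro powr_mono2) (auto intro: integral_nonneg_AE)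
  then show ?thesis using 3 p0 by (simp add: powr_powr a_def[symmetric] b_def[symmetric])
 qed
qed

lemma lp_fun_diff:
 fixes f g :: "'a => 'b::{real_normed_vector, second_countable_topology}"
 assumes "lp_fun M p f" "lp_fun M p g" "p > 0"
 shows "lp_fun M p (%x. f x - g x)"
proof -
 have "lp_fun M p (%x. - g x)" using assms(2) by (simp add: lp_fun_def)
 from lp_fun_add[OF assms(1) this assms(3)] show ?thesis by simp
qed

lemma lp_norm_minus_commute: "lp_norm M p (%x. f x - g x) = lp_norm M p (%x. g x - f x)"
 by (rule lp_norm_cong_norm) (rule norm_minus_commute)

lemma lp_norm_nn_integral:
 assumes "lp_fun M p f" "p > 0"
 shows "(\<integral>\<^sup>+x. ennreal (norm (f x) powr p) \<partial>M) = ennreal (lp_norm M p f powr p)"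
 unfolding lp_norm_powr[OF assms(2)] using assms(1)
 by (intro nn_integral_eq_integral) (auto simp: lp_fun_def)

lemma lp_norm_leI_nn_integral:
 assumes [measurable]: "f \<in> borel_measurable M" and "p > 0" "B >= 0"
  and le: "(\<integral>\<^sup>+x. ennreal (norm (f x) powr p) \<partial>M) <= ennreal (B powr p)"
 shows "lp_fun M p f" "lp_norm M p f <= B"
proof -
 show f: "lp_fun M p f"
 proof -
  have fin: "(\<integral>\<^sup>+x. ennreal (norm (f x) powr p) \<partial>M) < \<infinity>"
   unfolding infinity_ennreal_def by (rule le_less_trans[OF le ennreal_less_top])
  have "integrable M (%x. norm (f x) powr p)" by (rule integrableI_nonneg[OF _ _ fin]) simp_all
  then show ?thesis by (simp add: lp_fun_def)
 qed
 have "lp_norm M p f powr p <= B powr p"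
  using le unfolding lp_norm_nn_integral[OF f \<open>p > 0\<close>] by (simp add: ennreal_le_iff)
 then show "lp_norm M p f <= B" using \<open>p > 0\<close> \<open>B >= 0\<close> by (meson lp_norm_nonneg not_less powr_less_mono2)
qed

text \<open>
The Riesz--Fischer theorem. A subsequence with increments at most \<open>4\<^sup>-\<^sup>j\<close>
converges almost everywhere, because the sum of the increments weighted by
\<open>2\<^sup>j\<close> has a finite integral; Fatou's lemma estimates the distance to the limit.
\<close>

theorem lp_complete:
 fixes f :: "nat => 'a => 'b::{banach, second_countable_topology}"
 assumes f: "!!k. lp_fun M p (f k)" and p: "p >= 1"
  and cauchy: "!!e. e > 0 ==> \<exists>N. \<forall>m\<ge>N. \<forall>n\<ge>N. lp_norm M p (%x. f m x - f n x) < e"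
 obtains g where "lp_fun M p g" "(%k. lp_norm M p (%x. f k x - g x)) \<longlonglongrightarrow> 0"
proof -
 have p0: "p > 0" using p by simp
 have [measurable]: "f k \<in> borel_measurable M" for k using f by (auto simp: lp_fun_def)
 have "\<exists>N. \<forall>m\<ge>N. \<forall>n\<ge>N. lp_norm M p (%x. f m x - f n x) < (1/4) ^ j" for j using cauchy by simp
 then obtain N where N: "!!j m n. m >= N j ==> n >= N j ==> lp_norm M p (%x. f m x - f n x) < (1/4) ^ j" by metis
 define r where "r j = (\<Sum>i\<le>j. N i)" for j
 have r_ge: "N j <= r i" if "j <= i" for i j
  unfolding r_def using that by (intro member_le_sum) auto
 define h where "h j x = f (r (Suc j)) x - f (r j) x" for j x
 have h: "lp_fun M p (h j)" for j unfolding h_def by (intro lp_fun_diff f p0)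
 have [measurable]: "h j \<in> borel_measurable M" for j unfolding h_def by measurable
 have h_le: "lp_norm M p (h j) <= (1/4) ^ j" for j
  unfolding h_def by (rule less_imp_le, rule N) (auto intro: r_ge)
 have "(\<integral>\<^sup>+x. (\<Sum>j. ennreal ((2 ^ j * norm (h j x)) powr p)) \<partial>M)
   = (\<Sum>j. \<integral>\<^sup>+x. ennreal ((2 ^ j * norm (h j x)) powr p) \<partial>M)"
  by (intro nn_integral_suminf) measurable
 also have "... <= (\<Sum>j. ennreal ((1/2) ^ j))"
 proof (intro suminf_le)
  fix j
  have "(\<integral>\<^sup>+x. ennreal ((2 ^ j * norm (h j x)) powr p) \<partial>M)
    = (\<integral>\<^sup>+x. ennreal ((2 ^ j) powr p) * ennreal (norm (h j x) powr p) \<partial>M)"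
   by (intro nn_integral_cong) (simp add: powr_mult ennreal_mult)
  also have "... = ennreal ((2 ^ j) powr p) * ennreal (lp_norm M p (h j) powr p)"
   by (subst nn_integral_cmult) (auto simp: lp_norm_nn_integral[OF h p0])
  also have "... = ennreal ((2 ^ j * lp_norm M p (h j)) powr p)" by (simp add: powr_mult ennreal_mult)
  also have "... <= ennreal ((1/2) ^ j)"
  proof (rule ennreal_leI)
   have "2 ^ j * lp_norm M p (h j) <= 2 ^ j * (1/4) ^ j" by (intro mult_left_mono h_le) auto
   also have "... = (1/2) ^ j" by (simp add: power_mult_distrib[symmetric])
   finally have "(2 ^ j * lp_norm M p (h j)) powr p <= ((1/2) ^ j) powr p" using p0 by (intro powr_mono2) auto
   also have "... <= ((1/2) ^ j) powr 1" using p by (intro powr_mono') (auto simp: power_le_one)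
   finally show "(2 ^ j * lp_norm M p (h j)) powr p <= (1/2) ^ j" by simp
  qed
  finally show "(\<integral>\<^sup>+x. ennreal ((2 ^ j * norm (h j x)) powr p) \<partial>M) <= ennreal ((1/2) ^ j)" .
 qed auto
 also have "... = ennreal (\<Sum>j. (1/2) ^ j)" by (intro suminf_ennreal2) auto
 finally have "(\<integral>\<^sup>+x. (\<Sum>j. ennreal ((2 ^ j * norm (h j x)) powr p)) \<partial>M) ~= \<infinity>"
  by (auto simp: top_unique)
 then have "AE x in M. (\<Sum>j. ennreal ((2 ^ j * norm (h j x)) powr p)) ~= \<infinity>"
  by (intro nn_integral_PInf_AE) auto
 then have conv: "AE x in M. convergent (%j. f (r j) x)"
 proof eventually_elim
  fix x assume fin: "(\<Sum>j. ennreal ((2 ^ j * norm (h j x)) powr p)) ~= \<infinity>"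
  define C where "C = enn2real (\<Sum>j. ennreal ((2 ^ j * norm (h j x)) powr p))"
  have C: "(\<Sum>j. ennreal ((2 ^ j * norm (h j x)) powr p)) = ennreal C"
   using fin by (simp add: C_def less_top[symmetric])
  have C0: "C >= 0" by (simp add: C_def)
  have "norm (h j x) <= C powr (1/p) * (1/2) ^ j" for j
  proof -
   have "ennreal ((2 ^ j * norm (h j x)) powr p) <= ennreal C"
    unfolding C[symmetric] by (rule order_trans[OF _ sum_le_suminf[of _ "{j}"]]) simp_all
   then have "(2 ^ j * norm (h j x)) powr p <= C" using C0 by (simp only: ennreal_le_iff)
   then have "((2 ^ j * norm (h j x)) powr p) powr (1/p) <= C powr (1/p)" using p0 by (intro powr_mono2) auto
   then have "2 ^ j * norm (h j x) <= C powr (1/p)" using p0 by (simp add: powr_powr powr_one')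
   then show ?thesis by (simp add: field_simps power_divide)
  qed
  then have "summable (%j. h j x)"
   by (intro summable_comparison_test[of "%j. h j x" "%j. C powr (1/p) * (1/2) ^ j"])
     (auto intro!: summable_mult summable_geometric)
  then have "convergent (%m. \<Sum>j<m. h j x)" by (simp add: summable_iff_convergent)
  moreover have "(\<Sum>j<m. h j x) = f (r m) x - f (r 0) x" for m
   unfolding h_def by (rule sum_lessThan_telescope)
  ultimately have "convergent (%m. f (r m) x - f (r 0) x)" by simp
  then show "convergent (%j. f (r j) x)" by (simp add: convergent_diff_const_right_iff)
 qed
 define g where "g x = lim (%j. f (r j) x)" for x
 have [measurable]: "g \<in> borel_measurable M" unfolding g_def by measurable
 have close: "lp_fun M p (%x. f k x - g x) & lp_norm M p (%x. f k x - g x) <= (1/4) ^ j" if k: "k >= N j" for k j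
 proof -
  have "(\<integral>\<^sup>+x. ennreal (norm (f k x - g x) powr p) \<partial>M)
    = (\<integral>\<^sup>+x. liminf (%i. ennreal (norm (f k x - f (r i) x) powr p)) \<partial>M)"
  proof (rule nn_integral_cong_AE, use conv in eventually_elim)
   fix x assume "convergent (%j. f (r j) x)"
   then have "(%j. f (r j) x) \<longlonglongrightarrow> g x" by (simp add: g_def convergent_LIMSEQ_iff)
   then have "(%i. ennreal (norm (f k x - f (r i) x) powr p)) \<longlonglongrightarrow> ennreal (norm (f k x - g x) powr p)"
    using p0 by (intro tendsto_ennrealI tendsto_powr2 tendsto_intros) auto
   then show "ennreal (norm (f k x - g x) powr p) = liminf (%i. ennreal (norm (f k x - f (r i) x) powr p))"
    by (rule lim_imp_Liminf[OF trivial_limit_sequentially, symmetric])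
  qed
  also have "... <= liminf (%i. \<integral>\<^sup>+x. ennreal (norm (f k x - f (r i) x) powr p) \<partial>M)"
   by (intro nn_integral_liminf) measurable
  also have "... <= liminf (%i. ennreal (((1/4) ^ j) powr p))"
  proof (rule Liminf_mono, rule eventually_sequentiallyI[of j])
   fix i assume "j <= i"
   then have "lp_norm M p (%x. f k x - f (r i) x) <= (1/4) ^ j" by (intro less_imp_le[OF N] k r_ge)
   then show "(\<integral>\<^sup>+x. ennreal (norm (f k x - f (r i) x) powr p) \<partial>M) <= ennreal (((1/4) ^ j) powr p)"
    using p0 by (subst lp_norm_nn_integral) (auto intro!: lp_fun_diff f ennreal_leI powr_mono2)
  qed
  also have "... = ennreal (((1/4) ^ j) powr p)" by (simp add: Liminf_const)
  finally show ?thesis using lp_norm_leI_nn_integral[of "%x. f k x - g x" M p "(1/4) ^ j"] p0 by simp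
 qed
 have "lp_fun M p (%x. f (N 0) x - (f (N 0) x - g x))" by (rule lp_fun_diff[OF f _ p0]) (use close[of 0 "N 0"] in blast)
 then have g: "lp_fun M p g" by simp
 moreover have "(%k. lp_norm M p (%x. f k x - g x)) \<longlonglongrightarrow> 0"
 proof (rule LIMSEQ_I)
  fix e :: real assume "e > 0"
  then obtain j where "(1/4) ^ j < e" using real_arch_pow_inv[of e "1/4"] by auto
  then show "\<exists>no. \<forall>n\<ge>no. norm (lp_norm M p (%x. f n x - g x) - 0) < e"
   using close by (intro exI[of _ "N j"]) (auto intro: le_less_trans)
 qed
 ultimately show ?thesis by (rule that)
qed

subsection \<open>Pairing with Schwartz functions\<close>

lemma lp_fun_pairing:
 fixes f :: "real^'n::finite => complex"
 assumes f: "lp_fun lborel p f" and p: "p >= 1"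
 shows "integrable lborel (%x. f x * schwartz_fun \<phi> x)" (is ?int)
  and "norm (LBINT x. f x * schwartz_fun \<phi> x)
   <= (1 + (\<integral>x. weight x \<partial>(lborel :: (real^'n) measure))) * schwartz_norm (2 * CARD('n)) \<phi> * lp_norm lborel p f" (is ?bound)
proof -
 have p0: "p > 0" using p by simp
 have [measurable]: "f \<in> borel_measurable lborel" using f by (auto simp: lp_fun_def)
 define S where "S = schwartz_norm (2 * CARD('n)) \<phi>"
 have S0: "S >= 0" unfolding S_def by (rule schwartz_norm_nonneg)
 have phi: "norm (schwartz_fun \<phi> x) <= S * weight x" for x
  using le_schwartz_norm[of "[]" "2 * CARD('n)" x \<phi>]
  by (simp add: weight_def S_def field_simps add_pos_nonneg)
 have w1: "weight x <= 1" for x :: "real^'n" by (simp add: weight_def add_pos_nonneg)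
 define a where "a = lp_norm lborel p f"
 have "?int & ?bound"
 proof (cases "a = 0")
  case True
  then have "AE x in lborel. f x = 0" using lp_norm_eq_0_iff[OF f p0] by (simp add: a_def)
  then have ae: "AE x in lborel. f x * schwartz_fun \<phi> x = 0" by eventually_elim simp
  have ?int by (subst integrable_cong_AE[OF _ _ ae]) auto
  moreover have "(LBINT x. f x * schwartz_fun \<phi> x) = 0" using integral_cong_AE[OF _ _ ae] by simp
  ultimately show ?thesis using True by (simp add: a_def)
 next
  case False
  then have a: "a > 0" by (simp add: a_def less_le)
  have fp: "integrable lborel (%x. norm (f x) powr p)" using f by (simp add: lp_fun_def)
  let ?b = "%x. a * S * (weight x + norm (f x) powr p / a powr p)"
  have int_b: "integrable lborel ?b" using fp integrable_weight by auto
  have le: "norm (f x * schwartz_fun \<phi> x) <= ?b x" for x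
  proof -
   have 1: "norm (f x) / a <= 1 + (norm (f x) / a) powr p"
   proof (cases "norm (f x) / a <= 1")
    case False
    then have "(norm (f x) / a) powr 1 <= (norm (f x) / a) powr p" using p by (intro powr_mono) auto
    then show ?thesis using a by simp
   qed (simp add: add_increasing2)
   have "norm (f x) * norm (schwartz_fun \<phi> x) <= norm (f x) * (S * weight x)" by (intro mult_left_mono phi) auto
   also have "... = a * S * (weight x * (norm (f x) / a))" using a by simp
   also have "... <= a * S * (weight x * (1 + (norm (f x) / a) powr p))"
    using a S0 1 by (intro mult_left_mono) (auto intro: less_imp_le weight_pos)
   also have "... <= ?b x"
   proof (rule mult_left_mono)
    have "weight x * (norm (f x) / a) powr p <= 1 * (norm (f x) / a) powr p" by (intro mult_right_mono w1) auto
    then show "weight x * (1 + (norm (f x) / a) powr p) <= weight x + norm (f x) powr p / a powr p"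
     using a by (simp add: distrib_left powr_divide)
   qed (use a S0 in simp)
   finally show ?thesis by (simp add: norm_mult)
  qed
  have ?int
  proof (rule Bochner_Integration.integrable_bound[OF int_b])
   show "AE x in lborel. norm (f x * schwartz_fun \<phi> x) <= norm (?b x)"
    unfolding real_norm_def by (intro AE_I2 order_trans[OF le abs_ge_self])
  qed measurable
  note i = this
  have "norm (LBINT x. f x * schwartz_fun \<phi> x) <= (LBINT x. ?b x)"
   by (rule Bochner_Integration.integral_norm_bound_integral) (use i int_b le in auto)
  also have "(LBINT x. ?b x) = a * S * ((\<integral>x. weight x \<partial>(lborel :: (real^'n) measure)) + 1)"
  proof -
   have "(LBINT x. weight x + norm (f x) powr p / a powr p)
     = (\<integral>x. weight x \<partial>(lborel :: (real^'n) measure)) + (LBINT x. norm (f x) powr p / a powr p)"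
    by (rule Bochner_Integration.integral_add) (use fp integrable_weight in auto)
   also have "(LBINT x. norm (f x) powr p / a powr p) = 1"
    using a by (simp add: lp_norm_powr[OF p0, symmetric] a_def[symmetric])
   finally show ?thesis by simp
  qed
  finally have "norm (LBINT x. f x * schwartz_fun \<phi> x)
    <= (1 + (\<integral>x. weight x \<partial>(lborel :: (real^'n) measure))) * S * a" by (simp only: mult_ac add.commute)
  with i show ?thesis unfolding S_def a_def by blast
 qed
 then show ?int ?bound by auto
qed

section \<open>Gaussians with complex parameter\<close>

text \<open>
A multiple of the heat kernel at the complex time \<open>z\<close>. The constant factor \<open>(4
\<pi>) powr (- n / 2)\<close> is left out, since the equations are linear.
\<close>

definition gauss :: "complex => real^'n::finite => complex" where
 "gauss z x = z powr (- of_nat CARD('n) / 2) * exp (- (of_real ((norm x)\<^sup>2) / (4 * z)))"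

datatype 'n gpoly = Const complex | InvZ | Coord 'n | NormSq | Add "'n gpoly" "'n gpoly" | Mul "'n gpoly" "'n gpoly"

text \<open>
All derivatives of the Gaussian, in space and in time, are polynomials in \<open>1 / z\<close>,
the coordinates and the squared norm, times the Gaussian. The polynomials are kept as syntax, so
that differentiation becomes the symbolic operations \<open>Dx\<close> and \<open>Dz\<close> and
estimates can be proved by induction.
\<close>

primrec ev :: "'n::finite gpoly => complex => real^'n => complex" where
 "ev (Const c) z x = c"
| "ev InvZ z x = 1 / z"
| "ev (Coord i) z x = of_real (x $ i)"
| "ev NormSq z x = of_real ((norm x)\<^sup>2)"
| "ev (Add P Q) z x = ev P z x + ev Q z x"
| "ev (Mul P Q) z x = ev P z x * ev Q z x"

primrec dx :: "'n::finite => 'n gpoly => 'n gpoly" where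
 "dx i (Const c) = Const 0"
| "dx i InvZ = Const 0"
| "dx i (Coord j) = Const (if i = j then 1 else 0)"
| "dx i NormSq = Mul (Const 2) (Coord i)"
| "dx i (Add P Q) = Add (dx i P) (dx i Q)"
| "dx i (Mul P Q) = Add (Mul P (dx i Q)) (Mul (dx i P) Q)"

primrec dz :: "'n::finite gpoly => 'n gpoly" where
 "dz (Const c) = Const 0"
| "dz InvZ = Mul (Const (-1)) (Mul InvZ InvZ)"
| "dz (Coord j) = Const 0"
| "dz NormSq = Const 0"
| "dz (Add P Q) = Add (dz P) (dz Q)"
| "dz (Mul P Q) = Add (Mul (dz P) Q) (Mul (dz Q) P)"

definition Dx :: "'n::finite => 'n gpoly => 'n gpoly" where
 "Dx i P = Add (dx i P) (Mul (Mul (Const (-1/2)) (Mul InvZ (Coord i))) P)"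

definition Dz :: "'n::finite gpoly => 'n gpoly" where
 "Dz P = Add (dz P) (Mul (Add (Mul (Const (- of_nat CARD('n) / 2)) InvZ) (Mul (Const (1/4)) (Mul (Mul InvZ InvZ) NormSq))) P)"

definition E :: "'n::finite gpoly => complex => real^'n => complex" where
 "E P z x = ev P z x * gauss z x"

lemma sum_axis_scaleR:
 fixes c :: "'n::finite => 'a::real_vector"
 shows "(\<Sum>j\<in>UNIV. axis i (1::real) $ j *\<^sub>R c j) = c i"
proof -
 have "(\<Sum>j\<in>UNIV. axis i (1::real) $ j *\<^sub>R c j) = (\<Sum>j\<in>UNIV. if i = j then c j else 0)"
  by (intro sum.cong) (auto simp: axis_def)
 then show ?thesis by simp
qed

lemma has_derivative_of_real_norm_sq:
 fixes x :: "real^'n::finite"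
 shows "((%x. of_real ((norm x)\<^sup>2) :: complex) has_derivative (%h. \<Sum>i\<in>UNIV. h $ i *\<^sub>R of_real (2 * x $ i))) (at x)"
proof -
 have "((%x. of_real (x \<bullet> x) :: complex) has_derivative (%h. of_real (x \<bullet> h + h \<bullet> x))) (at x)"
  by (intro bounded_linear.has_derivative[OF bounded_linear_of_real] has_derivative_inner has_derivative_ident)
 moreover have "(%h. of_real (x \<bullet> h + h \<bullet> x) :: complex) = (%h. \<Sum>i\<in>UNIV. h $ i *\<^sub>R of_real (2 * x $ i))"
  by (rule ext) (simp add: inner_vec_def sum_distrib_left sum.distrib[symmetric] scaleR_conv_of_real mult_ac)
 ultimately show ?thesis by (simp only: power2_norm_eq_inner)
qed

lemma ev_eta:
 "ev (Const c) z = (%x. c)" "ev InvZ z = (%x. 1 / z)" "ev (Coord i) z = (%x. of_real (x $ i))"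
 "ev NormSq z = (%x. of_real ((norm x)\<^sup>2))" "ev (Add P Q) z = (%x. ev P z x + ev Q z x)"
 "ev (Mul P Q) z = (%x. ev P z x * ev Q z x)"
 by (simp_all add: fun_eq_iff)

lemma ev_has_derivative:
 "(ev P z has_derivative (%h. \<Sum>i\<in>UNIV. h $ i *\<^sub>R ev (dx i P) z x)) (at x)"
proof (induction P)
 case (Coord j)
 have "((%x. of_real (x $ j) :: complex) has_derivative (%h. of_real (h $ j))) (at x)"
  by (intro bounded_linear.has_derivative[OF bounded_linear_of_real]
    bounded_linear.has_derivative[OF bounded_linear_vec_nth] has_derivative_ident)
 moreover have "(%h. of_real (h $ j) :: complex) = (%h. \<Sum>i\<in>UNIV. h $ i *\<^sub>R (if i = j then 1 else 0))"
  by (rule ext) (simp add: scaleR_conv_of_real if_distrib cong: if_cong)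
 ultimately show ?case by (simp add: ev_eta)
next
 case NormSq
 show ?case using has_derivative_of_real_norm_sq[of x] by (simp add: ev_eta)
next
 case (Add P Q)
 show ?case unfolding ev_eta
  by (rule has_derivative_eq_rhs[OF has_derivative_add[OF Add]]) (simp add: scaleR_add_right sum.distrib)
next
 case (Mul P Q)
 show ?case unfolding ev_eta
  by (rule has_derivative_eq_rhs[OF has_derivative_mult[OF Mul]])
    (simp add: scaleR_add_right sum.distrib sum_distrib_left sum_distrib_right)
qed (simp_all add: ev_eta)

lemma gauss_has_derivative:
 assumes "z ~= 0"
 shows "(gauss z has_derivative (%h. \<Sum>i\<in>UNIV. h $ i *\<^sub>R (- of_real (x $ i) / (2 * z) * gauss z x))) (at (x :: real^'n::finite))"
proof -
 define f where "f y = - (of_real ((norm y)\<^sup>2) / (4 * z))" for y :: "real^'n"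
 have f: "(f has_derivative (%h. - ((\<Sum>i\<in>UNIV. h $ i *\<^sub>R of_real (2 * x $ i)) / (4 * z)))) (at x)"
  unfolding f_def
  by (intro has_derivative_minus bounded_linear.has_derivative[OF bounded_linear_divide] has_derivative_of_real_norm_sq)
 have e: "(exp has_derivative (%h. exp (f x) * h)) (at (f x))"
  using DERIV_exp[of "f x"] by (simp add: has_field_derivative_def)
 have "((%y. z powr (- of_nat CARD('n) / 2) * exp (f y)) has_derivative
   (%h. z powr (- of_nat CARD('n) / 2) * (exp (f x) * (- ((\<Sum>i\<in>UNIV. h $ i *\<^sub>R of_real (2 * x $ i)) / (4 * z)))))) (at x)"
  by (intro has_derivative_mult_right has_derivative_compose[OF f e])
 moreover have "(%y. z powr (- of_nat CARD('n) / 2) * exp (f y)) = gauss z" by (simp add: gauss_def f_def fun_eq_iff)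
 moreover have "z powr (- of_nat CARD('n) / 2) * (exp (f x) * (- ((\<Sum>i\<in>UNIV. h $ i *\<^sub>R of_real (2 * x $ i)) / (4 * z))))
   = (\<Sum>i\<in>UNIV. h $ i *\<^sub>R (- of_real (x $ i) / (2 * z) * gauss z x))" for h
 proof -
  have "z powr (- of_nat CARD('n) / 2) * (exp (f x) * (- ((\<Sum>i\<in>UNIV. h $ i *\<^sub>R of_real (2 * x $ i)) / (4 * z))))
    = gauss z x * (\<Sum>i\<in>UNIV. - (h $ i *\<^sub>R of_real (2 * x $ i) / (4 * z)))"
   by (simp add: gauss_def f_def sum_negf sum_divide_distrib)
  also have "... = (\<Sum>i\<in>UNIV. h $ i *\<^sub>R (- of_real (x $ i) / (2 * z) * gauss z x))"
   unfolding sum_distrib_left using assms by (intro sum.cong refl) (simp add: scaleR_conv_of_real field_simps)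
  finally show ?thesis .
 qed
 ultimately show ?thesis by (simp only:)
qed

lemma E_has_derivative:
 assumes "z ~= 0"
 shows "(E P z has_derivative (%h. \<Sum>i\<in>UNIV. h $ i *\<^sub>R E (Dx i P) z x)) (at x)"
proof -
 have "((%x. ev P z x * gauss z x) has_derivative
   (%h. ev P z x * (\<Sum>i\<in>UNIV. h $ i *\<^sub>R (- of_real (x $ i) / (2 * z) * gauss z x))
    + (\<Sum>i\<in>UNIV. h $ i *\<^sub>R ev (dx i P) z x) * gauss z x)) (at x)"
  by (rule has_derivative_mult[OF ev_has_derivative gauss_has_derivative[OF assms]])
 moreover have "ev P z x * (\<Sum>i\<in>UNIV. h $ i *\<^sub>R (- of_real (x $ i) / (2 * z) * gauss z x))
   + (\<Sum>i\<in>UNIV. h $ i *\<^sub>R ev (dx i P) z x) * gauss z x = (\<Sum>i\<in>UNIV. h $ i *\<^sub>R E (Dx i P) z x)" for h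
  unfolding sum_distrib_left sum_distrib_right sum.distrib[symmetric]
  by (intro sum.cong refl) (simp add: E_def Dx_def algebra_simps)
 ultimately show ?thesis unfolding E_def[abs_def] by simp
qed

lemma partial_deriv_E: "z ~= 0 ==> partial_deriv i (E P z) = E (Dx i P) z"
 by (rule ext) (simp add: partial_derivI[OF E_has_derivative] sum_axis_scaleR)

lemma norm_gauss:
 assumes "Re z > 0"
 shows "norm (gauss z x) = norm z powr (- real CARD('n) / 2) * exp (- (Re z * (norm (x :: real^'n::finite))\<^sup>2 / (4 * (norm z)\<^sup>2)))"
proof -
 have "norm (z powr (- of_nat CARD('n) / 2)) = norm z powr (- real CARD('n) / 2)"
  by (subst norm_powr_real_powr') auto
 moreover have "Re (- (of_real ((norm x)\<^sup>2) / (4 * z))) = - (Re z * (norm x)\<^sup>2 / (4 * (norm z)\<^sup>2))"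
 proof -
  have "(4 * Re z)\<^sup>2 + (4 * Im z)\<^sup>2 = 16 * (norm z)\<^sup>2" by (simp add: cmod_power2 power_mult_distrib)
  moreover have "Re (of_real ((norm x)\<^sup>2) / (4 * z)) = (norm x)\<^sup>2 * (4 * Re z) / ((4 * Re z)\<^sup>2 + (4 * Im z)\<^sup>2)"
   unfolding Re_divide by simp
  ultimately have "Re (of_real ((norm x)\<^sup>2) / (4 * z)) = (norm x)\<^sup>2 * (4 * Re z) / (16 * (norm z)\<^sup>2)" by (simp only:)
  then show ?thesis by simp
 qed
 ultimately show ?thesis by (simp add: gauss_def norm_mult)
qed

lemma power_times_gaussian_bounded:
 fixes c :: real assumes "c > 0"
 shows "\<exists>B\<ge>0. \<forall>t\<ge>0. (1 + t) ^ N * exp (- (c * t\<^sup>2)) <= B"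
proof -
 have "((%t. (1 + t) ^ N * exp (- (c * t\<^sup>2))) \<longlongrightarrow> 0) at_top" using assms by real_asymp
 then have "\<forall>\<^sub>F t in at_top. (1 + t) ^ N * exp (- (c * t\<^sup>2)) < 1" by (rule order_tendstoD) simp
 then obtain T where T: "!!t. t >= T ==> (1 + t) ^ N * exp (- (c * t\<^sup>2)) < 1" by (auto simp: eventually_at_top_linorder)
 have "compact ((%t. (1 + t) ^ N * exp (- (c * t\<^sup>2))) ` {0..T})"
  by (intro compact_continuous_image continuous_intros) auto
 from compact_imp_bounded[OF this]
 obtain B where "\<forall>y\<in>(%t. (1 + t) ^ N * exp (- (c * t\<^sup>2))) ` {0..T}. norm y <= B"
  unfolding bounded_iff by blast
 then have B: "norm ((1 + t) ^ N * exp (- (c * t\<^sup>2))) <= B" if "t \<in> {0..T}" for t using that by blast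
 have "(1 + t) ^ N * exp (- (c * t\<^sup>2)) <= max 1 B" if "t >= 0" for t
  using T[of t] B[of t] that by (cases "t >= T") (simp_all add: less_imp_le abs_le_iff le_max_iff_disj)
 then show ?thesis by (intro exI[of _ "max 1 B"]) auto
qed

lemma ev_bound:
 assumes "a > 0"
 shows "\<exists>C\<ge>0. \<exists>k. \<forall>z x. a <= Re z --> norm (ev P z x) <= C * (1 + norm x) ^ k"
proof (induction P)
 case (Const c) show ?case by (intro exI[of _ "norm c"] conjI exI[of _ 0]) auto
next
 case InvZ
 have "norm (1 / z) <= 1 / a" if "a <= Re z" for z
  using that assms complex_Re_le_cmod[of z] by (simp add: norm_divide frac_le)
 then show ?case using assms by (intro exI[of _ "1 / a"] conjI exI[of _ 0]) auto
next
 case (Coord i)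
 have "\<bar>x $ i\<bar> <= 1 * (1 + norm x) ^ 1" for x :: "real^'a" using component_le_norm_cart[of x i] by simp
 then show ?case by (intro exI[of _ 1] conjI exI[of _ 1]) auto
next
 case NormSq
 have "norm (ev NormSq z x) <= 1 * (1 + norm x) ^ 2" for z and x :: "real^'a"
  unfolding ev.simps norm_of_real by (simp add: power_mono)
 then show ?case by (intro exI[of _ 1] conjI exI[of _ 2]) (blast | simp)+
next
 case (Add P Q)
 obtain C k where 1: "C >= 0" "!!z x. a <= Re z ==> norm (ev P z x) <= C * (1 + norm x) ^ k"
  using Add(1) by blast
 obtain D l where 2: "D >= 0" "!!z x. a <= Re z ==> norm (ev Q z x) <= D * (1 + norm x) ^ l"
  using Add(2) by blast
 have "norm (ev (Add P Q) z x) <= (C + D) * (1 + norm x) ^ (k + l)" if "a <= Re z" for z x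
 proof -
  have "C * (1 + norm x) ^ k <= C * (1 + norm x) ^ (k + l)" "D * (1 + norm x) ^ l <= D * (1 + norm x) ^ (k + l)"
   using 1(1) 2(1) by (auto intro!: mult_left_mono power_increasing)
  then show ?thesis using 1(2)[OF that, of x] 2(2)[OF that, of x] norm_triangle_ineq[of "ev P z x" "ev Q z x"]
   by (simp add: distrib_right)
 qed
 then show ?case using 1 2 by (intro exI[of _ "C + D"] conjI exI[of _ "k + l"]) auto
next
 case (Mul P Q)
 obtain C k where 1: "C >= 0" "!!z x. a <= Re z ==> norm (ev P z x) <= C * (1 + norm x) ^ k"
  using Mul(1) by blast
 obtain D l where 2: "D >= 0" "!!z x. a <= Re z ==> norm (ev Q z x) <= D * (1 + norm x) ^ l"
  using Mul(2) by blast
 have "norm (ev (Mul P Q) z x) <= (C * D) * (1 + norm x) ^ (k + l)" if "a <= Re z" for z x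
  using mult_mono[OF 1(2)[OF that, of x] 2(2)[OF that, of x]] 1(1)
  by (simp add: norm_mult power_add mult_ac)
 then show ?case using 1 2 by (intro exI[of _ "C * D"] conjI exI[of _ "k + l"]) auto
qed

text \<open>
For \<open>Re z \<ge> a\<close> and \<open>norm z \<le> b\<close> the real part of \<open>1 /
z\<close> is bounded below, so the Gaussian beats every polynomial uniformly in \<open>z\<close>.
\<close>

lemma E_decay:
 assumes "a > 0"
 shows "\<exists>S\<ge>0. \<forall>z x. a <= Re z & norm z <= b --> (1 + norm x) ^ N * norm (E P z (x :: real^'n::finite)) <= S"
proof -
 obtain C k where C: "C >= 0" "!!z (x :: real^'n). a <= Re z ==> norm (ev P z x) <= C * (1 + norm x) ^ k"
  using ev_bound[OF assms, of P] by blast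
 define c where "c = a / (4 * (max b a)\<^sup>2)"
 have c: "c > 0" using assms by (simp add: c_def)
 obtain B where B: "B >= 0" "!!t. t >= 0 ==> (1 + t) ^ (N + k) * exp (- (c * t\<^sup>2)) <= B"
  using power_times_gaussian_bounded[OF c] by blast
 define A where "A = a powr (- real CARD('n) / 2)"
 show ?thesis
 proof (intro exI[of _ "C * A * B"] conjI allI impI)
  show "0 <= C * A * B" using C B by (simp add: A_def)
  fix z and x :: "real^'n" assume z: "a <= Re z & norm z <= b"
  have az: "a <= norm z" using z complex_Re_le_cmod[of z] by linarith
  have "c <= Re z / (4 * (norm z)\<^sup>2)"
   unfolding c_def using z az assms by (intro frac_le) (auto intro!: power_mono)
  then have "c * (norm x)\<^sup>2 <= Re z / (4 * (norm z)\<^sup>2) * (norm x)\<^sup>2" by (rule mult_right_mono) simp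
  then have e: "exp (- (Re z * (norm x)\<^sup>2 / (4 * (norm z)\<^sup>2))) <= exp (- (c * (norm x)\<^sup>2))" by simp
  have "norm (gauss z x) <= A * exp (- (c * (norm x)\<^sup>2))"
   unfolding norm_gauss[OF less_le_trans[OF assms, of "Re z"], OF conjunct1[OF z]] A_def
   using az assms by (intro mult_mono e powr_mono2') auto
  then have "norm (E P z x) <= (C * (1 + norm x) ^ k) * (A * exp (- (c * (norm x)\<^sup>2)))"
   unfolding E_def norm_mult using C z by (intro mult_mono) auto
  then have "(1 + norm x) ^ N * norm (E P z x) <= (1 + norm x) ^ N * ((C * (1 + norm x) ^ k) * (A * exp (- (c * (norm x)\<^sup>2))))"
   by (rule mult_left_mono) simp
  also have "... = C * A * ((1 + norm x) ^ (N + k) * exp (- (c * (norm x)\<^sup>2)))"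
   by (simp add: power_add mult_ac)
  also have "... <= C * A * B" using C B by (intro mult_left_mono) (auto simp: A_def)
  finally show "(1 + norm x) ^ N * norm (E P z x) <= C * A * B" .
 qed
qed

lemma is_schwartz_E:
 assumes "Re z > 0" shows "is_schwartz (E P z)"
proof (rule is_schwartz_coinduct[where C = "range (%P. E P z)"])
 have "z ~= 0" using assms by auto
 then show "g differentiable (at x)" if "g \<in> range (%P. E P z)" for g and x :: "real^'a"
  using that E_has_derivative unfolding differentiable_def by blast
 show "partial_deriv i g \<in> range (%P. E P z)" if "g \<in> range (%P. E P z)" for g and i :: 'a
  using that partial_deriv_E[OF \<open>z ~= 0\<close>] by auto
 show "bounded (range (%x. (1 + norm x) ^ N *\<^sub>R g x))" if "g \<in> range (%P. E P z)" for g :: "real^'a => complex" and N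
  using that E_decay[OF assms, of "norm z" N] unfolding bounded_weighted_iff by (auto, blast)
qed simp

subsection \<open>The heat equation\<close>

lemma ev_has_field_derivative: "z ~= 0 ==> ((%z. ev P z x) has_field_derivative ev (dz P) z x) (at z)"
 by (induction P) (auto intro!: derivative_eq_intros simp: power2_eq_square)

lemma gauss_has_field_derivative:
 assumes "Re z > 0"
 shows "((%z. gauss z x) has_field_derivative
   (- of_nat CARD('n) / 2 * (1 / z) + 1 / 4 * (1 / z * (1 / z) * of_real ((norm (x :: real^'n::finite))\<^sup>2))) * gauss z x) (at z)"
proof -
 have z: "z ~= 0" "z \<notin> \<real>\<^sub>\<le>\<^sub>0" using assms by (auto simp: complex_nonpos_Reals_iff)
 have p: "z powr (s - 1) = z powr s / z" for s using z by (simp add: powr_diff powr_to_1)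
 show ?thesis unfolding gauss_def
  by (rule DERIV_cong[OF DERIV_mult[OF has_field_derivative_powr[OF z(2)] DERIV_chain2[OF DERIV_exp]]])
    (use z in \<open>auto intro!: derivative_eq_intros simp: p\<close>, simp add: field_simps power2_eq_square)
qed

lemma E_has_field_derivative:
 assumes "Re z > 0" shows "((%z. E P z x) has_field_derivative E (Dz P) z x) (at z)"
proof -
 have "z ~= 0" using assms by auto
 show ?thesis unfolding E_def
  by (rule DERIV_cong[OF DERIV_mult[OF ev_has_field_derivative[OF \<open>z ~= 0\<close>] gauss_has_field_derivative[OF assms]]])
    (simp add: Dz_def algebra_simps)
qed

lemma ev_dz_dx: "z ~= 0 ==> ev (dz (dx i P)) z x = ev (dx i (dz P)) z x"
 by (induction P) (auto simp: algebra_simps)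

lemma E_Dz_Dx: "z ~= 0 ==> E (Dz (Dx i P)) z x = E (Dx i (Dz P)) z x"
 unfolding E_def Dz_def Dx_def by (simp add: ev_dz_dx field_simps power2_eq_square)

lemma E_Dx_cong:
 assumes "E P z = E Q z" and "Re z > 0" shows "E (Dx i P) z = E (Dx i Q) z"
proof -
 have "z ~= 0" using assms(2) by auto
 then show ?thesis using assms(1) partial_deriv_E[of z i P] partial_deriv_E[of z i Q] by simp
qed

text \<open>
The Gaussian solves the heat equation at complex times. Twice differentiated polynomials agree
only as functions, not as syntax, hence the detour over \<open>E_Dx_cong\<close> for the second
equation.
\<close>

lemma E_heat:
 assumes "Re z > 0"
 shows "(\<Sum>i\<in>UNIV. E (Dx i (Dx i (Const 1))) z x) = E (Dz (Const 1)) z x"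
  and "(\<Sum>i\<in>UNIV. E (Dx i (Dx i (Dz (Const 1)))) z x) = E (Dz (Dz (Const 1))) z x"
proof -
 have first: "(\<Sum>i\<in>UNIV. E (Dx i (Dx i (Const 1))) z x) = E (Dz (Const 1)) z x" if "Re z > 0" for z
 proof -
  have "z ~= 0" using that by auto
  have "(\<Sum>i\<in>UNIV. E (Dx i (Dx i (Const 1))) z x)
    = (\<Sum>i\<in>UNIV. (- 1 / (2 * z)) * gauss z x + of_real ((x $ i)\<^sup>2) * (gauss z x / (4 * z\<^sup>2)))"
   using \<open>z ~= 0\<close> by (intro sum.cong refl) (simp add: E_def Dx_def field_simps power2_eq_square)
  also have "... = E (Dz (Const 1)) z x"
   unfolding sum.distrib sum_distrib_right[symmetric] of_real_sum[symmetric] E_def Dz_def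
   using \<open>z ~= 0\<close>
   by (simp add: norm_vec_def L2_set_def sum_nonneg) (simp add: field_simps power2_eq_square)
  finally show ?thesis .
 qed
 show "(\<Sum>i\<in>UNIV. E (Dx i (Dx i (Const 1))) z x) = E (Dz (Const 1)) z x" using assms by (rule first)
 have d: "((%z. \<Sum>i\<in>UNIV. E (Dx i (Dx i (Const 1))) z x) has_field_derivative
   (\<Sum>i\<in>UNIV. E (Dz (Dx i (Dx i (Const 1)))) z x)) (at z)"
  by (intro DERIV_sum E_has_field_derivative assms)
 have ev: "\<forall>\<^sub>F w in nhds z. (\<Sum>i\<in>UNIV. E (Dx i (Dx i (Const 1))) w x) = E (Dz (Const 1)) w x"
  by (rule eventually_mono[OF eventually_nhds_in_open[of "{w. Re w > 0}"]])
    (use assms first in \<open>auto simp: open_halfspace_Re_gt\<close>)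
 have "((%z. E (Dz (Const 1)) z x) has_field_derivative (\<Sum>i\<in>UNIV. E (Dz (Dx i (Dx i (Const 1)))) z x)) (at z)"
  by (rule DERIV_cong_ev[OF refl ev refl, THEN iffD1, OF d])
 then have "(\<Sum>i\<in>UNIV. E (Dz (Dx i (Dx i (Const 1)))) z x) = E (Dz (Dz (Const 1))) z x"
  using E_has_field_derivative[OF assms, of "Dz (Const 1)" x] DERIV_unique by blast
 moreover have "E (Dz (Dx i (Dx i (Const 1)))) z x = E (Dx i (Dx i (Dz (Const 1)))) z x" for i
 proof -
  have "z ~= 0" using assms by auto
  then have "E (Dz (Dx i (Const 1))) z = E (Dx i (Dz (Const 1))) z" by (intro ext E_Dz_Dx)
  then have "E (Dx i (Dz (Dx i (Const 1)))) z = E (Dx i (Dx i (Dz (Const 1)))) z" using assms by (rule E_Dx_cong)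
  then show ?thesis using E_Dz_Dx[OF \<open>z ~= 0\<close>, of i "Dx i (Const 1)" x] by simp
 qed
 ultimately show "(\<Sum>i\<in>UNIV. E (Dx i (Dx i (Dz (Const 1)))) z x) = E (Dz (Dz (Const 1))) z x" by simp
qed

section \<open>Mollification\<close>

subsection \<open>Continuity of translations\<close>

abbreviation translation_gap :: "('a::euclidean_space => complex) => 'a => real" where
 "translation_gap f h \<equiv> (LBINT x. norm (f (x + h) - f x))"

lemma integrable_translate:
 fixes f :: "'a::euclidean_space => complex"
 assumes "integrable lborel f"
 shows "integrable lborel (%x. f (x + h))" "integrable lborel (%x. norm (f (x + h) - f x))"
proof -
 have [measurable]: "f \<in> borel_measurable borel" using borel_measurable_integrable[OF assms] by simp
 show 1: "integrable lborel (%x. f (x + h))"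
  using integrable_shift[of 1 f h] assms by (simp add: add.commute)
 show "integrable lborel (%x. norm (f (x + h) - f x))"
  using 1 assms by (intro integrable_norm Bochner_Integration.integrable_diff)
qed

text \<open>
The \<open>L\<^sup>1\<close> modulus of continuity is stable under \<open>L\<^sup>1\<close>
approximation, as translations are isometries.
\<close>

lemma translation_gap_approx:
 assumes f: "integrable lborel f"
  and approx: "!!e. e > 0 ==> \<exists>g. integrable lborel g & (%m. translation_gap g (h m)) \<longlonglongrightarrow> 0
    & (LBINT x. norm (f x - g x)) <= e"
 shows "(%m. translation_gap f (h m)) \<longlonglongrightarrow> 0"
proof (rule LIMSEQ_I)
 fix e :: real assume "e > 0"
 then obtain g where g: "integrable lborel g" "(%m. translation_gap g (h m)) \<longlonglongrightarrow> 0"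
  and fg: "(LBINT x. norm (f x - g x)) <= e / 4" using approx[of "e / 4"] by auto
 have [measurable]: "f \<in> borel_measurable borel" "g \<in> borel_measurable borel"
  using borel_measurable_integrable[OF f] borel_measurable_integrable[OF g(1)] by auto
 have d: "integrable lborel (%x. f x - g x)" using f g by auto
 have le: "translation_gap f k <= translation_gap g k + e / 2" for k
 proof -
  have "translation_gap f k <= (LBINT x. norm (g (x + k) - g x) + (norm (f (x + k) - g (x + k)) + norm (f x - g x)))"
  proof (rule integral_mono)
   fix x
   have "f (x + k) - f x = (g (x + k) - g x) + ((f (x + k) - g (x + k)) - (f x - g x))" by simp
   then have "norm (f (x + k) - f x) <= norm (g (x + k) - g x) + norm ((f (x + k) - g (x + k)) - (f x - g x))"
    by (metis norm_triangle_ineq)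
   then show "norm (f (x + k) - f x) <= norm (g (x + k) - g x) + (norm (f (x + k) - g (x + k)) + norm (f x - g x))"
    using norm_triangle_ineq4[of "f (x + k) - g (x + k)" "f x - g x"] by linarith
  qed (use integrable_translate[OF f] integrable_translate[OF g(1)] integrable_translate(1)[OF d] d in auto)
  also have "... = translation_gap g k + ((LBINT x. norm (f (x + k) - g (x + k))) + (LBINT x. norm (f x - g x)))"
   using integrable_translate[OF g(1)] integrable_translate(1)[OF d] d by simp
  also have "(LBINT x. norm (f (x + k) - g (x + k))) = (LBINT x. norm (f x - g x))"
   using integral_shift[of 1 "%x. norm (f x - g x)" k] by (simp add: add.commute)
  finally show ?thesis using fg by simp
 qed
 obtain N where N: "!!m. m >= N ==> norm (translation_gap g (h m) - 0) < e / 2"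
  using LIMSEQ_D[OF g(2), of "e / 2"] \<open>e > 0\<close> by auto
 have nn: "0 <= translation_gap f k" for k by simp
 show "\<exists>no. \<forall>n\<ge>no. norm (translation_gap f (h n) - 0) < e"
 proof (intro exI[of _ N] allI impI)
  fix m assume "m >= N"
  then show "norm (translation_gap f (h m) - 0) < e"
   using N[of m] le[of "h m"] nn[of "h m"] abs_ge_self[of "translation_gap g (h m)"] by simp
 qed
qed

text \<open>
The indicator function of an open set is lower semicontinuous, so by Fatou's lemma the overlap of
the set with its translates tends to the full measure.
\<close>

lemma translation_gap_open:
 assumes T: "open T" "emeasure lborel T < \<infinity>" and h: "h \<longlonglongrightarrow> 0"
 shows "(%m. translation_gap (%x. indicator T x) (h m)) \<longlonglongrightarrow> 0"
proof -
 have [measurable]: "T \<in> sets borel" using T by simp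
 have int: "integrable lborel (indicator T :: _ => real)" using T by simp
 have int_h: "integrable lborel (%x. indicator T (x + k) :: real)" for k
  using integrable_shift[of 1 "indicator T :: _ => real" k] int by (simp add: add.commute)
 have int2: "integrable lborel (%x. indicator T (x + k) * indicator T x :: real)" for k
  by (rule Bochner_Integration.integrable_bound[OF int]) (auto simp: indicator_def)
 have eq: "translation_gap (%x. indicator T x) k
   = 2 * measure lborel T - 2 * (LBINT x. indicator T (x + k) * indicator T x)" for k
 proof -
  have "translation_gap (%x. indicator T x) k
    = (LBINT x. indicator T (x + k) + indicator T x - 2 * (indicator T (x + k) * indicator T x))"
   by (intro Bochner_Integration.integral_cong) (auto simp: indicator_def)
  also have "... = (LBINT x. indicator T (x + k)) + (LBINT x. indicator T x)
    - 2 * (LBINT x. indicator T (x + k) * indicator T x)"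
   using int int_h int2 by simp
  also have "(LBINT x. indicator T (x + k)) = (\<integral>x. indicator T x \<partial>lborel :: real)"
   using integral_shift[of 1 "indicator T :: _ => real" k] by (simp add: add.commute)
  finally show ?thesis by simp
 qed
 have "(%m. \<integral>x. indicator T (x + h m) * indicator T x \<partial>lborel) \<longlonglongrightarrow> (\<integral>x. indicator T x \<partial>lborel :: real)"
 proof (rule integral_dominated_convergence[OF _ _ int])
  show "AE x in lborel. (%m. indicator T (x + h m) * indicator T x :: real) \<longlonglongrightarrow> indicator T x"
  proof (rule AE_I2)
   fix x
   show "(%m. indicator T (x + h m) * indicator T x :: real) \<longlonglongrightarrow> indicator T x"
   proof (cases "x \<in> T")
    case True
    have "(%m. x + h m) \<longlonglongrightarrow> x + 0" by (intro tendsto_intros h)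
    then have "\<forall>\<^sub>F m in sequentially. x + h m \<in> T" using topological_tendstoD[OF _ T(1)] True by auto
    then have "\<forall>\<^sub>F m in sequentially. indicator T (x + h m) * indicator T x = (indicator T x :: real)"
     by eventually_elim (simp add: True)
    then show ?thesis by (rule tendsto_eventually)
   qed simp
  qed
 qed (auto simp: indicator_def)
 then have "(%m. 2 * measure lborel T - 2 * (LBINT x. indicator T (x + h m) * indicator T x))
   \<longlonglongrightarrow> 2 * measure lborel T - 2 * (LBINT x. indicator T x)" by (intro tendsto_intros)
 then show ?thesis by (simp add: eq)
qed

lemma integrable_indicator_complex:
 assumes "A \<in> sets M" "emeasure M A < \<infinity>"
 shows "integrable M (%x. indicator A x :: complex)"
proof -
 have "(%x. indicator A x :: complex) = (%x. of_real (indicator A x))" by (auto simp: indicator_def)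
 then show ?thesis using assms by (simp del: of_real_indicator)
qed

text \<open>
Translations act continuously on \<open>L\<^sup>1\<close>: measurable sets of finite measure are
approximated from outside by open sets, integrable functions by simple ones.
\<close>

theorem translation_gap_tendsto:
 fixes f :: "'a::euclidean_space => complex"
 assumes f: "integrable lborel f" and h: "h \<longlonglongrightarrow> 0"
 shows "(%m. translation_gap f (h m)) \<longlonglongrightarrow> 0"
 using f
proof (induction rule: integrable_induct)
 case (base A c)
 have [measurable]: "A \<in> sets borel" using base by simp
 have ind: "(%m. translation_gap (%x. indicator A x) (h m)) \<longlonglongrightarrow> 0"
 proof (rule translation_gap_approx)
  show "integrable lborel (%x. indicator A x :: complex)" using base by (intro integrable_indicator_complex) auto
  fix e :: real assume e: "e > 0"
  have "A \<in> sets lebesgue" using base(1) by (rule sets_completionI_sets)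
  then obtain T where T: "open T" "A \<subseteq> T" "emeasure lebesgue (T - A) < ennreal e"
   using e by (rule sets_lebesgue_outer_open)
  have [measurable]: "T \<in> sets borel" using T by simp
  have TA: "emeasure lborel (T - A) < ennreal e" using T(3) by simp
  have "emeasure lborel T <= emeasure lborel A + emeasure lborel (T - A)"
   using emeasure_subadditive[of A lborel "T - A"] T(2) by (simp add: Un_absorb1)
  also have "... < \<infinity>" using base(2) less_trans[OF TA ennreal_less_top] by (simp add: less_top[symmetric])
  finally have fin: "emeasure lborel T < \<infinity>" .
  have "(LBINT x. norm (indicator A x - indicator T x :: complex)) = (LBINT x. indicator (T - A) x)"
   by (intro Bochner_Integration.integral_cong) (use T(2) in \<open>auto simp: indicator_def\<close>)
  also have "... = measure lborel (T - A)" by simp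
  also have "... <= e" using TA e by (simp add: measure_def enn2real_leI less_imp_le)
  finally show "\<exists>g. integrable lborel g & (%m. translation_gap g (h m)) \<longlonglongrightarrow> 0
    & (LBINT x. norm (indicator A x - g x)) <= e"
   using translation_gap_open[OF T(1) fin h] integrable_indicator_complex[of T lborel] fin
   by (intro exI[of _ "%x. indicator T x"]) simp
 qed
 have "translation_gap (%x. indicator A x *\<^sub>R c) k = norm c * translation_gap (%x. indicator A x) k" for k
 proof -
  have "norm (indicator A (x + k) *\<^sub>R c - indicator A x *\<^sub>R c)
    = norm c * norm (indicator A (x + k) - indicator A x :: complex)" for x
   by (auto simp: indicator_def)
  then show ?thesis by simp
 qed
 then show ?case using tendsto_mult_right_zero[OF ind, of "norm c"] by simp
next
 case (add f g)
 show ?case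
 proof (rule tendsto_sandwich[OF _ _ tendsto_const])
  show "(%m. translation_gap f (h m) + translation_gap g (h m)) \<longlonglongrightarrow> 0"
   using tendsto_add[OF add.IH] by simp
  show "\<forall>\<^sub>F m in sequentially. translation_gap (%x. f x + g x) (h m) <= translation_gap f (h m) + translation_gap g (h m)"
  proof (intro always_eventually allI)
   fix m
   have "translation_gap (%x. f x + g x) (h m)
     <= (LBINT x. norm (f (x + h m) - f x) + norm (g (x + h m) - g x))"
   proof (rule integral_mono)
    show "norm (f (x + h m) + g (x + h m) - (f x + g x)) <= norm (f (x + h m) - f x) + norm (g (x + h m) - g x)" for x
     by (metis add_diff_add norm_triangle_ineq)
   qed (use integrable_translate[OF Bochner_Integration.integrable_add[OF add.hyps(1,2)]]
      integrable_translate[OF add.hyps(1)] integrable_translate[OF add.hyps(2)] in auto)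
   also have "... = translation_gap f (h m) + translation_gap g (h m)"
    using integrable_translate[OF add.hyps(1)] integrable_translate[OF add.hyps(2)] by simp
   finally show "translation_gap (%x. f x + g x) (h m) <= translation_gap f (h m) + translation_gap g (h m)" .
  qed
 qed auto
next
 case (lim f s)
 show ?case
 proof (rule translation_gap_approx[OF lim.hyps(4)])
  fix e :: real assume "e > 0"
  have [measurable]: "f \<in> borel_measurable borel" "s i \<in> borel_measurable borel" for i
   using borel_measurable_integrable[OF lim.hyps(4)] borel_measurable_integrable[OF lim.hyps(1)] by auto
  have "(%i. \<integral>x. norm (f x - s i x) \<partial>lborel) \<longlonglongrightarrow> (\<integral>x. 0 \<partial>(lborel :: 'a measure))"
  proof (rule integral_dominated_convergence)
   show "integrable lborel (%x. 3 * norm (f x))" using lim.hyps(4) by simp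
   show "AE x in lborel. (%i. norm (f x - s i x)) \<longlonglongrightarrow> 0"
   proof (rule AE_I2)
    fix x
    have "(%i. norm (f x - s i x)) \<longlonglongrightarrow> norm (f x - f x)" by (intro tendsto_intros lim.hyps(2)) simp
    then show "(%i. norm (f x - s i x)) \<longlonglongrightarrow> 0" by simp
   qed
   show "AE x in lborel. norm (norm (f x - s i x)) <= 3 * norm (f x)" for i
   proof (rule AE_I2)
    fix x
    show "norm (norm (f x - s i x)) <= 3 * norm (f x)"
     using norm_triangle_ineq4[of "f x" "s i x"] lim.hyps(3)[of x i] by simp
   qed
  qed auto
  then obtain i where "(LBINT x. norm (f x - s i x)) < e"
   using LIMSEQ_D[of _ 0 e] \<open>e > 0\<close> by fastforce
  then show "\<exists>g. integrable lborel g & (%m. translation_gap g (h m)) \<longlonglongrightarrow> 0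
    & (LBINT x. norm (f x - g x)) <= e"
   using lim.hyps(1) lim.IH by (intro exI[of _ "s i"]) auto
 qed
qed

subsection \<open>The heat kernel as a mollifier\<close>

lemma
 fixes f :: "'a::euclidean_space => ennreal"
 assumes [measurable]: "f \<in> borel_measurable borel" and c: "c > 0"
 shows nn_integral_dilate: "(\<integral>\<^sup>+x. f x \<partial>lborel) = ennreal (c ^ DIM('a)) * (\<integral>\<^sup>+x. f (c *\<^sub>R x) \<partial>lborel)"
proof -
 have l: "(lborel :: 'a measure) = density (distr lborel borel (%x. 0 + c *\<^sub>R x)) (%_. \<bar>c\<bar> ^ DIM('a))"
  using c by (intro lborel_affine) auto
 have "(\<integral>\<^sup>+x. f x \<partial>lborel) = (\<integral>\<^sup>+x. f x \<partial>density (distr lborel borel (%x. 0 + c *\<^sub>R x)) (%_. \<bar>c\<bar> ^ DIM('a)))"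
  using l by (rule arg_cong)
 also have "... = (\<integral>\<^sup>+x. ennreal (\<bar>c\<bar> ^ DIM('a)) * f (c *\<^sub>R x) \<partial>lborel)"
  by (simp add: nn_integral_density nn_integral_distr)
 finally show ?thesis using c by (simp add: nn_integral_cmult)
qed

lemma
 fixes f :: "'a::euclidean_space => 'b::{banach, second_countable_topology}"
 assumes [measurable]: "f \<in> borel_measurable borel" and c: "c > 0"
 shows integral_dilate: "(LBINT x. f (c *\<^sub>R x)) = (1 / c ^ DIM('a)) *\<^sub>R (LBINT x. f x)"
  and integrable_dilate: "integrable lborel (%x. f (c *\<^sub>R x)) \<longleftrightarrow> integrable lborel f"
proof -
 have l: "(lborel :: 'a measure) = density (distr lborel borel (%x. 0 + c *\<^sub>R x)) (%_. ennreal (c ^ DIM('a)))"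
  using c lborel_affine[of c "0 :: 'a"] by (simp add: ennreal_power)
 have "(LBINT x. f x) = (\<integral>x. f x \<partial>density (distr lborel borel (%x. 0 + c *\<^sub>R x)) (%_. ennreal (c ^ DIM('a))))"
  using l by (rule arg_cong)
 also have "... = c ^ DIM('a) *\<^sub>R (LBINT x. f (c *\<^sub>R x))"
  using c by (simp add: integral_density integral_distr)
 finally show "(LBINT x. f (c *\<^sub>R x)) = (1 / c ^ DIM('a)) *\<^sub>R (LBINT x. f x)" using c by simp
 have "integrable lborel f \<longleftrightarrow> integrable (density (distr lborel borel (%x. 0 + c *\<^sub>R x)) (%_. ennreal (c ^ DIM('a)))) f"
  using l by (rule arg_cong)
 also have "... \<longleftrightarrow> integrable lborel (%x. f (c *\<^sub>R x))"
 proof -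
  have "integrable lborel (%x. c ^ DIM('a) *\<^sub>R f (c *\<^sub>R x)) ==> integrable lborel (%x. f (c *\<^sub>R x))"
   using integrable_scaleR_right[of "1 / c ^ DIM('a)" lborel "%x. c ^ DIM('a) *\<^sub>R f (c *\<^sub>R x)"] c by simp
  then show ?thesis using c by (auto simp: integrable_density integrable_distr_eq)
 qed
 finally show "integrable lborel (%x. f (c *\<^sub>R x)) \<longleftrightarrow> integrable lborel f" ..
qed

text \<open>
The heat kernel at time 1, normalised; the mollifier below is the kernel at time \<open>1 / (m +
1)\<^sup>2\<close>.
\<close>

definition bump :: "real^'n::finite => real" where
 "bump x = exp (- ((norm x)\<^sup>2 / 4)) / (LBINT y. exp (- ((norm (y :: real^'n))\<^sup>2 / 4)))"

definition mollifier :: "nat => real^'n::finite => real" where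
 "mollifier m x = real (Suc m) ^ CARD('n) * bump (real (Suc m) *\<^sub>R x)"

lemma integrable_exp_norm_sq: "integrable lborel (%x :: real^'n::finite. exp (- ((norm x)\<^sup>2 / 4)))"
proof -
 have "integrable lborel (%x :: real^'n. Re (E (Const 1) 1 x))"
  by (intro integrable_Re schwartz_integrable is_schwartz_E) simp
 moreover have "E (Const 1) 1 x = of_real (exp (- ((norm x)\<^sup>2 / 4)))" for x :: "real^'n"
  by (simp add: E_def gauss_def exp_of_real[symmetric])
 ultimately show ?thesis by simp
qed

lemma integral_exp_norm_sq_pos: "(LBINT x. exp (- ((norm (x :: real^'n::finite))\<^sup>2 / 4))) > 0"
proof -
 have "(LBINT x. exp (- ((norm (x :: real^'n))\<^sup>2 / 4))) ~= 0"
 proof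
  assume "(LBINT x. exp (- ((norm (x :: real^'n))\<^sup>2 / 4))) = 0"
  then have "AE x in lborel. exp (- ((norm (x :: real^'n))\<^sup>2 / 4)) = 0"
   by (subst (asm) integral_nonneg_eq_0_iff_AE[OF integrable_exp_norm_sq]) auto
  then have "AE x in (lborel :: (real^'n) measure). False" by simp
  then show False by (simp add: eventually_False ae_filter_eq_bot_iff)
 qed
 moreover have "(LBINT x. exp (- ((norm (x :: real^'n))\<^sup>2 / 4))) >= 0" by simp
 ultimately show ?thesis by linarith
qed

lemma measurable_bump [measurable]: "bump \<in> borel_measurable borel"
 unfolding bump_def by measurable

lemma measurable_mollifier [measurable]: "mollifier m \<in> borel_measurable borel"
 unfolding mollifier_def by measurable

lemma bump_nonneg: "bump x >= 0"
 using integral_exp_norm_sq_pos unfolding bump_def by (intro divide_nonneg_pos) auto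

lemma integrable_bump: "integrable lborel (bump :: real^'n::finite => real)"
 unfolding bump_def using integrable_exp_norm_sq[where 'n = 'n] by simp

lemma integral_bump: "(LBINT x. bump (x :: real^'n::finite)) = 1"
 unfolding bump_def using integral_exp_norm_sq_pos[where 'n = 'n] by simp

lemma mollifier_nonneg: "mollifier m x >= 0"
 by (simp add: mollifier_def bump_nonneg)

lemma mollifier_even: "mollifier m (- x) = mollifier m x"
 by (simp add: mollifier_def bump_def)

lemma is_schwartz_mollifier: "is_schwartz (%x. of_real (mollifier m (x :: real^'n::finite)))"
proof -
 define N where "N = real (Suc m)"
 define z where "z = complex_of_real (1 / N\<^sup>2)"
 have N: "N > 0" by (simp add: N_def)
 then have z: "Re z > 0" "z ~= 0" by (auto simp: z_def)
 define M where "M = (LBINT y. exp (- ((norm (y :: real^'n))\<^sup>2 / 4)))"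
 define c where "c = of_real (N ^ CARD('n) / M) / z powr (- of_nat CARD('n) / 2)"
 have "of_real (mollifier m x) = c * E (Const 1) z x" for x :: "real^'n"
 proof -
  have "- (of_real ((norm x)\<^sup>2) / (4 * z)) = of_real (- ((norm (N *\<^sub>R x))\<^sup>2 / 4))"
   using N by (simp add: z_def power_mult_distrib field_simps)
  then have e: "exp (- (of_real ((norm x)\<^sup>2) / (4 * z))) = of_real (exp (- ((norm (N *\<^sub>R x))\<^sup>2 / 4)))"
   by (simp only: exp_of_real)
  define w where "w = z powr (- of_nat CARD('n) / 2)"
  have "w ~= 0" using z by (simp add: w_def)
  then have "c * E (Const 1) z x = of_real (N ^ CARD('n) / M) * of_real (exp (- ((norm (N *\<^sub>R x))\<^sup>2 / 4)))"
   unfolding c_def E_def gauss_def ev.simps e w_def[symmetric] by simp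
  also have "... = of_real (mollifier m x)"
   unfolding mollifier_def bump_def N_def[symmetric] M_def[symmetric] of_real_mult[symmetric] by (simp only: times_divide_eq_left times_divide_eq_right)
  finally show ?thesis ..
 qed
 then show ?thesis using is_schwartz_mult[OF is_schwartz_E[OF z(1), of "Const 1"], of c] by simp
qed

lemma integrable_mollifier: "integrable lborel (mollifier m :: real^'n::finite => real)"
 unfolding mollifier_def using integrable_dilate[of "bump :: real^'n => real" "real (Suc m)"] integrable_bump[where 'n = 'n] by simp

lemma integral_mollifier: "(LBINT x. mollifier m (x :: real^'n::finite)) = 1"
 unfolding mollifier_def using integral_dilate[of "bump :: real^'n => real" "real (Suc m)"] by (simp add: integral_bump)

lemma nn_integral_mollifier:
 fixes \<psi> :: "real^'n::finite => ennreal"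
 assumes [measurable]: "\<psi> \<in> borel_measurable borel"
 shows "(\<integral>\<^sup>+x. ennreal (mollifier m x) * \<psi> x \<partial>lborel) = (\<integral>\<^sup>+x. ennreal (bump x) * \<psi> ((1 / real (Suc m)) *\<^sub>R x) \<partial>lborel)"
proof -
 have "(\<integral>\<^sup>+x. ennreal (bump x) * \<psi> ((1 / real (Suc m)) *\<^sub>R x) \<partial>lborel)
   = ennreal (real (Suc m) ^ CARD('n)) * (\<integral>\<^sup>+x. ennreal (bump (real (Suc m) *\<^sub>R x)) * \<psi> x \<partial>lborel)"
  by (subst nn_integral_dilate[where c = "real (Suc m)"]) auto
 also have "... = (\<integral>\<^sup>+x. ennreal (mollifier m x) * \<psi> x \<partial>lborel)"
  by (subst nn_integral_cmult[symmetric])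
    (auto intro!: nn_integral_cong simp: mollifier_def ennreal_mult bump_nonneg mult.assoc)
 finally show ?thesis ..
qed

definition convolution :: "(real^'n::finite => complex) => (real^'n => complex) => real^'n => complex" where
 "convolution k f x = (LBINT y. k y * f (x - y))"

lemma measurable_convolution [measurable]:
 assumes [measurable]: "k \<in> borel_measurable borel" "f \<in> borel_measurable borel"
 shows "convolution k f \<in> borel_measurable borel"
 unfolding convolution_def by measurable

text \<open>
Jensen's inequality for the two powers that are needed, the second being the Cauchy--Schwarz
inequality.
\<close>

lemma average_power_le:
 fixes \<rho> :: "'a => real" and g :: "'a => complex"
 assumes [measurable]: "g \<in> borel_measurable M" and \<rho>: "integrable M \<rho>" "!!y. \<rho> y >= 0" "(\<integral>y. \<rho> y \<partial>M) = 1"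
  and int: "integrable M (%y. of_real (\<rho> y) * g y)" and q: "q = 1 \<or> q = (2::nat)"
 shows "ennreal (norm (\<integral>y. of_real (\<rho> y) * g y \<partial>M) ^ q) <= (\<integral>\<^sup>+y. ennreal (\<rho> y) * ennreal (norm (g y) ^ q) \<partial>M)"
proof -
 have [measurable]: "\<rho> \<in> borel_measurable M" using \<rho> by auto
 have 1: "ennreal (norm (\<integral>y. of_real (\<rho> y) * g y \<partial>M)) <= (\<integral>\<^sup>+y. ennreal (\<rho> y) * ennreal (norm (g y)) \<partial>M)"
 proof -
  have "ennreal (norm (\<integral>y. of_real (\<rho> y) * g y \<partial>M)) <= (\<integral>\<^sup>+y. ennreal (norm (of_real (\<rho> y) * g y)) \<partial>M)"
   by (rule integral_norm_bound_ennreal[OF int])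
  also have "... = (\<integral>\<^sup>+y. ennreal (\<rho> y) * ennreal (norm (g y)) \<partial>M)"
   by (intro nn_integral_cong) (simp add: norm_mult ennreal_mult \<rho>(2))
  finally show ?thesis .
 qed
 have "ennreal (norm (\<integral>y. of_real (\<rho> y) * g y \<partial>M) ^ 2) <= (\<integral>\<^sup>+y. ennreal (\<rho> y) * ennreal (norm (g y)) \<partial>M)\<^sup>2"
  using power_mono[OF 1, of 2] by (simp add: ennreal_power)
 also have "... = (\<integral>\<^sup>+y. ennreal (sqrt (\<rho> y)) * (ennreal (sqrt (\<rho> y)) * ennreal (norm (g y))) \<partial>M)\<^sup>2"
  by (simp add: mult.assoc[symmetric] ennreal_mult[symmetric] \<rho>(2) del: mult.assoc)
 also have "... <= (\<integral>\<^sup>+y. ennreal (sqrt (\<rho> y)) ^ 2 \<partial>M) * (\<integral>\<^sup>+y. (ennreal (sqrt (\<rho> y)) * ennreal (norm (g y))) ^ 2 \<partial>M)"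
  by (intro Cauchy_Schwarz_nn_integral) measurable
 also have "(\<integral>\<^sup>+y. ennreal (sqrt (\<rho> y)) ^ 2 \<partial>M) = 1"
  using nn_integral_eq_integral[OF \<rho>(1)] \<rho>(2,3) by (simp add: ennreal_power)
 also have "(\<integral>\<^sup>+y. (ennreal (sqrt (\<rho> y)) * ennreal (norm (g y))) ^ 2 \<partial>M) = (\<integral>\<^sup>+y. ennreal (\<rho> y) * ennreal (norm (g y) ^ 2) \<partial>M)"
  by (simp add: power_mult_distrib ennreal_power \<rho>(2))
 finally have "ennreal (norm (\<integral>y. of_real (\<rho> y) * g y \<partial>M) ^ 2) <= (\<integral>\<^sup>+y. ennreal (\<rho> y) * ennreal (norm (g y) ^ 2) \<partial>M)"
  by simp
 then show ?thesis using 1 q by auto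
qed

text \<open>
The distance of \<open>f\<close> to its mollification is an average, with weight
\<open>bump\<close>, of the distances of \<open>f\<close> to its translates by \<open>- y / (m +
1)\<close>; these are bounded and tend to zero.
\<close>

lemma convolution_mollifier_tendsto:
 fixes f :: "real^'n::finite => complex"
 assumes [measurable]: "f \<in> borel_measurable borel" and q: "q = 1 \<or> q = (2::nat)"
  and int: "!!m x. integrable lborel (%y. of_real (mollifier m y) * f (x - y))"
  and bound: "!!h. (\<integral>\<^sup>+x. ennreal (norm (f (x + h) - f x) ^ q) \<partial>lborel) <= ennreal C"
  and lim: "!!h. h \<longlonglongrightarrow> 0 ==> (%m. \<integral>\<^sup>+x. ennreal (norm (f (x + h m) - f x) ^ q) \<partial>lborel) \<longlonglongrightarrow> 0"
 shows "(%m. \<integral>\<^sup>+x. ennreal (norm (convolution (%y. of_real (mollifier m y)) f x - f x) ^ q) \<partial>lborel) \<longlonglongrightarrow> 0"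
proof -
 define \<omega> where "\<omega> h = (\<integral>\<^sup>+x. ennreal (norm (f (x + h) - f x) ^ q) \<partial>lborel)" for h
 have [measurable]: "\<omega> \<in> borel_measurable borel" unfolding \<omega>_def by measurable
 have le: "(\<integral>\<^sup>+x. ennreal (norm (convolution (%y. of_real (mollifier m y)) f x - f x) ^ q) \<partial>lborel)
   <= (\<integral>\<^sup>+y. ennreal (bump y) * \<omega> (- ((1 / real (Suc m)) *\<^sub>R y)) \<partial>lborel)" for m
 proof -
  have "(\<integral>\<^sup>+x. ennreal (norm (convolution (%y. of_real (mollifier m y)) f x - f x) ^ q) \<partial>lborel)
    <= (\<integral>\<^sup>+x. (\<integral>\<^sup>+y. ennreal (mollifier m y) * ennreal (norm (f (x + (- y)) - f x) ^ q) \<partial>lborel) \<partial>lborel)"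
  proof (rule nn_integral_mono)
   fix x
   have i2: "integrable lborel (%y :: real^'n. of_real (mollifier m y) * f x)"
    by (intro integrable_mult_left integrable_of_real integrable_mollifier)
   have i: "integrable lborel (%y. of_real (mollifier m y) * (f (x - y) - f x))"
    unfolding right_diff_distrib using int[of m x] i2 by (rule Bochner_Integration.integrable_diff)
   have "(\<integral>y. of_real (mollifier m y) * f x \<partial>(lborel :: (real^'n) measure)) = f x"
    by (simp add: integral_mollifier)
   then have "convolution (%y. of_real (mollifier m y)) f x - f x = (LBINT y. of_real (mollifier m y) * (f (x - y) - f x))"
    unfolding convolution_def right_diff_distrib using int[of m x] i2 by simp
   then have "ennreal (norm (convolution (%y. of_real (mollifier m y)) f x - f x) ^ q)
     <= (\<integral>\<^sup>+y. ennreal (mollifier m y) * ennreal (norm (f (x - y) - f x) ^ q) \<partial>lborel)"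
    using average_power_le[OF _ integrable_mollifier mollifier_nonneg integral_mollifier i q] by simp
   then show "ennreal (norm (convolution (%y. of_real (mollifier m y)) f x - f x) ^ q)
     <= (\<integral>\<^sup>+y. ennreal (mollifier m y) * ennreal (norm (f (x + (- y)) - f x) ^ q) \<partial>lborel)"
    by simp
  qed
  also have "... = (\<integral>\<^sup>+y. (\<integral>\<^sup>+x. ennreal (mollifier m y) * ennreal (norm (f (x + (- y)) - f x) ^ q) \<partial>lborel) \<partial>lborel)"
   by (rule lborel_pair.Fubini') measurable
  also have "... = (\<integral>\<^sup>+y. ennreal (mollifier m y) * \<omega> (- y) \<partial>lborel)"
   unfolding \<omega>_def by (intro nn_integral_cong nn_integral_cmult) measurable
  also have "... = (\<integral>\<^sup>+y. ennreal (bump y) * \<omega> (- ((1 / real (Suc m)) *\<^sub>R y)) \<partial>lborel)"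
   by (subst nn_integral_mollifier) auto
  finally show ?thesis .
 qed
 have "(%m. \<integral>\<^sup>+y. ennreal (bump y) * \<omega> (- ((1 / real (Suc m)) *\<^sub>R y)) \<partial>lborel) \<longlonglongrightarrow> (\<integral>\<^sup>+y. 0 \<partial>(lborel :: (real^'n) measure))"
 proof (rule nn_integral_dominated_convergence)
  show "AE y in lborel. ennreal (bump y) * \<omega> (- ((1 / real (Suc m)) *\<^sub>R y)) <= ennreal (bump y) * ennreal C" for m
   unfolding \<omega>_def by (intro AE_I2 mult_left_mono bound) simp
  have "(\<integral>\<^sup>+y. ennreal (bump y) * ennreal C \<partial>(lborel :: (real^'n) measure)) = (\<integral>\<^sup>+y. ennreal (bump y) \<partial>(lborel :: (real^'n) measure)) * ennreal C"
   by (rule nn_integral_multc) measurable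
  also have "(\<integral>\<^sup>+y. ennreal (bump y) \<partial>(lborel :: (real^'n) measure)) = ennreal 1"
   using nn_integral_eq_integral[OF integrable_bump] by (simp add: bump_nonneg integral_bump)
  finally show "(\<integral>\<^sup>+y. ennreal (bump y) * ennreal C \<partial>(lborel :: (real^'n) measure)) < \<infinity>" by simp
  show "AE y in lborel. (%m. ennreal (bump y) * \<omega> (- ((1 / real (Suc m)) *\<^sub>R y))) \<longlonglongrightarrow> 0"
  proof (rule AE_I2)
   fix y :: "real^'n"
   have "(%m. 1 / real (Suc m)) \<longlonglongrightarrow> 0" by real_asymp
   then have "(%m. - ((1 / real (Suc m)) *\<^sub>R y)) \<longlonglongrightarrow> - (0 *\<^sub>R y)" by (intro tendsto_intros)
   then have "(%m. \<omega> (- ((1 / real (Suc m)) *\<^sub>R y))) \<longlonglongrightarrow> 0" unfolding \<omega>_def by (intro lim) simp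
   then have "(%m. ennreal (bump y) * \<omega> (- ((1 / real (Suc m)) *\<^sub>R y))) \<longlonglongrightarrow> ennreal (bump y) * 0"
    by (intro ennreal_tendsto_cmult) auto
   then show "(%m. ennreal (bump y) * \<omega> (- ((1 / real (Suc m)) *\<^sub>R y))) \<longlonglongrightarrow> 0" by simp
  qed
 qed measurable
 then have *: "(%m. \<integral>\<^sup>+y. ennreal (bump y) * \<omega> (- ((1 / real (Suc m)) *\<^sub>R y)) \<partial>lborel) \<longlonglongrightarrow> 0"
  by simp
 show ?thesis
  by (rule tendsto_sandwich[OF _ _ tendsto_const *]) (rule always_eventually, rule allI, rule zero_le, rule always_eventually, rule allI, rule le)
qed

subsection \<open>The fundamental lemma of the calculus of variations\<close>

text \<open>
After multiplication by a Gaussian the function is integrable, and its mollifications vanish,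
being integrals against Schwartz functions; they converge to it in \<open>L\<^sup>1\<close>.
\<close>

lemma fundamental_lemma:
 fixes f :: "real^'n::finite => complex"
 assumes [measurable]: "f \<in> borel_measurable lborel"
  and int: "!!\<phi>. integrable lborel (%x. f x * schwartz_fun \<phi> x)"
  and zero: "!!\<phi>. (LBINT x. f x * schwartz_fun \<phi> x) = 0"
 shows "AE x in lborel. f x = 0"
proof -
 have test: "integrable lborel (%x. f x * \<phi> x)" "(LBINT x. f x * \<phi> x) = 0" if "is_schwartz \<phi>" for \<phi>
  using int[of "Schwartz \<phi>"] zero[of "Schwartz \<phi>"] that by (simp_all add: Schwartz_inverse)
 define \<gamma> where "\<gamma> = (E (Const 1) 1 :: real^'n => complex)"
 have \<gamma>: "is_schwartz \<gamma>" unfolding \<gamma>_def by (rule is_schwartz_E) simp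
 have [measurable]: "\<gamma> \<in> borel_measurable borel" using \<gamma> by (rule schwartz_measurable)
 define F where "F x = f x * \<gamma> x" for x
 have [measurable]: "F \<in> borel_measurable borel" unfolding F_def by measurable
 have F: "integrable lborel F" unfolding F_def by (rule test(1)[OF \<gamma>])
 have kernel: "is_schwartz (%y. \<gamma> y * of_real (mollifier m (x - y)))" for m x
  using is_schwartz_prod[OF \<gamma> is_schwartz_shift(1)[OF is_schwartz_mollifier[of m], of "-1" x]] by simp
 have i: "integrable lborel (%y. of_real (mollifier m y) * F (x - y))" for m x
  using integrable_shift[of "-1" "%y. of_real (mollifier m (x - y)) * F y" x] test(1)[OF kernel[of m x]]
  by (simp add: F_def mult_ac)
 have "convolution (%y. of_real (mollifier m y)) F x = 0" for m x
 proof -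
  have "convolution (%y. of_real (mollifier m y)) F x = (LBINT y. of_real (mollifier m (x - y)) * F y)"
   unfolding convolution_def
   using integral_shift[of "-1" "%y. of_real (mollifier m (x - y)) * F y" x] by simp
  also have "... = 0" using test(2)[OF kernel[of m x]] by (simp add: F_def mult_ac)
  finally show ?thesis .
 qed
 note conv0 = this
 have nn: "(\<integral>\<^sup>+x. ennreal (norm (F (x + h) - F x) ^ 1) \<partial>lborel) = ennreal (translation_gap F h)" for h
  using nn_integral_eq_integral[OF integrable_translate(2)[OF F, of h]] by simp
 have le: "translation_gap F h <= 2 * (LBINT x. norm (F x))" for h
 proof -
  have "translation_gap F h <= (LBINT x. norm (F (x + h)) + norm (F x))"
   using integrable_translate[OF F, of h] F by (intro integral_mono) (auto intro: norm_triangle_ineq4)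
  also have "... = (LBINT x. norm (F (x + h))) + (LBINT x. norm (F x))"
   using integrable_translate[OF F, of h] F by simp
  also have "(LBINT x. norm (F (x + h))) = (LBINT x. norm (F x))"
   using integral_shift[of 1 "%x. norm (F x)" h] by (simp add: add.commute)
  finally show ?thesis by simp
 qed
 have "(%m::nat. \<integral>\<^sup>+x. ennreal (norm (convolution (%y. of_real (mollifier m y)) F x - F x) ^ 1) \<partial>lborel) \<longlonglongrightarrow> 0"
 proof (rule convolution_mollifier_tendsto)
  show "(\<integral>\<^sup>+x. ennreal (norm (F (x + h) - F x) ^ 1) \<partial>lborel) <= ennreal (2 * (LBINT x. norm (F x)))" for h
   unfolding nn by (intro ennreal_leI le)
  show "(%m. \<integral>\<^sup>+x. ennreal (norm (F (x + h m) - F x) ^ 1) \<partial>lborel) \<longlonglongrightarrow> 0" if "h \<longlonglongrightarrow> 0" for h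
   unfolding nn using tendsto_ennrealI[OF translation_gap_tendsto[OF F that]] by simp
 qed (use i in auto)
 then have "(\<integral>\<^sup>+x. ennreal (norm (F x)) \<partial>lborel) = 0"
  by (simp add: conv0 LIMSEQ_const_iff)
 then have "AE x in lborel. F x = 0" by (subst (asm) nn_integral_0_iff_AE) auto
 then show ?thesis
  by eventually_elim (auto simp: F_def \<gamma>_def E_def gauss_def)
qed

lemma represented_by_unique:
 assumes "represented_by u f" "represented_by u g" shows "AE x in lborel. f x = g x"
proof -
 have "AE x in lborel. f x - g x = 0"
 proof (rule fundamental_lemma)
  show "(%x. f x - g x) \<in> borel_measurable lborel"
   using assms by (auto simp: represented_by_def)
  show "integrable lborel (%x. (f x - g x) * schwartz_fun \<phi> x)" for \<phi>
   unfolding left_diff_distrib using assms by (auto simp: represented_by_def)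
  show "(LBINT x. (f x - g x) * schwartz_fun \<phi> x) = 0" for \<phi>
   unfolding left_diff_distrib using assms
   by (subst Bochner_Integration.integral_diff) (auto simp: represented_by_def)
 qed
 then show ?thesis by eventually_elim simp
qed

subsection \<open>Convolution on square-integrable functions\<close>

lemma schwartz_lp_fun:
 assumes f: "is_schwartz (f :: real^'n::finite => complex)" and p: "p >= 1" shows "lp_fun lborel p f"
proof -
 have [measurable]: "f \<in> borel_measurable borel" using f by (rule schwartz_measurable)
 obtain S where S: "S >= 0" "!!x. norm (f x) <= S * weight x" using schwartz_le_weight[OF f] by metis
 have "integrable lborel (%x. norm (f x) powr p)"
 proof (rule Bochner_Integration.integrable_bound[OF integrable_mult_right[OF integrable_weight, of "S powr p"]])
  show "AE x in lborel. norm (norm (f x) powr p) <= norm (S powr p * weight x)"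
  proof (rule AE_I2)
   fix x :: "real^'n"
   have "norm (f x) powr p <= (S * weight x) powr p" using p by (intro powr_mono2 S) auto
   also have "... = S powr p * weight x powr p" using S(1) weight_pos[of x] by (simp add: powr_mult)
   also have "... <= S powr p * weight x powr 1"
    using p weight_pos[of x] by (intro mult_left_mono powr_mono') (auto simp: weight_def add_pos_nonneg)
   finally show "norm (norm (f x) powr p) <= norm (S powr p * weight x)" using weight_pos[of x] by simp
  qed
 qed measurable
 then show ?thesis by (simp add: lp_fun_def)
qed

lemma lp_fun_shift:
 fixes f :: "'a::euclidean_space => 'b::real_normed_vector"
 assumes f: "lp_fun lborel p f" and s: "\<bar>s\<bar> = 1"
 shows "lp_fun lborel p (%x. f (t + s *\<^sub>R x))" "lp_norm lborel p (%x. f (t + s *\<^sub>R x)) = lp_norm lborel p f"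
proof -
 have [measurable]: "f \<in> borel_measurable borel" using f by (simp add: lp_fun_def)
 show "lp_fun lborel p (%x. f (t + s *\<^sub>R x))"
  using f integrable_shift[OF s, of "%x. norm (f x) powr p" t] by (simp add: lp_fun_def)
 show "lp_norm lborel p (%x. f (t + s *\<^sub>R x)) = lp_norm lborel p f"
  using integral_shift[OF s, of "%x. norm (f x) powr p" t] by (simp add: lp_norm_def)
qed

lemma convolution_integrand:
 fixes f :: "real^'n::finite => complex"
 assumes f: "lp_fun lborel p f" and p: "p >= 1" and k: "is_schwartz k"
 shows "integrable lborel (%y. k y * f (x - y))"
 using lp_fun_pairing(1)[OF lp_fun_shift(1)[OF f, of "-1" x] p, of "Schwartz k"] k
 by (simp add: Schwartz_inverse mult.commute)

lemma nn_integral_norm_sq: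
 assumes "lp_fun M 2 f" shows "(\<integral>\<^sup>+x. ennreal (norm (f x) ^ 2) \<partial>M) = ennreal (lp_norm M 2 f ^ 2)"
 using lp_norm_nn_integral[OF assms] by simp

text \<open>
Young's inequality, from Jensen's inequality for the probability density \<open>norm (k y) /
A\<close>.
\<close>

lemma convolution_L2:
 fixes f :: "real^'n::finite => complex"
 assumes f: "lp_fun lborel 2 f" and k: "is_schwartz k"
 shows "lp_fun lborel 2 (convolution k f)"
  and "lp_norm lborel 2 (convolution k f) <= (LBINT y. norm (k y)) * lp_norm lborel 2 f"
proof -
 have [measurable]: "f \<in> borel_measurable borel" "k \<in> borel_measurable borel"
  using f schwartz_measurable[OF k] by (simp_all add: lp_fun_def)
 define A where "A = (LBINT y. norm (k y))"
 have A0: "A >= 0" by (simp add: A_def)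
 have kint: "integrable lborel (%y. norm (k y))" using schwartz_integrable[OF k] by simp
 have "(\<integral>\<^sup>+x. ennreal (norm (convolution k f x) ^ 2) \<partial>lborel) <= ennreal ((A * lp_norm lborel 2 f) ^ 2)"
 proof (cases "A = 0")
  case True
  then have "AE y in lborel. norm (k y) = 0"
   unfolding A_def by (subst (asm) integral_nonneg_eq_0_iff_AE[OF kint]) auto
  then have "AE y in lborel. k y * f (x - y) = 0" for x by eventually_elim simp
  from integral_cong_AE[OF _ _ this] have "convolution k f x = 0" for x
   unfolding convolution_def by simp
  then show ?thesis by simp
 next
  case False
  then have A: "A > 0" using A0 by simp
  define \<rho> where "\<rho> y = norm (k y) / A" for y
  have [measurable]: "\<rho> \<in> borel_measurable borel" unfolding \<rho>_def by measurable
  have \<rho>: "integrable lborel \<rho>" "!!y. \<rho> y >= 0" "(LBINT y. \<rho> y) = 1"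
   unfolding \<rho>_def using kint A by (auto simp: A_def[symmetric])
  have pw: "ennreal (norm (convolution k f x) ^ 2) <= (\<integral>\<^sup>+y. ennreal (\<rho> y) * ennreal (A\<^sup>2 * norm (f (x - y)) ^ 2) \<partial>lborel)" for x
  proof -
   define g where "g y = of_real A * (k y / of_real (norm (k y))) * f (x - y)" for y
   have [measurable]: "g \<in> borel_measurable borel" unfolding g_def by measurable
   have rg: "of_real (\<rho> y) * g y = k y * f (x - y)" for y using A by (simp add: \<rho>_def g_def)
   have "ennreal (norm (convolution k f x) ^ 2) <= (\<integral>\<^sup>+y. ennreal (\<rho> y) * ennreal (norm (g y) ^ 2) \<partial>lborel)"
    using average_power_le[of g lborel \<rho> 2] \<rho> convolution_integrand[OF f _ k, of x] by (simp add: rg convolution_def)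
   also have "... <= (\<integral>\<^sup>+y. ennreal (\<rho> y) * ennreal (A\<^sup>2 * norm (f (x - y)) ^ 2) \<partial>lborel)"
   proof (intro nn_integral_mono mult_left_mono ennreal_leI)
    fix y
    have "norm (g y) <= A * norm (f (x - y))" using A by (simp add: g_def norm_mult norm_divide)
    then have "norm (g y) ^ 2 <= (A * norm (f (x - y))) ^ 2" by (intro power_mono) auto
    then show "norm (g y) ^ 2 <= A\<^sup>2 * norm (f (x - y)) ^ 2" by (simp add: power_mult_distrib)
   qed simp
   finally show ?thesis .
  qed
  have "(\<integral>\<^sup>+x. ennreal (norm (convolution k f x) ^ 2) \<partial>lborel)
    <= (\<integral>\<^sup>+x. (\<integral>\<^sup>+y. ennreal (\<rho> y) * ennreal (A\<^sup>2 * norm (f (x - y)) ^ 2) \<partial>lborel) \<partial>lborel)"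
   by (intro nn_integral_mono pw)
  also have "... = (\<integral>\<^sup>+y. (\<integral>\<^sup>+x. ennreal (\<rho> y) * ennreal (A\<^sup>2 * norm (f (x - y)) ^ 2) \<partial>lborel) \<partial>lborel)"
   by (rule lborel_pair.Fubini') measurable
  also have "... = (\<integral>\<^sup>+y. ennreal (\<rho> y) * ennreal (A\<^sup>2 * lp_norm lborel 2 f ^ 2) \<partial>lborel)"
  proof (rule nn_integral_cong)
   fix y
   have "(\<integral>\<^sup>+x. ennreal (\<rho> y) * ennreal (A\<^sup>2 * norm (f (x - y)) ^ 2) \<partial>lborel)
     = (\<integral>\<^sup>+x. (ennreal (\<rho> y) * ennreal (A\<^sup>2)) * ennreal (norm (f (- y + 1 *\<^sub>R x)) ^ 2) \<partial>lborel)"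
    by (intro nn_integral_cong) (simp add: ennreal_mult mult.assoc)
   also have "... = (ennreal (\<rho> y) * ennreal (A\<^sup>2)) * (\<integral>\<^sup>+x. ennreal (norm (f (- y + 1 *\<^sub>R x)) ^ 2) \<partial>lborel)"
    by (rule nn_integral_cmult) measurable
   also have "(\<integral>\<^sup>+x. ennreal (norm (f (- y + 1 *\<^sub>R x)) ^ 2) \<partial>lborel) = (\<integral>\<^sup>+x. ennreal (norm (f x) ^ 2) \<partial>lborel)"
    by (rule nn_integral_shift) auto
   finally show "(\<integral>\<^sup>+x. ennreal (\<rho> y) * ennreal (A\<^sup>2 * norm (f (x - y)) ^ 2) \<partial>lborel)
     = ennreal (\<rho> y) * ennreal (A\<^sup>2 * lp_norm lborel 2 f ^ 2)"
    by (simp add: nn_integral_norm_sq[OF f] ennreal_mult mult.assoc)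
  qed
  also have "... = (\<integral>\<^sup>+y. ennreal (\<rho> y) \<partial>lborel) * ennreal (A\<^sup>2 * lp_norm lborel 2 f ^ 2)"
   by (rule nn_integral_multc) measurable
  also have "(\<integral>\<^sup>+y. ennreal (\<rho> y) \<partial>lborel) = 1" using nn_integral_eq_integral[OF \<rho>(1)] \<rho>(2,3) by simp
  finally show ?thesis by (simp add: power_mult_distrib)
 qed
 then have "(\<integral>\<^sup>+x. ennreal (norm (convolution k f x) powr 2) \<partial>lborel) <= ennreal ((A * lp_norm lborel 2 f) powr 2)"
  using A0 by simp
 from lp_norm_leI_nn_integral[OF _ _ _ this] A0
 show "lp_fun lborel 2 (convolution k f)"
  "lp_norm lborel 2 (convolution k f) <= (LBINT y. norm (k y)) * lp_norm lborel 2 f"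
  by (simp_all add: A_def)
qed

lemma triple_integrable:
 fixes f g k :: "real^'n::finite => complex"
 assumes f: "lp_fun lborel 2 f" and g: "lp_fun lborel 2 g" and k: "integrable lborel k"
 shows "integrable (lborel \<Otimes>\<^sub>M lborel) (%(x, y). k y * (f (x + a *\<^sub>R y) * g (x + b *\<^sub>R y)))"
proof -
 have [measurable]: "f \<in> borel_measurable borel" "g \<in> borel_measurable borel" "k \<in> borel_measurable borel"
  using f g borel_measurable_integrable[OF k] by (simp_all add: lp_fun_def)
 define C where "C = lp_norm lborel 2 f ^ 2 + lp_norm lborel 2 g ^ 2"
 have C0: "C >= 0" by (simp add: C_def)
 have "(\<integral>\<^sup>+p. ennreal (norm (case p of (x, y) => k y * (f (x + a *\<^sub>R y) * g (x + b *\<^sub>R y)))) \<partial>(lborel \<Otimes>\<^sub>M lborel))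
   = (\<integral>\<^sup>+y. (\<integral>\<^sup>+x. ennreal (norm (k y * (f (x + a *\<^sub>R y) * g (x + b *\<^sub>R y)))) \<partial>lborel) \<partial>lborel)"
  by (subst lborel_pair.nn_integral_snd[symmetric]) (auto simp: case_prod_unfold)
 also have "... <= (\<integral>\<^sup>+y. ennreal (norm (k y)) * ennreal C \<partial>lborel)"
 proof (rule nn_integral_mono)
  fix y
  have "(\<integral>\<^sup>+x. ennreal (norm (k y * (f (x + a *\<^sub>R y) * g (x + b *\<^sub>R y)))) \<partial>lborel)
    <= (\<integral>\<^sup>+x. ennreal (norm (k y)) * (ennreal (norm (f (a *\<^sub>R y + 1 *\<^sub>R x)) ^ 2) + ennreal (norm (g (b *\<^sub>R y + 1 *\<^sub>R x)) ^ 2)) \<partial>lborel)"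
  proof (rule nn_integral_mono)
   fix x
   let ?u = "norm (f (x + a *\<^sub>R y))" and ?v = "norm (g (x + b *\<^sub>R y))"
   have "0 <= ?u * ?v" by simp
   then have "?u * ?v <= ?u ^ 2 + ?v ^ 2" using sum_squares_bound[of ?u ?v] by linarith
   then have "norm (k y) * (?u * ?v) <= norm (k y) * (?u ^ 2 + ?v ^ 2)" by (rule mult_left_mono) simp
   then have "ennreal (norm (k y * (f (x + a *\<^sub>R y) * g (x + b *\<^sub>R y)))) <= ennreal (norm (k y) * (?u ^ 2 + ?v ^ 2))"
    by (intro ennreal_leI) (simp add: norm_mult)
   then show "ennreal (norm (k y * (f (x + a *\<^sub>R y) * g (x + b *\<^sub>R y))))
     <= ennreal (norm (k y)) * (ennreal (norm (f (a *\<^sub>R y + 1 *\<^sub>R x)) ^ 2) + ennreal (norm (g (b *\<^sub>R y + 1 *\<^sub>R x)) ^ 2))"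
    by (simp add: ennreal_mult ennreal_plus add.commute)
  qed
  also have "... = ennreal (norm (k y)) * ((\<integral>\<^sup>+x. ennreal (norm (f (a *\<^sub>R y + 1 *\<^sub>R x)) ^ 2) \<partial>lborel)
    + (\<integral>\<^sup>+x. ennreal (norm (g (b *\<^sub>R y + 1 *\<^sub>R x)) ^ 2) \<partial>lborel))"
  proof -
   have "(\<integral>\<^sup>+x. ennreal (norm (k y)) * (ennreal (norm (f (a *\<^sub>R y + 1 *\<^sub>R x)) ^ 2) + ennreal (norm (g (b *\<^sub>R y + 1 *\<^sub>R x)) ^ 2)) \<partial>lborel)
     = ennreal (norm (k y)) * (\<integral>\<^sup>+x. ennreal (norm (f (a *\<^sub>R y + 1 *\<^sub>R x)) ^ 2) + ennreal (norm (g (b *\<^sub>R y + 1 *\<^sub>R x)) ^ 2) \<partial>lborel)"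
    by (rule nn_integral_cmult) measurable
   also have "(\<integral>\<^sup>+x. ennreal (norm (f (a *\<^sub>R y + 1 *\<^sub>R x)) ^ 2) + ennreal (norm (g (b *\<^sub>R y + 1 *\<^sub>R x)) ^ 2) \<partial>lborel)
     = (\<integral>\<^sup>+x. ennreal (norm (f (a *\<^sub>R y + 1 *\<^sub>R x)) ^ 2) \<partial>lborel) + (\<integral>\<^sup>+x. ennreal (norm (g (b *\<^sub>R y + 1 *\<^sub>R x)) ^ 2) \<partial>lborel)"
    by (rule nn_integral_add) measurable
   finally show ?thesis .
  qed
  also have "(\<integral>\<^sup>+x. ennreal (norm (f (a *\<^sub>R y + 1 *\<^sub>R x)) ^ 2) \<partial>lborel) = (\<integral>\<^sup>+x. ennreal (norm (f x) ^ 2) \<partial>lborel)"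
   by (rule nn_integral_shift) auto
  also have "(\<integral>\<^sup>+x. ennreal (norm (g (b *\<^sub>R y + 1 *\<^sub>R x)) ^ 2) \<partial>lborel) = (\<integral>\<^sup>+x. ennreal (norm (g x) ^ 2) \<partial>lborel)"
   by (rule nn_integral_shift) auto
  finally show "(\<integral>\<^sup>+x. ennreal (norm (k y * (f (x + a *\<^sub>R y) * g (x + b *\<^sub>R y)))) \<partial>lborel) <= ennreal (norm (k y)) * ennreal C"
   by (simp add: nn_integral_norm_sq[OF f] nn_integral_norm_sq[OF g] C_def ennreal_plus)
 qed
 also have "... = (\<integral>\<^sup>+y. ennreal (norm (k y)) \<partial>lborel) * ennreal C"
  by (rule nn_integral_multc) measurable
 also have "... < \<infinity>"
  using nn_integral_eq_integral[OF integrable_norm[OF k]] by (simp add: ennreal_mult_less_top)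
 finally show ?thesis by (intro integrableI_bounded) measurable
qed

lemma convolution_adjoint:
 fixes f g k :: "real^'n::finite => complex"
 assumes f: "lp_fun lborel 2 f" and g: "lp_fun lborel 2 g" and k: "is_schwartz k"
 shows "(LBINT x. convolution k f x * g x) = (LBINT x. f x * correlation k g x)"
proof -
 have [measurable]: "f \<in> borel_measurable borel" "g \<in> borel_measurable borel"
  using f g by (simp_all add: lp_fun_def)
 note ki = schwartz_integrable[OF k]
 have i1: "integrable (lborel \<Otimes>\<^sub>M lborel) (%(x, y). k y * (f (x - y) * g x))"
  using triple_integrable[OF f g ki, of "-1" 0] by simp
 have i2: "integrable (lborel \<Otimes>\<^sub>M lborel) (%(x, y). k y * (f x * g (x + y)))"
  using triple_integrable[OF f g ki, of 0 1] by simp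
 have "(LBINT x. convolution k f x * g x) = (LBINT x. (LBINT y. k y * (f (x - y) * g x)))"
  by (simp add: convolution_def mult.assoc flip: integral_mult_left_zero)
 also have "... = (LBINT y. (LBINT x. k y * (f (x - y) * g x)))"
  using lborel_pair.Fubini_integral[OF i1] by simp
 also have "... = (LBINT y. (LBINT x. k y * (f x * g (x + y))))"
 proof (rule Bochner_Integration.integral_cong[OF refl])
  fix y
  show "(LBINT x. k y * (f (x - y) * g x)) = (LBINT x. k y * (f x * g (x + y)))"
  proof -
   have "(LBINT x. k y * (f x * g (x + y))) = (LBINT x. k y * (f ((y + 1 *\<^sub>R x) - y) * g (y + 1 *\<^sub>R x)))"
    by (simp add: add.commute)
   also have "... = (LBINT x. k y * (f (x - y) * g x))"
    by (rule integral_shift[of 1 "%x. k y * (f (x - y) * g x)"]) auto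
   finally show ?thesis ..
  qed
 qed
 also have "... = (LBINT x. (LBINT y. k y * (f x * g (x + y))))"
  using lborel_pair.Fubini_integral[OF i2] by simp
 also have "... = (LBINT x. f x * correlation k g x)"
  by (simp add: correlation_def mult.left_commute flip: integral_mult_right_zero)
 finally show ?thesis .
qed

lemma represented_by_dist_conv:
 assumes u: "represented_by u f" and f: "lp_fun lborel 2 f"
 shows "represented_by (dist_conv k u) (convolution (schwartz_fun k) f)"
proof -
 let ?k = "schwartz_fun k"
 have k: "is_schwartz ?k" by simp
 have [measurable]: "f \<in> borel_measurable borel" using f by (simp add: lp_fun_def)
 show ?thesis unfolding represented_by_def
 proof (intro conjI allI)
  show "convolution ?k f \<in> borel_measurable lborel" by simp
  fix \<phi>
  show "integrable lborel (%x. convolution ?k f x * schwartz_fun \<phi> x)"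
   by (rule lp_fun_pairing(1)[OF convolution_L2(1)[OF f k]]) simp
  have "pairing (dist_conv k u) \<phi> = (LBINT x. f x * correlation ?k (schwartz_fun \<phi>) x)"
   using u by (simp add: represented_by_def dist_conv.rep_eq schwartz_correlation.rep_eq)
  also have "... = (LBINT x. convolution ?k f x * schwartz_fun \<phi> x)"
   by (rule convolution_adjoint[OF f schwartz_lp_fun k, symmetric]) auto
  finally show "pairing (dist_conv k u) \<phi> = (LBINT x. convolution ?k f x * schwartz_fun \<phi> x)" .
 qed
qed

lemma lp_norm_shift_gap:
 fixes f g :: "real^'n::finite => complex"
 assumes f: "lp_fun lborel p f" and g: "lp_fun lborel p g" and p: "p >= 1"
 shows "lp_norm lborel p (%x. f (x + k) - f x) <= lp_norm lborel p (%x. g (x + k) - g x) + 2 * lp_norm lborel p (%x. f x - g x)"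
proof -
 have p0: "p > 0" using p by simp
 have sh: "lp_fun lborel p (%x. u (x + k))" "lp_norm lborel p (%x. u (x + k)) = lp_norm lborel p u"
  if "lp_fun lborel p u" for u :: "real^'n => complex"
  using lp_fun_shift[OF that, of 1 k] by (simp_all add: add.commute)
 have fg: "lp_fun lborel p (%x. f x - g x)" "lp_fun lborel p (%x. g x - f x)"
  using f g p0 by (auto intro: lp_fun_diff)
 have gk: "lp_fun lborel p (%x. g (x + k) - g x)" by (rule lp_fun_diff[OF sh(1)[OF g] g p0])
 have fgk: "lp_fun lborel p (%x. (f (x + k) - g (x + k)) + (g x - f x))"
  by (rule lp_fun_add[OF sh(1)[OF fg(1)] fg(2) p0])
 have "lp_norm lborel p (%x. f (x + k) - f x)
   = lp_norm lborel p (%x. ((f (x + k) - g (x + k)) + (g x - f x)) + (g (x + k) - g x))" by simp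
 also have "... <= lp_norm lborel p (%x. (f (x + k) - g (x + k)) + (g x - f x)) + lp_norm lborel p (%x. g (x + k) - g x)"
  by (rule lp_norm_triangle[OF fgk gk p])
 also have "lp_norm lborel p (%x. (f (x + k) - g (x + k)) + (g x - f x))
   <= lp_norm lborel p (%x. f (x + k) - g (x + k)) + lp_norm lborel p (%x. g x - f x)"
  by (rule lp_norm_triangle[OF sh(1)[OF fg(1)] fg(2) p])
 also have "lp_norm lborel p (%x. f (x + k) - g (x + k)) = lp_norm lborel p (%x. f x - g x)" by (rule sh(2)[OF fg(1)])
 also have "lp_norm lborel p (%x. g x - f x) = lp_norm lborel p (%x. f x - g x)" by (rule lp_norm_minus_commute)
 finally show ?thesis by simp
qed

lemma truncation_tendsto:
 fixes f :: "real^'n::finite => complex"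
 assumes f: "lp_fun lborel 2 f"
 defines "g \<equiv> %N x. if norm (f x) <= real N & norm x <= real N then f x else 0"
 shows "lp_fun lborel 2 (g N)" "integrable lborel (g N)" "(%N. lp_norm lborel 2 (%x. f x - g N x)) \<longlonglongrightarrow> 0"
proof -
 have [measurable]: "f \<in> borel_measurable borel" using f by (simp add: lp_fun_def)
 have gm [measurable]: "g N \<in> borel_measurable borel" for N unfolding g_def by measurable
 show gl: "lp_fun lborel 2 (g N)" for N by (rule lp_fun_bound(1)[OF f]) (auto simp: g_def)
 have ind: "integrable lborel (%x :: real^'n. real N * indicator (cball 0 (real N)) x)" for N :: nat
  using emeasure_lborel_cball_finite
  by (intro integrable_mult_right integrable_real_indicator) (auto simp: less_top[symmetric])
 show "integrable lborel (g N)" for N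
  by (rule Bochner_Integration.integrable_bound[OF ind[of N]]) (auto simp: g_def indicator_def)
 have fi: "integrable lborel (%x. norm (f x) powr 2)" using f by (simp add: lp_fun_def)
 have "(%N. \<integral>x. norm (f x - g N x) powr 2 \<partial>lborel) \<longlonglongrightarrow> (\<integral>x. 0 \<partial>(lborel :: (real^'n) measure))"
 proof (rule integral_dominated_convergence[OF _ _ fi])
  show "AE x in lborel. (%N. norm (f x - g N x) powr 2) \<longlonglongrightarrow> 0"
  proof (rule AE_I2)
   fix x
   obtain M :: nat where "max (norm (f x)) (norm x) <= real M" using real_arch_simple by blast
   then have "\<forall>\<^sub>F N in sequentially. norm (f x - g N x) powr 2 = 0"
    by (intro eventually_sequentiallyI[of M]) (auto simp: g_def)
   then show "(%N. norm (f x - g N x) powr 2) \<longlonglongrightarrow> 0" by (rule tendsto_eventually)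
  qed
  show "AE x in lborel. norm (norm (f x - g N x) powr 2) <= norm (f x) powr 2" for N
   by (rule AE_I2) (simp add: g_def)
 qed auto
 then have "(%N. (LBINT x. norm (f x - g N x) powr 2) powr (1/2)) \<longlonglongrightarrow> 0 powr (1/2)"
  by (intro tendsto_powr2 tendsto_const) auto
 then show "(%N. lp_norm lborel 2 (%x. f x - g N x)) \<longlonglongrightarrow> 0" unfolding lp_norm_def by simp
qed

text \<open>
On bounded functions the \<open>L\<^sup>2\<close> distance is controlled by the
\<open>L\<^sup>1\<close> distance, where translations are continuous; the truncations of
\<open>f\<close> in height and support approximate \<open>f\<close>.
\<close>

lemma translation_L2:
 fixes f :: "real^'n::finite => complex"
 assumes f: "lp_fun lborel 2 f" and h: "h \<longlonglongrightarrow> 0"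
 shows "(%m. lp_norm lborel 2 (%x. f (x + h m) - f x)) \<longlonglongrightarrow> 0"
proof (rule LIMSEQ_I)
 fix e :: real assume e: "e > 0"
 define g where "g N x = (if norm (f x) <= real N & norm x <= real N then f x else 0)" for N :: nat and x
 have g: "lp_fun lborel 2 (g N)" "integrable lborel (g N)" "(%N. lp_norm lborel 2 (%x. f x - g N x)) \<longlonglongrightarrow> 0" for N
  unfolding g_def using truncation_tendsto[OF f] by auto
 obtain N where N: "lp_norm lborel 2 (%x. f x - g N x) < e / 4"
  using LIMSEQ_D[OF g(3), of "e / 4"] e by auto
 have [measurable]: "g N \<in> borel_measurable borel" using g(1) by (simp add: lp_fun_def)
 have sq: "lp_norm lborel 2 (%x. g N (x + k) - g N x) <= sqrt (2 * real N * translation_gap (g N) k)" for k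
 proof -
  have "lp_norm lborel 2 (%x. g N (x + k) - g N x) = sqrt (LBINT x. norm (g N (x + k) - g N x) ^ 2)"
   by (simp add: lp_norm_def powr_half_sqrt)
  also have "... <= sqrt (LBINT x. 2 * real N * norm (g N (x + k) - g N x))"
  proof (intro real_sqrt_le_mono integral_mono)
   have pw: "norm (g N (x + k) - g N x) ^ 2 <= 2 * real N * norm (g N (x + k) - g N x)" for x
   proof -
    have "norm (g N (x + k) - g N x) <= norm (g N (x + k)) + norm (g N x)" by (rule norm_triangle_ineq4)
    also have "... <= real N + real N" by (intro add_mono) (auto simp: g_def)
    finally show ?thesis unfolding power2_eq_square by (intro mult_right_mono) auto
   qed
   then show "norm (g N (x + k) - g N x) ^ 2 <= 2 * real N * norm (g N (x + k) - g N x)" for x .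
   show i: "integrable lborel (%x. 2 * real N * norm (g N (x + k) - g N x))"
    by (intro integrable_mult_right integrable_translate(2) g)
   show "integrable lborel (%x. norm (g N (x + k) - g N x) ^ 2)"
    by (rule Bochner_Integration.integrable_bound[OF i]) (use pw in auto)
  qed
  finally show ?thesis by simp
 qed
 have "(%m. sqrt (2 * real N * translation_gap (g N) (h m))) \<longlonglongrightarrow> sqrt (2 * real N * 0)"
  by (intro tendsto_intros translation_gap_tendsto g h)
 then have lim: "(%m. sqrt (2 * real N * translation_gap (g N) (h m))) \<longlonglongrightarrow> 0" by simp
 obtain M where M: "!!m. m >= M ==> norm (sqrt (2 * real N * translation_gap (g N) (h m)) - 0) < e / 2"
  using LIMSEQ_D[OF lim, of "e / 2"] e by auto
 show "\<exists>no. \<forall>m\<ge>no. norm (lp_norm lborel 2 (%x. f (x + h m) - f x) - 0) < e"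
 proof (intro exI[of _ M] allI impI)
  fix m assume "m >= M"
  then have "sqrt (2 * real N * translation_gap (g N) (h m)) < e / 2" using M[of m] by auto
  moreover have "lp_norm lborel 2 (%x. f (x + h m) - f x) <= lp_norm lborel 2 (%x. g N (x + h m) - g N x) + 2 * lp_norm lborel 2 (%x. f x - g N x)"
   by (rule lp_norm_shift_gap[OF f g(1)]) simp
  ultimately have "lp_norm lborel 2 (%x. f (x + h m) - f x) < e" using sq[of "h m"] N by linarith
  then show "norm (lp_norm lborel 2 (%x. f (x + h m) - f x) - 0) < e" by simp
 qed
qed

theorem mollification_L2:
 fixes f :: "real^'n::finite => complex"
 assumes f: "lp_fun lborel 2 f"
 shows "(%m. lp_norm lborel 2 (%x. convolution (%y. of_real (mollifier m y)) f x - f x)) \<longlonglongrightarrow> 0"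
proof -
 have [measurable]: "f \<in> borel_measurable borel" using f by (simp add: lp_fun_def)
 have sh: "lp_fun lborel 2 (%x. f (x + k))" "lp_norm lborel 2 (%x. f (x + k)) = lp_norm lborel 2 f" for k
  using lp_fun_shift[OF f, of 1 k] by (simp_all add: add.commute)
 have d: "lp_fun lborel 2 (%x. f (x + k) - f x)" for k by (rule lp_fun_diff[OF sh(1) f]) simp
 have le: "lp_norm lborel 2 (%x. f (x + k) - f x) <= 2 * lp_norm lborel 2 f" for k
  using lp_norm_shift_gap[OF f, of "%x. 0" k] by (simp add: lp_fun_def, simp add: lp_norm_def)
 have "(%m. \<integral>\<^sup>+x. ennreal (norm (convolution (%y. of_real (mollifier m y)) f x - f x) ^ 2) \<partial>lborel) \<longlonglongrightarrow> 0"
 proof (rule convolution_mollifier_tendsto)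
  show "integrable lborel (%y. of_real (mollifier m y) * f (x - y))" for m x
   by (rule convolution_integrand[OF f _ is_schwartz_mollifier]) simp
  show "(\<integral>\<^sup>+x. ennreal (norm (f (x + k) - f x) ^ 2) \<partial>lborel) <= ennreal ((2 * lp_norm lborel 2 f) ^ 2)" for k
   unfolding nn_integral_norm_sq[OF d] by (intro ennreal_leI power_mono le) simp
  show "(%m. \<integral>\<^sup>+x. ennreal (norm (f (x + h m) - f x) ^ 2) \<partial>lborel) \<longlonglongrightarrow> 0" if "h \<longlonglongrightarrow> 0" for h
  proof -
   have "(%m. ennreal (lp_norm lborel 2 (%x. f (x + h m) - f x) ^ 2)) \<longlonglongrightarrow> ennreal (0 ^ 2)"
    by (intro tendsto_ennrealI tendsto_power translation_L2 f that)
   then show ?thesis unfolding nn_integral_norm_sq[OF d] by simp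
  qed
 qed auto
 moreover have cl: "lp_fun lborel 2 (%x. convolution (%y. of_real (mollifier m y)) f x - f x)" for m
  by (rule lp_fun_diff[OF convolution_L2(1)[OF f is_schwartz_mollifier] f]) simp
 ultimately have "(%m. ennreal (lp_norm lborel 2 (%x. convolution (%y. of_real (mollifier m y)) f x - f x) ^ 2)) \<longlonglongrightarrow> ennreal 0"
  unfolding nn_integral_norm_sq[OF cl] by simp
 then have "(%m. lp_norm lborel 2 (%x. convolution (%y. of_real (mollifier m y)) f x - f x) ^ 2) \<longlonglongrightarrow> 0"
  by (subst (asm) tendsto_ennreal_iff) auto
 then have "(%m. sqrt (lp_norm lborel 2 (%x. convolution (%y. of_real (mollifier m y)) f x - f x) ^ 2)) \<longlonglongrightarrow> sqrt 0"
  by (rule tendsto_real_sqrt)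
 then show ?thesis by simp
qed

section \<open>Banach spaces given by a carrier\<close>

lemma scaleC_zero_left [simp]: "0 *\<^sub>C x = (0 :: 'b::complex_vector)"
 using scaleC_add_left[of 0 0 x] by simp

lemma scaleC_zero_right [simp]: "c *\<^sub>C 0 = (0 :: 'b::complex_vector)"
 using scaleC_add_right[of c 0 "0 :: 'b"] by simp

lemma scaleC_minus_left: "(- c) *\<^sub>C x = - (c *\<^sub>C (x :: 'b::complex_vector))"
 using scaleC_add_left[of c "- c" x] by (simp add: add_eq_0_iff)

lemma scaleC_minus_right: "c *\<^sub>C (- x) = - (c *\<^sub>C (x :: 'b::complex_vector))"
 using scaleC_add_right[of c x "- x"] by (simp add: add_eq_0_iff)

lemma scaleC_diff_right: "c *\<^sub>C (x - y) = c *\<^sub>C x - c *\<^sub>C (y :: 'b::complex_vector)"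
 using scaleC_add_right[of c x "- y"] by (simp add: scaleC_minus_right)

lemma scaleC_minus_one: "(- 1) *\<^sub>C x = - (x :: 'b::complex_vector)"
 by (simp add: scaleC_minus_left scaleC_one)

text \<open>
The spaces are subsets of a space of distributions and depend on the real parameter
\<open>p\<close>, so they cannot be types; the structure of a complex Banach space is required on
a set instead.
\<close>

locale banach_carrier =
 fixes X :: "'b::complex_vector set" and nrm :: "'b => real"
 assumes zero_mem: "0 \<in> X"
  and add_mem: "x \<in> X ==> y \<in> X ==> x + y \<in> X"
  and scale_mem: "x \<in> X ==> c *\<^sub>C x \<in> X"
  and nrm_triangle: "x \<in> X ==> y \<in> X ==> nrm (x + y) <= nrm x + nrm y"
  and nrm_scale: "x \<in> X ==> nrm (c *\<^sub>C x) = norm c * nrm x"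
  and nrm_eq_0: "x \<in> X ==> nrm x = 0 ==> x = 0"
  and complete: "(!!k. s k \<in> X) ==> (!!e. e > 0 ==> \<exists>N. \<forall>m\<ge>N. \<forall>n\<ge>N. nrm (s m - s n) < e)
    ==> \<exists>y\<in>X. (%k. nrm (s k - y)) \<longlonglongrightarrow> 0"
begin

lemma uminus_mem: "x \<in> X ==> - x \<in> X"
 using scale_mem[of x "-1"] by (simp add: scaleC_minus_one)

lemma diff_mem: "x \<in> X ==> y \<in> X ==> x - y \<in> X"
 using add_mem[of x "- y"] uminus_mem by simp

lemma nrm_zero [simp]: "nrm 0 = 0"
 using nrm_scale[OF zero_mem, of 0] by simp

lemma nrm_uminus: "x \<in> X ==> nrm (- x) = nrm x"
 using nrm_scale[of x "-1"] by (simp add: scaleC_minus_one)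

lemma nrm_nonneg: "x \<in> X ==> 0 <= nrm x"
 using nrm_triangle[of x "- x"] by (simp add: nrm_uminus uminus_mem)

lemma nrm_minus_commute: "x \<in> X ==> y \<in> X ==> nrm (x - y) = nrm (y - x)"
 using nrm_uminus[of "x - y"] by (simp add: diff_mem)

lemma nrm_diff_le: "x \<in> X ==> y \<in> X ==> nrm (x - y) <= nrm x + nrm y"
 using nrm_triangle[of x "- y"] by (simp add: nrm_uminus uminus_mem)

lemma nrm_le_add_diff: "x \<in> X ==> y \<in> X ==> nrm x <= nrm y + nrm (x - y)"
 using nrm_triangle[of y "x - y"] by (simp add: diff_mem)

lemma nrm_diff_triangle: "x \<in> X ==> y \<in> X ==> z \<in> X ==> nrm (x - z) <= nrm (x - y) + nrm (y - z)"
 using nrm_triangle[of "x - y" "y - z"] by (simp add: diff_mem)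

end

lemma banach_carrier_prod:
 assumes "banach_carrier X n1" "banach_carrier Y n2"
 shows "banach_carrier (X \<times> Y) (%p. n1 (fst p) + n2 (snd p))"
proof -
 interpret X: banach_carrier X n1 by fact
 interpret Y: banach_carrier Y n2 by fact
 show ?thesis
 proof
  fix p assume p: "p \<in> X \<times> Y" "n1 (fst p) + n2 (snd p) = 0"
  then have "n1 (fst p) = 0" "n2 (snd p) = 0"
   using X.nrm_nonneg[of "fst p"] Y.nrm_nonneg[of "snd p"] by auto
  then show "p = 0" using p X.nrm_eq_0 Y.nrm_eq_0 by (auto simp: prod_eq_iff)
 next
  fix s :: "nat => 'a \<times> 'b" assume s: "!!k. s k \<in> X \<times> Y"
   and c: "!!e. e > 0 ==> \<exists>N. \<forall>m\<ge>N. \<forall>n\<ge>N. n1 (fst (s m - s n)) + n2 (snd (s m - s n)) < e"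
  have s': "fst (s k) \<in> X" "snd (s k) \<in> Y" for k using s[of k] by (auto simp: mem_Times_iff)
  have nn: "0 <= n1 (fst (s m) - fst (s n))" "0 <= n2 (snd (s m) - snd (s n))" for m n
   using s' by (auto intro: X.nrm_nonneg Y.nrm_nonneg X.diff_mem Y.diff_mem)
  have "\<exists>y\<in>X. (%k. n1 (fst (s k) - y)) \<longlonglongrightarrow> 0"
  proof (rule X.complete[OF s'(1)])
   fix e :: real assume "e > 0"
   from c[OF this] obtain N where N: "\<forall>m\<ge>N. \<forall>n\<ge>N. n1 (fst (s m - s n)) + n2 (snd (s m - s n)) < e" by blast
   have "n1 (fst (s m) - fst (s n)) < e" if "m >= N" "n >= N" for m n
    using N[rule_format, OF that] nn(2)[of m n] by simp
   then show "\<exists>N. \<forall>m\<ge>N. \<forall>n\<ge>N. n1 (fst (s m) - fst (s n)) < e" by blast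
  qed
  then obtain y where y: "y \<in> X" "(%k. n1 (fst (s k) - y)) \<longlonglongrightarrow> 0" by blast
  have "\<exists>z\<in>Y. (%k. n2 (snd (s k) - z)) \<longlonglongrightarrow> 0"
  proof (rule Y.complete[OF s'(2)])
   fix e :: real assume "e > 0"
   from c[OF this] obtain N where N: "\<forall>m\<ge>N. \<forall>n\<ge>N. n1 (fst (s m - s n)) + n2 (snd (s m - s n)) < e" by blast
   have "n2 (snd (s m) - snd (s n)) < e" if "m >= N" "n >= N" for m n
    using N[rule_format, OF that] nn(1)[of m n] by simp
   then show "\<exists>N. \<forall>m\<ge>N. \<forall>n\<ge>N. n2 (snd (s m) - snd (s n)) < e" by blast
  qed
  then obtain z where z: "z \<in> Y" "(%k. n2 (snd (s k) - z)) \<longlonglongrightarrow> 0" by blast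
  show "\<exists>p\<in>X \<times> Y. (%k. n1 (fst (s k - p)) + n2 (snd (s k - p))) \<longlonglongrightarrow> 0"
   using y z tendsto_add[OF y(2) z(2)] by (intro bexI[of _ "(y, z)"]) auto
 next
  fix x y assume "x \<in> X \<times> Y" "y \<in> X \<times> Y"
  then show "n1 (fst (x + y)) + n2 (snd (x + y)) <= n1 (fst x) + n2 (snd x) + (n1 (fst y) + n2 (snd y))"
   using X.nrm_triangle[of "fst x" "fst y"] Y.nrm_triangle[of "snd x" "snd y"] by auto
 qed (auto simp: X.zero_mem Y.zero_mem X.add_mem Y.add_mem X.scale_mem Y.scale_mem scaleC_prod_def
   X.nrm_scale Y.nrm_scale distrib_left zero_prod_def)
qed

section \<open>Lebesgue and Sobolev spaces are Banach spaces\<close>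

lemma Lp_iff: "u \<in> Lp p \<longleftrightarrow> (\<exists>f. represented_by u f & lp_fun lborel p f)"
 by (auto simp: Lp_def lp_fun_def represented_by_def)

lemma Lp_norm_eq:
 assumes "represented_by u f" shows "Lp_norm p u = lp_norm lborel p f"
proof -
 have s: "represented_by u (SOME f. represented_by u f)" using assms by (rule someI[where P = "represented_by u"])
 have m: "f \<in> borel_measurable lborel" if "represented_by u f" for f using that unfolding represented_by_def by blast
 show ?thesis unfolding Lp_norm_def lp_norm_def[symmetric]
  by (rule lp_norm_cong_AE[OF represented_by_unique[OF s assms] m[OF s] m[OF assms]])
qed

lemma LpE:
 assumes "u \<in> Lp p"
 obtains f where "represented_by u f" "lp_fun lborel p f" "Lp_norm p u = lp_norm lborel p f"
 using assms Lp_norm_eq unfolding Lp_iff by metis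

lemma LpI: "represented_by u f ==> lp_fun lborel p f ==> u \<in> Lp p"
 unfolding Lp_iff by blast

lemma represented_by_zero: "represented_by 0 (%x. 0)"
 by (auto simp: represented_by_def pairing_simps)

lemma represented_by_add: "represented_by u f ==> represented_by v g ==> represented_by (u + v) (%x. f x + g x)"
 by (auto simp: represented_by_def pairing_simps distrib_right)

lemma represented_by_diff: "represented_by u f ==> represented_by v g ==> represented_by (u - v) (%x. f x - g x)"
 by (auto simp: represented_by_def pairing_simps left_diff_distrib)

lemma represented_by_scale: "represented_by u f ==> represented_by (c *\<^sub>C u) (%x. c * f x)"
 by (auto simp: represented_by_def pairing_simps mult.assoc)

definition dist_of :: "(real^'n::finite => complex) => 'n tempdist" where
 "dist_of f = Tempdist (%\<phi>. \<integral>x. f x * schwartz_fun \<phi> x \<partial>lborel)"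

lemma represented_by_dist_of:
 fixes f :: "real^'n::finite => complex"
 assumes f: "lp_fun lborel p f" and p: "p >= 1" shows "represented_by (dist_of f) f"
proof -
 note i = lp_fun_pairing(1)[OF f p]
 have "is_tempered (%\<phi>. \<integral>x. f x * schwartz_fun \<phi> x \<partial>lborel)"
  unfolding is_tempered_def
 proof (intro conjI allI)
  fix \<phi> \<psi> :: "'n schwartz" and c
  show "(LBINT x. f x * schwartz_fun (\<phi> + \<psi>) x) = (LBINT x. f x * schwartz_fun \<phi> x) + (LBINT x. f x * schwartz_fun \<psi> x)"
   using i by (simp add: plus_schwartz.rep_eq distrib_left)
  show "(LBINT x. f x * schwartz_fun (c *\<^sub>C \<phi>) x) = c * (LBINT x. f x * schwartz_fun \<phi> x)"
   by (simp add: scaleC_schwartz.rep_eq mult.left_commute)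
  show "\<exists>C N. \<forall>\<phi>. norm (LBINT x. f x * schwartz_fun \<phi> x) <= C * schwartz_norm N \<phi>"
  proof (intro exI allI)
   fix \<phi> :: "'n schwartz"
   show "norm (LBINT x. f x * schwartz_fun \<phi> x)
     <= ((1 + (\<integral>x. weight x \<partial>(lborel :: (real^'n) measure))) * lp_norm lborel p f) * schwartz_norm (2 * CARD('n)) \<phi>"
    using lp_fun_pairing(2)[OF f p, of \<phi>] by (simp only: mult_ac)
  qed
 qed
 then have "pairing (dist_of f) = (%\<phi>. \<integral>x. f x * schwartz_fun \<phi> x \<partial>lborel)"
  unfolding dist_of_def by (intro Tempdist_inverse) simp
 then show ?thesis using f i by (auto simp: represented_by_def lp_fun_def)
qed

lemma Lp_pairing_bound:
 fixes u :: "'n::finite tempdist"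
 assumes "u \<in> Lp p" "p >= 1"
 shows "norm (pairing u \<phi>) <= (1 + (\<integral>x. weight x \<partial>(lborel :: (real^'n) measure))) * schwartz_norm (2 * CARD('n)) \<phi> * Lp_norm p u"
 using assms by (elim LpE) (use lp_fun_pairing(2) in \<open>auto simp: represented_by_def\<close>)

lemma banach_carrier_Lp:
 assumes p: "p >= 1" shows "banach_carrier (Lp p :: 'n::finite tempdist set) (Lp_norm p)"
proof
 have p0: "p > 0" using p by simp
 show "0 \<in> (Lp p :: 'n tempdist set)"
  by (rule LpI[OF represented_by_zero]) (simp add: lp_fun_def)
 fix u v :: "'n tempdist" and c
 { assume "u \<in> Lp p" "v \<in> Lp p"
  then obtain f g where f: "represented_by u f" "lp_fun lborel p f" and g: "represented_by v g" "lp_fun lborel p g"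
   by (auto elim!: LpE)
  show "u + v \<in> Lp p" by (rule LpI[OF represented_by_add[OF f(1) g(1)] lp_fun_add[OF f(2) g(2) p0]])
  show "Lp_norm p (u + v) <= Lp_norm p u + Lp_norm p v"
   unfolding Lp_norm_eq[OF f(1)] Lp_norm_eq[OF g(1)] Lp_norm_eq[OF represented_by_add[OF f(1) g(1)]]
   by (rule lp_norm_triangle[OF f(2) g(2) p]) }
 { assume "u \<in> Lp p"
  then obtain f where f: "represented_by u f" "lp_fun lborel p f" by (auto elim!: LpE)
  show "c *\<^sub>C u \<in> Lp p"
   by (rule LpI[OF represented_by_scale[OF f(1)] lp_fun_scale[OF f(2), of "norm c"]])
     (use f(2) in \<open>auto simp: norm_mult lp_fun_def\<close>)
  show "Lp_norm p (c *\<^sub>C u) = norm c * Lp_norm p u"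
   unfolding Lp_norm_eq[OF f(1)] Lp_norm_eq[OF represented_by_scale[OF f(1)]]
   by (rule lp_norm_scale[OF p0]) (auto simp: norm_mult)
  show "u = 0" if "Lp_norm p u = 0"
  proof -
   have "AE x in lborel. f x = 0" using that lp_norm_eq_0_iff[OF f(2) p0] unfolding Lp_norm_eq[OF f(1)] by simp
   then have ae: "AE x in lborel. f x * schwartz_fun \<phi> x = 0" for \<phi> by eventually_elim simp
   have [measurable]: "f \<in> borel_measurable borel" using f(2) by (simp add: lp_fun_def)
   have "pairing u \<phi> = 0" for \<phi>
    using integral_cong_AE[OF _ _ ae[of \<phi>]] f(1) by (simp add: represented_by_def)
   then show "u = 0" by (intro tempdist_eqI) (simp add: pairing_simps)
  qed }
next
 fix s :: "nat => 'n tempdist" assume s: "!!k. s k \<in> Lp p"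
  and c: "!!e. e > 0 ==> \<exists>N. \<forall>m\<ge>N. \<forall>n\<ge>N. Lp_norm p (s m - s n) < e"
 have "\<forall>k. \<exists>f. represented_by (s k) f & lp_fun lborel p f" using s unfolding Lp_iff by blast
 from choice[OF this] obtain f where f: "!!k. represented_by (s k) (f k)" "!!k. lp_fun lborel p (f k)" by blast
 have eq: "Lp_norm p (s m - s n) = lp_norm lborel p (%x. f m x - f n x)" for m n
  by (rule Lp_norm_eq[OF represented_by_diff[OF f(1) f(1)]])
 obtain g where g: "lp_fun lborel p g" "(%k. lp_norm lborel p (%x. f k x - g x)) \<longlonglongrightarrow> 0"
  using lp_complete[OF f(2) p c[unfolded eq]] by blast
 note rg = represented_by_dist_of[OF g(1) p]
 have "Lp_norm p (s k - dist_of g) = lp_norm lborel p (%x. f k x - g x)" for k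
  by (rule Lp_norm_eq[OF represented_by_diff[OF f(1) rg]])
 then show "\<exists>y\<in>Lp p. (%k. Lp_norm p (s k - y)) \<longlonglongrightarrow> 0"
  using g(2) LpI[OF rg g(1)] by (intro bexI[of _ "dist_of g"]) simp_all
qed

lemma Lp_tendsto_pairing:
 fixes s :: "nat => 'n::finite tempdist"
 assumes p: "p >= 1" and s: "!!k. s k \<in> Lp p" "u \<in> Lp p" and lim: "(%k. Lp_norm p (s k - u)) \<longlonglongrightarrow> 0"
 shows "(%k. pairing (s k) \<phi>) \<longlonglongrightarrow> pairing u \<phi>"
proof (rule LIM_zero_cancel, rule tendsto_norm_zero_cancel, rule tendsto_sandwich[OF _ _ tendsto_const])
 interpret banach_carrier "Lp p :: 'n tempdist set" "Lp_norm p" using p by (rule banach_carrier_Lp)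
 let ?C = "(1 + (\<integral>x. weight x \<partial>(lborel :: (real^'n) measure))) * schwartz_norm (2 * CARD('n)) \<phi>"
 show "\<forall>\<^sub>F k in sequentially. norm (pairing (s k) \<phi> - pairing u \<phi>) <= ?C * Lp_norm p (s k - u)"
  using Lp_pairing_bound[OF diff_mem[OF s] p, of _ \<phi>] by (simp add: pairing_simps)
 show "(%k. ?C * Lp_norm p (s k - u)) \<longlonglongrightarrow> 0" using tendsto_mult_right_zero[OF lim] by simp
qed auto

lemma foldr_dist_deriv_linear:
 "foldr dist_deriv is (S + T) = foldr dist_deriv is S + foldr dist_deriv is T"
 "foldr dist_deriv is (S - T) = foldr dist_deriv is S - foldr dist_deriv is T"
 "foldr dist_deriv is (c *\<^sub>C T) = c *\<^sub>C foldr dist_deriv is T" "foldr dist_deriv is 0 = 0"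
 by (induction "is") (auto simp: dist_deriv_linear)

lemma pairing_foldr_tendsto:
 assumes "!!\<phi>. (%k. pairing (s k) \<phi>) \<longlonglongrightarrow> pairing u \<phi>"
 shows "(%k. pairing (foldr dist_deriv is (s k)) \<phi>) \<longlonglongrightarrow> pairing (foldr dist_deriv is u) \<phi>"
proof (induction "is" arbitrary: \<phi>)
 case (Cons i "is") then show ?case by (simp add: pairing_simps tendsto_minus)
qed (use assms in simp)

lemma Sobolev_norm_eq_lp_norm:
 "Sobolev_norm k p u = lp_norm (count_space (words_upto k)) p (%is. Lp_norm p (foldr dist_deriv is u))"
 by (simp add: Sobolev_norm_def lp_norm_def lebesgue_integral_count_space_finite finite_words_upto Lp_norm_def)

lemma lp_fun_count_space: "finite A ==> lp_fun (count_space A) p f"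
 by (simp add: lp_fun_def integrable_count_space)

lemma lp_norm_count_space_ge:
 fixes f :: "'a => real"
 assumes "finite A" "a \<in> A" "p > 0" shows "\<bar>f a\<bar> <= lp_norm (count_space A) p f"
proof -
 have "\<bar>f a\<bar> powr p <= (\<Sum>x\<in>A. \<bar>f x\<bar> powr p)" using assms by (intro member_le_sum) auto
 then have "(\<bar>f a\<bar> powr p) powr (1 / p) <= (\<Sum>x\<in>A. \<bar>f x\<bar> powr p) powr (1 / p)" using assms by (intro powr_mono2) auto
 then show ?thesis using assms
  by (simp add: lp_norm_def lebesgue_integral_count_space_finite powr_powr powr_one')
qed

lemma Lp_norm_nonneg [simp]: "0 <= Lp_norm p u"
 by (simp add: Lp_norm_def)

lemma Sobolev_norm_ge:
 assumes "length is <= k" "p > 0" shows "Lp_norm p (foldr dist_deriv is u) <= Sobolev_norm k p u"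
 using lp_norm_count_space_ge[OF finite_words_upto, of "is" k p "%is. Lp_norm p (foldr dist_deriv is u)"] assms
 by (simp add: Sobolev_norm_eq_lp_norm)

lemma SobolevD: "u \<in> Sobolev k p ==> length is <= k ==> foldr dist_deriv is u \<in> Lp p"
 by (simp add: Sobolev_def)

lemma Sobolev_norm_tendsto_zero:
 assumes "!!is. length is <= k ==> ((%x. Lp_norm p (foldr dist_deriv is (s x))) \<longlongrightarrow> 0) F" "p > 0"
 shows "((%x. Sobolev_norm k p (s x)) \<longlongrightarrow> 0) F"
proof -
 have "((%x. \<Sum>is\<in>words_upto k. Lp_norm p (foldr dist_deriv is (s x)) powr p) \<longlongrightarrow> (\<Sum>is\<in>(words_upto k :: 'a list set). 0 powr p)) F"
  using assms by (intro tendsto_sum tendsto_powr2 tendsto_const) auto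
 then have "((%x. (\<Sum>is\<in>words_upto k. Lp_norm p (foldr dist_deriv is (s x)) powr p) powr (1 / p)) \<longlongrightarrow> 0 powr (1 / p)) F"
  using assms(2) by (intro tendsto_powr2 tendsto_const) (auto intro!: always_eventually sum_nonneg)
 then show ?thesis unfolding Sobolev_norm_def by simp
qed

text \<open>
Completeness: the derivatives of a Cauchy sequence converge in \<open>L\<^sup>p\<close>, hence as
distributions, where differentiation is continuous.
\<close>

lemma banach_carrier_Sobolev:
 assumes p: "p >= 1" shows "banach_carrier (Sobolev k p :: 'n::finite tempdist set) (Sobolev_norm k p)"
proof -
 have p0: "p > 0" using p by simp
 interpret L: banach_carrier "Lp p :: 'n tempdist set" "Lp_norm p" using p by (rule banach_carrier_Lp)
 note fin = finite_words_upto[where 'n = 'n, of k]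
 show ?thesis
 proof
  show "0 \<in> (Sobolev k p :: 'n tempdist set)" by (auto simp: Sobolev_def foldr_dist_deriv_linear L.zero_mem)
  fix u v :: "'n tempdist" and c
  { assume uv: "u \<in> Sobolev k p" "v \<in> Sobolev k p"
   then show "u + v \<in> Sobolev k p" by (auto simp: Sobolev_def foldr_dist_deriv_linear L.add_mem)
   have "Sobolev_norm k p (u + v)
     <= lp_norm (count_space (words_upto k)) p (%is. Lp_norm p (foldr dist_deriv is u) + Lp_norm p (foldr dist_deriv is v))"
    unfolding Sobolev_norm_eq_lp_norm
    by (rule lp_fun_bound(2)[OF lp_fun_count_space[OF fin]])
      (use uv p0 in \<open>auto simp: foldr_dist_deriv_linear AE_count_space intro!: L.nrm_triangle SobolevD\<close>)
   also have "... <= Sobolev_norm k p u + Sobolev_norm k p v"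
    unfolding Sobolev_norm_eq_lp_norm by (rule lp_norm_triangle[OF lp_fun_count_space[OF fin] lp_fun_count_space[OF fin] p])
   finally show "Sobolev_norm k p (u + v) <= Sobolev_norm k p u + Sobolev_norm k p v" . }
  { assume u: "u \<in> Sobolev k p"
   then show "c *\<^sub>C u \<in> Sobolev k p" by (auto simp: Sobolev_def foldr_dist_deriv_linear L.scale_mem)
   have "Sobolev_norm k p (c *\<^sub>C u) = lp_norm (count_space (words_upto k)) p (%is. norm c * Lp_norm p (foldr dist_deriv is u))"
    unfolding Sobolev_norm_eq_lp_norm
    by (rule lp_norm_cong_norm) (use u in \<open>auto simp: foldr_dist_deriv_linear L.nrm_scale SobolevD\<close>)
   also have "... = norm c * Sobolev_norm k p u"
    unfolding Sobolev_norm_eq_lp_norm by (rule lp_norm_scale[OF p0]) (auto simp: abs_mult)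
   finally show "Sobolev_norm k p (c *\<^sub>C u) = norm c * Sobolev_norm k p u" .
   show "u = 0" if "Sobolev_norm k p u = 0"
    using Sobolev_norm_ge[of "[]" k p u] that p0 SobolevD[OF u, of "[]"] L.nrm_eq_0[of u] Lp_norm_nonneg[of p u]
    by (simp add: order_antisym) }
 next
  fix s :: "nat => 'n tempdist" assume s: "!!j. s j \<in> Sobolev k p"
   and c: "!!e. e > 0 ==> \<exists>N. \<forall>m\<ge>N. \<forall>n\<ge>N. Sobolev_norm k p (s m - s n) < e"
  have "\<exists>w\<in>Lp p. (%j. Lp_norm p (foldr dist_deriv is (s j) - w)) \<longlonglongrightarrow> 0" if len: "length is <= k" for "is"
  proof (rule L.complete)
   show "foldr dist_deriv is (s j) \<in> Lp p" for j using SobolevD[OF s len] .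
   fix e :: real assume "e > 0"
   from c[OF this] obtain N where N: "\<forall>m\<ge>N. \<forall>n\<ge>N. Sobolev_norm k p (s m - s n) < e" by blast
   have "Lp_norm p (foldr dist_deriv is (s m) - foldr dist_deriv is (s n)) < e" if "m >= N" "n >= N" for m n
    using Sobolev_norm_ge[OF len p0, of "s m - s n"] N that by (auto simp: foldr_dist_deriv_linear intro: le_less_trans)
   then show "\<exists>N. \<forall>m\<ge>N. \<forall>n\<ge>N. Lp_norm p (foldr dist_deriv is (s m) - foldr dist_deriv is (s n)) < e" by blast
  qed
  then have "\<forall>is. \<exists>w. length is <= k --> w \<in> Lp p & (%j. Lp_norm p (foldr dist_deriv is (s j) - w)) \<longlonglongrightarrow> 0" by blast
  from choice[OF this] obtain w where w: "!!is. length is <= k ==> w is \<in> Lp p"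
   "!!is. length is <= k ==> (%j. Lp_norm p (foldr dist_deriv is (s j) - w is)) \<longlonglongrightarrow> 0" by blast
  have "(%j. pairing (s j) \<phi>) \<longlonglongrightarrow> pairing (w []) \<phi>" for \<phi>
   using w[of "[]"] SobolevD[OF s, of "[]"] by (intro Lp_tendsto_pairing[OF p]) auto
  note lim = pairing_foldr_tendsto[of s "w []", OF this]
  have eq: "foldr dist_deriv is (w []) = w is" if len: "length is <= k" for "is"
  proof (rule tempdist_eqI)
   fix \<phi>
   have "(%j. pairing (foldr dist_deriv is (s j)) \<phi>) \<longlonglongrightarrow> pairing (w is) \<phi>"
    using w[OF len] SobolevD[OF s len] by (intro Lp_tendsto_pairing[OF p]) auto
   then show "pairing (foldr dist_deriv is (w [])) \<phi> = pairing (w is) \<phi>" using lim LIMSEQ_unique by blast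
  qed
  have "w [] \<in> Sobolev k p" using eq w(1) by (auto simp: Sobolev_def)
  moreover have "(%j. Sobolev_norm k p (s j - w [])) \<longlonglongrightarrow> 0"
   by (rule Sobolev_norm_tendsto_zero[OF _ p0]) (use eq w(2) in \<open>simp add: foldr_dist_deriv_linear\<close>)
  ultimately show "\<exists>y\<in>Sobolev k p. (%j. Sobolev_norm k p (s j - y)) \<longlonglongrightarrow> 0" by blast
 qed
qed

lemma measurable_vec_complex:
 fixes f :: "'a => complex^'n::finite"
 assumes [measurable]: "!!i. (%x. f x $ i) \<in> borel_measurable M"
 shows "f \<in> borel_measurable M"
proof -
 have eq: "f x = (\<Sum>i\<in>UNIV. axis i (f x $ i))" for x
  by (simp add: vec_eq_iff axis_def if_distrib cong: if_cong)
 have "(%x. axis i (f x $ i)) \<in> borel_measurable M" for i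
 proof (rule borel_measurable_continuous_on[where f = "axis i"])
  show "continuous_on UNIV (axis i :: complex => complex^'n)"
  proof -
   have "axis i = (%x :: complex. \<chi> j :: 'n. if j = i then x else 0)" by (simp add: axis_def fun_eq_iff vec_eq_iff)
   moreover have "continuous_on UNIV (%x :: complex. if j = i then x else 0)" for j :: 'n
    by (cases "j = i") (simp_all add: continuous_on_id)
   ultimately show ?thesis by (simp add: continuous_on_vec_lambda)
  qed
 qed measurable
 then have "(%x. \<Sum>i\<in>UNIV. axis i (f x $ i)) \<in> borel_measurable M" by (intro borel_measurable_sum)
 then show ?thesis by (simp only: eq[symmetric])
qed

lemma Lp_vec_iff: "q \<in> Lp_vec p \<longleftrightarrow> (\<exists>f. represented_by_vec q f & lp_fun lborel p f)"
proof -
 have "f \<in> borel_measurable lborel" if "represented_by_vec q f" for f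
  by (rule measurable_vec_complex) (use that in \<open>auto simp: represented_by_vec_def represented_by_def\<close>)
 then show ?thesis by (auto simp: Lp_vec_def lp_fun_def)
qed

lemma represented_by_vec_measurable: "represented_by_vec q f ==> f \<in> borel_measurable lborel"
 by (rule measurable_vec_complex) (auto simp: represented_by_vec_def represented_by_def)

lemma Lp_vec_norm_eq:
 assumes "represented_by_vec q f" shows "Lp_vec_norm p q = lp_norm lborel p f"
proof -
 have s: "represented_by_vec q (SOME f. represented_by_vec q f)" using assms by (rule someI[where P = "represented_by_vec q"])
 have "AE x in lborel. \<forall>i\<in>UNIV. (SOME f. represented_by_vec q f) x $ i = f x $ i"
  using s assms by (intro AE_finite_allI) (auto simp: represented_by_vec_def intro: represented_by_unique)
 then have "AE x in lborel. (SOME f. represented_by_vec q f) x = f x"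
  by eventually_elim (simp add: vec_eq_iff)
 then show ?thesis unfolding Lp_vec_norm_def lp_norm_def[symmetric]
  using s assms by (intro lp_norm_cong_AE represented_by_vec_measurable)
qed

lemma lp_norm_sum_le:
 fixes f :: "'i => 'a => 'b::{real_normed_vector, second_countable_topology}"
 assumes "finite I" "p >= 1" "!!i. i \<in> I ==> lp_fun M p (f i)"
 shows "lp_fun M p (%x. \<Sum>i\<in>I. f i x) & lp_norm M p (%x. \<Sum>i\<in>I. f i x) <= (\<Sum>i\<in>I. lp_norm M p (f i))"
 using assms(1,3)
proof (induction I rule: finite_induct)
 case empty
 show ?case using assms(2) by (simp add: lp_fun_def lp_norm_def)
next
 case (insert i I)
 then have IH: "lp_fun M p (%x. \<Sum>i\<in>I. f i x)" "lp_norm M p (%x. \<Sum>i\<in>I. f i x) <= (\<Sum>i\<in>I. lp_norm M p (f i))" and fi: "lp_fun M p (f i)" by auto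
 show ?case using lp_fun_add[OF fi IH(1)] lp_norm_triangle[OF fi IH(1) assms(2)] IH(2) insert.hyps assms(2) by simp
qed

lemma Lp_vec_components:
 fixes q :: "'n::finite tempdist^'n"
 assumes q: "q \<in> Lp_vec p" and p: "p > 0"
 shows "q $ i \<in> Lp p" "Lp_norm p (q $ i) <= Lp_vec_norm p q"
proof -
 obtain f where f: "represented_by_vec q f" "lp_fun lborel p f" using q unfolding Lp_vec_iff by blast
 have fi: "represented_by (q $ i) (%x. f x $ i)" using f(1) by (simp add: represented_by_vec_def)
 have [measurable]: "(%x. f x $ i) \<in> borel_measurable lborel" using fi by (simp add: represented_by_def)
 note b = lp_fun_bound[OF f(2) this p, OF AE_I2, OF Finite_Cartesian_Product.norm_nth_le]
 show "q $ i \<in> Lp p" by (rule LpI[OF fi b(1)])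
 show "Lp_norm p (q $ i) <= Lp_vec_norm p q" unfolding Lp_norm_eq[OF fi] Lp_vec_norm_eq[OF f(1)] by (rule b(2))
qed

lemma Lp_vecI:
 fixes q :: "'n::finite tempdist^'n"
 assumes q: "!!i. q $ i \<in> Lp p" and p: "p >= 1"
 shows "q \<in> Lp_vec p" "Lp_vec_norm p q <= (\<Sum>i\<in>UNIV. Lp_norm p (q $ i))"
proof -
 have "\<forall>i. \<exists>f. represented_by (q $ i) f & lp_fun lborel p f" using q unfolding Lp_iff by blast
 from choice[OF this] obtain f where f: "!!i. represented_by (q $ i) (f i)" "!!i. lp_fun lborel p (f i)" by blast
 define g where "g x = (\<chi> i. f i x)" for x
 have g: "represented_by_vec q g" using f(1) by (simp add: represented_by_vec_def g_def)
 have n: "lp_fun lborel p (%x. norm (f i x))" "lp_norm lborel p (%x. norm (f i x)) = lp_norm lborel p (f i)" for i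
  using f(2)[of i] by (auto simp: lp_fun_def lp_norm_def)
 have s: "lp_fun lborel p (%x. \<Sum>i\<in>UNIV. norm (f i x)) \<and>
   lp_norm lborel p (%x. \<Sum>i\<in>UNIV. norm (f i x)) <= (\<Sum>i\<in>UNIV. lp_norm lborel p (%x. norm (f i x)))"
  by (rule lp_norm_sum_le[OF _ p n(1)]) simp
 have le: "norm (g x) <= norm (\<Sum>i\<in>UNIV. norm (f i x))" for x
 proof -
  have "norm (g x) <= (\<Sum>i\<in>UNIV. norm (f i x))"
   unfolding norm_vec_def g_def by (rule order_trans[OF L2_set_le_sum]) auto
  then show ?thesis by (simp add: sum_nonneg)
 qed
 have p0: "p > 0" using p by simp
 note b = lp_fun_bound[OF conjunct1[OF s] represented_by_vec_measurable[OF g] p0, OF AE_I2, OF le]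
 show "q \<in> Lp_vec p" unfolding Lp_vec_iff using g b(1) by blast
 show "Lp_vec_norm p q <= (\<Sum>i\<in>UNIV. Lp_norm p (q $ i))"
  unfolding Lp_vec_norm_eq[OF g] Lp_norm_eq[OF f(1)] using b(2) s by (simp add: n(2))
qed

lemma Lp_vec_norm_nonneg [simp]: "0 <= Lp_vec_norm p q"
 by (simp add: Lp_vec_norm_def)

lemma scaleC_vec_nth: "(c *\<^sub>C q) $ i = c *\<^sub>C (q $ i)" for q :: "'a::complex_vector^'n::finite"
 by (simp add: scaleC_vec_def)

lemma Lp_vec_norm_tendsto_zero:
 fixes s :: "'x => 'n::finite tempdist^'n"
 assumes "!!x i. s x $ i \<in> Lp p" "p >= 1" "!!i. ((%x. Lp_norm p (s x $ i)) \<longlongrightarrow> 0) F"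
 shows "((%x. Lp_vec_norm p (s x)) \<longlongrightarrow> 0) F"
proof (rule tendsto_sandwich[OF _ _ tendsto_const])
 show "((%x. \<Sum>i\<in>UNIV. Lp_norm p (s x $ i)) \<longlongrightarrow> 0) F" using assms(3) by (intro tendsto_null_sum)
 show "\<forall>\<^sub>F x in F. Lp_vec_norm p (s x) <= (\<Sum>i\<in>UNIV. Lp_norm p (s x $ i))"
  using Lp_vecI(2)[OF assms(1,2)] by (intro always_eventually allI)
qed auto

lemma banach_carrier_Lp_vec:
 assumes p: "p >= 1" shows "banach_carrier (Lp_vec p :: ('n::finite tempdist^'n) set) (Lp_vec_norm p)"
proof -
 have p0: "p > 0" using p by simp
 interpret L: banach_carrier "Lp p :: 'n tempdist set" "Lp_norm p" using p by (rule banach_carrier_Lp)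
 show ?thesis
 proof
  show "0 \<in> (Lp_vec p :: ('n tempdist^'n) set)" by (rule Lp_vecI(1)[OF _ p]) (simp add: L.zero_mem)
  fix q r :: "'n tempdist^'n" and c
  { assume q: "q \<in> Lp_vec p" and r: "r \<in> Lp_vec p"
   show "q + r \<in> Lp_vec p"
    by (rule Lp_vecI(1)[OF _ p]) (simp add: L.add_mem Lp_vec_components(1)[OF q p0] Lp_vec_components(1)[OF r p0])
   obtain f g where f: "represented_by_vec q f" "lp_fun lborel p f" and g: "represented_by_vec r g" "lp_fun lborel p g"
    using q r unfolding Lp_vec_iff by blast
   have fg: "represented_by_vec (q + r) (%x. f x + g x)"
    using f(1) g(1) by (auto simp: represented_by_vec_def intro: represented_by_add)
   show "Lp_vec_norm p (q + r) <= Lp_vec_norm p q + Lp_vec_norm p r"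
    unfolding Lp_vec_norm_eq[OF f(1)] Lp_vec_norm_eq[OF g(1)] Lp_vec_norm_eq[OF fg] by (rule lp_norm_triangle[OF f(2) g(2) p]) }
  { assume q: "q \<in> Lp_vec p"
   show "c *\<^sub>C q \<in> Lp_vec p"
    by (rule Lp_vecI(1)[OF _ p]) (simp add: scaleC_vec_nth L.scale_mem Lp_vec_components(1)[OF q p0])
   obtain f where f: "represented_by_vec q f" using q unfolding Lp_vec_iff by blast
   have cf: "represented_by_vec (c *\<^sub>C q) (%x. \<chi> i. c * f x $ i)"
    using f by (auto simp: represented_by_vec_def scaleC_vec_nth intro: represented_by_scale)
   have n: "norm (\<chi> i. c * f x $ i) = norm c * norm (f x)" for x
    by (simp add: norm_vec_def norm_mult L2_set_right_distrib)
   show "Lp_vec_norm p (c *\<^sub>C q) = norm c * Lp_vec_norm p q"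
    unfolding Lp_vec_norm_eq[OF f] Lp_vec_norm_eq[OF cf] by (rule lp_norm_scale[OF p0 _ n]) simp
   show "q = 0" if "Lp_vec_norm p q = 0"
    using Lp_vec_components[OF q p0] that by (auto simp: vec_eq_iff intro!: L.nrm_eq_0 order_antisym) }
 next
  fix s :: "nat => 'n tempdist^'n" assume s: "!!k. s k \<in> Lp_vec p"
   and c: "!!e. e > 0 ==> \<exists>N. \<forall>m\<ge>N. \<forall>n\<ge>N. Lp_vec_norm p (s m - s n) < e"
  have si: "s k $ i \<in> Lp p" for k i by (rule Lp_vec_components(1)[OF s p0])
  have sd: "s m - s n \<in> Lp_vec p" for m n by (rule Lp_vecI(1)[OF _ p]) (simp add: L.diff_mem si)
  have "\<exists>y\<in>Lp p. (%k. Lp_norm p (s k $ i - y)) \<longlonglongrightarrow> 0" for i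
  proof (rule L.complete[OF si])
   fix e :: real assume "e > 0"
   from c[OF this] obtain N where N: "\<forall>m\<ge>N. \<forall>n\<ge>N. Lp_vec_norm p (s m - s n) < e" by blast
   have "Lp_norm p (s m $ i - s n $ i) < e" if "m >= N" "n >= N" for m n
    using Lp_vec_components(2)[OF sd[of m n] p0, of i] N[rule_format, OF that] by simp
   then show "\<exists>N. \<forall>m\<ge>N. \<forall>n\<ge>N. Lp_norm p (s m $ i - s n $ i) < e" by blast
  qed
  then have "\<forall>i. \<exists>y. y \<in> Lp p & (%k. Lp_norm p (s k $ i - y)) \<longlonglongrightarrow> 0" by blast
  from choice[OF this] obtain y where y: "!!i. y i \<in> Lp p" "!!i. (%k. Lp_norm p (s k $ i - y i)) \<longlonglongrightarrow> 0" by blast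
  show "\<exists>y\<in>Lp_vec p. (%k. Lp_vec_norm p (s k - y)) \<longlonglongrightarrow> 0"
  proof (intro bexI[of _ "\<chi> i. y i"] Lp_vec_norm_tendsto_zero Lp_vecI(1))
   show "(s k - (\<chi> i. y i)) $ i \<in> Lp p" for k i using L.diff_mem[OF si y(1)] by simp
  qed (use y p in simp_all)
 qed
qed

theorem banach_carrier_plate:
 assumes p: "p >= 1" shows "banach_carrier (plate_space p :: 'n::finite state set) (plate_norm p)"
proof -
 have "(plate_norm p :: 'n state => real)
   = (%U. Sobolev_norm 2 p (fst U) + (Lp_norm p (fst (snd U)) + (Lp_norm p (fst (snd (snd U))) + Lp_vec_norm p (snd (snd (snd U))))))"
  by (auto simp: plate_norm_def fun_eq_iff)
 moreover note banach_carrier_prod[OF banach_carrier_Sobolev[OF p, of 2, where 'n = 'n]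
   banach_carrier_prod[OF banach_carrier_Lp[OF p] banach_carrier_prod[OF banach_carrier_Lp[OF p] banach_carrier_Lp_vec[OF p]]]]
 ultimately show ?thesis unfolding plate_space_def by simp
qed

section \<open>Uniform boundedness\<close>

context banach_carrier
begin

lemma bounded_operatorD:
 assumes "bounded_operator_on X nrm T"
 shows "x \<in> X ==> T x \<in> X" "x \<in> X ==> y \<in> X ==> T (x + y) = T x + T y"
  "x \<in> X ==> y \<in> X ==> T (x - y) = T x - T y" "x \<in> X ==> T (c *\<^sub>C x) = c *\<^sub>C T x" "T 0 = 0"
proof -
 show 1: "x \<in> X ==> T x \<in> X" for x using assms unfolding bounded_operator_on_def by blast
 show 2: "x \<in> X ==> y \<in> X ==> T (x + y) = T x + T y" for x y using assms unfolding bounded_operator_on_def by blast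
 show 3: "x \<in> X ==> T (c *\<^sub>C x) = c *\<^sub>C T x" for c x using assms unfolding bounded_operator_on_def by blast
 show "T 0 = 0" using 3[OF zero_mem, of 0] by simp
 show "x \<in> X ==> y \<in> X ==> T (x - y) = T x - T y"
  using 2[of x "- y"] 3[of y "-1"] by (simp add: uminus_mem scaleC_minus_one)
qed

lemma bounded_operator_bound:
 assumes "bounded_operator_on X nrm T"
 obtains C where "C > 0" "!!x. x \<in> X ==> nrm (T x) <= C * nrm x"
proof -
 obtain C where C: "!!x. x \<in> X ==> nrm (T x) <= C * nrm x" using assms unfolding bounded_operator_on_def by blast
 have "nrm (T x) <= (\<bar>C\<bar> + 1) * nrm x" if "x \<in> X" for x
 proof (rule order_trans[OF C[OF that] mult_right_mono[OF _ nrm_nonneg[OF that]]])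
  show "C <= \<bar>C\<bar> + 1" by linarith
 qed
 then show ?thesis using that[of "\<bar>C\<bar> + 1"] by simp
qed

text \<open>
One step of the nested ball argument of Sokal: one of \<open>x + h\<close> and \<open>x -
h\<close> is mapped to a vector at least as large as the image of \<open>h\<close>.
\<close>

lemma unbounded_family_ball:
 assumes T: "!!k. bounded_operator_on X nrm (T k)"
  and unb: "!!M. \<exists>k. \<exists>x\<in>X. nrm (T k x) > M * nrm x"
  and x: "x \<in> X" and r: "r > (0::real)" and j: "j >= (0::real)"
 shows "\<exists>x' r' k. x' \<in> X & r' > 0 & nrm (x' - x) + r' <= r & r' <= r / 2 & (\<forall>y\<in>X. nrm (y - x') <= r' --> nrm (T k y) > j)"
proof -
 obtain k z where z: "z \<in> X" "nrm (T k z) > (2 * (j + 1) / r) * nrm z" using unb by blast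
 have z0: "nrm z > 0"
 proof (rule ccontr)
  assume "\<not> nrm z > 0"
  then have "nrm z = 0" using nrm_nonneg[OF z(1)] by simp
  then have "z = 0" by (rule nrm_eq_0[OF z(1)])
  then show False using z(2) bounded_operatorD(5)[OF T] by simp
 qed
 define h where "h = complex_of_real (r / (2 * nrm z)) *\<^sub>C z"
 have h: "h \<in> X" unfolding h_def using z(1) by (rule scale_mem)
 have nh: "nrm h = r / 2" unfolding h_def nrm_scale[OF z(1)] using z0 r by (simp add: norm_divide)
 have "nrm (T k h) = r / (2 * nrm z) * nrm (T k z)"
  unfolding h_def bounded_operatorD(4)[OF T z(1)] nrm_scale[OF bounded_operatorD(1)[OF T z(1)]] using z0 r by (simp add: norm_divide)
 also have "... > r / (2 * nrm z) * ((2 * (j + 1) / r) * nrm z)" using z0 r z(2) by (intro mult_strict_left_mono) auto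
 also have "r / (2 * nrm z) * ((2 * (j + 1) / r) * nrm z) = j + 1" using z0 r by simp
 finally have Th: "nrm (T k h) > j + 1" .
 have "\<exists>x'\<in>X. nrm (x' - x) = r / 2 & nrm (T k x') > j + 1"
 proof (rule ccontr)
  assume n: "\<not> ?thesis"
  have "nrm (T k (x + h)) <= j + 1" using n add_mem[OF x h] nh by (auto simp: not_less)
  moreover have "nrm (T k (x - h)) <= j + 1" using n diff_mem[OF x h] nh h nrm_uminus[OF h] by (auto simp: not_less)
  moreover have "T k (x + h) - T k (x - h) = 2 *\<^sub>C T k h"
   using scaleC_add_left[of 1 1 "T k h"] by (simp add: bounded_operatorD(2,3)[OF T x h] scaleC_one)
  then have "2 * nrm (T k h) = nrm (T k (x + h) - T k (x - h))"
   using nrm_scale[OF bounded_operatorD(1)[OF T h], of 2 k] by simp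
  moreover have "nrm (T k (x + h) - T k (x - h)) <= nrm (T k (x + h)) + nrm (T k (x - h))"
   by (intro nrm_diff_le bounded_operatorD(1)[OF T] add_mem diff_mem x h)
  ultimately show False using Th by linarith
 qed
 then obtain x' where x': "x' \<in> X" "nrm (x' - x) = r / 2" "nrm (T k x') > j + 1" by blast
 obtain C where C: "C > 0" "!!x. x \<in> X ==> nrm (T k x) <= C * nrm x" using bounded_operator_bound[OF T] by blast
 define r' where "r' = min (r / 2) (1 / C)"
 have "nrm (T k y) > j" if y: "y \<in> X" "nrm (y - x') <= r'" for y
 proof -
  have "nrm (T k x') <= nrm (T k y) + nrm (T k x' - T k y)" by (intro nrm_le_add_diff bounded_operatorD(1)[OF T] x' y)
  also have "T k x' - T k y = T k (x' - y)" by (simp add: bounded_operatorD(3)[OF T x'(1) y(1)])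
  also have "nrm (T k (x' - y)) <= C * nrm (x' - y)" by (intro C diff_mem x' y)
  also have "... <= C * (1 / C)" using y(2) C(1) nrm_minus_commute[OF x'(1) y(1)] by (intro mult_left_mono) (auto simp: r'_def)
  finally show ?thesis using C(1) x'(3) by simp
 qed
 then show ?thesis using x'(1,2) r C(1) by (intro exI[of _ x'] exI[of _ r'] exI[of _ k]) (auto simp: r'_def)
qed

theorem uniform_boundedness:
 fixes T :: "nat => 'b => 'b"
 assumes T: "!!k. bounded_operator_on X nrm (T k)"
  and pt: "!!x. x \<in> X ==> \<exists>C. \<forall>k. nrm (T k x) <= C"
 shows "\<exists>M. \<forall>k. \<forall>x\<in>X. nrm (T k x) <= M * nrm x"
proof (rule ccontr)
 assume "\<not> ?thesis"
 then have unb: "\<exists>k. \<exists>x\<in>X. nrm (T k x) > M * nrm x" for M by (auto simp: not_le)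
 have "\<exists>f. \<forall>n. (fst (f n) \<in> X & snd (f n) > 0) \<and>
   (nrm (fst (f (Suc n)) - fst (f n)) + snd (f (Suc n)) <= snd (f n) & snd (f (Suc n)) <= snd (f n) / 2 \<and>
    (\<exists>k. \<forall>y\<in>X. nrm (y - fst (f (Suc n))) <= snd (f (Suc n)) --> nrm (T k y) > real n))"
 proof (rule dependent_nat_choice)
  show "\<exists>p :: 'b \<times> real. fst p \<in> X & 0 < snd p" using zero_mem by (intro exI[of _ "(0, 1)"]) auto
  fix p :: "'b \<times> real" and n assume p: "fst p \<in> X & 0 < snd p"
  obtain x' r' k where "x' \<in> X & r' > 0 & nrm (x' - fst p) + r' <= snd p & r' <= snd p / 2
    & (\<forall>y\<in>X. nrm (y - x') <= r' --> nrm (T k y) > real n)"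
   using unbounded_family_ball[OF T unb conjunct1[OF p] conjunct2[OF p], of "real n"] by auto
  then show "\<exists>q. (fst q \<in> X & 0 < snd q) & nrm (fst q - fst p) + snd q <= snd p & snd q <= snd p / 2 \<and>
    (\<exists>k. \<forall>y\<in>X. nrm (y - fst q) <= snd q --> nrm (T k y) > real n)"
   by (intro exI[of _ "(x', r')"]) auto
 qed
 then obtain f where f: "!!n. fst (f n) \<in> X" "!!n. snd (f n) > 0"
  "!!n. nrm (fst (f (Suc n)) - fst (f n)) + snd (f (Suc n)) <= snd (f n)" "!!n. snd (f (Suc n)) <= snd (f n) / 2"
  "!!n. \<exists>k. \<forall>y\<in>X. nrm (y - fst (f (Suc n))) <= snd (f (Suc n)) --> nrm (T k y) > real n" by blast
 have nest: "nrm (fst (f (n + i)) - fst (f n)) + snd (f (n + i)) <= snd (f n)" for n i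
 proof (induction i)
  case (Suc i)
  have "nrm (fst (f (n + Suc i)) - fst (f n)) <= nrm (fst (f (n + Suc i)) - fst (f (n + i))) + nrm (fst (f (n + i)) - fst (f n))"
   by (intro nrm_diff_triangle f)
  then show ?case using Suc f(3)[of "n + i"] by simp
 qed simp
 have near: "nrm (fst (f m) - fst (f n)) <= snd (f n)" if "m >= n" for m n
  using nest[of n "m - n"] f(2)[of m] that by simp
 have small: "snd (f n) <= snd (f 0) / 2 ^ n" for n
 proof (induction n)
  case (Suc n) then show ?case using f(4)[of n] by simp
 qed simp
 have "\<exists>y\<in>X. (%k. nrm (fst (f k) - y)) \<longlonglongrightarrow> 0"
 proof (rule complete[OF f(1)])
  fix e :: real assume e: "e > 0"
  have "(%n. snd (f 0) / 2 ^ n) \<longlonglongrightarrow> 0" by real_asymp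
  then obtain N where "norm (snd (f 0) / 2 ^ N - 0) < e / 2" using LIMSEQ_D[of _ 0 "e / 2"] e by (meson half_gt_zero order_refl)
  then have N: "snd (f N) < e / 2" 
   using small[of N] abs_ge_self[of "snd (f 0) / 2 ^ N"] unfolding real_norm_def diff_0_right by linarith
  have "nrm (fst (f m) - fst (f n)) < e" if "m >= N" "n >= N" for m n
   using nrm_diff_triangle[OF f(1)[of m] f(1)[of N] f(1)[of n]] near[OF that(1)] near[OF that(2)]
    nrm_minus_commute[OF f(1)[of N] f(1)[of n]] N by linarith
  then show "\<exists>N. \<forall>m\<ge>N. \<forall>n\<ge>N. nrm (fst (f m) - fst (f n)) < e" by blast
 qed
 then obtain y where y: "y \<in> X" "(%k. nrm (fst (f k) - y)) \<longlonglongrightarrow> 0" by blast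
 have yn: "nrm (y - fst (f n)) <= snd (f n)" for n
 proof (rule LIMSEQ_le_const[of "%k. nrm (fst (f k) - y) + snd (f n)"])
  show "(%k. nrm (fst (f k) - y) + snd (f n)) \<longlonglongrightarrow> snd (f n)" using tendsto_add[OF y(2) tendsto_const] by simp
  have "nrm (y - fst (f n)) <= nrm (fst (f k) - y) + snd (f n)" if "k >= n" for k
   using nrm_diff_triangle[OF y(1) f(1)[of k] f(1)[of n]] nrm_minus_commute[OF y(1) f(1)[of k]] near[OF that] by linarith
  then show "\<exists>N. \<forall>k\<ge>N. nrm (y - fst (f n)) <= nrm (fst (f k) - y) + snd (f n)" by blast
 qed
 obtain C where C: "!!k. nrm (T k y) <= C" using pt[OF y(1)] by blast
 obtain n :: nat where n: "C <= real n" using real_arch_simple by blast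
 obtain k where "\<forall>y\<in>X. nrm (y - fst (f (Suc n))) <= snd (f (Suc n)) --> nrm (T k y) > real n" using f(5) by blast
 then have "nrm (T k y) > real n" using y(1) yn by blast
 then show False using C[of k] n by linarith
qed

text \<open>
If no bound holds near 0, a sequence \<open>z k\<close> tending to 0 violates the uniform
boundedness principle. The set \<open>A\<close> is a half-line for semigroups and a sector for
analytic ones.
\<close>

lemma local_bound:
 fixes S :: "'z::real_normed_vector => 'b => 'b" and A :: "'z set"
 assumes S: "!!z. z \<in> A ==> bounded_operator_on X nrm (S z)"
  and lim: "!!x. x \<in> X ==> ((%z. nrm (S z x - x)) \<longlongrightarrow> 0) (at 0 within A)"
 shows "\<exists>M\<ge>1. \<exists>d>0. \<forall>z\<in>A. z ~= 0 & norm z < d --> (\<forall>x\<in>X. nrm (S z x) <= M * nrm x)"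
proof (rule ccontr)
 assume n: "\<not> ?thesis"
 have "\<exists>z. (z \<in> A & z ~= 0 & norm z < 1 / real (Suc k)) & (\<exists>x\<in>X. nrm (S z x) > real (Suc k) * nrm x)" for k
 proof (rule ccontr)
  assume "\<not> ?thesis"
  then have "\<forall>z\<in>A. z ~= 0 & norm z < 1 / real (Suc k) --> (\<forall>x\<in>X. nrm (S z x) <= real (Suc k) * nrm x)" by (auto simp: not_less)
  moreover have "1 <= real (Suc k)" "1 / real (Suc k) > 0" by auto
  ultimately show False using n by blast
 qed
 then have "\<forall>k. \<exists>z. (z \<in> A & z ~= 0 & norm z < 1 / real (Suc k)) & (\<exists>x\<in>X. nrm (S z x) > real (Suc k) * nrm x)" by blast
 from choice[OF this] obtain z where z: "!!k. z k \<in> A" "!!k. z k ~= 0" "!!k. norm (z k) < 1 / real (Suc k)"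
  "!!k. \<exists>x\<in>X. nrm (S (z k) x) > real (Suc k) * nrm x" by blast
 have "z \<longlonglongrightarrow> 0"
 proof (rule tendsto_norm_zero_cancel, rule tendsto_sandwich[OF _ _ tendsto_const])
  show "(%k. 1 / real (Suc k)) \<longlonglongrightarrow> 0" by real_asymp
 qed (use z(3) in \<open>auto intro!: always_eventually less_imp_le\<close>)
 then have z0: "filterlim z (at 0 within A) sequentially" using z(1,2) by (auto simp: filterlim_at)
 have "\<exists>M. \<forall>k. \<forall>x\<in>X. nrm (S (z k) x) <= M * nrm x"
 proof (rule uniform_boundedness)
  show "bounded_operator_on X nrm (S (z k))" for k by (rule S[OF z(1)])
  fix x assume x: "x \<in> X"
  have "(%k. nrm (S (z k) x - x)) \<longlonglongrightarrow> 0" by (rule filterlim_compose[OF lim[OF x] z0])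
  then have "Bseq (%k. nrm (S (z k) x - x))" by (intro convergent_imp_Bseq convergentI)
  then obtain B where B: "!!k. norm (nrm (S (z k) x - x)) <= B" using BseqE by blast
  have "nrm (S (z k) x) <= nrm x + B" for k
   using nrm_le_add_diff[OF bounded_operatorD(1)[OF S[OF z(1)] x, of k] x] B[of k] abs_ge_self[of "nrm (S (z k) x - x)"] by simp
  then show "\<exists>C. \<forall>k. nrm (S (z k) x) <= C" by blast
 qed
 then obtain M where M: "!!k x. x \<in> X ==> nrm (S (z k) x) <= M * nrm x" by blast
 obtain k :: nat where k: "M <= real k" using real_arch_simple by blast
 obtain x where x: "x \<in> X" "nrm (S (z k) x) > real (Suc k) * nrm x" using z(4) by blast
 have "M * nrm x <= real (Suc k) * nrm x" using k nrm_nonneg[OF x(1)] by (intro mult_right_mono) auto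
 then show False using M[OF x(1), of k] x(2) by linarith
qed

end

section \<open>Approximate orbits of semigroups\<close>

text \<open>
A continuous function whose right upper derivative is at most \<open>K\<close> everywhere grows at
most with slope \<open>K\<close>: the largest point up to which the bound with slope \<open>K +
\<eta>\<close> holds is the end point.
\<close>

lemma dini_bound:
 fixes \<phi> :: "real => real"
 assumes cont: "continuous_on {0..s} \<phi>" and \<phi>0: "\<phi> 0 <= 0" and s: "s >= 0"
  and step: "!!r \<eta>. 0 <= r ==> r < s ==> \<eta> > 0 ==> \<exists>\<delta>>0. \<forall>h. 0 < h & h < \<delta> & r + h <= s --> \<phi> (r + h) <= \<phi> r + (K + \<eta>) * h"
 shows "\<phi> s <= K * s"
proof -
 have main: "\<phi> s <= (K + \<eta>) * s" if \<eta>: "\<eta> > 0" for \<eta>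
 proof -
  define \<psi> where "\<psi> r = \<phi> r - (K + \<eta>) * r" for r
  define Z where "Z = {r \<in> {0..s}. \<psi> r \<in> {..0}}"
  have "continuous_on {0..s} \<psi>" unfolding \<psi>_def by (intro continuous_intros cont)
  then have closed: "closed Z" unfolding Z_def by (intro continuous_closed_preimage[unfolded vimage_def, simplified Int_def mem_Collect_eq]) auto
  have Z0: "0 \<in> Z" using s \<phi>0 by (simp add: Z_def \<psi>_def)
  have bdd: "bdd_above Z" by (auto simp: Z_def intro!: bdd_aboveI[of _ s])
  define c where "c = Sup Z"
  have c: "c \<in> Z" unfolding c_def using closed_contains_Sup[OF _ bdd closed] Z0 by blast
  show ?thesis
  proof (cases "c = s")
   case True then show ?thesis using c by (simp add: Z_def \<psi>_def)
  next
   case False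
   then have cs: "0 <= c" "c < s" using c by (auto simp: Z_def)
   obtain \<delta> where \<delta>: "\<delta> > 0" "!!h. 0 < h ==> h < \<delta> ==> c + h <= s ==> \<phi> (c + h) <= \<phi> c + (K + \<eta>) * h"
    using step[OF cs \<eta>] by blast
   define h where "h = min (\<delta> / 2) (s - c)"
   have h: "0 < h" "h < \<delta>" "c + h <= s" using \<delta>(1) cs by (auto simp: h_def)
   have "\<psi> (c + h) <= \<psi> c" using \<delta>(2)[OF h] by (simp add: \<psi>_def algebra_simps)
   then have "c + h \<in> Z" using c h cs by (auto simp: Z_def)
   then have "c + h <= c" unfolding c_def using bdd by (rule cSup_upper)
   then show ?thesis using h by simp
  qed
 qed
 show ?thesis
 proof (cases "s = 0")
  case True then show ?thesis using \<phi>0 by simp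
 next
  case False
  show ?thesis
  proof (rule field_le_epsilon)
   fix e :: real assume "e > 0"
   then show "\<phi> s <= K * s + e" using main[of "e / s"] False s by (simp add: distrib_right)
  qed
 qed
qed

context banach_carrier
begin

lemma C0_semigroupD:
 assumes "C0_semigroup_on X nrm T"
 shows "t >= 0 ==> bounded_operator_on X nrm (T t)" "x \<in> X ==> T 0 x = x"
  "s >= 0 ==> t >= 0 ==> x \<in> X ==> T (s + t) x = T s (T t x)"
  "x \<in> X ==> ((%t. nrm (T t x - x)) \<longlongrightarrow> 0) (at_right 0)"
 using assms unfolding C0_semigroup_on_def by blast+

lemma C0_local_bound:
 assumes "C0_semigroup_on X nrm T"
 shows "\<exists>M\<ge>1. \<exists>d>0. \<forall>t. 0 <= t & t <= d --> (\<forall>x\<in>X. nrm (T t x) <= M * nrm x)"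
proof -
 obtain M d where M: "M >= 1" "d > 0" "!!t x. t \<in> {0<..} ==> t ~= 0 ==> norm t < d ==> x \<in> X ==> nrm (T t x) <= M * nrm x"
 proof -
  have "\<exists>M\<ge>1. \<exists>d>0. \<forall>t\<in>{0<..}. t ~= 0 & norm t < d --> (\<forall>x\<in>X. nrm (T t x) <= M * nrm x)"
   by (rule local_bound) (use C0_semigroupD[OF assms] in auto)
  then show ?thesis using that by blast
 qed
 have "nrm (T t x) <= M * nrm x" if "0 <= t" "t <= d / 2" "x \<in> X" for t x
 proof (cases "t = 0")
  case True
  have "1 * nrm x <= M * nrm x" using M(1) nrm_nonneg[OF that(3)] by (rule mult_right_mono)
  then show ?thesis using True C0_semigroupD(2)[OF assms that(3)] by simp
 qed (use M that in auto)
 then show ?thesis using M(1,2) by (intro exI[of _ M] conjI exI[of _ "d / 2"]) auto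
qed

text \<open>
Duhamel's principle without integrals. For an approximate solution \<open>U\<close> with residual
\<open>R\<close> the function \<open>F r = T (s - r) (U r)\<close> joins \<open>T s (U 0)\<close>
to \<open>U s\<close>, and its right derivative \<open>T (s - r) (R r)\<close> is bounded by
\<open>M * K\<close>. The norm of \<open>F r - F 0\<close> is only right differentiable, hence
\<open>dini_bound\<close>.
\<close>

lemma approximate_orbit:
 assumes C0: "C0_semigroup_on X nrm T" and gen: "is_generator_of X nrm T D A"
  and M: "M >= 0" "!!t x. 0 <= t ==> t <= d ==> x \<in> X ==> nrm (T t x) <= M * nrm x"
  and s: "0 <= s" "s <= d"
  and U: "!!t. 0 <= t ==> t <= s ==> U t \<in> D" and R: "!!t. 0 <= t ==> t <= s ==> R t \<in> X"
  and K: "!!t. 0 <= t ==> t <= s ==> nrm (R t) <= K"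
  and deriv: "!!t h. 0 <= t ==> 0 < h ==> t + h <= s ==>
    nrm (U (t + h) - U t - complex_of_real h *\<^sub>C (A (U t) + R t)) <= C * h\<^sup>2"
  and lip: "!!t h. 0 <= t ==> 0 < h ==> t + h <= s ==> nrm (U (t + h) - U t) <= L * h"
 shows "nrm (T s (U 0) - U s) <= M * K * s"
proof -
 note C = C0_semigroupD[OF C0]
 have UX: "U t \<in> X" "A (U t) \<in> X" and gv: "has_generator_value nrm T (U t) (A (U t))" if "0 <= t" "t <= s" for t
  using U[OF that] gen unfolding is_generator_of_def by blast+
 have TX: "T t x \<in> X" if "0 <= t" "x \<in> X" for t x by (rule bounded_operatorD(1)[OF C(1)[OF that(1)] that(2)])
 have Td: "T t (x - y) = T t x - T t y" if "0 <= t" "x \<in> X" "y \<in> X" for t x y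
  by (rule bounded_operatorD(3)[OF C(1)[OF that(1)] that(2,3)])
 have Mle: "nrm (T t x - T t y) <= M * nrm (x - y)" if "0 <= t" "t <= d" "x \<in> X" "y \<in> X" for t x y
  using M(2)[OF that(1,2) diff_mem[OF that(3,4)]] Td[OF that(1,3,4)] by simp
 define F where "F r = T (s - r) (U r)" for r
 have FX: "F r \<in> X" if "0 <= r" "r <= s" for r unfolding F_def using UX(1)[OF that] that by (intro TX) auto
 have step1: "nrm (F (r + h) - F r) <= M * nrm (U (r + h) - T h (U r))" if "0 <= r" "0 <= h" "r + h <= s" for r h
 proof -
  have "T (s - r) (U r) = T (s - (r + h)) (T h (U r))"
   using C(3)[of "s - (r + h)" h "U r"] UX(1)[of r] that by simp
  then show ?thesis unfolding F_def using that s UX by (auto intro!: Mle TX)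
 qed
 define g where "g r h = nrm (T h (U r) - U r)" for r h
 have g: "(g r \<longlongrightarrow> 0) (at_right 0)" if "0 <= r" "r <= s" for r unfolding g_def by (rule C(4)[OF UX(1)[OF that]])
 have L0: "L * h <= \<bar>L\<bar> * h" "0 <= \<bar>L\<bar> * h" if "0 < h" for h using that by (auto intro: mult_right_mono)
 have right: "nrm (F (r + h) - F r) <= M * (g r h + (M + 1) * (\<bar>L\<bar> * h))" if "0 <= r" "0 < h" "r + h <= s" for r h
 proof -
  have a: "U (r + h) \<in> X" "U r \<in> X" "T h (U r) \<in> X" using that UX(1) by (auto intro!: TX)
  have "nrm (U (r + h) - T h (U r)) <= nrm (U (r + h) - U r) + nrm (U r - T h (U r))" by (rule nrm_diff_triangle[OF a])
  also have "... <= g r h + (M + 1) * (\<bar>L\<bar> * h)"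
   using lip[OF that] nrm_minus_commute[OF a(2,3)] L0[OF that(2)] mult_nonneg_nonneg[OF M(1) L0(2)[OF that(2)]]
   unfolding distrib_right g_def by linarith
  finally show ?thesis using step1[of r h] that mult_left_mono[OF _ M(1)] by (meson less_imp_le order_trans)
 qed
 have left: "nrm (F r - F (r - h)) <= M * (g r h + (M + 1) * (\<bar>L\<bar> * h))" if "0 <= r - h" "0 < h" "r <= s" for r h
 proof -
  have a: "U r \<in> X" "T h (U r) \<in> X" "U (r - h) \<in> X" "T h (U (r - h)) \<in> X" using that UX(1) by (auto intro!: TX)
  have "nrm (U r - T h (U (r - h))) <= nrm (U r - T h (U r)) + nrm (T h (U r) - T h (U (r - h)))" by (rule nrm_diff_triangle[OF a(1,2,4)])
  moreover have "nrm (T h (U r) - T h (U (r - h))) <= M * (\<bar>L\<bar> * h)"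
   using Mle[of h, OF _ _ a(1,3)] mult_left_mono[OF order_trans[OF lip[of "r - h" h] L0(1)[OF that(2)]] M(1)] that s by simp
  ultimately have le: "nrm (U r - T h (U (r - h))) <= g r h + (M + 1) * (\<bar>L\<bar> * h)"
   using nrm_minus_commute[OF a(1,2)] L0[OF that(2)] unfolding distrib_right g_def by linarith
  have "nrm (F r - F (r - h)) <= M * nrm (U r - T h (U (r - h)))" using step1[of "r - h" h] that by simp
  then show ?thesis using mult_left_mono[OF le M(1)] by linarith
 qed
 define \<phi> where "\<phi> r = nrm (F r - F 0)" for r
 have \<phi>diff: "\<bar>\<phi> r' - \<phi> r\<bar> <= nrm (F r' - F r)" if "0 <= r" "r <= s" "0 <= r'" "r' <= s" for r r'
  using nrm_diff_triangle[OF FX[OF that(1,2)] FX[OF that(3,4)] FX[of 0]] nrm_diff_triangle[OF FX[OF that(3,4)] FX[OF that(1,2)] FX[of 0]]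
   nrm_minus_commute[OF FX[OF that(1,2)] FX[OF that(3,4)]] s unfolding \<phi>_def by linarith
 have small: "\<exists>\<delta>>0. \<forall>h. 0 < h & h < \<delta> --> f h < e" if "(f \<longlongrightarrow> 0) (at_right 0)" "e > 0" for f :: "real => real" and e
  using order_tendstoD(2)[OF that] unfolding eventually_at_right_field by auto
 have "continuous_on {0..s} \<phi>"
  unfolding continuous_on_iff
 proof (intro ballI allI impI)
  fix r e assume r: "r \<in> {0..s}" and e: "(e::real) > 0"
  have "((%h. M * (g r h + (M + 1) * (\<bar>L\<bar> * h))) \<longlongrightarrow> M * (0 + (M + 1) * (\<bar>L\<bar> * 0))) (at_right 0)"
   using g[of r] r by (intro tendsto_intros) auto
  then obtain \<delta> where \<delta>: "\<delta> > 0" "!!h. 0 < h & h < \<delta> ==> M * (g r h + (M + 1) * (\<bar>L\<bar> * h)) < e" using small[OF _ e] by auto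
  have "dist (\<phi> r') (\<phi> r) < e" if r': "r' \<in> {0..s}" "dist r' r < \<delta>" for r'
  proof -
   consider "r' = r" | "r < r'" | "r' < r" by linarith
   then show ?thesis
   proof cases
    case 2
    then show ?thesis using right[of r "r' - r"] \<delta>(2)[of "r' - r"] \<phi>diff[of r r'] r r' unfolding dist_real_def by auto
   next
    case 3
    then show ?thesis using left[of r "r - r'"] \<delta>(2)[of "r - r'"] \<phi>diff[of r' r] r r' unfolding dist_real_def by auto
   qed (use e in simp)
  qed
  then show "\<exists>\<delta>>0. \<forall>r'\<in>{0..s}. dist r' r < \<delta> --> dist (\<phi> r') (\<phi> r) < e" using \<delta>(1) by blast
 qed
 moreover have "\<phi> 0 <= 0" by (simp add: \<phi>_def)
 moreover have "\<exists>\<delta>>0. \<forall>h. 0 < h & h < \<delta> & r + h <= s --> \<phi> (r + h) <= \<phi> r + (M * K + \<eta>) * h"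
  if r: "0 <= r" "r < s" and \<eta>: "\<eta> > 0" for r \<eta>
 proof -
  let ?G = "%h. complex_of_real (1 / h) *\<^sub>C (T h (U r) - U r) - A (U r)"
  have "((%h. M * (C * h + nrm (?G h))) \<longlongrightarrow> M * (C * 0 + 0)) (at_right 0)"
   using gv[of r] r unfolding has_generator_value_def by (intro tendsto_intros) auto
  then have "((%h. M * (C * h + nrm (?G h))) \<longlongrightarrow> 0) (at_right 0)" by (simp only: mult_zero_right add_0_right)
  from small[OF this \<eta>] obtain \<delta> where \<delta>: "\<delta> > 0" "!!h. 0 < h & h < \<delta> ==> M * (C * h + nrm (?G h)) < \<eta>" by blast
  have "\<phi> (r + h) <= \<phi> r + (M * K + \<eta>) * h" if h: "0 < h" "h < \<delta>" "r + h <= s" for h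
  proof -
   have X: "U r \<in> X" "U (r + h) \<in> X" "T h (U r) \<in> X" "A (U r) \<in> X" "R r \<in> X"
    using r h UX R by (auto intro!: TX)
   have GX: "?G h \<in> X" by (intro diff_mem scale_mem X)
   let ?E = "U (r + h) - U r - complex_of_real h *\<^sub>C (A (U r) + R r)"
   have EX: "?E \<in> X" by (intro diff_mem add_mem scale_mem X)
   have hG: "complex_of_real h *\<^sub>C ?G h = T h (U r) - U r - complex_of_real h *\<^sub>C A (U r)"
    using h by (simp add: scaleC_diff_right scaleC_scaleC scaleC_one)
   have "U (r + h) - T h (U r) = ?E + complex_of_real h *\<^sub>C R r - complex_of_real h *\<^sub>C ?G h"
    unfolding hG by (simp add: scaleC_add_right)
   then have "nrm (U (r + h) - T h (U r)) <= nrm (?E + complex_of_real h *\<^sub>C R r) + nrm (complex_of_real h *\<^sub>C ?G h)"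
    using nrm_diff_le[OF add_mem[OF EX scale_mem[OF X(5)]] scale_mem[OF GX]] by metis
   also have "... <= nrm ?E + nrm (complex_of_real h *\<^sub>C R r) + nrm (complex_of_real h *\<^sub>C ?G h)"
    using nrm_triangle[OF EX scale_mem[OF X(5)]] by simp
   also have "... <= C * h\<^sup>2 + h * K + h * nrm (?G h)"
    unfolding nrm_scale[OF X(5)] nrm_scale[OF GX] using deriv[OF r(1) h(1,3)] K[of r] h r by (intro add_mono) auto
   finally have "M * nrm (U (r + h) - T h (U r)) <= M * (C * h\<^sup>2 + h * K + h * nrm (?G h))" using M(1) by (rule mult_left_mono)
   also have "... = M * K * h + M * (C * h + nrm (?G h)) * h" by (simp add: algebra_simps power2_eq_square)
   also have "... <= (M * K + \<eta>) * h" unfolding distrib_right using mult_right_mono[OF less_imp_le[OF \<delta>(2)[of h]], of h] h by simp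
   finally have "nrm (F (r + h) - F r) <= (M * K + \<eta>) * h" using step1[of r h] r h by linarith
   then show ?thesis using \<phi>diff[of r "r + h"] r h by linarith
  qed
  then show ?thesis using \<delta>(1) by blast
 qed
 ultimately have "\<phi> s <= (M * K) * s" by (intro dini_bound s(1)) auto
 moreover have "F s = U s" "F 0 = T s (U 0)" unfolding F_def using C(2)[OF UX(1)] s by auto
 ultimately show ?thesis unfolding \<phi>_def using nrm_minus_commute[of "U s" "T s (U 0)"] UX(1) s TX by simp
qed

end

section \<open>Gaussian beams\<close>

lemma represented_by_inject:
 assumes "represented_by u f" "represented_by v f" shows "u = v"
 using assms by (intro tempdist_eqI) (simp add: represented_by_def)

lemma
 assumes f: "is_schwartz f"
 shows represented_by_schwartz: "represented_by (dist_of f) f"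
  and dist_of_Lp: "p >= 1 ==> dist_of f \<in> Lp p"
  and Lp_norm_dist_of: "Lp_norm p (dist_of f) = lp_norm lborel p f"
proof -
 show r: "represented_by (dist_of f) f" by (rule represented_by_dist_of[OF schwartz_lp_fun[OF f], of 1]) auto
 show "p >= 1 ==> dist_of f \<in> Lp p" by (rule LpI[OF r schwartz_lp_fun[OF f]])
 show "Lp_norm p (dist_of f) = lp_norm lborel p f" by (rule Lp_norm_eq[OF r])
qed

lemma dist_deriv_dist_of:
 assumes f: "is_schwartz f" shows "dist_deriv i (dist_of f) = dist_of (partial_deriv i f)"
proof (rule tempdist_eqI)
 fix \<phi>
 have "pairing (dist_deriv i (dist_of f)) \<phi> = - (LBINT x. f x * partial_deriv i (schwartz_fun \<phi>) x)"
  using represented_by_schwartz[OF f] by (simp add: pairing_simps represented_by_def schwartz_deriv.rep_eq)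
 also have "... = (LBINT x. partial_deriv i f x * schwartz_fun \<phi> x)"
  by (rule schwartz_integral_by_parts[OF f, symmetric]) simp
 also have "... = pairing (dist_of (partial_deriv i f)) \<phi>"
  using represented_by_schwartz[OF is_schwartz_partial_deriv[OF f]] by (simp add: represented_by_def)
 finally show "pairing (dist_deriv i (dist_of f)) \<phi> = pairing (dist_of (partial_deriv i f)) \<phi>" .
qed

abbreviation P0 :: "'n::finite gpoly" where "P0 \<equiv> Const 1"
abbreviation P1 :: "'n::finite gpoly" where "P1 \<equiv> Dz P0"
abbreviation P2 :: "'n::finite gpoly" where "P2 \<equiv> Dz P1"

definition D :: "'n::finite gpoly => complex => 'n tempdist" where
 "D P z = dist_of (E P z)"

lemma D_Lp: "Re z > 0 ==> p >= 1 ==> D P z \<in> Lp p"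
 unfolding D_def by (intro dist_of_Lp is_schwartz_E)

lemma Lp_norm_D: "Re z > 0 ==> Lp_norm p (D P z) = lp_norm lborel p (E P z)"
 unfolding D_def by (intro Lp_norm_dist_of is_schwartz_E)

lemma dist_deriv_D:
 assumes "Re z > 0" shows "dist_deriv i (D P z) = D (Dx i P) z"
proof -
 have "z ~= 0" using assms by auto
 then show ?thesis unfolding D_def by (simp add: dist_deriv_dist_of[OF is_schwartz_E[OF assms]] partial_deriv_E)
qed

lemma foldr_dist_deriv_D: "Re z > 0 ==> foldr dist_deriv is (D P z) = D (foldr Dx is P) z"
 by (induction "is") (auto simp: dist_deriv_D)

lemma sum_D:
 assumes "Re z > 0" "finite I" "!!x. (\<Sum>i\<in>I. E (P i) z x) = E Q z x"
 shows "(\<Sum>i\<in>I. D (P i) z) = D Q z"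
proof -
 have r: "represented_by (\<Sum>i\<in>I. D (P i) z) (%x. \<Sum>i\<in>I. E (P i) z x)"
  using assms(2)
 proof (induction I rule: finite_induct)
  case empty show ?case using represented_by_zero by simp
 next
  case (insert i I)
  then show ?case
   using represented_by_add[OF represented_by_schwartz[OF is_schwartz_E[OF assms(1)], of "P i"] insert.IH] by (simp add: D_def)
 qed
 have "(%x. \<Sum>i\<in>I. E (P i) z x) = E Q z" using assms(3) by auto
 then show ?thesis using r represented_by_schwartz[OF is_schwartz_E[OF assms(1)], of Q] unfolding D_def
  by (auto intro: represented_by_inject)
qed

lemma laplacian_D:
 assumes "Re z > 0" shows "dist_laplacian (D P0 z) = D P1 z" "dist_laplacian (D P1 z) = D P2 z"
 unfolding dist_laplacian_def dist_deriv_D[OF assms]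
 by (rule sum_D[OF assms _ E_heat(1)[OF assms]], simp, rule sum_D[OF assms _ E_heat(2)[OF assms]], simp)

lemma dist_laplacian_linear:
 "dist_laplacian (u + v) = dist_laplacian u + dist_laplacian v" "dist_laplacian (u - v) = dist_laplacian u - dist_laplacian v"
 "dist_laplacian (c *\<^sub>C u) = c *\<^sub>C dist_laplacian u" "dist_laplacian 0 = 0"
proof -
 have "(\<Sum>i\<in>A. c *\<^sub>C f i) = c *\<^sub>C (\<Sum>i\<in>A. f i)" for f :: "'a => 'a tempdist" and A
  by (induction A rule: infinite_finite_induct) (auto simp: scaleC_add_right)
 then show "dist_laplacian (c *\<^sub>C u) = c *\<^sub>C dist_laplacian u" by (simp add: dist_laplacian_def dist_deriv_linear)
qed (simp_all add: dist_laplacian_def dist_deriv_linear sum.distrib sum_subtractf)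

lemma dist_div_linear:
 fixes q r :: "'n::finite tempdist^'n"
 shows "dist_div (q + r) = dist_div q + dist_div r" "dist_div 0 = (0 :: 'n tempdist)" "dist_div (c *\<^sub>C q) = c *\<^sub>C dist_div q"
proof -
 have "(\<Sum>i\<in>A. c *\<^sub>C f i) = c *\<^sub>C (\<Sum>i\<in>A. f i)" for f :: "'n => 'n tempdist" and A
  by (induction A rule: infinite_finite_induct) (auto simp: scaleC_add_right)
 then show "dist_div (c *\<^sub>C q) = c *\<^sub>C dist_div q" by (simp add: dist_div_def dist_deriv_linear scaleC_vec_nth)
qed (simp_all add: dist_div_def dist_deriv_linear sum.distrib)

definition lam :: complex where "lam = \<i> * of_real (sqrt 2)"

lemma lam_simps: "lam * lam = - 2" "Re lam = 0" "norm lam = sqrt 2" "Im lam = sqrt 2"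
proof -
 have "lam * lam = (\<i> * \<i>) * of_real (sqrt 2 * sqrt 2)" unfolding lam_def of_real_mult by (simp only: mult_ac)
 then show "lam * lam = - 2" by simp
qed (auto simp: lam_def norm_mult)

text \<open>
The component \<open>u = g z\<close> determines the others: \<open>v\<close> is the time
derivative of \<open>u\<close> along \<open>z = z\<^sub>0 + lam * t\<close>, and \<open>\<theta> =
\<Delta> u\<close>, since then \<open>\<theta>\<close> has the derivative \<open>\<Delta>
v\<close>. The remaining equation demands \<open>lam\<^sup>2 = - 2\<close>.
\<close>

definition wave :: "complex => 'n::finite state" where
 "wave z = (D P0 z, lam *\<^sub>C D P1 z, D P1 z, 0)"

definition wave_rhs :: "complex => 'n::finite state" where
 "wave_rhs z = (lam *\<^sub>C D P1 z, (- 2) *\<^sub>C D P2 z, lam *\<^sub>C D P2 z, 0)"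

definition residual :: "real => complex => 'n::finite state" where
 "residual \<tau> z = (0, 0, 0, complex_of_real (1 / \<tau>) *\<^sub>C dist_grad (D P1 z))"

text \<open>
The wave would be an exact solution if the gradient of the temperature did not produce a heat
flux.
\<close>

lemma wave_equation:
 assumes "Re z > 0" shows "plate_operator \<tau> (wave z) + residual \<tau> z = wave_rhs z"
proof -
 have "(- 2) *\<^sub>C D P2 z = - D P2 z - D P2 z"
  using scaleC_add_left[of "-1" "-1" "D P2 z"] by (simp add: scaleC_minus_one)
 from this[symmetric] show ?thesis
  by (simp add: plate_operator_def wave_def residual_def wave_rhs_def laplacian_D[OF assms] dist_laplacian_linear dist_div_linear)
qed

lemma wave_rhs_mem:
 assumes z: "Re z > 0" and p: "p >= 1"
 shows "wave z \<in> (plate_space p :: 'a::finite state set)" "wave_rhs z \<in> (plate_space p :: 'a state set)"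
  "residual \<tau> z \<in> (plate_space p :: 'a state set)" "wave z \<in> (plate_domain \<tau> p :: 'a state set)"
proof -
 interpret L: banach_carrier "Lp p :: 'a tempdist set" "Lp_norm p" using p by (rule banach_carrier_Lp)
 interpret V: banach_carrier "Lp_vec p :: ('a tempdist^'a) set" "Lp_vec_norm p" using p by (rule banach_carrier_Lp_vec)
 interpret S: banach_carrier "Sobolev 2 p :: 'a tempdist set" "Sobolev_norm 2 p" using p by (rule banach_carrier_Sobolev)
 interpret X: banach_carrier "plate_space p :: 'a state set" "plate_norm p" using p by (rule banach_carrier_plate)
 have sob: "D P z \<in> Sobolev 2 p" for P :: "'a gpoly" by (simp add: Sobolev_def foldr_dist_deriv_D[OF z] D_Lp[OF z p])
 show w: "wave z \<in> (plate_space p :: 'a state set)"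
  by (simp add: wave_def plate_space_def sob D_Lp[OF z p] L.scale_mem V.zero_mem)
 show r: "wave_rhs z \<in> (plate_space p :: 'a state set)"
  by (simp add: wave_rhs_def plate_space_def sob S.scale_mem D_Lp[OF z p] L.scale_mem V.zero_mem)
 have "dist_grad (D P1 z :: 'a tempdist) \<in> Lp_vec p" by (rule Lp_vecI(1)[OF _ p]) (simp add: dist_grad_def dist_deriv_D[OF z] D_Lp[OF z p])
 then show s: "residual \<tau> z \<in> (plate_space p :: 'a state set)"
  by (simp add: residual_def plate_space_def S.zero_mem L.zero_mem V.scale_mem)
 have "plate_operator \<tau> (wave z :: 'a state) = wave_rhs z - residual \<tau> z" using wave_equation[OF z, of \<tau>] by (simp add: eq_diff_eq)
 then show "wave z \<in> (plate_domain \<tau> p :: 'a state set)" unfolding plate_domain_def using w X.diff_mem[OF r s] by simp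
qed

subsection \<open>Smoothness in time\<close>

lemma lp_fun_weight: "p >= 1 ==> lp_fun lborel p (weight :: real^'n::finite => real)"
proof -
 assume p: "p >= 1"
 have "integrable lborel (%x :: real^'n. norm (weight x) powr p)"
 proof (rule Bochner_Integration.integrable_bound[OF integrable_weight])
  show "AE x in lborel. norm (norm (weight x) powr p) <= norm (weight (x :: real^'n))"
  proof (rule AE_I2)
   fix x :: "real^'n"
   have "weight x powr p <= weight x powr 1"
    using p weight_pos[of x] by (intro powr_mono') (auto simp: weight_def add_pos_nonneg)
   then show "norm (norm (weight x) powr p) <= norm (weight x)" using weight_pos[of x] by simp
  qed
 qed measurable
 then show ?thesis by (simp add: lp_fun_def)
qed

text \<open>
Second-order Taylor estimates along the path of the wave, weighted so as to be integrable in every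
\<open>L\<^sup>p\<close>.
\<close>

lemma E_taylor:
 fixes P :: "'n::finite gpoly"
 assumes z: "Re z0 > 0" and s: "s >= 0"
 shows "\<exists>C\<ge>0. \<forall>t h x. 0 <= t & 0 < h & t + h <= s \<longrightarrow>
   norm (E P (z0 + of_real (t + h) * lam) x - E P (z0 + of_real t * lam) x) <= C * h * weight x \<and>
   norm (E P (z0 + of_real (t + h) * lam) x - E P (z0 + of_real t * lam) x
    - (of_real h * lam) * E (Dz P) (z0 + of_real t * lam) x) <= C * h\<^sup>2 * weight x"
proof -
 define \<zeta> where "\<zeta> t = z0 + of_real t * lam" for t
 define b where "b = norm z0 + s * sqrt 2"
 have \<zeta>: "Re (\<zeta> t) = Re z0" for t by (simp add: \<zeta>_def lam_simps)
 have \<zeta>b: "norm (\<zeta> t) <= b" if "t \<in> {0..s}" for t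
 proof -
  have "norm (\<zeta> t) <= norm z0 + t * sqrt 2" using norm_triangle_ineq[of z0 "of_real t * lam"] that by (simp add: \<zeta>_def norm_mult lam_simps)
  also have "... <= b" using that by (simp add: b_def)
  finally show ?thesis .
 qed
 have "\<exists>S\<ge>0. \<forall>t\<in>{0..s}. \<forall>x. norm (E Q (\<zeta> t) x) <= S * weight x" for Q :: "'n gpoly"
 proof -
  obtain S where S: "S >= 0" "!!z x. Re z0 <= Re z & norm z <= b ==> (1 + norm x) ^ (2 * CARD('n)) * norm (E Q z x) <= S"
   using E_decay[OF z, of b "2 * CARD('n)" Q] by blast
  have "norm (E Q (\<zeta> t) x) <= S * weight x" if "t \<in> {0..s}" for t x
   using S(2)[of "\<zeta> t" x] \<zeta>[of t] \<zeta>b[OF that] by (simp add: weight_def field_simps add_pos_nonneg)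
  then show ?thesis using S(1) by blast
 qed
 note bnd = this
 obtain S1 where S1: "S1 >= 0" "!!t x. t \<in> {0..s} ==> norm (E (Dz P) (\<zeta> t) x) <= S1 * weight x" using bnd[of "Dz P"] by blast
 obtain S2 where S2: "S2 >= 0" "!!t x. t \<in> {0..s} ==> norm (E (Dz (Dz P)) (\<zeta> t) x) <= S2 * weight x" using bnd[of "Dz (Dz P)"] by blast
 have der: "((%t. E Q (\<zeta> t) x) has_vector_derivative lam * E (Dz Q) (\<zeta> t) x) (at t within S)" for Q :: "'n gpoly" and t x S
 proof -
  have "(\<zeta> has_vector_derivative lam) (at t)" unfolding \<zeta>_def
   by (auto intro!: derivative_eq_intros simp: has_vector_derivative_def scaleR_conv_of_real)
  moreover have "((%z. E Q z x) has_field_derivative E (Dz Q) (\<zeta> t) x) (at (\<zeta> t))"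
   by (rule E_has_field_derivative) (simp add: \<zeta> z)
  ultimately have "((%z. E Q z x) \<circ> \<zeta> has_vector_derivative lam * E (Dz Q) (\<zeta> t) x) (at t)"
   by (rule field_vector_diff_chain_at)
  then show ?thesis by (auto simp: o_def intro: has_vector_derivative_at_within)
 qed
 have lip: "norm (E Q (\<zeta> t') x - E Q (\<zeta> t) x) <= (sqrt 2 * B) * norm (t' - t)"
  if B: "!!r. r \<in> {0..s} ==> norm (E (Dz Q) (\<zeta> r) x) <= B" and t: "t \<in> {0..s}" "t' \<in> {0..s}" for Q :: "'n gpoly" and t t' x B
 proof (rule differentiable_bound[of "{0..s}"])
  show "((%t. E Q (\<zeta> t) x) has_derivative (%h. h *\<^sub>R (lam * E (Dz Q) (\<zeta> r) x))) (at r within {0..s})" for r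
   using der[of Q x r "{0..s}"] by (simp add: has_vector_derivative_def)
  show "onorm (%h. h *\<^sub>R (lam * E (Dz Q) (\<zeta> r) x)) <= sqrt 2 * B" if "r \<in> {0..s}" for r
  proof (rule onorm_le)
   fix h :: real
   have "\<bar>h\<bar> * (sqrt 2 * norm (E (Dz Q) (\<zeta> r) x)) <= \<bar>h\<bar> * (sqrt 2 * B)" using B[OF that] by (intro mult_left_mono) auto
   then show "norm (h *\<^sub>R (lam * E (Dz Q) (\<zeta> r) x)) <= sqrt 2 * B * norm h" by (simp add: norm_mult lam_simps mult_ac)
  qed
 qed (use t in auto)
 define C where "C = sqrt 2 * S1 + 2 * S2"
 have C: "C >= 0" "sqrt 2 * S1 <= C" "2 * S2 <= C" using S1(1) S2(1) by (auto simp: C_def)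
 have main: "norm (E P (\<zeta> (t + h)) x - E P (\<zeta> t) x) <= C * h * weight x \<and>
   norm (E P (\<zeta> (t + h)) x - E P (\<zeta> t) x - (of_real h * lam) * E (Dz P) (\<zeta> t) x) <= C * h\<^sup>2 * weight x"
  if t: "0 <= t" "0 < h" "t + h <= s" for t h x
 proof
  have wp: "0 <= weight x" using weight_pos[of x] by simp
  have "norm (E P (\<zeta> (t + h)) x - E P (\<zeta> t) x) <= (sqrt 2 * (S1 * weight x)) * norm (t + h - t)"
   using t by (intro lip S1) auto
  also have "... = (sqrt 2 * S1) * (h * weight x)" using t by simp
  also have "... <= C * (h * weight x)" using C(2) t wp by (intro mult_right_mono) auto
  finally show "norm (E P (\<zeta> (t + h)) x - E P (\<zeta> t) x) <= C * h * weight x" by (simp add: mult.assoc)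
  let ?S = "{t..t + h}"
  have "norm (E P (\<zeta> (t + h)) x - E P (\<zeta> t) x - ((t + h) - t) *\<^sub>R (lam * E (Dz P) (\<zeta> t) x)) <= norm ((t + h) - t) * (2 * S2 * weight x * h)"
  proof (rule vector_differentiable_bound_linearization[where f = "%t. E P (\<zeta> t) x" and f' = "%t. lam * E (Dz P) (\<zeta> t) x" and S = ?S])
   show "norm (lam * E (Dz P) (\<zeta> r) x - lam * E (Dz P) (\<zeta> t) x) <= 2 * S2 * weight x * h" if r: "r \<in> ?S" for r
   proof -
    have "norm (E (Dz P) (\<zeta> r) x - E (Dz P) (\<zeta> t) x) <= (sqrt 2 * (S2 * weight x)) * norm (r - t)"
     using t r by (intro lip S2) auto
    also have "... <= (sqrt 2 * (S2 * weight x)) * h" using r S2(1) wp by (intro mult_left_mono) auto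
    finally have "sqrt 2 * norm (E (Dz P) (\<zeta> r) x - E (Dz P) (\<zeta> t) x) <= sqrt 2 * ((sqrt 2 * (S2 * weight x)) * h)"
     by (intro mult_left_mono) auto
    then show ?thesis by (simp add: right_diff_distrib[symmetric] norm_mult lam_simps mult.assoc[symmetric])
   qed
  qed (use t der in \<open>auto simp: closed_segment_eq_real_ivl\<close>)
  then have "norm (E P (\<zeta> (t + h)) x - E P (\<zeta> t) x - (of_real h * lam) * E (Dz P) (\<zeta> t) x) <= (2 * S2) * (h\<^sup>2 * weight x)"
   using t by (simp add: scaleR_conv_of_real power2_eq_square mult_ac)
  also have "... <= C * (h\<^sup>2 * weight x)" using C(3) wp by (intro mult_right_mono) auto
  finally show "norm (E P (\<zeta> (t + h)) x - E P (\<zeta> t) x - (of_real h * lam) * E (Dz P) (\<zeta> t) x) <= C * h\<^sup>2 * weight x"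
   by (simp add: mult.assoc)
 qed
 show ?thesis
  by (intro exI[of _ C] conjI C(1) allI impI) (use main in \<open>auto simp: \<zeta>_def\<close>)
qed

lemma D_taylor:
 fixes P :: "'n::finite gpoly"
 assumes z: "Re z0 > 0" and s: "s >= 0" and p: "p >= 1"
 shows "\<exists>C\<ge>0. \<forall>t h. 0 <= t & 0 < h & t + h <= s \<longrightarrow>
   Lp_norm p (D P (z0 + of_real (t + h) * lam) - D P (z0 + of_real t * lam)) <= C * h \<and>
   Lp_norm p (D P (z0 + of_real (t + h) * lam) - D P (z0 + of_real t * lam)
    - (of_real h * lam) *\<^sub>C D (Dz P) (z0 + of_real t * lam)) <= C * h\<^sup>2"
proof -
 obtain C where C: "C >= 0" "!!t h x. 0 <= t & 0 < h & t + h <= s ==>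
   norm (E P (z0 + of_real (t + h) * lam) x - E P (z0 + of_real t * lam) x) <= C * h * weight x \<and>
   norm (E P (z0 + of_real (t + h) * lam) x - E P (z0 + of_real t * lam) x
    - (of_real h * lam) * E (Dz P) (z0 + of_real t * lam) x) <= C * h\<^sup>2 * weight x"
  using E_taylor[OF z s, of P] by blast
 define W where "W = lp_norm lborel p (weight :: real^'n => real)"
 have p0: "p > 0" using p by simp
 have rD: "represented_by (D Q (z0 + of_real t * lam)) (E Q (z0 + of_real t * lam))" for Q :: "'n gpoly" and t
  unfolding D_def by (rule represented_by_schwartz[OF is_schwartz_E]) (use z in \<open>simp add: lam_simps\<close>)
 have le: "Lp_norm p u <= c * W" if u: "represented_by u f" and f: "!!x. norm (f x) <= c * weight x" and c: "c >= 0" for u :: "'n tempdist" and f c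
 proof -
  have cw: "lp_fun lborel p (%x :: real^'n. c * weight x)"
   by (rule lp_fun_scale[OF lp_fun_weight[OF p] c]) (use c in \<open>auto simp: abs_mult\<close>)
  have "lp_norm lborel p f <= lp_norm lborel p (%x :: real^'n. c * weight x)"
  proof (rule lp_fun_bound(2)[OF cw _ p0 AE_I2])
   show "norm (f x) <= norm (c * weight x)" for x using f[of x] by simp
   show "f \<in> borel_measurable lborel" using u by (simp add: represented_by_def)
  qed
  also have "... = c * W" unfolding W_def by (rule lp_norm_scale[OF p0 c]) (use c in \<open>simp add: abs_mult\<close>)
  finally show ?thesis unfolding Lp_norm_eq[OF u] .
 qed
 show ?thesis
 proof (intro exI[of _ "C * W"] conjI allI impI)
  show "0 <= C * W" using C(1) by (simp add: W_def)
  fix t h assume t: "0 <= t & 0 < h & t + h <= s"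
  have "Lp_norm p (D P (z0 + of_real (t + h) * lam) - D P (z0 + of_real t * lam)) <= (C * h) * W"
   by (rule le[OF represented_by_diff[OF rD rD]]) (use C(1) C(2)[OF t] t in auto)
  then show "Lp_norm p (D P (z0 + of_real (t + h) * lam) - D P (z0 + of_real t * lam)) <= C * W * h" by (simp add: mult_ac)
  have "Lp_norm p (D P (z0 + of_real (t + h) * lam) - D P (z0 + of_real t * lam)
    - (of_real h * lam) *\<^sub>C D (Dz P) (z0 + of_real t * lam)) <= (C * h\<^sup>2) * W"
   by (rule le[OF represented_by_diff[OF represented_by_diff[OF rD rD] represented_by_scale[OF rD]]]) (use C(1) C(2)[OF t] t in auto)
  then show "Lp_norm p (D P (z0 + of_real (t + h) * lam) - D P (z0 + of_real t * lam)
    - (of_real h * lam) *\<^sub>C D (Dz P) (z0 + of_real t * lam)) <= C * W * h\<^sup>2" by (simp add: mult_ac)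
 qed
qed

lemma E_Dz_foldr: "Re z > 0 ==> E (Dz (foldr Dx is P)) z = E (foldr Dx is (Dz P)) z"
proof (induction "is")
 case (Cons i "is")
 have "z ~= 0" using Cons.prems by auto
 then have "E (Dz (Dx i (foldr Dx is P))) z = E (Dx i (Dz (foldr Dx is P))) z" by (intro ext E_Dz_Dx)
 also have "... = E (Dx i (foldr Dx is (Dz P))) z" using Cons by (intro E_Dx_cong) auto
 finally show ?case by simp
qed simp

lemma Sobolev_norm_le_sum:
 assumes "p >= 1"
 shows "Sobolev_norm k p u <= (\<Sum>is\<in>words_upto k. Lp_norm p (foldr dist_deriv is (u :: 'n::finite tempdist)))"
proof -
 define a where "a is = Lp_norm p (foldr dist_deriv is u)" for "is"
 define S where "S = (\<Sum>is\<in>(words_upto k :: 'n list set). a is)"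
 have a: "a is >= 0" for "is" by (simp add: a_def)
 have S: "S >= 0" unfolding S_def by (intro sum_nonneg a)
 have aS: "a is <= S" if "is \<in> words_upto k" for "is" unfolding S_def by (rule member_le_sum[OF that]) (auto simp: a finite_words_upto)
 have "(\<Sum>is\<in>(words_upto k :: 'n list set). a is powr p) <= (\<Sum>is\<in>(words_upto k :: 'n list set). a is * S powr (p - 1))"
 proof (rule sum_mono)
  fix "is" :: "'n list" assume i: "is \<in> words_upto k"
  show "a is powr p <= a is * S powr (p - 1)"
  proof (cases "a is = 0")
   case False
   then have "a is powr p = a is * a is powr (p - 1)" using a[of "is"] by (simp add: powr_mult_base)
   also have "... <= a is * S powr (p - 1)" using assms a aS[OF i] by (intro mult_left_mono powr_mono2) auto
   finally show ?thesis .
  qed (use assms in simp)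
 qed
 also have "... = S * S powr (p - 1)" by (simp add: S_def sum_distrib_right)
 also have "... = S powr p" using S assms by (cases "S = 0") (auto simp: powr_mult_base)
 finally have "(\<Sum>is\<in>(words_upto k :: 'n list set). a is powr p) powr (1 / p) <= (S powr p) powr (1 / p)"
  using assms by (intro powr_mono2) (auto intro!: sum_nonneg)
 then show ?thesis using assms S by (simp add: Sobolev_norm_def a_def[symmetric] powr_powr S_def[symmetric])
qed

lemma wave_taylor:
 assumes z: "Re z0 > 0" and s: "s >= 0" and p: "p >= 1"
 shows "\<exists>C\<ge>0. \<forall>t h. 0 <= t & 0 < h & t + h <= s \<longrightarrow>
   plate_norm p (wave (z0 + of_real (t + h) * lam) - wave (z0 + of_real t * lam) :: 'n::finite state) <= C * h \<and>
   plate_norm p (wave (z0 + of_real (t + h) * lam) - wave (z0 + of_real t * lam)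
    - complex_of_real h *\<^sub>C wave_rhs (z0 + of_real t * lam) :: 'n state) <= C * h\<^sup>2"
proof -
 define \<zeta> where "\<zeta> t = z0 + of_real t * lam" for t
 have \<zeta>: "Re (\<zeta> t) > 0" for t using z by (simp add: \<zeta>_def lam_simps)
 interpret L: banach_carrier "Lp p :: 'n tempdist set" "Lp_norm p" using p by (rule banach_carrier_Lp)
 interpret V: banach_carrier "Lp_vec p :: ('n tempdist^'n) set" "Lp_vec_norm p" using p by (rule banach_carrier_Lp_vec)
 have "\<forall>P :: 'n gpoly. \<exists>C. C >= 0 & (\<forall>t h. 0 <= t & 0 < h & t + h <= s \<longrightarrow>
   Lp_norm p (D P (\<zeta> (t + h)) - D P (\<zeta> t)) <= C * h \<and>
   Lp_norm p (D P (\<zeta> (t + h)) - D P (\<zeta> t) - (of_real h * lam) *\<^sub>C D (Dz P) (\<zeta> t)) <= C * h\<^sup>2)"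
  unfolding \<zeta>_def using D_taylor[OF z s p] by blast
 from choice[OF this] obtain C where C: "!!P :: 'n gpoly. C P >= 0"
  "!!(P :: 'n gpoly) t h. 0 <= t ==> 0 < h ==> t + h <= s ==> Lp_norm p (D P (\<zeta> (t + h)) - D P (\<zeta> t)) <= C P * h"
  "!!(P :: 'n gpoly) t h. 0 <= t ==> 0 < h ==> t + h <= s ==> Lp_norm p (D P (\<zeta> (t + h)) - D P (\<zeta> t) - (of_real h * lam) *\<^sub>C D (Dz P) (\<zeta> t)) <= C P * h\<^sup>2"
  by blast
 define K where "K = (\<Sum>is\<in>(words_upto 2 :: 'n list set). C (foldr Dx is P0)) + sqrt 2 * C P1 + C P1"
 have K: "K >= 0" unfolding K_def using C(1) by (intro add_nonneg_nonneg sum_nonneg mult_nonneg_nonneg) auto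
 have LD: "D P (\<zeta> t) \<in> Lp p" for P :: "'n gpoly" and t by (rule D_Lp[OF \<zeta> p])
 have "plate_norm p (wave (\<zeta> (t + h)) - wave (\<zeta> t) :: 'n state) <= K * h \<and>
   plate_norm p (wave (\<zeta> (t + h)) - wave (\<zeta> t) - complex_of_real h *\<^sub>C wave_rhs (\<zeta> t) :: 'n state) <= K * h\<^sup>2"
  if t: "0 <= t" "0 < h" "t + h <= s" for t h
 proof
  have f: "foldr dist_deriv is (D P0 (\<zeta> r)) = D (foldr Dx is P0) (\<zeta> r)" for "is" :: "'n list" and r by (rule foldr_dist_deriv_D[OF \<zeta>])
  have f1: "foldr dist_deriv is (D P1 (\<zeta> r)) = D (Dz (foldr Dx is P0)) (\<zeta> r)" for "is" :: "'n list" and r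
   unfolding foldr_dist_deriv_D[OF \<zeta>] unfolding D_def by (simp add: E_Dz_foldr[OF \<zeta>])
  have "Sobolev_norm 2 p (D P0 (\<zeta> (t + h)) - D P0 (\<zeta> t) :: 'n tempdist) <= (\<Sum>is\<in>(words_upto 2 :: 'n list set). C (foldr Dx is P0) * h)"
   by (rule order_trans[OF Sobolev_norm_le_sum[OF p]], rule sum_mono) (simp add: foldr_dist_deriv_linear f C(2)[OF t])
  moreover have "Lp_norm p (lam *\<^sub>C D P1 (\<zeta> (t + h)) - lam *\<^sub>C D P1 (\<zeta> t) :: 'n tempdist) <= sqrt 2 * (C P1 * h)"
   unfolding scaleC_diff_right[symmetric] L.nrm_scale[OF L.diff_mem[OF LD LD]] lam_simps by (intro mult_left_mono C(2) t) simp
  moreover have "Lp_norm p (D P1 (\<zeta> (t + h)) - D P1 (\<zeta> t) :: 'n tempdist) <= C P1 * h" by (rule C(2)[OF t])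
  ultimately show "plate_norm p (wave (\<zeta> (t + h)) - wave (\<zeta> t) :: 'n state) <= K * h"
   by (simp add: plate_norm_def wave_def K_def distrib_right sum_distrib_right)
  have "Sobolev_norm 2 p (D P0 (\<zeta> (t + h)) - D P0 (\<zeta> t) - (of_real h * lam) *\<^sub>C D P1 (\<zeta> t) :: 'n tempdist)
    <= (\<Sum>is\<in>(words_upto 2 :: 'n list set). C (foldr Dx is P0) * h\<^sup>2)"
   by (rule order_trans[OF Sobolev_norm_le_sum[OF p]], rule sum_mono) (simp add: foldr_dist_deriv_linear f f1 C(3)[OF t])
  moreover have "Lp_norm p (lam *\<^sub>C D P1 (\<zeta> (t + h)) - lam *\<^sub>C D P1 (\<zeta> t) - (of_real h * - 2) *\<^sub>C D P2 (\<zeta> t) :: 'n tempdist) <= sqrt 2 * (C P1 * h\<^sup>2)"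
  proof -
   have "lam *\<^sub>C D P1 (\<zeta> (t + h)) - lam *\<^sub>C D P1 (\<zeta> t) - (of_real h * - 2) *\<^sub>C D P2 (\<zeta> t)
     = lam *\<^sub>C (D P1 (\<zeta> (t + h)) - D P1 (\<zeta> t) - (of_real h * lam) *\<^sub>C D P2 (\<zeta> t) :: 'n tempdist)"
    by (simp add: scaleC_diff_right scaleC_scaleC lam_simps(1)[symmetric] mult_ac del: mult_minus_right)
   then show ?thesis
    using L.nrm_scale[OF L.diff_mem[OF L.diff_mem[OF LD LD] L.scale_mem[OF LD]], of lam] lam_simps(3) C(3)[OF t, of P1]
    by simp
  qed
  moreover have "Lp_norm p (D P1 (\<zeta> (t + h)) - D P1 (\<zeta> t) - (of_real h * lam) *\<^sub>C D P2 (\<zeta> t) :: 'n tempdist) <= C P1 * h\<^sup>2" by (rule C(3)[OF t])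
  ultimately show "plate_norm p (wave (\<zeta> (t + h)) - wave (\<zeta> t) - complex_of_real h *\<^sub>C wave_rhs (\<zeta> t) :: 'n state) <= K * h\<^sup>2"
   by (simp add: plate_norm_def wave_def wave_rhs_def scaleC_prod_def scaleC_scaleC K_def distrib_right sum_distrib_right)
 qed
 then show ?thesis unfolding \<zeta>_def using K by blast
qed

subsection \<open>Scaling\<close>

text \<open>
Parabolic scaling: \<open>m\<close> counts derivatives, those in \<open>z\<close> twice. For
\<open>m = 0\<close> the factor is that of the Gaussian itself.
\<close>

definition homogeneous :: "real => 'n::finite gpoly => bool" where
 "homogeneous m P \<longleftrightarrow> (\<forall>a>0. \<forall>z y. Re z > 0 \<longrightarrow>
   E P (of_real a * z) (sqrt a *\<^sub>R y) = of_real (a powr (- (m + real CARD('n)) / 2)) * E P z y)"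

lemma homogeneousD:
 fixes P :: "'n::finite gpoly"
 assumes "homogeneous m P" "a > 0" "Re z > 0"
 shows "E P (of_real a * z) (sqrt a *\<^sub>R y) = of_real (a powr (- (m + real CARD('n)) / 2)) * E P z y"
 using assms unfolding homogeneous_def by blast

lemma homogeneous_P0: "homogeneous 0 (P0 :: 'n::finite gpoly)"
 unfolding homogeneous_def
proof (intro allI impI)
 fix a :: real and z and y :: "real^'n" assume a: "0 < a" and z: "Re z > 0"
 then have "z ~= 0" by auto
 define s :: complex where "s = - of_nat CARD('n) / 2"
 have s: "s = of_real (- real CARD('n) / 2)" by (simp add: s_def)
 have "(of_real a * z) powr s = exp (s * of_real (ln a)) * z powr s"
  using a \<open>z ~= 0\<close> by (simp add: powr_def Ln_times_of_real Ln_of_real distrib_left exp_add)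
 also have "exp (s * of_real (ln a)) = of_real (a powr (- real CARD('n) / 2))"
  unfolding s of_real_mult[symmetric] exp_of_real using a by (simp add: powr_def)
 finally have p: "(of_real a * z) powr s = of_real (a powr (- real CARD('n) / 2)) * z powr s" .
 have "of_real ((norm (sqrt a *\<^sub>R y))\<^sup>2) / (4 * (of_real a * z)) = of_real ((norm y)\<^sup>2) / (4 * z)"
  using a \<open>z ~= 0\<close> by (simp add: power_mult_distrib)
 then show "E P0 (of_real a * z) (sqrt a *\<^sub>R y) = of_real (a powr (- (0 + real CARD('n)) / 2)) * E P0 z y"
  unfolding E_def gauss_def ev.simps s_def[symmetric] p by (simp add: mult.assoc)
qed

lemma homogeneous_Dx:
 assumes P: "homogeneous m (P :: 'n::finite gpoly)" shows "homogeneous (m + 1) (Dx i P)"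
 unfolding homogeneous_def
proof (intro allI impI)
 fix a :: real and z and y :: "real^'n" assume a: "0 < a" and z: "Re z > 0"
 define w where "w = of_real a * z"
 have nz: "z ~= 0" "w ~= 0" using a z by (auto simp: w_def)
 define c :: complex where "c = of_real (a powr (- (m + real CARD('n)) / 2))"
 have eq: "(%y. E P w (sqrt a *\<^sub>R y)) = (%y. c * E P z y)"
  using homogeneousD[OF P a z] by (auto simp: c_def w_def)
 have "((%y. E P w (sqrt a *\<^sub>R y)) has_derivative (%h. \<Sum>j\<in>UNIV. (sqrt a *\<^sub>R h) $ j *\<^sub>R E (Dx j P) w (sqrt a *\<^sub>R y))) (at y)"
  by (rule has_derivative_compose[of "%y. sqrt a *\<^sub>R y" _ _ _ "E P w", OF _ E_has_derivative[OF nz(2)]])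
    (auto intro!: derivative_eq_intros)
 moreover have "((%y. c * E P z y) has_derivative (%h. c * (\<Sum>j\<in>UNIV. h $ j *\<^sub>R E (Dx j P) z y))) (at y)"
  by (intro has_derivative_mult_right E_has_derivative nz)
 ultimately have "(%h. \<Sum>j\<in>UNIV. (sqrt a *\<^sub>R h) $ j *\<^sub>R E (Dx j P) w (sqrt a *\<^sub>R y)) = (%h. c * (\<Sum>j\<in>UNIV. h $ j *\<^sub>R E (Dx j P) z y))"
  unfolding eq by (rule has_derivative_unique)
 from fun_cong[OF this, of "axis i 1"]
 have "sqrt a *\<^sub>R E (Dx i P) w (sqrt a *\<^sub>R y) = c * E (Dx i P) z y"
  by (simp add: scaleR_scaleR[symmetric] scaleR_sum_right[symmetric] sum_axis_scaleR del: scaleR_scaleR)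
 then have "E (Dx i P) w (sqrt a *\<^sub>R y) = (1 / sqrt a) *\<^sub>R (c * E (Dx i P) z y)"
  using a by (metis divide_inverse mult_1 real_sqrt_gt_zero less_irrefl scaleR_left_imp_eq scaleR_one scaleR_scaleR right_inverse mult.commute)
 also have "... = of_real (a powr (- (m + real CARD('n)) / 2) / sqrt a) * E (Dx i P) z y"
  by (simp add: c_def scaleR_conv_of_real)
 also have "a powr (- (m + real CARD('n)) / 2) / sqrt a = a powr (- ((m + 1) + real CARD('n)) / 2)"
 proof -
  have "- (m + real CARD('n)) / 2 - 1 / 2 = - ((m + 1) + real CARD('n)) / 2" by (simp add: field_simps)
  then show ?thesis unfolding powr_half_sqrt[OF less_imp_le[OF a], symmetric] powr_diff[symmetric] by (simp only:)
 qed
 finally show "E (Dx i P) (of_real a * z) (sqrt a *\<^sub>R y) = of_real (a powr (- (m + 1 + real CARD('n)) / 2)) * E (Dx i P) z y"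
  by (simp add: w_def)
qed

lemma homogeneous_Dz:
 assumes P: "homogeneous m (P :: 'n::finite gpoly)" shows "homogeneous (m + 2) (Dz P)"
 unfolding homogeneous_def
proof (intro allI impI)
 fix a :: real and z and y :: "real^'n" assume a: "0 < a" and z: "Re z > 0"
 define c :: complex where "c = of_real (a powr (- (m + real CARD('n)) / 2))"
 have "((%z. E P (of_real a * z) (sqrt a *\<^sub>R y)) has_field_derivative E (Dz P) (of_real a * z) (sqrt a *\<^sub>R y) * of_real a) (at z)"
 proof (rule DERIV_chain2[where f = "%z. E P z (sqrt a *\<^sub>R y)" and g = "%z. of_real a * z"])
  show "((%z. E P z (sqrt a *\<^sub>R y)) has_field_derivative E (Dz P) (of_real a * z) (sqrt a *\<^sub>R y)) (at (of_real a * z))"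
   by (rule E_has_field_derivative) (use a z in simp)
 qed (auto intro!: derivative_eq_intros)
 moreover have ev: "\<forall>\<^sub>F w in nhds z. E P (of_real a * w) (sqrt a *\<^sub>R y) = c * E P w y"
  by (rule eventually_mono[OF eventually_nhds_in_open[of "{w. Re w > 0}"]])
    (use z homogeneousD[OF P a] in \<open>auto simp: open_halfspace_Re_gt c_def\<close>)
 ultimately have "((%z. c * E P z y) has_field_derivative E (Dz P) (of_real a * z) (sqrt a *\<^sub>R y) * of_real a) (at z)"
  using DERIV_cong_ev[OF refl ev refl] by blast
 moreover have "((%z. c * E P z y) has_field_derivative c * E (Dz P) z y) (at z)"
  by (intro DERIV_cmult E_has_field_derivative z)
 ultimately have "E (Dz P) (of_real a * z) (sqrt a *\<^sub>R y) * of_real a = c * E (Dz P) z y" by (rule DERIV_unique)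
 then have "E (Dz P) (of_real a * z) (sqrt a *\<^sub>R y) = of_real (a powr (- (m + real CARD('n)) / 2) / a) * E (Dz P) z y"
  using a by (simp add: c_def field_simps)
 also have "a powr (- (m + real CARD('n)) / 2) / a = a powr (- (m + real CARD('n)) / 2 - 1)" using a by (simp add: powr_diff)
 also have "- (m + real CARD('n)) / 2 - 1 = - ((m + 2) + real CARD('n)) / 2" by simp
 finally show "E (Dz P) (of_real a * z) (sqrt a *\<^sub>R y) = of_real (a powr (- (m + 2 + real CARD('n)) / 2)) * E (Dz P) z y" .
qed

lemma homogeneous_foldr: "homogeneous (real (length is)) (foldr Dx is P0)"
proof (induction "is")
 case (Cons i "is") then show ?case using homogeneous_Dx[OF Cons, of i] by (simp add: add.commute)
qed (use homogeneous_P0 in simp)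

lemma homogeneous_P1: "homogeneous 2 P1" "homogeneous 3 (Dx i P1)"
 using homogeneous_Dz[OF homogeneous_P0] homogeneous_Dx[OF homogeneous_Dz[OF homogeneous_P0]] by simp_all

lemma lp_norm_dilate:
 fixes f :: "real^'n::finite => 'b::{real_normed_vector}"
 assumes [measurable]: "f \<in> borel_measurable borel" and r: "r > 0"
 shows "lp_norm lborel p (%x. f (r *\<^sub>R x)) = r powr (- real CARD('n) / p) * lp_norm lborel p f"
proof -
 have "(LBINT x. norm (f (r *\<^sub>R x)) powr p) = (1 / r ^ CARD('n)) * (LBINT x. norm (f x) powr p)"
  using integral_dilate[of "%x. norm (f x) powr p" r] r by simp
 then have "lp_norm lborel p (%x. f (r *\<^sub>R x)) = (1 / r ^ CARD('n)) powr (1 / p) * lp_norm lborel p f"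
  unfolding lp_norm_def using r by (simp only:) (simp add: powr_divide)
 also have "1 / r ^ CARD('n) = r powr (- real CARD('n))" using r by (simp add: powr_minus_divide powr_realpow)
 finally show ?thesis using r by (simp add: powr_powr)
qed

text \<open>
The factor by which the top-order components of the wave, those with \<open>m = 2\<close>, scale
in \<open>L\<^sup>p\<close>.
\<close>

abbreviation scale_factor :: "'n::finite itself => real => real => real" where
 "scale_factor n p a \<equiv> a powr (- (2 + real CARD('n)) / 2 + real CARD('n) / (2 * p))"

lemma lp_norm_scaling:
 fixes f g :: "real^'n::finite => complex"
 assumes fg: "!!y. f (sqrt a *\<^sub>R y) = of_real (a powr (- (m + real CARD('n)) / 2)) * g y"
  and [measurable]: "g \<in> borel_measurable borel" and a: "a > 0" and p: "p >= 1"
 shows "lp_norm lborel p f = scale_factor TYPE('n) p a * a powr ((2 - m) / 2) * lp_norm lborel p g"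
proof -
 have "f x = of_real (a powr (- (m + real CARD('n)) / 2)) * g ((1 / sqrt a) *\<^sub>R x)" for x
  using fg[of "(1 / sqrt a) *\<^sub>R x"] a by simp
 then have "lp_norm lborel p f = a powr (- (m + real CARD('n)) / 2) * lp_norm lborel p (%x. g ((1 / sqrt a) *\<^sub>R x))"
  using p by (intro lp_norm_scale) (auto simp: norm_mult)
 also have "lp_norm lborel p (%x. g ((1 / sqrt a) *\<^sub>R x)) = (1 / sqrt a) powr (- real CARD('n) / p) * lp_norm lborel p g"
  by (rule lp_norm_dilate) (use a in auto)
 also have "(1 / sqrt a) powr (- real CARD('n) / p) = a powr (real CARD('n) / (2 * p))"
  using a p by (simp add: powr_half_sqrt[symmetric] powr_minus_divide[symmetric] powr_powr)
 finally have "lp_norm lborel p f = a powr (- (m + real CARD('n)) / 2) * a powr (real CARD('n) / (2 * p)) * lp_norm lborel p g" by simp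
 also have "a powr (- (m + real CARD('n)) / 2) * a powr (real CARD('n) / (2 * p)) = scale_factor TYPE('n) p a * a powr ((2 - m) / 2)"
  unfolding powr_add[symmetric] by (rule arg_cong[where f = "%x. a powr x"]) (simp add: field_simps)
 finally show ?thesis .
qed

text \<open>
Each derivative that is missing to the order 2 gains a factor \<open>sqrt a\<close>, and the third
derivative in the residual loses one.
\<close>

lemma lp_norm_E_scale:
 fixes P :: "'n::finite gpoly"
 assumes P: "homogeneous m P" and a: "a > 0" and z: "Re z > 0" and p: "p >= 1"
 shows "lp_norm lborel p (E P (of_real a * z)) = scale_factor TYPE('n) p a * a powr ((2 - m) / 2) * lp_norm lborel p (E P z)"
 by (rule lp_norm_scaling[OF homogeneousD[OF P a z] schwartz_measurable[OF is_schwartz_E[OF z]] a p])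

lemma lp_norm_E_bounded:
 fixes P :: "'n::finite gpoly"
 assumes p: "p >= 1"
 shows "\<exists>B\<ge>0. \<forall>z. Re z = 1 & norm z <= b --> lp_norm lborel p (E P z) <= B"
proof -
 obtain S where S: "S >= 0" "!!z x. 1 <= Re z & norm z <= b ==> (1 + norm x) ^ (2 * CARD('n)) * norm (E P z x) <= S"
  using E_decay[of 1 b "2 * CARD('n)" P] by auto
 have Sw: "lp_fun lborel p (%x :: real^'n. S * weight x)"
  by (rule lp_fun_scale[OF lp_fun_weight[OF p] S(1)]) (use S(1) in \<open>auto simp: abs_mult\<close>)
 have "lp_norm lborel p (E P z) <= lp_norm lborel p (%x :: real^'n. S * weight x)" if z: "Re z = 1" "norm z <= b" for z
 proof (rule lp_fun_bound(2)[OF Sw _ _ AE_I2])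
  show "norm (E P z x) <= norm (S * weight x)" for x
   using S(2)[of z x] z S(1) weight_pos[of x] by (simp add: abs_mult, simp add: weight_def field_simps add_pos_nonneg)
  show "E P z \<in> borel_measurable lborel" using schwartz_measurable[OF is_schwartz_E[of z P]] z by simp
 qed (use p in simp)
 then show ?thesis by (intro exI[of _ "lp_norm lborel p (%x :: real^'n. S * weight x)"]) auto
qed

subsection \<open>Orbits along beams\<close>

text \<open>
The contribution of the top-order components to the norm of the wave at \<open>\<kappa>\<close>.
The factor \<open>sqrt 2\<close> is the modulus of \<open>lam\<close>.
\<close>

definition initial_size :: "'n::finite itself => real => complex => real" where
 "initial_size n p \<kappa> = (\<Sum>is\<in>{is :: 'n list. length is = 2}. lp_norm lborel p (E (foldr Dx is P0 :: 'n gpoly) \<kappa>))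
   + (sqrt 2 + 1) * lp_norm lborel p (E (P1 :: 'n gpoly) \<kappa>)"

lemma finite_length_eq: "finite {is :: 'n::finite list. length is = k}"
 by (rule finite_subset[OF _ finite_words_upto[of k]]) auto

lemma wave_size:
 assumes \<kappa>: "Re \<kappa> = 1" and p: "p >= 1"
 shows "\<exists>C\<ge>0. \<forall>a. 0 < a & a <= 1 --> plate_norm p (wave (of_real a * \<kappa>) :: 'n::finite state)
   <= scale_factor TYPE('n) p a * (initial_size TYPE('n) p \<kappa> + C * sqrt a)"
proof -
 interpret L: banach_carrier "Lp p :: 'n tempdist set" "Lp_norm p" using p by (rule banach_carrier_Lp)
 interpret V: banach_carrier "Lp_vec p :: ('n tempdist^'n) set" "Lp_vec_norm p" using p by (rule banach_carrier_Lp_vec)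
 define N where "N P = lp_norm lborel p (E (P :: 'n gpoly) \<kappa>)" for P
 have N: "N P >= 0" for P by (simp add: N_def)
 define C where "C = (\<Sum>is\<in>(words_upto 1 :: 'n list set). N (foldr Dx is P0))"
 show ?thesis
 proof (intro exI[of _ C] conjI allI impI)
  show "C >= 0" unfolding C_def by (intro sum_nonneg N)
  fix a :: real assume a: "0 < a & a <= 1"
  define A where "A = scale_factor TYPE('n) p a"
  have A: "A >= 0" by (simp add: A_def)
  have Re: "Re (of_real a * \<kappa>) > 0" using a \<kappa> by simp
  have fold: "Lp_norm p (foldr dist_deriv is (D P0 (of_real a * \<kappa>))) = A * a powr ((2 - real (length is)) / 2) * N (foldr Dx is P0)" for "is" :: "'n list"
   unfolding foldr_dist_deriv_D[OF Re] Lp_norm_D[OF Re] A_def N_def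
   by (rule lp_norm_E_scale[OF homogeneous_foldr _ _ p]) (use a \<kappa> in auto)
  have P1n: "Lp_norm p (D P1 (of_real a * \<kappa>) :: 'n tempdist) = A * N P1"
   unfolding Lp_norm_D[OF Re] using lp_norm_E_scale[OF homogeneous_P1(1) _ _ p, of a \<kappa>] a \<kappa> by (simp add: A_def N_def)
  have split: "(words_upto 2 :: 'n list set) = words_upto 1 \<union> {is. length is = 2}" "words_upto 1 \<inter> {is :: 'n list. length is = 2} = {}" by auto
  have "Sobolev_norm 2 p (D P0 (of_real a * \<kappa>) :: 'n tempdist) <= (\<Sum>is\<in>(words_upto 2 :: 'n list set). A * a powr ((2 - real (length is)) / 2) * N (foldr Dx is P0))"
   using Sobolev_norm_le_sum[OF p, of 2 "D P0 (of_real a * \<kappa>) :: 'n tempdist"] by (simp only: fold)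
  also have "... = (\<Sum>is\<in>(words_upto 1 :: 'n list set). A * a powr ((2 - real (length is)) / 2) * N (foldr Dx is P0))
    + (\<Sum>is\<in>{is :: 'n list. length is = 2}. A * a powr ((2 - real (length is)) / 2) * N (foldr Dx is P0))"
   unfolding split(1) by (rule sum.union_disjoint[OF finite_words_upto finite_length_eq split(2)])
  also have "(\<Sum>is\<in>(words_upto 1 :: 'n list set). A * a powr ((2 - real (length is)) / 2) * N (foldr Dx is P0))
    <= (\<Sum>is\<in>(words_upto 1 :: 'n list set). A * sqrt a * N (foldr Dx is P0))"
  proof (intro sum_mono mult_right_mono mult_left_mono N A)
   fix "is" :: "'n list" assume "is \<in> words_upto 1"
   then have "a powr ((2 - real (length is)) / 2) <= a powr (1 / 2)" using a by (intro powr_mono') auto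
   then show "a powr ((2 - real (length is)) / 2) <= sqrt a" using a by (simp add: powr_half_sqrt)
  qed
  also have "(\<Sum>is\<in>{is :: 'n list. length is = 2}. A * a powr ((2 - real (length is)) / 2) * N (foldr Dx is P0))
    = A * (\<Sum>is\<in>{is :: 'n list. length is = 2}. N (foldr Dx is P0))"
   using a by (simp add: sum_distrib_left)
  finally have sob: "Sobolev_norm 2 p (D P0 (of_real a * \<kappa>) :: 'n tempdist) <= A * (C * sqrt a) + A * (\<Sum>is\<in>{is :: 'n list. length is = 2}. N (foldr Dx is P0))"
   by (simp add: C_def sum_distrib_left sum_distrib_right mult_ac)
  have v: "Lp_norm p (lam *\<^sub>C D P1 (of_real a * \<kappa>) :: 'n tempdist) = sqrt 2 * (A * N P1)"
   unfolding L.nrm_scale[OF D_Lp[OF Re p]] P1n lam_simps ..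
  have "plate_norm p (wave (of_real a * \<kappa>) :: 'n state) = Sobolev_norm 2 p (D P0 (of_real a * \<kappa>) :: 'n tempdist)
    + Lp_norm p (lam *\<^sub>C D P1 (of_real a * \<kappa>) :: 'n tempdist) + Lp_norm p (D P1 (of_real a * \<kappa>) :: 'n tempdist)"
   by (simp add: plate_norm_def wave_def)
  also have "... <= A * (C * sqrt a) + A * (\<Sum>is\<in>{is :: 'n list. length is = 2}. N (foldr Dx is P0)) + sqrt 2 * (A * N P1) + A * N P1"
   unfolding v P1n using sob by simp
  also have "... = A * (((\<Sum>is\<in>{is :: 'n list. length is = 2}. N (foldr Dx is P0)) + (sqrt 2 + 1) * N P1) + C * sqrt a)"
   by (simp add: algebra_simps)
  finally show "plate_norm p (wave (of_real a * \<kappa>) :: 'n state) <= scale_factor TYPE('n) p a * (initial_size TYPE('n) p \<kappa> + C * sqrt a)"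
   unfolding A_def initial_size_def N_def .
 qed
qed

text \<open>
From \<open>\<sigma>0\<close> to \<open>\<sigma>1\<close> the wave needs the time \<open>a *
(\<sigma>1 - \<sigma>0) / sqrt 2\<close>. The residual loses a factor \<open>sqrt a\<close>
against the wave, and the short time gains \<open>a\<close>.
\<close>

lemma wave_orbit:
 fixes T :: "real => 'n::finite state => 'n state"
 assumes \<tau>: "\<tau> > 0" and p: "p >= 1"
  and C0: "C0_semigroup_on (plate_space p) (plate_norm p) T"
  and gen: "is_generator_of (plate_space p) (plate_norm p) T (plate_domain \<tau> p) (plate_operator \<tau>)"
  and M: "M >= 0" "!!t x. 0 <= t ==> t <= d ==> x \<in> plate_space p ==> plate_norm p (T t x) <= M * plate_norm p x"
  and \<sigma>: "\<sigma>0 <= \<sigma>1"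
 shows "\<exists>C\<ge>0. \<forall>a. 0 < a & a <= 1 & a * (\<sigma>1 - \<sigma>0) / sqrt 2 <= d \<longrightarrow>
   plate_norm p (T (a * (\<sigma>1 - \<sigma>0) / sqrt 2) (wave (of_real a * Complex 1 \<sigma>0)) - wave (of_real a * Complex 1 \<sigma>1))
    <= scale_factor TYPE('n) p a * (C * sqrt a)"
proof -
 interpret X: banach_carrier "plate_space p :: 'n state set" "plate_norm p" using p by (rule banach_carrier_plate)
 interpret L: banach_carrier "Lp p :: 'n tempdist set" "Lp_norm p" using p by (rule banach_carrier_Lp)
 interpret V: banach_carrier "Lp_vec p :: ('n tempdist^'n) set" "Lp_vec_norm p" using p by (rule banach_carrier_Lp_vec)
 interpret S: banach_carrier "Sobolev 2 p :: 'n tempdist set" "Sobolev_norm 2 p" using p by (rule banach_carrier_Sobolev)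
 define b where "b = 1 + \<bar>\<sigma>0\<bar> + \<bar>\<sigma>1\<bar>"
 have "\<forall>i :: 'n. \<exists>B. B >= 0 & (\<forall>z. Re z = 1 & norm z <= b --> lp_norm lborel p (E (Dx i P1) z) <= B)"
  using lp_norm_E_bounded[OF p, of b] by blast
 from choice[OF this] obtain B where B: "!!i :: 'n. B i >= 0" "!!(i :: 'n) z. Re z = 1 ==> norm z <= b ==> lp_norm lborel p (E (Dx i P1) z) <= B i" by blast
 define K0 where "K0 = (1 / \<tau>) * (\<Sum>i\<in>UNIV. B i)"
 have K0: "K0 >= 0" unfolding K0_def using \<tau> B(1) by (intro mult_nonneg_nonneg sum_nonneg) auto
 define C where "C = M * K0 * ((\<sigma>1 - \<sigma>0) / sqrt 2)"
 have C: "C >= 0" using M(1) K0 \<sigma> by (simp add: C_def)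
 show ?thesis
 proof (intro exI[of _ C] conjI C allI impI)
  fix a :: real assume "0 < a & a <= 1 & a * (\<sigma>1 - \<sigma>0) / sqrt 2 <= d"
  then have a: "0 < a" "a <= 1" "a * (\<sigma>1 - \<sigma>0) / sqrt 2 <= d" by auto
  define s where "s = a * (\<sigma>1 - \<sigma>0) / sqrt 2"
  have s: "0 <= s" "s <= d" using a \<sigma> by (auto simp: s_def)
  define z0 where "z0 = of_real a * Complex 1 \<sigma>0"
  define \<zeta> where "\<zeta> t = z0 + of_real t * lam" for t
  have z0: "Re z0 > 0" using a by (simp add: z0_def)
  have \<zeta>: "Re (\<zeta> t) > 0" for t using z0 by (simp add: \<zeta>_def lam_simps)
  define A where "A = scale_factor TYPE('n) p a"
  have \<zeta>eq: "\<zeta> t = of_real a * Complex 1 (\<sigma>0 + t * sqrt 2 / a)" for t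
   using a by (simp add: \<zeta>_def z0_def complex_eq_iff lam_simps distrib_left)
  have resid: "plate_norm p (residual \<tau> (\<zeta> t) :: 'n state) <= A * a powr (- 1 / 2) * K0" if t: "0 <= t" "t <= s" for t
  proof -
   define \<kappa> where "\<kappa> = Complex 1 (\<sigma>0 + t * sqrt 2 / a)"
   have "t * sqrt 2 / a <= \<sigma>1 - \<sigma>0" using t a by (simp add: s_def pos_le_divide_eq pos_divide_le_eq mult_ac)
   moreover have "0 <= t * sqrt 2 / a" using t a by simp
   ultimately have "\<bar>\<sigma>0 + t * sqrt 2 / a\<bar> <= \<bar>\<sigma>0\<bar> + \<bar>\<sigma>1\<bar>" by linarith
   then have \<kappa>b: "norm \<kappa> <= b" using cmod_le[of \<kappa>] by (simp add: \<kappa>_def b_def)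
   have n: "Lp_norm p (dist_deriv i (D P1 (\<zeta> t))) <= A * a powr (- 1 / 2) * B i" for i :: 'n
   proof -
    have "Lp_norm p (dist_deriv i (D P1 (\<zeta> t))) = A * a powr ((2 - 3) / 2) * lp_norm lborel p (E (Dx i P1) \<kappa>)"
     unfolding dist_deriv_D[OF \<zeta>] Lp_norm_D[OF \<zeta>] unfolding \<zeta>eq \<kappa>_def[symmetric] A_def
     by (rule lp_norm_E_scale[OF homogeneous_P1(2) a(1) _ p]) (simp add: \<kappa>_def)
    also have "... <= A * a powr ((2 - 3) / 2) * B i" using B(2)[of \<kappa> i] \<kappa>b by (intro mult_left_mono) (auto simp: \<kappa>_def A_def)
    finally show ?thesis by simp
   qed
   have mem: "dist_grad (D P1 (\<zeta> t) :: 'n tempdist) \<in> Lp_vec p"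
    by (rule Lp_vecI(1)[OF _ p]) (simp add: dist_grad_def dist_deriv_D[OF \<zeta>] D_Lp[OF \<zeta> p])
   have "Lp_vec_norm p (dist_grad (D P1 (\<zeta> t) :: 'n tempdist)) <= (\<Sum>i\<in>UNIV. Lp_norm p (dist_grad (D P1 (\<zeta> t) :: 'n tempdist) $ i))"
    by (rule Lp_vecI(2)[OF _ p]) (simp add: dist_grad_def dist_deriv_D[OF \<zeta>] D_Lp[OF \<zeta> p])
   also have "... <= (\<Sum>i\<in>UNIV. A * a powr (- 1 / 2) * B i)" unfolding dist_grad_def vec_lambda_beta by (intro sum_mono n)
   finally have "(1 / \<tau>) * Lp_vec_norm p (dist_grad (D P1 (\<zeta> t) :: 'n tempdist)) <= (1 / \<tau>) * (\<Sum>i\<in>UNIV. A * a powr (- 1 / 2) * B i)"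
    using \<tau> by (intro mult_left_mono) auto
   also have "... = A * a powr (- 1 / 2) * K0" unfolding sum_distrib_left[symmetric] K0_def by simp
   finally show ?thesis using \<tau> by (simp add: plate_norm_def residual_def V.nrm_scale[OF mem] norm_divide)
  qed
  obtain CT where CT: "!!t h. 0 <= t & 0 < h & t + h <= s ==>
    plate_norm p (wave (\<zeta> (t + h)) - wave (\<zeta> t) :: 'n state) <= CT * h \<and>
    plate_norm p (wave (\<zeta> (t + h)) - wave (\<zeta> t) - complex_of_real h *\<^sub>C wave_rhs (\<zeta> t) :: 'n state) <= CT * h\<^sup>2"
   using wave_taylor[OF z0 s(1) p, where 'n = 'n] unfolding \<zeta>_def by blast
  have "plate_norm p (T s (wave (\<zeta> 0)) - wave (\<zeta> s)) <= M * (A * a powr (- 1 / 2) * K0) * s"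
  proof (rule X.approximate_orbit[OF C0 gen M s, where R = "%t. residual \<tau> (\<zeta> t)" and C = CT and L = CT])
   show "(wave (\<zeta> t) :: 'n state) \<in> plate_domain \<tau> p" "(residual \<tau> (\<zeta> t) :: 'n state) \<in> plate_space p" for t
    using wave_rhs_mem(3,4)[OF \<zeta> p] by auto
   show "plate_norm p (wave (\<zeta> (t + h)) - wave (\<zeta> t) - complex_of_real h *\<^sub>C (plate_operator \<tau> (wave (\<zeta> t)) + residual \<tau> (\<zeta> t)) :: 'n state) <= CT * h\<^sup>2"
    if "0 <= t" "0 < h" "t + h <= s" for t h
    unfolding wave_equation[OF \<zeta>] by (rule conjunct2[OF CT]) (use that in simp)
   show "plate_norm p (wave (\<zeta> (t + h)) - wave (\<zeta> t) :: 'n state) <= CT * h" if "0 <= t" "0 < h" "t + h <= s" for t h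
    by (rule conjunct1[OF CT]) (use that in simp)
  qed (use resid in auto)
  also have "M * (A * a powr (- 1 / 2) * K0) * s = A * (C * (a powr (- 1 / 2) * a powr 1))"
   using a by (simp add: s_def C_def)
  also have "a powr (- 1 / 2) * a powr 1 = sqrt a" using a unfolding powr_add[symmetric] by (simp add: powr_half_sqrt)
  finally show "plate_norm p (T (a * (\<sigma>1 - \<sigma>0) / sqrt 2) (wave (of_real a * Complex 1 \<sigma>0)) - wave (of_real a * Complex 1 \<sigma>1))
    <= scale_factor TYPE('n) p a * (C * sqrt a)"
   using \<zeta>eq[of 0] \<zeta>eq[of s] a by (simp add: s_def A_def)
 qed
qed

subsection \<open>The size of a beam\<close>

lemma continuous_AE_zero:
 fixes f :: "'a::euclidean_space => 'b::real_normed_vector"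
 assumes "continuous_on UNIV f" "AE x in lborel. f x = 0" shows "f x = 0"
proof -
 have "closed {x. f x = 0}" using assms(1) by (intro closed_Collect_eq) auto
 moreover have "AE x in lebesgue. x \<in> {x. f x = 0}" using AE_completion[OF assms(2)] by simp
 ultimately show ?thesis using mem_closed_if_AE_lebesgue by fast
qed

text \<open>
For \<open>Re \<kappa> = 1\<close> the modulus of the Gaussian is \<open>norm \<kappa> powr (- n /
2)\<close> times a fixed Gaussian of \<open>x / norm \<kappa>\<close>, whose dilation contributes
\<open>norm \<kappa> powr (n / p)\<close>. The polynomial factors are, up to constants, bounded in
terms of \<open>x / norm \<kappa>\<close>; below, the quadratic term of the Laplacian dominates
where this quotient is large.
\<close>

lemma beam_size:
 assumes p: "p >= 1"
 defines "\<alpha> \<equiv> - real CARD('n) / 2 + real CARD('n) / p"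
 shows "\<exists>C>0. \<exists>c>0. \<forall>\<kappa>. Re \<kappa> = 1 --> initial_size TYPE('n::finite) p \<kappa> <= C * norm \<kappa> powr \<alpha>
   & c * norm \<kappa> powr \<alpha> <= lp_norm lborel p (E (P1 :: 'n gpoly) \<kappa>)"
proof -
 define n where "n = real CARD('n)"
 have n1: "n >= 1" by (simp add: n_def)
 have p0: "p > 0" using p by simp
 define H where "H x = (1 + (norm x)\<^sup>2) * exp (- ((norm x)\<^sup>2 / 4))" for x :: "real^'n"
 define h where "h x = max 0 ((norm x)\<^sup>2 / 4 - n / 2) * exp (- ((norm x)\<^sup>2 / 4))" for x :: "real^'n"
 have [measurable]: "H \<in> borel_measurable borel" "h \<in> borel_measurable borel" unfolding H_def h_def by measurable
 have H0: "H x >= 0" "h x >= 0" for x by (simp_all add: H_def h_def)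
 have "E (Add P0 NormSq) 1 x = of_real (H x)" for x :: "real^'n"
  by (simp add: E_def gauss_def H_def exp_of_real[symmetric])
 moreover have "lp_fun lborel p (E (Add P0 NormSq) 1 :: real^'n => complex)"
  by (intro schwartz_lp_fun is_schwartz_E p) simp
 ultimately have Hl: "lp_fun lborel p H" by (simp add: lp_fun_def)
 have hH: "h x <= H x" for x 
 proof -
  have "max 0 ((norm x)\<^sup>2 / 4 - n / 2) <= 1 + (norm x)\<^sup>2"
   using n1 zero_le_power2[of "norm x"] by (intro max.boundedI) linarith+
  then show ?thesis unfolding h_def H_def by (intro mult_right_mono) auto
 qed
 have hl: "lp_fun lborel p h" by (rule lp_fun_bound(1)[OF Hl _ p0]) (use hH H0 in auto)
 have hpos: "lp_norm lborel p h > 0"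
 proof (rule ccontr)
  assume "\<not> lp_norm lborel p h > 0"
  then have "lp_norm lborel p h = 0" using lp_norm_nonneg[of lborel p h] by linarith
  then have ae: "AE x in lborel. h x = 0" using lp_norm_eq_0_iff[OF hl p0] by simp
  have "continuous_on UNIV h" unfolding h_def by (intro continuous_intros) auto
  from continuous_AE_zero[OF this ae] have "h ((2 * n + 2) *\<^sub>R axis i 1) = 0" for i by blast
  moreover have "(2 * n + 2)\<^sup>2 / 4 - n / 2 > 0" using n1 by (simp add: power2_eq_square algebra_simps add_pos_nonneg)
  ultimately show False using n1 by (simp add: h_def power_mult_distrib abs_mult)
 qed
 have gaussn: "norm (gauss \<kappa> x) = norm \<kappa> powr (- n / 2) * exp (- ((norm ((1 / norm \<kappa>) *\<^sub>R x))\<^sup>2 / 4))"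
  if "Re \<kappa> = 1" for \<kappa> and x :: "real^'n"
  using norm_gauss[of \<kappa> x] that by (simp add: n_def power_divide mult.commute)
 have dil: "lp_norm lborel p (%x. norm \<kappa> powr (- n / 2) * f ((1 / norm \<kappa>) *\<^sub>R x)) = norm \<kappa> powr \<alpha> * lp_norm lborel p f"
  if \<kappa>: "Re \<kappa> = 1" and f: "f \<in> borel_measurable borel" "!!x. f x >= 0" for \<kappa> and f :: "real^'n => real"
 proof -
  have k: "norm \<kappa> > 0" using \<kappa> by auto
  have "lp_norm lborel p (%x. norm \<kappa> powr (- n / 2) * f ((1 / norm \<kappa>) *\<^sub>R x))
    = norm \<kappa> powr (- n / 2) * lp_norm lborel p (%x. f ((1 / norm \<kappa>) *\<^sub>R x))"
   by (rule lp_norm_scale[OF p0]) (simp_all add: abs_mult)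
  also have "lp_norm lborel p (%x. f ((1 / norm \<kappa>) *\<^sub>R x)) = (1 / norm \<kappa>) powr (- n / p) * lp_norm lborel p f"
   unfolding n_def by (rule lp_norm_dilate[OF f(1)]) (use k in simp)
  also have "(1 / norm \<kappa>) powr (- n / p) = norm \<kappa> powr (n / p)" using k by (simp add: powr_divide powr_minus_divide)
  finally show ?thesis unfolding \<alpha>_def n_def[symmetric] powr_add by (simp only: mult.assoc minus_divide_left)
 qed
 have upper: "lp_norm lborel p (E Q \<kappa>) <= K * (norm \<kappa> powr \<alpha> * lp_norm lborel p H)"
  if \<kappa>: "Re \<kappa> = 1" and K: "K >= 0" and Q: "!!x. norm (ev Q \<kappa> x) <= K * (1 + (norm ((1 / norm \<kappa>) *\<^sub>R x))\<^sup>2)" for Q :: "'n gpoly" and \<kappa> K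
 proof -
  let ?F = "%x. K * (norm \<kappa> powr (- n / 2) * H ((1 / norm \<kappa>) *\<^sub>R x))"
  have k: "norm \<kappa> > 0" using \<kappa> by auto
  have Fl: "lp_fun lborel p ?F"
  proof (rule lp_fun_scale[of lborel p "%x. H ((1 / norm \<kappa>) *\<^sub>R x)" "K * norm \<kappa> powr (- n / 2)"])
   show "lp_fun lborel p (%x. H ((1 / norm \<kappa>) *\<^sub>R x))"
    using Hl integrable_dilate[of "%x. norm (H x) powr p" "1 / norm \<kappa>"] k by (simp add: lp_fun_def)
  qed (use K in \<open>auto simp: abs_mult\<close>)
  have "lp_norm lborel p (E Q \<kappa>) <= lp_norm lborel p ?F"
  proof (rule lp_fun_bound(2)[OF Fl _ p0 AE_I2])
   show "E Q \<kappa> \<in> borel_measurable lborel" using schwartz_measurable[OF is_schwartz_E[of \<kappa> Q]] \<kappa> by simp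
   fix x
   have "norm (E Q \<kappa> x) <= (K * (1 + (norm ((1 / norm \<kappa>) *\<^sub>R x))\<^sup>2)) * (norm \<kappa> powr (- n / 2) * exp (- ((norm ((1 / norm \<kappa>) *\<^sub>R x))\<^sup>2 / 4)))"
    unfolding E_def norm_mult gaussn[OF \<kappa>] by (intro mult_right_mono Q) auto
   also have "... = ?F x" by (simp add: H_def)
   finally show "norm (E Q \<kappa> x) <= norm (?F x)" by simp
  qed
  also have "... = K * lp_norm lborel p (%x. norm \<kappa> powr (- n / 2) * H ((1 / norm \<kappa>) *\<^sub>R x))"
   by (rule lp_norm_scale[OF p0 K]) (use K in \<open>simp add: abs_mult\<close>)
  also have "... = K * (norm \<kappa> powr \<alpha> * lp_norm lborel p H)" by (subst dil[OF \<kappa> _ H0(1)]) auto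
  finally show ?thesis .
 qed
 have kx: "(norm ((1 / norm \<kappa>) *\<^sub>R x))\<^sup>2 = norm (of_real ((norm x)\<^sup>2) / \<kappa>\<^sup>2)" for \<kappa> :: complex and x :: "real^'n"
  by (simp add: norm_divide norm_power power_divide)
 have inv1: "norm (1 / \<kappa>) <= 1" if "Re \<kappa> = 1" for \<kappa>
 proof -
  have "1 <= norm \<kappa>" using complex_Re_le_cmod[of \<kappa>] that by simp
  then have "1 / norm \<kappa> <= 1 / 1" by (intro divide_left_mono) auto
  then show ?thesis by (simp add: norm_divide)
 qed
 have second: "lp_norm lborel p (E (foldr Dx is P0) \<kappa>) <= norm \<kappa> powr \<alpha> * lp_norm lborel p H"
  if \<kappa>: "Re \<kappa> = 1" and len: "length is = 2" for "is" :: "'n list" and \<kappa>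
 proof -
  obtain i j where ij: "is = [i, j]" using len by (auto simp: numeral_2_eq_2 length_Suc_conv)
  have "norm (ev (foldr Dx is P0) \<kappa> x) <= 1 * (1 + (norm ((1 / norm \<kappa>) *\<^sub>R x))\<^sup>2)" for x
  proof -
   define d :: complex where "d = (if i = j then 1 else 0)"
   have "ev (foldr Dx is P0) \<kappa> x = (- 1/2) * d * (1 / \<kappa>) + of_real (x $ i * x $ j) / (4 * \<kappa>\<^sup>2)"
    by (simp add: ij Dx_def d_def power2_eq_square)
   then have "norm (ev (foldr Dx is P0) \<kappa> x) <= norm ((- 1/2) * d * (1 / \<kappa>)) + norm (of_real (x $ i * x $ j) / (4 * \<kappa>\<^sup>2))"
    by (simp only: norm_triangle_ineq)
   also have "norm ((- 1/2) * d * (1 / \<kappa>)) <= 1" unfolding norm_mult using inv1[OF \<kappa>] by (simp add: d_def)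
   also have "norm (of_real (x $ i * x $ j) / (4 * \<kappa>\<^sup>2)) <= norm (of_real ((norm x)\<^sup>2) / \<kappa>\<^sup>2)"
   proof -
    have "\<bar>x $ i * x $ j\<bar> <= (norm x)\<^sup>2"
     unfolding abs_mult power2_eq_square by (intro mult_mono component_le_norm_cart) auto
    then have "\<bar>x $ i * x $ j\<bar> / 4 / (norm \<kappa>)\<^sup>2 <= (norm x)\<^sup>2 / (norm \<kappa>)\<^sup>2" by (intro divide_right_mono) auto
    then show ?thesis unfolding norm_divide norm_mult norm_power norm_of_real by simp
   qed
   finally show ?thesis unfolding kx by simp
  qed
  from upper[OF \<kappa> _ this] show ?thesis by simp
 qed
 have P1ev: "ev P1 \<kappa> x = of_real ((norm x)\<^sup>2) / \<kappa>\<^sup>2 / 4 - of_real (n / 2) * (1 / \<kappa>)" for \<kappa> and x :: "real^'n"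
  by (simp add: Dz_def n_def power2_eq_square)
 have nk: "norm (of_real (n / 2) * (1 / \<kappa>)) <= n / 2" if "Re \<kappa> = 1" for \<kappa>
  unfolding norm_mult norm_of_real using mult_left_mono[OF inv1[OF that], of "\<bar>n / 2\<bar>"] n1 by simp
 have P1up: "lp_norm lborel p (E (P1 :: 'n gpoly) \<kappa>) <= n * (norm \<kappa> powr \<alpha> * lp_norm lborel p H)" if \<kappa>: "Re \<kappa> = 1" for \<kappa>
 proof (rule upper[OF \<kappa>])
  fix x :: "real^'n"
  let ?y = "norm (of_real ((norm x)\<^sup>2) / \<kappa>\<^sup>2)"
  have "norm (ev P1 \<kappa> x) <= norm (of_real ((norm x)\<^sup>2) / \<kappa>\<^sup>2 / 4) + norm (of_real (n / 2) * (1 / \<kappa>))"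
   unfolding P1ev by (rule norm_triangle_ineq4)
  also have "... <= ?y / 4 + n / 2" using nk[OF \<kappa>] by (simp add: norm_divide)
  also have "... <= n * (1 + ?y)"
  proof -
   have "1 * ?y <= n * ?y" using n1 by (intro mult_right_mono) auto
   moreover have "?y >= 0" by simp
   ultimately show ?thesis using n1 unfolding distrib_left by linarith
  qed
  finally show "norm (ev P1 \<kappa> x) <= n * (1 + (norm ((1 / norm \<kappa>) *\<^sub>R x))\<^sup>2)" unfolding kx .
 qed (use n1 in simp)
 have lower: "norm \<kappa> powr \<alpha> * lp_norm lborel p h <= lp_norm lborel p (E (P1 :: 'n gpoly) \<kappa>)" if \<kappa>: "Re \<kappa> = 1" for \<kappa>
 proof -
  have "norm \<kappa> powr \<alpha> * lp_norm lborel p h = lp_norm lborel p (%x. norm \<kappa> powr (- n / 2) * h ((1 / norm \<kappa>) *\<^sub>R x))"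
   by (rule dil[symmetric, OF \<kappa> _ H0(2)]) auto
  also have "... <= lp_norm lborel p (E (P1 :: 'n gpoly) \<kappa>)"
  proof (rule lp_fun_bound(2)[OF schwartz_lp_fun[OF is_schwartz_E p] _ p0 AE_I2])
   fix x :: "real^'n"
   let ?y = "norm (of_real ((norm x)\<^sup>2) / \<kappa>\<^sup>2)"
   have "?y / 4 - n / 2 <= norm (of_real ((norm x)\<^sup>2) / \<kappa>\<^sup>2 / 4) - norm (of_real (n / 2) * (1 / \<kappa>))"
    using nk[OF \<kappa>] by (simp add: norm_divide)
   also have "... <= norm (ev P1 \<kappa> x)" unfolding P1ev by (rule norm_triangle_ineq2)
   finally have "max 0 (?y / 4 - n / 2) <= norm (ev P1 \<kappa> x)" by simp
   then show "norm (norm \<kappa> powr (- n / 2) * h ((1 / norm \<kappa>) *\<^sub>R x)) <= norm (E P1 \<kappa> x)"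
   proof -
    have "norm (norm \<kappa> powr (- n / 2) * h ((1 / norm \<kappa>) *\<^sub>R x)) = norm \<kappa> powr (- n / 2) * h ((1 / norm \<kappa>) *\<^sub>R x)"
     using H0(2) by simp
    also have "... = max 0 (?y / 4 - n / 2) * (norm \<kappa> powr (- n / 2) * exp (- (?y / 4)))" unfolding h_def kx by (simp only: mult_ac)
    also have "... <= norm (ev P1 \<kappa> x) * (norm \<kappa> powr (- n / 2) * exp (- (?y / 4)))"
     by (rule mult_right_mono[OF \<open>max 0 _ <= _\<close>]) simp
    also have "... = norm (E P1 \<kappa> x)" unfolding E_def norm_mult gaussn[OF \<kappa>] kx ..
    finally show ?thesis .
   qed
  qed (use \<kappa> in auto)
  finally show ?thesis .
 qed
 define m where "m = real (card {is :: 'n list. length is = 2}) + (sqrt 2 + 1) * n"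
 define C where "C = m * lp_norm lborel p H"
 have "lp_norm lborel p h <= lp_norm lborel p H" by (rule lp_fun_bound(2)[OF Hl _ p0]) (use hH H0 in auto)
 then have HC: "lp_norm lborel p H > 0" using hpos by linarith
 have "m > 0" unfolding m_def using n1 by (intro add_nonneg_pos mult_pos_pos) (auto simp: add_pos_pos)
 then have C: "C > 0" using HC by (simp add: C_def)
 have "initial_size TYPE('n) p \<kappa> <= C * norm \<kappa> powr \<alpha>" if \<kappa>: "Re \<kappa> = 1" for \<kappa>
 proof -
  have "(\<Sum>is\<in>{is :: 'n list. length is = 2}. lp_norm lborel p (E (foldr Dx is P0 :: 'n gpoly) \<kappa>))
    <= real (card {is :: 'n list. length is = 2}) * (norm \<kappa> powr \<alpha> * lp_norm lborel p H)"
   by (rule sum_bounded_above) (use second[OF \<kappa>] in auto)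
  moreover have "(sqrt 2 + 1) * lp_norm lborel p (E (P1 :: 'n gpoly) \<kappa>) <= (sqrt 2 + 1) * (n * (norm \<kappa> powr \<alpha> * lp_norm lborel p H))"
   by (intro mult_left_mono P1up \<kappa>) auto
  ultimately show ?thesis unfolding initial_size_def C_def m_def by (simp add: algebra_simps)
 qed
 then show ?thesis using C hpos lower by (intro exI[of _ C] conjI exI[of _ "lp_norm lborel p h"] allI impI) (auto simp: mult.commute)
qed

section \<open>Failure of generation for exponents other than two\<close>

lemma le_if_le_add_sqrt:
 fixes x y C a0 :: real
 assumes "a0 > 0" "!!a. 0 < a ==> a <= a0 ==> x <= y + C * sqrt a" shows "x <= y"
proof (rule tendsto_lowerbound)
 show "((%a. y + C * sqrt a) \<longlongrightarrow> y) (at_right 0)"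
 proof -
  have "((%a. y + C * sqrt a) \<longlongrightarrow> y + C * sqrt 0) (at_right 0)" by (intro tendsto_intros)
  then show ?thesis by simp
 qed
 show "\<forall>\<^sub>F a in at_right 0. x <= y + C * sqrt a"
  unfolding eventually_at_right_field using assms by (intro exI[of _ a0]) auto
qed simp

lemma Lp_norm_le_plate_norm:
 "Lp_norm p (fst (snd (snd U))) <= plate_norm p U"
proof -
 have "0 <= Sobolev_norm 2 p (fst U)" by (simp add: Sobolev_norm_def)
 then show ?thesis by (simp add: plate_norm_def case_prod_unfold)
qed

text \<open>
The bound \<open>M\<close> of the semigroup near time 0 serves all \<open>\<sigma>0 \<le>
\<sigma>1\<close> at once, because the time from one to the other tends to 0 with
\<open>a\<close>.
\<close>

lemma beam_inequality:
 fixes T :: "real => 'n::finite state => 'n state"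
 assumes \<tau>: "\<tau> > 0" and p: "p >= 1"
  and C0: "C0_semigroup_on (plate_space p) (plate_norm p) T"
  and gen: "is_generator_of (plate_space p) (plate_norm p) T (plate_domain \<tau> p) (plate_operator \<tau>)"
 shows "\<exists>M\<ge>1. \<forall>\<sigma>0 \<sigma>1. \<sigma>0 <= \<sigma>1 \<longrightarrow>
   lp_norm lborel p (E (P1 :: 'n gpoly) (Complex 1 \<sigma>1)) <= M * initial_size TYPE('n) p (Complex 1 \<sigma>0)"
proof -
 interpret X: banach_carrier "plate_space p :: 'n state set" "plate_norm p" using p by (rule banach_carrier_plate)
 obtain M d where M: "M >= 1" "d > 0" "!!t x. 0 <= t ==> t <= d ==> x \<in> plate_space p ==> plate_norm p (T t x) <= M * plate_norm p x"
  using X.C0_local_bound[OF C0] by blast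
 have M0: "M >= 0" using M(1) by simp
 have "lp_norm lborel p (E (P1 :: 'n gpoly) (Complex 1 \<sigma>1)) <= M * initial_size TYPE('n) p (Complex 1 \<sigma>0)"
  if \<sigma>: "\<sigma>0 <= \<sigma>1" for \<sigma>0 \<sigma>1
 proof -
  obtain C where C: "C >= 0" "!!a. 0 < a & a <= 1 & a * (\<sigma>1 - \<sigma>0) / sqrt 2 <= d ==>
    plate_norm p (T (a * (\<sigma>1 - \<sigma>0) / sqrt 2) (wave (of_real a * Complex 1 \<sigma>0)) - wave (of_real a * Complex 1 \<sigma>1))
    <= scale_factor TYPE('n) p a * (C * sqrt a)"
   using wave_orbit[OF \<tau> p C0 gen M0 M(3) \<sigma>] by blast
  obtain C' where C': "C' >= 0" "!!a. 0 < a & a <= 1 ==> plate_norm p (wave (of_real a * Complex 1 \<sigma>0) :: 'n state)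
    <= scale_factor TYPE('n) p a * (initial_size TYPE('n) p (Complex 1 \<sigma>0) + C' * sqrt a)"
   using wave_size[OF _ p, of "Complex 1 \<sigma>0", where 'n = 'n] by auto
  define a0 where "a0 = min 1 (d / (\<sigma>1 - \<sigma>0 + 1))"
  have a0: "a0 > 0" using M(2) \<sigma> by (simp add: a0_def)
  show ?thesis
  proof (rule le_if_le_add_sqrt[OF a0, where C = "M * C' + C"])
   fix a assume a: "0 < a" "a <= a0"
   have a1: "a <= 1" using a by (simp add: a0_def)
   define s where "s = a * (\<sigma>1 - \<sigma>0) / sqrt 2"
   have "a * (\<sigma>1 - \<sigma>0 + 1) <= d" using a \<sigma> by (simp add: a0_def pos_le_divide_eq)
   then have "a * (\<sigma>1 - \<sigma>0) <= d" using a by (simp add: distrib_left)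
   moreover have "s <= a * (\<sigma>1 - \<sigma>0) / 1" unfolding s_def using a \<sigma> by (intro divide_left_mono) auto
   ultimately have s: "0 <= s" "s <= d" using a \<sigma> by (auto simp: s_def)
   define A where "A = scale_factor TYPE('n) p a"
   have A: "A > 0" using a by (simp add: A_def)
   have Re: "Re (of_real a * Complex 1 \<sigma>1) > 0" "Re (of_real a * Complex 1 \<sigma>0) > 0" using a by auto
   let ?x = "wave (of_real a * Complex 1 \<sigma>0) :: 'n state" and ?y = "wave (of_real a * Complex 1 \<sigma>1) :: 'n state"
   have mem: "?x \<in> plate_space p" "?y \<in> plate_space p" by (rule wave_rhs_mem(1)[OF Re(2) p], rule wave_rhs_mem(1)[OF Re(1) p])
   have Tx: "T s ?x \<in> plate_space p" by (rule X.bounded_operatorD(1)[OF X.C0_semigroupD(1)[OF C0 s(1)] mem(1)])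
   have "A * lp_norm lborel p (E (P1 :: 'n gpoly) (Complex 1 \<sigma>1)) = Lp_norm p (D P1 (of_real a * Complex 1 \<sigma>1) :: 'n tempdist)"
    unfolding Lp_norm_D[OF Re(1)] using lp_norm_E_scale[where P = "P1 :: 'n gpoly", OF homogeneous_P1(1) a(1) _ p, of "Complex 1 \<sigma>1"] a by (simp add: A_def)
   also have "... <= plate_norm p ?y" using Lp_norm_le_plate_norm[of p ?y] by (simp add: wave_def)
   also have "... <= plate_norm p (T s ?x) + plate_norm p (?y - T s ?x)" by (rule X.nrm_le_add_diff[OF mem(2) Tx])
   also have "... <= M * plate_norm p ?x + A * (C * sqrt a)"
    using M(3)[OF s mem(1)] C(2)[of a] X.nrm_minus_commute[OF mem(2) Tx] a(1) a1 s(2) by (simp add: s_def A_def)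
   also have "... <= M * (A * (initial_size TYPE('n) p (Complex 1 \<sigma>0) + C' * sqrt a)) + A * (C * sqrt a)"
    using C'(2)[of a] a(1) a1 M0 by (intro add_right_mono mult_left_mono) (auto simp: A_def)
   also have "... = A * (M * initial_size TYPE('n) p (Complex 1 \<sigma>0) + (M * C' + C) * sqrt a)" by (simp add: algebra_simps)
   finally show "lp_norm lborel p (E (P1 :: 'n gpoly) (Complex 1 \<sigma>1)) <= M * initial_size TYPE('n) p (Complex 1 \<sigma>0) + (M * C' + C) * sqrt a"
    using A by simp
  qed
 qed
 then show ?thesis using M(1) by blast
qed

text \<open>
The exponent \<open>\<alpha>\<close> is positive for \<open>p < 2\<close> and negative for
\<open>p > 2\<close>. In the first case the beam spreads from \<open>\<sigma> = 0\<close>, in the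
second it focuses from \<open>- \<sigma>\<close> to 0.
\<close>

theorem no_C0_semigroup:
 assumes \<tau>: "\<tau> > 0" and p: "p >= 1" "p ~= 2"
 shows "\<not> generates_C0_semigroup (plate_space p :: 'n::finite state set) (plate_norm p) (plate_domain \<tau> p) (plate_operator \<tau>)"
proof
 assume "generates_C0_semigroup (plate_space p :: 'n state set) (plate_norm p) (plate_domain \<tau> p) (plate_operator \<tau>)"
 then obtain T where T: "C0_semigroup_on (plate_space p :: 'n state set) (plate_norm p) T"
  "is_generator_of (plate_space p :: 'n state set) (plate_norm p) T (plate_domain \<tau> p) (plate_operator \<tau>)"
  unfolding generates_C0_semigroup_def by blast
 define \<alpha> where "\<alpha> = - real CARD('n) / 2 + real CARD('n) / p"
 obtain M where M: "M >= 1" "!!\<sigma>0 \<sigma>1. \<sigma>0 <= \<sigma>1 ==>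
   lp_norm lborel p (E (P1 :: 'n gpoly) (Complex 1 \<sigma>1)) <= M * initial_size TYPE('n) p (Complex 1 \<sigma>0)"
  using beam_inequality[OF \<tau> p(1) T] by blast
 obtain C c where C: "C > 0" "c > 0" "!!\<kappa>. Re \<kappa> = 1 ==> initial_size TYPE('n) p \<kappa> <= C * norm \<kappa> powr \<alpha>
   & c * norm \<kappa> powr \<alpha> <= lp_norm lborel p (E (P1 :: 'n gpoly) \<kappa>)"
  using beam_size[OF p(1), where 'n = 'n] unfolding \<alpha>_def by blast
 define R where "R = M * C / c"
 have R: "R > 0" using M(1) C by (simp add: R_def)
 have key: "norm (Complex 1 \<sigma>1) powr \<alpha> <= R * norm (Complex 1 \<sigma>0) powr \<alpha>" if "\<sigma>0 <= \<sigma>1" for \<sigma>0 \<sigma>1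
 proof -
  have "c * norm (Complex 1 \<sigma>1) powr \<alpha> <= lp_norm lborel p (E (P1 :: 'n gpoly) (Complex 1 \<sigma>1))"
   using C(3)[of "Complex 1 \<sigma>1"] by simp
  also have "... <= M * initial_size TYPE('n) p (Complex 1 \<sigma>0)" by (rule M(2)[OF that])
  also have "... <= M * (C * norm (Complex 1 \<sigma>0) powr \<alpha>)" using C(3)[of "Complex 1 \<sigma>0"] M(1) by (intro mult_left_mono) auto
  finally show ?thesis using C(2) by (simp add: R_def pos_le_divide_eq mult_ac)
 qed
 have one: "norm (Complex 1 0) = 1" by (simp add: cmod_def)
 have ge: "\<bar>\<sigma>\<bar> <= norm (Complex 1 \<sigma>)" for \<sigma> using abs_Im_le_cmod[of "Complex 1 \<sigma>"] by simp
 have "\<alpha> ~= 0" using p by (auto simp: \<alpha>_def field_simps)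
 then consider "\<alpha> > 0" | "\<alpha> < 0" by linarith
 then show False
 proof cases
  case 1
  define \<sigma> where "\<sigma> = (R + 1) powr (1 / \<alpha>)"
  have \<sigma>: "\<sigma> > 0" "\<sigma> powr \<alpha> = R + 1" using R 1 by (auto simp: \<sigma>_def powr_powr)
  have "R + 1 <= norm (Complex 1 \<sigma>) powr \<alpha>" unfolding \<sigma>(2)[symmetric] using 1 \<sigma>(1) ge[of \<sigma>] by (intro powr_mono2) auto
  then show False using key[of 0 \<sigma>] \<sigma>(1) one by simp
 next
  case 2
  define \<sigma> where "\<sigma> = (R + 1) powr (1 / - \<alpha>)"
  have "\<sigma> powr \<alpha> = (R + 1) powr (- 1)" using 2 by (simp add: \<sigma>_def powr_powr)
  then have \<sigma>: "\<sigma> > 0" "\<sigma> powr \<alpha> = 1 / (R + 1)" using R by (auto simp: \<sigma>_def powr_minus_divide)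
  have "norm (Complex 1 (- \<sigma>)) powr \<alpha> <= 1 / (R + 1)" unfolding \<sigma>(2)[symmetric] using 2 \<sigma>(1) ge[of "- \<sigma>"] by (intro powr_mono2') auto
  then have "R * norm (Complex 1 (- \<sigma>)) powr \<alpha> <= R * (1 / (R + 1))" using R by (intro mult_left_mono) auto
  also have "... < 1" using R by simp
  finally show False using key[of "- \<sigma>" 0] \<sigma>(1) one by simp
 qed
qed

section \<open>Failure of analyticity\<close>

lemma cauchy_schwarz_L2:
 fixes f g :: "'a => complex"
 assumes f: "lp_fun M 2 f" and g: "lp_fun M 2 g"
 shows "integrable M (%x. f x * g x)" "norm (\<integral>x. f x * g x \<partial>M) <= lp_norm M 2 f * lp_norm M 2 g"
proof -
 have [measurable]: "f \<in> borel_measurable M" "g \<in> borel_measurable M" using f g by (auto simp: lp_fun_def)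
 define N where "N = (\<integral>\<^sup>+x. ennreal (norm (f x)) * ennreal (norm (g x)) \<partial>M)"
 define B where "B = lp_norm M 2 f * lp_norm M 2 g"
 have B: "B >= 0" by (simp add: B_def)
 have "N\<^sup>2 <= ennreal (lp_norm M 2 f ^ 2) * ennreal (lp_norm M 2 g ^ 2)"
  using Cauchy_Schwarz_nn_integral[of "%x. ennreal (norm (f x))" M "%x. ennreal (norm (g x))"]
  unfolding N_def by (simp add: ennreal_power nn_integral_norm_sq[OF f] nn_integral_norm_sq[OF g])
 also have "... = ennreal (B\<^sup>2)" by (simp add: B_def ennreal_mult power_mult_distrib)
 finally have N: "N\<^sup>2 <= ennreal (B\<^sup>2)" .
 have NB: "N <= ennreal B"
 proof (cases N)
  case (real r)
  have "r\<^sup>2 <= B\<^sup>2" using N real by (simp add: ennreal_power)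
  then show ?thesis using real power2_le_imp_le[OF _ B] by (simp add: ennreal_leI)
 next
  case top
  then show ?thesis using N by (simp add: top_unique ennreal_top_eq_mult_iff power2_eq_square)
 qed
 have fg: "(\<integral>\<^sup>+x. ennreal (norm (f x * g x)) \<partial>M) = N" unfolding N_def by (simp add: norm_mult ennreal_mult)
 have "N < \<infinity>" using NB by (simp add: le_less_trans)
 then show i: "integrable M (%x. f x * g x)" by (intro integrableI_bounded) (auto simp: fg)
 from integral_norm_bound_ennreal[OF i] NB show "norm (\<integral>x. f x * g x \<partial>M) <= lp_norm M 2 f * lp_norm M 2 g"
  unfolding fg B_def[symmetric] using B by (meson ennreal_le_iff order_trans)
qed

lemma pairing_le_L2:
 assumes "u \<in> Lp 2" shows "norm (pairing u \<psi>) <= Lp_norm 2 u * lp_norm lborel 2 (schwartz_fun \<psi>)"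
proof -
 obtain f where f: "represented_by u f" "lp_fun lborel 2 f" using assms LpE by blast
 have \<psi>: "lp_fun lborel 2 (schwartz_fun \<psi>)" by (rule schwartz_lp_fun) (simp_all add: is_schwartz_schwartz_fun)
 show ?thesis using cauchy_schwarz_L2(2)[OF f(2) \<psi>] f(1) by (simp add: Lp_norm_eq[OF f(1)] represented_by_def)
qed

text \<open>
A disc around \<open>t\<close> with radius proportional to \<open>t\<close> lies in the sector,
uniformly in \<open>t\<close>; Cauchy's inequality will be applied on it.
\<close>

lemma small_disc_in_sector:
 assumes "\<delta> > 0"
 obtains c where "0 < c" "c <= 1 / 2" "!!t w. t > 0 ==> norm (of_real t - w) <= c * t ==> w \<in> sector \<delta> & norm w < 2 * t"
proof -
 have "isCont arctan 0" by (rule isCont_arctan)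
 then obtain \<eta> where \<eta>: "\<eta> > 0" "!!x. norm (x - 0) < \<eta> ==> norm (arctan x - arctan 0) < \<delta>"
  using LIM_D[of arctan "arctan 0" 0 \<delta>] assms unfolding isCont_def by (metis diff_self norm_zero)
 define c where "c = min (1 / 2) (\<eta> / 4)"
 show ?thesis
 proof
  show c: "0 < c" "c <= 1 / 2" using \<eta>(1) by (auto simp: c_def)
  fix t :: real and w :: complex assume t: "t > 0" and w: "norm (of_real t - w) <= c * t"
  have "\<bar>t - Re w\<bar> <= c * t" "\<bar>Im w\<bar> <= c * t"
   using w abs_Re_le_cmod[of "of_real t - w"] abs_Im_le_cmod[of "of_real t - w"] by auto
  moreover have "c * t <= (1 / 2) * t" using c t by (intro mult_right_mono) auto
  ultimately have Re: "Re w >= t / 2" and Im: "\<bar>Im w\<bar> <= c * t" by linarith+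
  have Re0: "Re w > 0" using Re t by linarith
  have "\<bar>Im w / Re w\<bar> <= c * t / (t / 2)" unfolding abs_divide using Re Im Re0 t c by (intro frac_le) auto
  also have "... < \<eta>" using t \<eta>(1) by (simp add: c_def min_def)
  finally have "\<bar>Im w / Re w\<bar> < \<eta>" .
  then have Arg: "\<bar>Arg w\<bar> < \<delta>" using \<eta>(2)[of "Im w / Re w"] by (simp add: arg_conv_arctan[OF Re0])
  have "norm w <= norm (of_real t :: complex) + norm (of_real t - w)" by norm
  moreover have "norm (of_real t :: complex) = t" using t by simp
  ultimately have "norm w < 2 * t" using w \<open>c * t <= (1 / 2) * t\<close> t by linarith
  then show "w \<in> sector \<delta> & norm w < 2 * t" using Arg Re0 by (auto simp: sector_def)
 qed
qed

lemma sector_mono: "\<delta> <= \<delta>' ==> sector \<delta> \<subseteq> sector \<delta>'"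
 by (auto simp: sector_def)

lemma of_real_sector: "t > 0 ==> \<delta> > 0 ==> of_real t \<in> sector \<delta>"
 by (simp add: sector_def)

lemma eventually_sector:
 assumes z: "z \<in> sector \<delta>" "\<delta> <= pi / 2" shows "\<forall>\<^sub>F h in at 0. z + h \<in> sector \<delta>"
proof -
 have "z \<notin> \<real>\<^sub>\<le>\<^sub>0"
 proof
  assume "z \<in> \<real>\<^sub>\<le>\<^sub>0"
  then have "Im z = 0" "Re z <= 0" by (auto simp: complex_nonpos_Reals_iff)
  moreover have "z ~= 0" using z by (simp add: sector_def)
  ultimately have "Re z < 0 & Im z = 0" by (auto simp: complex_eq_iff less_le)
  then have "Arg z = pi" by (simp add: Arg_eq_pi)
  then show False using z pi_gt_zero by (simp add: sector_def)
 qed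
 then have "continuous (at z) Arg" by (rule continuous_at_Arg)
 then have "((%h. Arg (z + h)) \<longlongrightarrow> Arg z) (at 0)" by (simp only: isCont_iff)
 from order_tendstoD(2)[OF tendsto_rabs[OF this], of \<delta>] z(1)
 have "\<forall>\<^sub>F h in at 0. \<bar>Arg (z + h)\<bar> < \<delta>" by (simp add: sector_def)
 moreover have "((%h. z + h) \<longlongrightarrow> z + 0) (at 0)" by (intro tendsto_intros)
 then have "\<forall>\<^sub>F h in at 0. z + h ~= 0" by (rule tendsto_imp_eventually_ne) (use z in \<open>auto simp: sector_def\<close>)
 ultimately show ?thesis by eventually_elim (simp add: sector_def)
qed

context banach_carrier
begin

lemma analytic_semigroup_C0:
 assumes T: "analytic_semigroup_on X nrm \<delta> T" and \<delta>: "\<delta> > 0"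
 shows "C0_semigroup_on X nrm (%t. T (of_real t))"
 unfolding C0_semigroup_on_def
proof (intro conjI allI impI ballI)
 have bdd: "bounded_operator_on X nrm (T (of_real t))" if "t >= 0" for t
  using T of_real_sector[of t \<delta>] \<delta> that unfolding analytic_semigroup_on_def by (cases "t = 0") auto
 then show "bounded_operator_on X nrm (T (of_real t))" if "0 <= t" for t using that by blast
 show T0: "T (of_real 0) x = x" if "x \<in> X" for x using T that unfolding analytic_semigroup_on_def by simp
 show "T (of_real (s + t)) x = T (of_real s) (T (of_real t) x)" if "0 <= s" "0 <= t" "x \<in> X" for s t x
 proof (cases "s = 0 \<or> t = 0")
  case True then show ?thesis using T0 that(3) bounded_operatorD(1)[OF bdd[OF that(2)] that(3)] by auto
 next
  case False
  then show ?thesis using T that of_real_sector[of _ \<delta>] \<delta> unfolding analytic_semigroup_on_def by auto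
 qed
 fix x assume x: "x \<in> X"
 have "filterlim (of_real :: real => complex) (at 0 within sector (\<delta> / 2)) (at_right 0)"
  unfolding filterlim_at using \<delta> by (auto intro!: tendsto_eq_intros always_eventually of_real_sector simp: eventually_at_filter)
 moreover have "((%z. nrm (T z x - x)) \<longlongrightarrow> 0) (at 0 within sector (\<delta> / 2))"
  using T x \<delta> unfolding analytic_semigroup_on_def by auto
 ultimately show "((%t. nrm (T (of_real t) x - x)) \<longlongrightarrow> 0) (at_right 0)" by (rule filterlim_compose[rotated])
qed

text \<open>
Differentiability in operator norm makes the scalar functions \<open>l (T z x)\<close>
holomorphic, so that classical complex analysis applies.
\<close>

lemma functional_orbit_derivative:
 assumes T: "analytic_semigroup_on X nrm \<delta> T" and \<delta>: "\<delta> <= pi / 2" and z: "z \<in> sector \<delta>" and x: "x \<in> X"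
  and l: "!!u v. l (u - v) = l u - l v" "!!c u. l (c *\<^sub>C u) = c * l u"
   "!!u. u \<in> X ==> norm (l u :: complex) <= K * nrm u" and K: "K >= 0"
 shows "(%z. l (T z x)) field_differentiable (at z)"
proof -
 have Tm: "T w x \<in> X" if "w \<in> sector \<delta>" for w
  using T x that unfolding analytic_semigroup_on_def bounded_operator_on_def by blast
 obtain L where L: "bounded_operator_on X nrm L"
  "!!\<epsilon>. \<epsilon> > 0 ==> \<forall>\<^sub>F h in at 0. \<forall>x\<in>X. nrm ((1 / h) *\<^sub>C (T (z + h) x - T z x) - L x) <= \<epsilon> * nrm x"
  using T z unfolding analytic_semigroup_on_def operator_differentiable_at_def by blast
 have Lx: "L x \<in> X" by (rule bounded_operatorD(1)[OF L(1) x])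
 have "((%h. (l (T (z + h) x) - l (T z x)) / h) \<longlongrightarrow> l (L x)) (at 0)"
 proof (rule tendstoI)
  fix e :: real assume e: "e > 0"
  define \<epsilon> where "\<epsilon> = e / (K * nrm x + 1)"
  have pos: "K * nrm x + 1 > 0" using K nrm_nonneg[OF x] by (simp add: add_nonneg_pos)
  have \<epsilon>: "\<epsilon> > 0" using e pos by (simp add: \<epsilon>_def)
  have "K * (\<epsilon> * nrm x) < e"
  proof -
   have "K * (\<epsilon> * nrm x) < \<epsilon> * (K * nrm x + 1)" using \<epsilon> by (simp add: algebra_simps)
   then show ?thesis using pos by (simp add: \<epsilon>_def)
  qed
  note Ke = this
  show "\<forall>\<^sub>F h in at 0. dist ((l (T (z + h) x) - l (T z x)) / h) (l (L x)) < e"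
   using L(2)[OF \<epsilon>] eventually_sector[OF z \<delta>]
  proof eventually_elim
   fix h assume h: "\<forall>x\<in>X. nrm ((1 / h) *\<^sub>C (T (z + h) x - T z x) - L x) <= \<epsilon> * nrm x" and zh: "z + h \<in> sector \<delta>"
   let ?d = "(1 / h) *\<^sub>C (T (z + h) x - T z x) - L x"
   have "dist ((l (T (z + h) x) - l (T z x)) / h) (l (L x)) = norm (l ?d)" by (simp add: dist_norm l(1,2))
   also have "... <= K * nrm ?d" by (intro l(3) diff_mem scale_mem Tm zh z Lx)
   also have "... <= K * (\<epsilon> * nrm x)" using h x K by (intro mult_left_mono) auto
   finally show "dist ((l (T (z + h) x) - l (T z x)) / h) (l (L x)) < e" using Ke by linarith
  qed
 qed
 then show ?thesis unfolding field_differentiable_def has_field_derivative_def[symmetric] DERIV_def by blast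
qed

text \<open>
 The orbits of an analytic semigroup move slowly: Cauchy's inequality on a disc around \<open>t\<close> whose
 radius is proportional to \<open>t\<close> bounds the derivative by a multiple of \<open>1 / t\<close>.
\<close>

lemma analytic_orbit_slow:
 assumes T: "analytic_semigroup_on X nrm \<delta> T" and \<delta>: "0 < \<delta>" "\<delta> <= pi / 2"
 shows "\<exists>C\<ge>0. \<exists>d>0. \<forall>x\<in>X. \<forall>l K t1 t2. (\<forall>u v. l (u - v) = l u - l v) & (\<forall>c u. l (c *\<^sub>C u) = c * l u) \<and>
   (\<forall>u\<in>X. norm (l u :: complex) <= K * nrm u) & K >= 0 & 0 < t1 & t1 <= t2 & t2 <= d \<longrightarrow>
   norm (l (T (of_real t2) x) - l (T (of_real t1) x)) <= C * (K * nrm x) * ((t2 - t1) / t1)"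
proof -
 have half: "\<delta> / 2 > 0" "sector (\<delta> / 2) \<subseteq> sector \<delta>" using \<delta> by (auto intro!: sector_mono)
 obtain M d where M: "M >= 1" "d > 0" "!!z x. z \<in> sector (\<delta> / 2) ==> norm z < d ==> x \<in> X ==> nrm (T z x) <= M * nrm x"
 proof -
  have "\<exists>M\<ge>1. \<exists>d>0. \<forall>z\<in>sector (\<delta> / 2). z ~= 0 & norm z < d --> (\<forall>x\<in>X. nrm (T z x) <= M * nrm x)"
   by (rule local_bound) (use T half \<delta> in \<open>auto simp: analytic_semigroup_on_def\<close>)
  then show ?thesis using that by (auto simp: sector_def)
 qed
 obtain c where c: "0 < c" "c <= 1 / 2"
  "!!t w. t > 0 ==> norm (of_real t - w) <= c * t ==> w \<in> sector (\<delta> / 2) & norm w < 2 * t"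
  using small_disc_in_sector[OF half(1)] by blast
 show ?thesis
 proof (rule exI[of _ "M / c"], rule conjI, goal_cases)
  case 1 show ?case using M c by simp
 next
  case 2 show ?case
 proof (intro exI[of _ "d / 2"] conjI ballI allI impI)
  show "0 < d / 2" using M by simp
  fix x l K t1 t2 assume x: "x \<in> X"
  assume "(\<forall>u v. l (u - v) = l u - l v) & (\<forall>c u. l (c *\<^sub>C u) = c * l u) \<and>
   (\<forall>u\<in>X. norm (l u :: complex) <= K * nrm u) & K >= 0 & 0 < t1 & t1 <= t2 & t2 <= d / 2"
  then have l: "!!u v. l (u - v) = l u - l v" "!!c u. l (c *\<^sub>C u) = c * l u"
   "!!u. u \<in> X ==> norm (l u) <= K * nrm u" and K: "K >= 0" and t: "0 < t1" "t1 <= t2" "t2 <= d / 2" by auto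
  define F where "F z = l (T z x)" for z
  have F: "F field_differentiable (at z)" if "z \<in> sector \<delta>" for z
   unfolding F_def by (rule functional_orbit_derivative[OF T \<delta>(2) that x l K])
  have b: "norm (deriv F (of_real t)) <= M / c * (K * nrm x) / t1" if t': "t1 <= t" "t <= t2" for t
  proof -
   have t0: "t > 0" using t t' by linarith
   have disc: "w \<in> sector (\<delta> / 2)" "norm w < d" if "norm (of_real t - w) <= c * t" for w
    using c(3)[OF t0 that] t t' by auto
   have hol: "F holomorphic_on cball (of_real t) (c * t)"
    unfolding holomorphic_on_def
   proof
    fix w :: complex assume "w \<in> cball (of_real t) (c * t)"
    then have "w \<in> sector \<delta>" using disc(1)[of w] half(2) by (auto simp: dist_norm)
    then show "F field_differentiable (at w within cball (of_real t) (c * t))" by (rule field_differentiable_at_within[OF F])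
   qed
   have "norm ((deriv ^^ 1) F (of_real t)) <= fact 1 * (K * (M * nrm x)) / (c * t) ^ 1"
   proof (rule Cauchy_inequality)
    show "F holomorphic_on ball (of_real t) (c * t)" using hol by (rule holomorphic_on_subset) auto
    show "continuous_on (cball (of_real t) (c * t)) F" using hol by (rule holomorphic_on_imp_continuous_on)
    show "0 < c * t" using c t0 by simp
    fix w :: complex assume "norm (of_real t - w) = c * t"
    then have w: "w \<in> sector (\<delta> / 2)" "norm w < d" using disc[of w] by auto
    have "T w x \<in> X" using T x w half(2) unfolding analytic_semigroup_on_def bounded_operator_on_def by blast
    then have "norm (F w) <= K * nrm (T w x)" unfolding F_def by (rule l(3))
    also have "... <= K * (M * nrm x)" by (intro mult_left_mono K M(3) w x)
    finally show "norm (F w) <= K * (M * nrm x)" .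
   qed
   then have "norm (deriv F (of_real t)) <= M / c * (K * nrm x) / t" by (simp add: mult_ac)
   also have "... <= M / c * (K * nrm x) / t1"
    using t t' M(1) c(1) K nrm_nonneg[OF x] by (intro divide_left_mono) auto
   finally show ?thesis .
  qed
  have "norm (F (of_real t2) - F (of_real t1)) <= M / c * (K * nrm x) / t1 * norm (of_real t2 - of_real t1 :: complex)"
  proof (rule field_differentiable_bound[of "closed_segment (of_real t1) (of_real t2)" F "deriv F"])
   fix z :: complex assume "z \<in> closed_segment (of_real t1) (of_real t2)"
   then obtain t where "t \<in> closed_segment t1 t2" "z = of_real t" by (auto simp: closed_segment_of_real)
   then have t': "t1 <= t" "t <= t2" "z = of_real t" using t(2) by (auto simp: closed_segment_eq_real_ivl)
   have "F field_differentiable (at z)" using F[OF of_real_sector[of t \<delta>]] t t' \<delta> by simp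
   then show "(F has_field_derivative deriv F z) (at z within closed_segment (of_real t1) (of_real t2))"
    by (simp add: field_differentiable_derivI has_field_derivative_at_within)
   show "norm (deriv F z) <= M / c * (K * nrm x) / t1" unfolding t'(3) by (rule b[OF t'(1,2)])
  qed auto
  also have "norm (of_real t2 - of_real t1 :: complex) = t2 - t1" unfolding of_real_diff[symmetric] norm_of_real using t by simp
  finally show "norm (l (T (of_real t2) x) - l (T (of_real t1) x)) <= M / c * (K * nrm x) * ((t2 - t1) / t1)"
   unfolding F_def by simp
 qed
 qed
qed

end

text \<open>
At \<open>x = 0\<close> the two values have different moduli, and a continuous function that
vanishes almost everywhere vanishes.
\<close>

lemma beam_moves: "lp_norm lborel 2 (%x. E P1 (Complex 1 1) x - E P1 (Complex 1 0) (x :: real^'n::finite)) > 0"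
proof (rule ccontr)
 let ?g = "%x :: real^'n. E P1 (Complex 1 1) x - E P1 (Complex 1 0) x"
 assume "\<not> lp_norm lborel 2 ?g > 0"
 then have z: "lp_norm lborel 2 ?g = 0" using lp_norm_nonneg[of lborel 2 ?g] by linarith
 have s: "is_schwartz (E P1 (Complex 1 1) :: real^'n => complex)" "is_schwartz (E P1 (Complex 1 0) :: real^'n => complex)"
  by (auto intro: is_schwartz_E)
 have "lp_fun lborel 2 ?g" by (intro lp_fun_diff schwartz_lp_fun s) auto
 then have ae: "AE x in lborel. ?g x = 0" using z lp_norm_eq_0_iff by fastforce
 have "continuous_on UNIV ?g"
  by (intro continuous_on_diff continuous_at_imp_continuous_on ballI
    has_derivative_continuous[OF E_has_derivative]) (auto simp: complex_eq_iff)
 from continuous_AE_zero[OF this ae, of 0] have E0: "norm (E P1 (Complex 1 1) (0 :: real^'n)) = norm (E P1 (Complex 1 0) (0 :: real^'n))" by simp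
 have n: "norm (E P1 \<kappa> (0 :: real^'n)) = real CARD('n) / 2 * (norm \<kappa> powr (- real CARD('n) / 2) / norm \<kappa>)" if "Re \<kappa> = 1" for \<kappa>
  using that by (simp add: E_def norm_mult norm_gauss norm_divide Dz_def)
 have "real CARD('n) / 2 * (norm (Complex 1 1) powr (- real CARD('n) / 2) / norm (Complex 1 1))
   = real CARD('n) / 2 * (norm (Complex 1 0) powr (- real CARD('n) / 2) / norm (Complex 1 0))"
  using E0 unfolding n[of "Complex 1 1", OF complex.sel(1)] n[of "Complex 1 0", OF complex.sel(1)] .
 then have eq: "norm (Complex 1 1) powr (- real CARD('n) / 2) / norm (Complex 1 1)
   = norm (Complex 1 0) powr (- real CARD('n) / 2) / norm (Complex 1 0)" unfolding mult_cancel_left by simp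
 have "norm (Complex 1 1) = sqrt 2" "norm (Complex 1 0) = 1" by (simp_all add: cmod_def)
 then have "sqrt 2 powr (- real CARD('n) / 2) = sqrt 2" using eq by (simp add: field_simps)
 moreover have "sqrt 2 powr (- real CARD('n) / 2) <= sqrt 2 powr 0" by (intro powr_mono) auto
 ultimately show False using real_sqrt_gt_1_iff[of 2] by simp
qed

text \<open>
The functional pairs the third component with the conjugate of the difference of the beams at
\<open>\<sigma> = 0\<close> and \<open>\<sigma> = 1\<close>, which detects the full
\<open>L\<^sup>2\<close> norm \<open>L\<close> of this difference. For \<open>p = 2\<close> the
size of the wave is bounded independently of \<open>S\<close>, so \<open>L\<close> is at most a
multiple of \<open>1 / S\<close>.
\<close>

theorem no_analytic_semigroup:
 assumes \<tau>: "\<tau> > 0"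
 shows "\<not> generates_analytic_semigroup (plate_space 2 :: 'n::finite state set) (plate_norm 2) (plate_domain \<tau> 2) (plate_operator \<tau>)"
proof
 assume "generates_analytic_semigroup (plate_space 2 :: 'n state set) (plate_norm 2) (plate_domain \<tau> 2) (plate_operator \<tau>)"
 then obtain \<delta> T where \<delta>: "0 < \<delta>" "\<delta> <= pi / 2" and T: "analytic_semigroup_on (plate_space 2 :: 'n state set) (plate_norm 2) \<delta> T"
  and gen: "is_generator_of (plate_space 2 :: 'n state set) (plate_norm 2) (%t. T (of_real t)) (plate_domain \<tau> 2) (plate_operator \<tau>)"
  unfolding generates_analytic_semigroup_def by auto
 interpret X: banach_carrier "plate_space 2 :: 'n state set" "plate_norm 2" by (rule banach_carrier_plate) simp
 note C0 = X.analytic_semigroup_C0[OF T \<delta>(1)]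
 obtain M d where M: "M >= 1" "d > 0" "!!t x. 0 <= t ==> t <= d ==> x \<in> plate_space 2 ==> plate_norm 2 (T (of_real t) x) <= M * plate_norm 2 x"
  using X.C0_local_bound[OF C0] by blast
 have M0: "M >= 0" using M(1) by simp
 obtain C d2 where C: "C >= 0" "d2 > 0" "!!x l K t1 t2. x \<in> plate_space 2 ==> (\<forall>u v. l (u - v) = l u - l v) & (\<forall>c u. l (c *\<^sub>C u) = c * l u) \<and>
   (\<forall>u\<in>plate_space 2. norm (l u :: complex) <= K * plate_norm 2 u) & K >= 0 & 0 < t1 & t1 <= t2 & t2 <= d2 ==>
   norm (l (T (of_real t2) x) - l (T (of_real t1) x)) <= C * (K * plate_norm 2 x) * ((t2 - t1) / t1)"
  using X.analytic_orbit_slow[OF T \<delta>] by blast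
 obtain CI where CI: "CI > 0" "!!\<kappa>. Re \<kappa> = 1 ==> initial_size TYPE('n) 2 \<kappa> <= CI"
 proof -
  obtain K where K: "K > 0" "!!\<kappa>. Re \<kappa> = 1 ==> initial_size TYPE('n) 2 \<kappa> <= K * norm \<kappa> powr (- real CARD('n) / 2 + real CARD('n) / 2)"
   using beam_size[of 2, where 'n = 'n] by auto
  have "norm \<kappa> powr (- real CARD('n) / 2 + real CARD('n) / 2) = 1" if "Re \<kappa> = 1" for \<kappa> using that by auto
  then show ?thesis using K that by simp
 qed
 define G where "G x = E P1 (Complex 1 1) x - E P1 (Complex 1 0) x" for x :: "real^'n"
 define L where "L = lp_norm lborel 2 G"
 have L: "L > 0" using beam_moves unfolding L_def G_def .
 have key: "L <= C * CI / S" if S: "S > 0" for S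
 proof -
  have S0: "- S <= 0" "- S <= 1" using S by auto
  obtain C1 where C1: "C1 >= 0" "!!a. 0 < a & a <= 1 & a * (0 - (- S)) / sqrt 2 <= d ==>
    plate_norm 2 (T (of_real (a * (0 - (- S)) / sqrt 2)) (wave (of_real a * Complex 1 (- S))) - wave (of_real a * Complex 1 0))
    <= scale_factor TYPE('n) 2 a * (C1 * sqrt a)"
   using wave_orbit[OF \<tau> _ C0 gen M0 M(3) S0(1)] by auto
  obtain C2 where C2: "C2 >= 0" "!!a. 0 < a & a <= 1 & a * (1 - (- S)) / sqrt 2 <= d ==>
    plate_norm 2 (T (of_real (a * (1 - (- S)) / sqrt 2)) (wave (of_real a * Complex 1 (- S))) - wave (of_real a * Complex 1 1))
    <= scale_factor TYPE('n) 2 a * (C2 * sqrt a)"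
   using wave_orbit[OF \<tau> _ C0 gen M0 M(3) S0(2)] by auto
  obtain C' where C': "C' >= 0" "!!a. 0 < a & a <= 1 ==> plate_norm 2 (wave (of_real a * Complex 1 (- S)) :: 'n state)
    <= scale_factor TYPE('n) 2 a * (initial_size TYPE('n) 2 (Complex 1 (- S)) + C' * sqrt a)"
   using wave_size[of "Complex 1 (- S)" 2, where 'n = 'n] by auto
  define a0 where "a0 = min 1 (min d d2 / (S + 1))"
  have a0: "a0 > 0" using M(2) C(2) S by (simp add: a0_def)
  show ?thesis
  proof (rule le_if_le_add_sqrt[OF a0, where C = "C1 + C2 + C * C' / S"])
   fix a assume a: "0 < a" "a <= a0"
   have a1: "a <= 1" using a by (simp add: a0_def)
   define t1 where "t1 = a * S / sqrt 2"
   define t2 where "t2 = a * (S + 1) / sqrt 2"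
   have "a * (S + 1) <= min d d2" using a S by (simp add: a0_def pos_le_divide_eq)
   moreover have "t2 <= a * (S + 1) / 1" unfolding t2_def using a S by (intro divide_left_mono) auto
   moreover have "t1 <= t2" unfolding t1_def t2_def using a S by (intro divide_right_mono) auto
   moreover have "t1 > 0" using a S by (simp add: t1_def)
   ultimately have t: "0 < t1" "t1 <= t2" "t2 <= d" "t2 <= d2" "t1 <= d" by auto
   have tt: "(t2 - t1) / t1 = 1 / S" using a S by (simp add: t1_def t2_def field_simps)
   define A where "A = scale_factor TYPE('n) 2 a"
   have A: "A > 0" using a by (simp add: A_def)
   define k0 where "k0 = of_real a * Complex 1 (- S)"
   define k1 where "k1 = of_real a * Complex 1 0"
   define k2 where "k2 = of_real a * Complex 1 1"
   have k: "Re k0 > 0" "Re k1 > 0" "Re k2 > 0" using a by (auto simp: k0_def k1_def k2_def)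
   define g where "g x = E P1 k2 x - E P1 k1 x" for x :: "real^'n"
   have "is_schwartz (%x. E P1 k2 x + (- 1) * E P1 k1 x :: complex)" by (intro is_schwartz_add is_schwartz_mult is_schwartz_E k)
   then have gs: "is_schwartz g" by (simp add: g_def[abs_def])
   define \<psi> where "\<psi> = Schwartz (%x. cnj (g x))"
   have \<psi>: "schwartz_fun \<psi> = (%x. cnj (g x))" unfolding \<psi>_def by (rule Schwartz_inverse) (simp add: is_schwartz_cnj gs)
   have g2: "lp_fun lborel 2 g" by (rule schwartz_lp_fun[OF gs]) simp
   define N where "N = lp_norm lborel 2 g"
   have N\<psi>: "lp_norm lborel 2 (schwartz_fun \<psi>) = N" unfolding N_def \<psi> by (rule lp_norm_cong_norm) simp
   have "N = A * a powr ((2 - 2) / 2) * L"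
    unfolding N_def A_def L_def
   proof (rule lp_norm_scaling)
    show "g (sqrt a *\<^sub>R y) = of_real (a powr (- (2 + real CARD('n)) / 2)) * G y" for y
     unfolding g_def G_def k1_def k2_def using homogeneousD[where P = "P1 :: 'n gpoly", OF homogeneous_P1(1) a(1)]
     by (simp add: right_diff_distrib)
    have "(%x :: real^'n. E P1 (Complex 1 1) x - E P1 (Complex 1 0) x) \<in> borel_measurable borel"
     by (intro borel_measurable_diff schwartz_measurable is_schwartz_E) auto
    then show "G \<in> borel_measurable borel" by (simp add: G_def[abs_def])
   qed (use a in auto)
   then have N: "N = A * L" using a by simp
   have N0: "N > 0" using A L N by simp
   define l where "l U = pairing (fst (snd (snd U))) \<psi>" for U :: "'n state"
   have ll: "l (u - v) = l u - l v" "l (c *\<^sub>C u) = c * l u" for u v c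
    by (simp_all add: l_def scaleC_prod_def pairing_simps)
   have lb: "norm (l u) <= N * plate_norm 2 u" if "u \<in> plate_space 2" for u
   proof -
    have "fst (snd (snd u)) \<in> Lp 2" using that by (auto simp: plate_space_def)
    from pairing_le_L2[OF this, of \<psi>] have "norm (l u) <= N * Lp_norm 2 (fst (snd (snd u)))" by (simp add: l_def N\<psi> mult.commute)
    also have "... <= N * plate_norm 2 u" using N0 Lp_norm_le_plate_norm[of 2 u] by (intro mult_left_mono) auto
    finally show ?thesis .
   qed
   let ?x = "wave k0 :: 'n state" and ?y1 = "wave k1 :: 'n state" and ?y2 = "wave k2 :: 'n state"
   have mem: "?x \<in> plate_space 2" "?y1 \<in> plate_space 2" "?y2 \<in> plate_space 2" by (intro wave_rhs_mem(1) k; simp)+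
   have Tm: "T (of_real t1) ?x \<in> plate_space 2" "T (of_real t2) ?x \<in> plate_space 2"
    using X.bounded_operatorD(1)[OF X.C0_semigroupD(1)[OF C0] mem(1)] t by auto
   have e: "a * (0 - (- S)) / sqrt 2 = t1" "a * (1 - (- S)) / sqrt 2 = t2" by (simp_all add: t1_def t2_def add.commute)
   have y: "plate_norm 2 (T (of_real t1) ?x - ?y1) <= A * (C1 * sqrt a)" "plate_norm 2 (T (of_real t2) ?x - ?y2) <= A * (C2 * sqrt a)"
    using C1(2)[of a, unfolded e, folded k0_def k1_def A_def] C2(2)[of a, unfolded e, folded k0_def k2_def A_def] a(1) a1 t by blast+
   have d1: "norm (l (T (of_real t1) ?x - ?y1)) <= N * (A * (C1 * sqrt a))"
    by (rule order_trans[OF lb[OF X.diff_mem[OF Tm(1) mem(2)]] mult_left_mono[OF y(1) less_imp_le[OF N0]]])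
   have d2: "norm (l (T (of_real t2) ?x - ?y2)) <= N * (A * (C2 * sqrt a))"
    by (rule order_trans[OF lb[OF X.diff_mem[OF Tm(2) mem(3)]] mult_left_mono[OF y(2) less_imp_le[OF N0]]])
   have "norm (l (T (of_real t2) ?x) - l (T (of_real t1) ?x)) <= C * (N * plate_norm 2 ?x) * ((t2 - t1) / t1)"
    by (rule C(3)[OF mem(1)]) (use ll lb N0 t in auto)
   also have "... <= C * (N * (A * (CI + C' * sqrt a))) * (1 / S)"
   proof -
    have "plate_norm 2 ?x <= A * (initial_size TYPE('n) 2 (Complex 1 (- S)) + C' * sqrt a)"
     using C'(2)[of a] a a1 by (simp add: k0_def A_def)
    also have "... <= A * (CI + C' * sqrt a)" using CI(2)[of "Complex 1 (- S)"] A by (intro mult_left_mono) auto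
    finally show ?thesis unfolding tt using C(1) N0 S by (intro mult_right_mono mult_left_mono) auto
   qed
   finally have d3: "norm (l (T (of_real t2) ?x) - l (T (of_real t1) ?x)) <= C * (N * (A * (CI + C' * sqrt a))) * (1 / S)" .
   have "l (?y2 - ?y1) = of_real (N\<^sup>2)"
   proof -
    have r: "represented_by (D P1 k2 - D P1 k1) g"
     unfolding D_def g_def by (intro represented_by_diff represented_by_schwartz is_schwartz_E k)
    have "l (?y2 - ?y1) = (LBINT x. g x * schwartz_fun \<psi> x)"
     using r by (simp add: l_def wave_def represented_by_def)
    also have "... = (LBINT x. of_real (norm (g x) powr 2))" unfolding \<psi> by (simp add: complex_norm_square[symmetric])
    also have "... = of_real (LBINT x. norm (g x) powr 2)" by (rule integral_complex_of_real)
    also have "(LBINT x. norm (g x) powr 2) = lp_norm lborel 2 g powr 2" by (rule lp_norm_powr[symmetric]) simp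
    finally show ?thesis by (simp add: N_def)
   qed
   then have "N\<^sup>2 = norm (l (?y2 - ?y1))" by (simp add: norm_power)
   also have "l (?y2 - ?y1) = (l (T (of_real t2) ?x) - l (T (of_real t1) ?x)) + l (T (of_real t1) ?x - ?y1) - l (T (of_real t2) ?x - ?y2)"
    by (simp add: ll)
   also have "norm ... <= C * (N * (A * (CI + C' * sqrt a))) * (1 / S) + N * (A * (C1 * sqrt a)) + N * (A * (C2 * sqrt a))"
   proof -
    have "norm (x + y - z) <= norm x + norm y + norm z" for x y z :: complex by norm
    from order_trans[OF this add_mono[OF add_mono[OF d3 d1] d2]] show ?thesis .
   qed
   also have "... = N * A * (C * CI / S + (C1 + C2 + C * C' / S) * sqrt a)" using S by (simp add: field_simps)
   finally have "N * A * L <= N * A * (C * CI / S + (C1 + C2 + C * C' / S) * sqrt a)" using N by (simp add: power2_eq_square mult_ac)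
   then show "L <= C * CI / S + (C1 + C2 + C * C' / S) * sqrt a" using N0 A by simp
  qed
 qed
 define S where "S = C * CI / L + 1"
 have S: "S > 0" using C(1) CI(1) L by (simp add: S_def add_nonneg_pos)
 have "L * S <= C * CI" using key[OF S] S by (simp add: pos_le_divide_eq)
 moreover have "L * S = C * CI + L" using L by (simp add: S_def distrib_left)
 ultimately show False using L by linarith
qed

section \<open>Generation by regularisation\<close>

text \<open>
Bounded operators from a space to itself, as a copy of the type of bounded linear maps:
composition makes it a Banach algebra, in which the exponential function is available.
\<close>

typedef (overloaded) 'a endo = "UNIV :: ('a::real_normed_vector \<Rightarrow>\<^sub>L 'a) set" morphisms endo_map Endo ..

setup_lifting type_definition_endo

instantiation endo :: ("{real_normed_vector, perfect_space}") real_normed_algebra_1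
begin

lift_definition zero_endo :: "'a endo" is 0 .
lift_definition one_endo :: "'a endo" is id_blinfun .
lift_definition plus_endo :: "'a endo => 'a endo => 'a endo" is "(+)" .
lift_definition minus_endo :: "'a endo => 'a endo => 'a endo" is "(-)" .
lift_definition uminus_endo :: "'a endo => 'a endo" is uminus .
lift_definition times_endo :: "'a endo => 'a endo => 'a endo" is "(o\<^sub>L)" .
lift_definition scaleR_endo :: "real => 'a endo => 'a endo" is "(*\<^sub>R)" .
lift_definition norm_endo :: "'a endo => real" is norm .
definition dist_endo :: "'a endo => 'a endo => real" where "dist_endo S T = norm (S - T)"
definition sgn_endo :: "'a endo => 'a endo" where "sgn_endo T = inverse (norm T) *\<^sub>R T"
definition uniformity_endo :: "('a endo \<times> 'a endo) filter" where
 "uniformity_endo = (INF e\<in>{0<..}. principal {(S, T). dist S T < e})"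
definition open_endo :: "'a endo set => bool" where
 "open_endo U = (\<forall>S\<in>U. \<forall>\<^sub>F (S', T) in uniformity. S' = S --> T \<in> U)"

instance
proof
 show "(0 :: 'a endo) ~= 1" by transfer (metis norm_blinfun_id norm_zero zero_neq_one)
 show "norm (1 :: 'a endo) = 1" by transfer simp
 show "norm (S * T) <= norm S * norm T" for S T :: "'a endo" by transfer (rule norm_blinfun_compose)
 show "norm (S + T) <= norm S + norm T" for S T :: "'a endo" by transfer (rule norm_triangle_ineq)
qed (simp_all add: dist_endo_def sgn_endo_def uniformity_endo_def open_endo_def,
  (transfer; auto intro!: blinfun_eqI simp: blinfun.bilinear_simps scaleR_add_right scaleR_add_left)+)

end

instance endo :: ("{banach, perfect_space}") banach
proof
 fix S :: "nat => 'a endo" assume "Cauchy S"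
 then have "Cauchy (%k. endo_map (S k))"
  unfolding Cauchy_def dist_norm by (simp add: norm_endo.rep_eq minus_endo.rep_eq)
 then obtain l where "(%k. endo_map (S k)) \<longlonglongrightarrow> l" by (metis Cauchy_convergent_iff convergent_def)
 then have "S \<longlonglongrightarrow> Endo l"
  unfolding LIMSEQ_iff by (simp add: norm_endo.rep_eq minus_endo.rep_eq Endo_inverse)
 then show "convergent S" by (rule convergentI)
qed

definition app :: "'a::{real_normed_vector, perfect_space} endo => 'a => 'a" where
 "app T = blinfun_apply (endo_map T)"

lemma app_times: "app (S * T) x = app S (app T x)" and app_one [simp]: "app 1 x = x"
 by (simp_all add: app_def times_endo.rep_eq one_endo.rep_eq)

lemma app_Endo: "bounded_linear f ==> app (Endo (Blinfun f)) = f"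
 by (simp add: app_def Endo_inverse bounded_linear_Blinfun_apply)

lemma endo_eqI: "(!!x. app S x = app T x) ==> S = T"
 by (simp add: app_def endo_map_inject[symmetric] blinfun_eqI)

interpretation app: bounded_bilinear "app :: 'a::{real_normed_vector, perfect_space} endo => 'a => 'a"
proof
 show "\<exists>K. \<forall>S x. norm (app S x :: 'a) <= norm S * norm x * K"
  by (rule exI[of _ 1]) (simp add: app_def norm_endo.rep_eq norm_blinfun)
qed (simp_all add: app_def plus_endo.rep_eq scaleR_endo.rep_eq blinfun.bilinear_simps)

lemma exp_commute:
 fixes A B :: "'a::{real_normed_algebra_1, banach}"
 assumes "A * B = B * A" shows "exp A * B = B * exp A"
proof -
 have "A ^ n * B = B * A ^ n" for n
 proof (induction n)
  case (Suc n)
  have "A ^ Suc n * B = A * (A ^ n * B)" by (simp add: mult.assoc)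
  also have "... = B * A ^ Suc n" unfolding Suc by (simp add: mult.assoc[symmetric] assms)
  finally show ?case .
 qed simp
 then show ?thesis by (simp add: exp_def suminf_mult[symmetric] summable_exp_generic suminf_mult2)
qed

lemma exp_orbit_derivative:
 fixes B :: "'a::{banach, perfect_space} endo"
 shows "((%t. app (exp (t *\<^sub>R B)) x) has_vector_derivative app B (app (exp (t *\<^sub>R B)) x)) (at t within S)"
 using bounded_linear.has_vector_derivative[OF app.bounded_linear_left exp_scaleR_has_vector_derivative_left[of B t], of x]
 by (auto simp: app_times intro: has_vector_derivative_at_within)

lemma mean_value_bound:
 fixes f :: "real => 'a::real_normed_vector"
 assumes t: "t >= 0" and f: "!!s. 0 <= s ==> s <= t ==> (f has_vector_derivative f' s) (at s)"
  and B: "!!s. 0 <= s ==> s <= t ==> norm (f' s) <= K"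
 shows "norm (f t - f 0) <= K * t"
proof -
 have "norm (f t - f 0) <= K * norm (t - 0)"
 proof (rule differentiable_bound[of "{0..t}" f "%s h. h *\<^sub>R f' s"])
  fix s assume s: "s \<in> {0..t}"
  then show "(f has_derivative (%h. h *\<^sub>R f' s)) (at s within {0..t})"
   using f[of s] unfolding has_vector_derivative_def by (auto intro: has_derivative_at_withinI)
  show "onorm (%h. h *\<^sub>R f' s) <= K"
   by (rule onorm_le) (use B[of s] s in \<open>auto simp: mult.commute[of K] intro!: mult_left_mono\<close>)
 qed (use t in auto)
 then show ?thesis using t by simp
qed

lemma tendsto_zero_if_gap:
 fixes f :: "real => real"
 assumes "!!s. f s >= 0" "!!\<epsilon>. \<epsilon> > 0 ==> \<exists>C\<ge>0. \<forall>s. 0 < s & s <= 1 --> f s <= \<epsilon> + C * s"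
 shows "(f \<longlongrightarrow> 0) (at_right 0)"
proof (rule tendstoI)
 fix e :: real assume e: "e > 0"
 obtain C where C: "C >= 0" "!!s. 0 < s & s <= 1 ==> f s <= e / 2 + C * s" using assms(2)[of "e / 2"] e by auto
 define b where "b = min 1 (e / (2 * (C + 1)))"
 have b: "b > 0" using e C by (simp add: b_def)
 have "dist (f s) 0 < e" if s: "0 < s" "s < b" for s
 proof -
  have "s < e / (2 * (C + 1))" using s by (simp add: b_def)
  then have "s * (2 * (C + 1)) < e" using C(1) by (simp add: pos_less_divide_eq)
  then have "C * s < e / 2" using s by (simp add: algebra_simps)
  then show ?thesis using C(2)[of s] s assms(1)[of s] by (simp add: b_def)
 qed
 then show "\<forall>\<^sub>F s in at_right 0. dist (f s) 0 < e"
  unfolding eventually_at_right_field using b by blast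
qed

text \<open>
Here \<open>graph\<close> is the graph of the operator, \<open>J m\<close> its regularisations of
the identity, and \<open>B m\<close> the bounded operators that arise by composing the operator
with \<open>J m\<close>. The energy \<open>Q\<close> is an equivalent inner product in which the
\<open>B m\<close> are dissipative up to \<open>\<omega>\<close>. Closedness is required in the
only form in which it is used.
\<close>

locale regularised_operator =
 fixes B J :: "nat => 'a::{banach, perfect_space} endo" and graph :: "'a => 'a => bool"
  and Q :: "'a => 'a => real" and c \<omega> :: real
 assumes Q: "bounded_bilinear Q" and Q_sym: "Q x y = Q y x"
  and c: "c > 0" and coercive: "c * (norm x)\<^sup>2 <= Q x x"
  and \<omega>: "\<omega> >= 0" and dissipative: "Q (app (B m) x) x <= \<omega> * Q x x"
  and BB: "B m * B k = B k * B m" and JB: "J k * B m = B m * J k"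
  and approx: "(%m. app (J m) x) \<longlonglongrightarrow> x"
  and graph_B: "graph x y ==> app (B m) x = app (J m) y"
  and graph_J: "graph (app (J m) x) (app (B m) x)"
  and graph_closed: "(!!m. app (B m) x = app (J m) y) ==> graph x y"
begin

definition S :: "nat => real => 'a => 'a" where "S m t = app (exp (t *\<^sub>R B m))"

lemma S_simps: "S m t (x + y) = S m t x + S m t y" "S m t (x - y) = S m t x - S m t y" "S m 0 x = x"
 by (simp_all add: S_def app.add_right app.diff_right)

lemma S_derivative: "((%t. S m t x) has_vector_derivative app (B m) (S m t x)) (at t)"
 unfolding S_def by (rule exp_orbit_derivative)

lemma S_commute: "L * B m = B m * L ==> S m t (app L x) = app L (S m t x)"
 unfolding S_def app_times[symmetric] by (subst exp_commute) (simp_all add: mult_scaleR_left mult_scaleR_right)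

text \<open>
Gronwall: \<open>exp (- 2 * \<omega> * s)\<close> times the energy of the orbit is nonincreasing.
\<close>

lemma S_growth: "\<exists>M\<ge>1. \<forall>m t x. t >= 0 --> norm (S m t x) <= M * exp (\<omega> * t) * norm x"
proof -
 interpret Q: bounded_bilinear Q by (rule Q)
 obtain K where K: "K > 0" "!!x y. norm (Q x y) <= norm x * norm y * K" using Q.pos_bounded by blast
 have "norm (S m t x) <= sqrt (K / c) * exp (\<omega> * t) * norm x" if t: "t >= 0" for m t x
 proof -
  define f where "f s = exp (- 2 * \<omega> * s) * Q (S m s x) (S m s x)" for s
  have "f t <= f 0"
  proof (rule DERIV_nonpos_imp_nonincreasing[OF t])
   fix s
   let ?u = "S m s x"
   have "((%s. Q (S m s x) (S m s x)) has_real_derivative Q ?u (app (B m) ?u) + Q (app (B m) ?u) ?u) (at s)"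
    unfolding has_real_derivative_iff_has_vector_derivative
    by (rule Q.has_vector_derivative[OF S_derivative S_derivative])
   then have "(f has_real_derivative exp (- 2 * \<omega> * s) * (Q ?u (app (B m) ?u) + Q (app (B m) ?u) ?u)
     + (exp (- 2 * \<omega> * s) * (- 2 * \<omega>)) * Q ?u ?u) (at s)"
    unfolding f_def by (auto intro!: derivative_eq_intros)
   moreover have "exp (- 2 * \<omega> * s) * (Q ?u (app (B m) ?u) + Q (app (B m) ?u) ?u) + (exp (- 2 * \<omega> * s) * (- 2 * \<omega>)) * Q ?u ?u
     = exp (- 2 * \<omega> * s) * (2 * (Q (app (B m) ?u) ?u - \<omega> * Q ?u ?u))"
    using Q_sym[of ?u "app (B m) ?u"] by (simp add: algebra_simps)
   moreover have "... <= 0" using dissipative[of m ?u] by (intro mult_nonneg_nonpos) auto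
   ultimately show "\<exists>y. DERIV f s :> y & y <= 0" by metis
  qed
  then have "Q (S m t x) (S m t x) <= exp (\<omega> * t) ^ 2 * Q x x"
   by (simp add: f_def S_simps exp_minus field_simps exp_of_nat2_mult power2_eq_square exp_add[symmetric])
  also have "... <= exp (\<omega> * t) ^ 2 * (norm x * norm x * K)" using K(2)[of x x] by (intro mult_left_mono) auto
  finally have "c * (norm (S m t x))\<^sup>2 <= exp (\<omega> * t) ^ 2 * (norm x * norm x * K)" using coercive[of "S m t x"] by linarith
  then have "(norm (S m t x))\<^sup>2 <= exp (\<omega> * t) ^ 2 * (norm x * norm x * K) / c" using c by (simp add: pos_le_divide_eq mult.commute)
  also have "... = (sqrt (K / c) * exp (\<omega> * t) * norm x)\<^sup>2"
  proof -
   have "(sqrt (K / c))\<^sup>2 = K / c" using K c by simp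
   then show ?thesis unfolding power_mult_distrib by (simp add: power2_eq_square)
  qed
  finally show ?thesis by (rule power2_le_imp_le) (use K c in auto)
 qed
 then have "norm (S m t x) <= (sqrt (K / c) + 1) * exp (\<omega> * t) * norm x" if "t >= 0" for m t x
  using that by (fastforce simp: distrib_right intro: order_trans)
 moreover have "sqrt (K / c) + 1 >= 1" using K c by simp
 ultimately show ?thesis by blast
qed

definition M :: real where "M = (SOME M. M >= 1 & (\<forall>m t x. t >= 0 --> norm (S m t x) <= M * exp (\<omega> * t) * norm x))"

definition G :: "real => real" where "G t = M * exp (\<omega> * t)"

lemma S_bound: "t >= 0 ==> norm (S m t x) <= G t * norm x" and G_ge_1: "t >= 0 ==> 1 <= G t"
 and G_mono: "s <= t ==> G s <= G t"
proof -
 have M: "M >= 1 & (\<forall>m t x. t >= 0 --> norm (S m t x) <= M * exp (\<omega> * t) * norm x)"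
  unfolding M_def using S_growth by (rule someI_ex)
 show "t >= 0 ==> norm (S m t x) <= G t * norm x" using M by (simp add: G_def)
 show "s <= t ==> G s <= G t" unfolding G_def using M \<omega> by (intro mult_left_mono) (auto intro: mult_left_mono)
 show "t >= 0 ==> 1 <= G t" unfolding G_def using M \<omega> mult_mono[of 1 M 1 "exp (\<omega> * t)"] by simp
qed

lemma S_bound': "0 <= s ==> s <= t ==> norm (S m s x) <= G t * norm x"
 using S_bound[of s m x] mult_right_mono[OF G_mono[of s t], of "norm x"] by simp

text \<open>
The path \<open>s \<mapsto> exp (s * B m) * exp ((t - s) * B l)\<close> joins the two
exponentials; its derivative contains the factor \<open>B m - B l\<close>, since the operators
commute.
\<close>

lemma S_difference:
 assumes t: "t >= 0"
 shows "norm (S m t x - S l t x) <= G t * (G t * norm (app (B m) x - app (B l) x)) * t"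
proof -
 define D where "D = B m - B l"
 define f where "f s = app (exp (s *\<^sub>R B m) * exp ((t - s) *\<^sub>R B l)) x" for s
 have D: "D * B l = B l * D" by (simp add: D_def algebra_simps BB[of m l])
 have split: "exp (s *\<^sub>R B m) * exp ((t - s) *\<^sub>R B l) = exp (s *\<^sub>R D) * exp (t *\<^sub>R B l)" for s
 proof -
  have "exp (s *\<^sub>R B m) * exp ((t - s) *\<^sub>R B l) = exp (s *\<^sub>R B m + (t - s) *\<^sub>R B l)"
   by (rule exp_add_commuting[symmetric]) (simp add: BB[of m l])
  also have "s *\<^sub>R B m + (t - s) *\<^sub>R B l = s *\<^sub>R D + t *\<^sub>R B l" by (simp add: D_def algebra_simps)
  also have "exp ... = exp (s *\<^sub>R D) * exp (t *\<^sub>R B l)" by (rule exp_add_commuting) (simp add: D)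
  finally show ?thesis .
 qed
 have f: "f s = app (exp (s *\<^sub>R D)) (app (exp (t *\<^sub>R B l)) x)" for s by (simp add: f_def split app_times)
 have "norm (f t - f 0) <= (G t * (G t * norm (app D x))) * t"
 proof (rule mean_value_bound[OF t])
  fix s assume s: "0 <= s" "s <= t"
  show "(f has_vector_derivative app D (f s)) (at s)" unfolding f by (rule exp_orbit_derivative)
  have Dm: "D * B m = B m * D" by (simp add: D_def algebra_simps BB[of m l])
  have "app D (f s) = app D (S m s (S l (t - s) x))" by (simp add: f_def S_def app_times)
  also have "... = S m s (S l (t - s) (app D x))" by (simp add: S_commute Dm D)
  also have "norm ... <= G t * norm (S l (t - s) (app D x))" by (rule S_bound'[OF s])
  also have "... <= G t * (G t * norm (app D x))" using G_ge_1[OF t] s by (intro mult_left_mono S_bound') auto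
  finally show "norm (app D (f s)) <= G t * (G t * norm (app D x))" .
 qed
 then show ?thesis by (simp add: f_def S_def D_def app.diff_left)
qed

lemma B_converges: "(%m. app (B m) (app (J k) x)) \<longlonglongrightarrow> app (B k) x"
 unfolding graph_B[OF graph_J] by (rule approx)

text \<open>
On the range of \<open>J k\<close> the operators \<open>B m\<close> converge pointwise, and there
\<open>S_difference\<close> gives convergence; the uniform bound extends it to the closure, which
is everything.
\<close>

lemma S_converges:
 assumes t: "t >= 0" shows "convergent (%m. S m t x)"
proof (rule Cauchy_convergent, rule CauchyI)
 fix e :: real assume e: "e > 0"
 have G: "G t >= 1" by (rule G_ge_1[OF t])
 have "\<exists>k. norm (app (J k) x - x) < e / (4 * G t)" using LIMSEQ_D[OF approx[of x], of "e / (4 * G t)"] e G by auto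
 then obtain k where "norm (app (J k) x - x) < e / (4 * G t)" by blast
 then have k: "G t * norm (app (J k) x - x) < e / 4" using G by (simp add: pos_less_divide_eq mult_ac)
 define z where "z = app (J k) x"
 define X where "X = G t * G t * t + 1"
 define e' where "e' = e / (2 * X)"
 have pos: "X > 0" using G t by (simp add: X_def add_nonneg_pos)
 then have "e' > 0" using e by (simp add: e'_def)
 then obtain N where N: "!!m l. m >= N ==> l >= N ==> norm (app (B m) z - app (B l) z) < e'"
  using CauchyD[OF LIMSEQ_imp_Cauchy[OF B_converges[of k x]], of e'] unfolding z_def by blast
 have near: "norm (S m t x - S m t z) < e / 4" for m
  using S_bound[OF t, of m "x - z"] k by (simp add: S_simps z_def norm_minus_commute)
 have "norm (S m t x - S l t x) < e" if "m >= N" "l >= N" for m l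
 proof -
  have "norm (S m t z - S l t z) <= G t * G t * t * norm (app (B m) z - app (B l) z)"
   using S_difference[OF t, of m z l] by (simp add: mult_ac)
  also have "... <= G t * G t * t * e'" using N[OF that] G t by (intro mult_left_mono) auto
  also have "... <= X * e'" using \<open>e' > 0\<close> by (simp add: X_def distrib_right)
  also have "... = e / 2" using pos by (simp add: e'_def)
  finally have mid: "norm (S m t z - S l t z) <= e / 2" .
  have "S m t x - S l t x = (S m t x - S m t z) + (S m t z - S l t z) - (S l t x - S l t z)" by simp
  also have "norm ... <= norm (S m t x - S m t z) + norm (S m t z - S l t z) + norm (S l t x - S l t z)" by norm
  finally show ?thesis using mid near[of m] near[of l] by linarith
 qed
 then show "\<exists>N. \<forall>m\<ge>N. \<forall>l\<ge>N. norm (S m t x - S l t x) < e" by blast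
qed

definition T :: "real => 'a => 'a" where "T t x = lim (%m. S m t x)"

lemma S_tendsto: "t >= 0 ==> (%m. S m t x) \<longlonglongrightarrow> T t x"
 unfolding T_def using S_converges by (simp add: convergent_LIMSEQ_iff)

lemma T_bound: "t >= 0 ==> norm (T t x) <= G t * norm x"
 by (rule LIMSEQ_le_const2[OF tendsto_norm[OF S_tendsto]]) (auto intro: S_bound)

lemma T_add: "t >= 0 ==> T t (x + y) = T t x + T t y"
 by (rule LIMSEQ_unique[OF S_tendsto]) (auto simp: S_simps intro: tendsto_add S_tendsto)

lemma T_zero: "T 0 x = x"
 by (rule LIMSEQ_unique[OF S_tendsto]) (auto simp: S_simps)

lemma T_commute: "t >= 0 ==> (!!m. L * B m = B m * L) ==> T t (app L x) = app L (T t x)"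
 by (rule LIMSEQ_unique[OF S_tendsto]) (auto simp: S_commute intro: app.tendsto S_tendsto)

lemma T_semigroup:
 assumes s: "s >= 0" and t: "t >= 0" shows "T (s + t) x = T s (T t x)"
proof (rule LIMSEQ_unique[OF S_tendsto])
 have "(%m. S m s (S m t x - T t x)) \<longlonglongrightarrow> 0"
 proof (rule Lim_null_comparison)
  show "\<forall>\<^sub>F m in sequentially. norm (S m s (S m t x - T t x)) <= G s * norm (S m t x - T t x)"
   by (intro always_eventually allI S_bound s)
  show "(%m. G s * norm (S m t x - T t x)) \<longlonglongrightarrow> 0"
   using tendsto_mult_right_zero[OF tendsto_norm_zero[OF LIM_zero[OF S_tendsto[OF t, of x]]]] .
 qed
 from tendsto_add[OF this S_tendsto[OF s, of "T t x"]]
 have "(%m. S m s (S m t x)) \<longlonglongrightarrow> T s (T t x)" by (simp add: S_simps)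
 moreover have "S m (s + t) x = S m s (S m t x)" for m
  unfolding S_def app_times[symmetric] scaleR_add_left by (subst exp_add_commuting) simp_all
 ultimately show "(%m. S m (s + t) x) \<longlonglongrightarrow> T s (T t x)" by simp
qed (use s t in simp)

text \<open>
Strong continuity at time 0, uniformly in \<open>m\<close>.
\<close>

lemma S_gap:
 assumes \<epsilon>: "\<epsilon> > 0"
 shows "\<exists>C\<ge>0. \<forall>m s. 0 <= s & s <= 1 --> norm (S m s y - y) <= \<epsilon> + C * s"
proof -
 have G: "G 1 >= 1" by (rule G_ge_1) simp
 have "\<exists>k. norm (app (J k) y - y) < \<epsilon> / (G 1 + 1)" using LIMSEQ_D[OF approx[of y], of "\<epsilon> / (G 1 + 1)"] \<epsilon> G by auto
 then obtain k where "norm (app (J k) y - y) < \<epsilon> / (G 1 + 1)" by blast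
 then have k: "(G 1 + 1) * norm (app (J k) y - y) < \<epsilon>" using G by (simp add: pos_less_divide_eq mult.commute)
 define z where "z = app (J k) y"
 have "Bseq (%m. app (B m) z)" unfolding z_def by (rule convergent_imp_Bseq[OF convergentI[OF B_converges]])
 then obtain K where K: "K > 0" "!!m. norm (app (B m) z) <= K" by (auto elim: BseqE)
 have "norm (S m s y - y) <= \<epsilon> + (G 1 * K) * s" if s: "0 <= s" "s <= 1" for m s
 proof -
  have "norm (S m s z - S m 0 z) <= (G 1 * K) * s"
  proof (rule mean_value_bound[OF s(1) S_derivative])
   fix r assume r: "0 <= r" "r <= s"
   have "norm (app (B m) (S m r z)) = norm (S m r (app (B m) z))" by (simp add: S_commute)
   also have "... <= G 1 * norm (app (B m) z)" by (rule S_bound') (use r s in auto)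
   also have "... <= G 1 * K" using K(2) G by (intro mult_left_mono) auto
   finally show "norm (app (B m) (S m r z)) <= G 1 * K" .
  qed
  then have "norm (S m s z - z) <= (G 1 * K) * s" by (simp add: S_simps)
  moreover have "norm (S m s (y - z)) <= G 1 * norm (y - z)" by (rule S_bound'[OF s])
  moreover have "S m s y - y = S m s (y - z) + (S m s z - z) - (y - z)" by (simp add: S_simps)
  moreover have "norm (S m s (y - z) + (S m s z - z) - (y - z)) <= norm (S m s (y - z)) + norm (S m s z - z) + norm (y - z)" by norm
  ultimately show ?thesis using k by (simp add: z_def norm_minus_commute distrib_right)
 qed
 then show ?thesis using K(1) G by (intro exI[of _ "G 1 * K"]) auto
qed

lemma T_continuous: "((%t. T t x) \<longlongrightarrow> x) (at_right 0)"
proof (rule LIM_zero_cancel, rule tendsto_norm_zero_cancel, rule tendsto_zero_if_gap)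
 fix \<epsilon> :: real assume "\<epsilon> > 0"
 then obtain C where C: "C >= 0" "!!m s. 0 <= s & s <= 1 ==> norm (S m s x - x) <= \<epsilon> + C * s" using S_gap[of \<epsilon> x] by blast
 have "norm (T s x - x) <= \<epsilon> + C * s" if "0 < s & s <= 1" for s
  by (rule LIMSEQ_le_const2[OF tendsto_norm[OF tendsto_diff[OF S_tendsto tendsto_const]]]) (use C(2) that in auto)
 then show "\<exists>C\<ge>0. \<forall>s. 0 < s & s <= 1 --> norm (T s x - x) <= \<epsilon> + C * s" using C(1) by blast
qed simp

text \<open>
The derivative of \<open>S m s x\<close> is \<open>S m s (J m y)\<close>, which differs from
\<open>y\<close> by terms that are small for small \<open>s\<close> and large \<open>m\<close>.
\<close>

lemma T_derivative:
 assumes xy: "graph x y" shows "((%h. (1 / h) *\<^sub>R (T h x - x)) \<longlongrightarrow> y) (at_right 0)"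
proof (rule LIM_zero_cancel, rule tendsto_norm_zero_cancel, rule tendsto_zero_if_gap)
 fix \<epsilon> :: real assume "\<epsilon> > 0"
 then obtain C where C: "C >= 0" "!!m s. 0 <= s & s <= 1 ==> norm (S m s y - y) <= \<epsilon> + C * s" using S_gap[of \<epsilon> y] by blast
 have "norm ((1 / h) *\<^sub>R (T h x - x) - y) <= \<epsilon> + C * h" if h: "0 < h & h <= 1" for h
 proof -
  define r where "r m = norm (app (J m) y - y)" for m
  have r: "r \<longlonglongrightarrow> 0" unfolding r_def using tendsto_norm_zero[OF LIM_zero[OF approx[of y]]] .
  have "norm (S m h x - x - h *\<^sub>R app (J m) y) <= (\<epsilon> + C * h + (G 1 + 1) * r m) * h" for m
  proof -
   define f where "f s = S m s x - s *\<^sub>R app (B m) x" for s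
   have "norm (f h - f 0) <= (\<epsilon> + C * h + (G 1 + 1) * r m) * h"
   proof (rule mean_value_bound)
    fix s assume s: "0 <= s" "s <= h"
    show "(f has_vector_derivative (app (B m) (S m s x) - app (B m) x)) (at s)"
     unfolding f_def by (auto intro!: derivative_eq_intros S_derivative)
    let ?j = "app (J m) y"
    have "app (B m) (S m s x) - app (B m) x = S m s ?j - ?j"
     by (simp add: S_commute[symmetric] graph_B[OF xy])
    also have "... = S m s (?j - y) + (S m s y - y) - (?j - y)" by (simp add: S_simps)
    also have "norm ... <= norm (S m s (?j - y)) + norm (S m s y - y) + norm (?j - y)" by norm
    also have "... <= G 1 * r m + (\<epsilon> + C * s) + r m"
     unfolding r_def using s h by (intro add_mono S_bound' C(2)) auto
    also have "... <= \<epsilon> + C * h + (G 1 + 1) * r m"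
     using mult_left_mono[OF s(2) C(1)] by (simp add: distrib_right)
    finally show "norm (app (B m) (S m s x) - app (B m) x) <= \<epsilon> + C * h + (G 1 + 1) * r m" .
   qed (use h in simp)
   then show ?thesis by (simp add: f_def S_simps graph_B[OF xy] algebra_simps)
  qed
  note b = this
  have "norm (T h x - x - h *\<^sub>R y) <= (\<epsilon> + C * h + (G 1 + 1) * 0) * h"
  proof (rule LIMSEQ_le)
   show "(%m. norm (S m h x - x - h *\<^sub>R app (J m) y)) \<longlonglongrightarrow> norm (T h x - x - h *\<^sub>R y)"
    using h by (intro tendsto_intros S_tendsto approx) simp
   show "(%m. (\<epsilon> + C * h + (G 1 + 1) * r m) * h) \<longlonglongrightarrow> (\<epsilon> + C * h + (G 1 + 1) * 0) * h"
    by (intro tendsto_intros r)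
  qed (use b in blast)
  moreover have "(1 / h) *\<^sub>R (T h x - x) - y = (1 / h) *\<^sub>R (T h x - x - h *\<^sub>R y)" using h by (simp add: scaleR_diff_right)
  ultimately show ?thesis using h by (simp add: pos_divide_le_eq)
 qed
 then show "\<exists>C\<ge>0. \<forall>h. 0 < h & h <= 1 --> norm ((1 / h) *\<^sub>R (T h x - x) - y) <= \<epsilon> + C * h" using C(1) by blast
qed simp

text \<open>
Regularisation maps everything into the domain and commutes with the semigroup, so \<open>J m
y\<close> is the derivative at 0 of the orbit of \<open>J m x\<close>, which is \<open>B m
x\<close>.
\<close>

lemma derivative_in_graph:
 assumes "((%h. (1 / h) *\<^sub>R (T h x - x)) \<longlongrightarrow> y) (at_right 0)" shows "graph x y"
proof (rule graph_closed)
 fix m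
 have "((%h. app (J m) ((1 / h) *\<^sub>R (T h x - x))) \<longlongrightarrow> app (J m) y) (at_right 0)"
  by (intro app.tendsto tendsto_const assms)
 moreover have "\<forall>\<^sub>F h in at_right 0. app (J m) ((1 / h) *\<^sub>R (T h x - x)) = (1 / h) *\<^sub>R (T h (app (J m) x) - app (J m) x)"
  by (auto simp: eventually_at_filter app.diff_right app.scaleR_right T_commute JB intro!: always_eventually)
 ultimately have "((%h. (1 / h) *\<^sub>R (T h (app (J m) x) - app (J m) x)) \<longlongrightarrow> app (J m) y) (at_right 0)"
  by (rule Lim_transform_eventually)
 from tendsto_unique[OF _ T_derivative[OF graph_J] this] show "app (B m) x = app (J m) y" by simp
qed

end

section \<open>The inner product of square-integrable distributions\<close>

lemma measurable_cnj: "f \<in> borel_measurable M ==> (%x. cnj (f x)) \<in> borel_measurable M"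
 by (rule borel_measurable_continuous_on[OF continuous_on_cnj]) (auto intro: continuous_intros)

lemma lp_fun_cnj: "lp_fun M p f ==> lp_fun M p (%x. cnj (f x))"
 by (simp add: lp_fun_def measurable_cnj)

text \<open>
The real part of the \<open>L\<^sup>2\<close> inner product. The real part suffices, because
energies only involve real inner products.
\<close>

definition ip :: "'n::finite tempdist => 'n tempdist => real" where
 "ip u w = Re (LBINT x. (SOME f. represented_by u f) x * cnj ((SOME g. represented_by w g) x))"

lemma ip_eq:
 assumes u: "represented_by u f" and w: "represented_by w g"
 shows "ip u w = Re (LBINT x. f x * cnj (g x))"
proof -
 let ?f = "SOME f. represented_by u f" and ?g = "SOME g. represented_by w g"
 have r: "represented_by u ?f" "represented_by w ?g" by (rule someI[of "represented_by u", OF u], rule someI[of "represented_by w", OF w])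
 have m0: "f \<in> borel_measurable lborel" "?f \<in> borel_measurable lborel" "g \<in> borel_measurable lborel" "?g \<in> borel_measurable lborel"
  using u r w unfolding represented_by_def by blast+
 note m = m0(1,2) measurable_cnj[OF m0(3)] measurable_cnj[OF m0(4)]
 have "AE x in lborel. ?f x * cnj (?g x) = f x * cnj (g x)"
  using represented_by_unique[OF r(1) u] represented_by_unique[OF r(2) w] by eventually_elim simp
 then show ?thesis unfolding ip_def
  by (intro arg_cong[where f = Re] integral_cong_AE borel_measurable_times m)
qed

lemma ip_commute:
 assumes "u \<in> Lp 2" "w \<in> Lp 2" shows "ip u w = ip w u"
proof -
 obtain f g where r: "represented_by u f" "represented_by w g" using LpE[OF assms(1)] LpE[OF assms(2)] by metis
 have "(LBINT x. f x * cnj (g x)) = cnj (LBINT x. g x * cnj (f x))"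
  unfolding Bochner_Integration.integral_cnj[symmetric] by (simp add: mult.commute)
 then show ?thesis by (simp add: ip_eq[OF r] ip_eq[OF r(2,1)])
qed

lemma ip_self:
 assumes "u \<in> Lp 2" shows "ip u u = (Lp_norm 2 u)\<^sup>2"
proof -
 obtain f where f: "represented_by u f" "lp_fun lborel 2 f" using LpE[OF assms] by blast
 have "(LBINT x. f x * cnj (f x)) = (LBINT x. of_real (norm (f x) powr 2))" by (simp add: complex_norm_square[symmetric])
 also have "... = of_real (LBINT x. norm (f x) powr 2)" by (rule integral_complex_of_real)
 also have "(LBINT x. norm (f x) powr 2) = lp_norm lborel 2 f powr 2" by (rule lp_norm_powr[symmetric]) simp
 finally show ?thesis by (simp add: ip_eq[OF f(1) f(1)] Lp_norm_eq[OF f(1)])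
qed

lemma ip_le:
 assumes "u \<in> Lp 2" "w \<in> Lp 2" shows "\<bar>ip u w\<bar> <= Lp_norm 2 u * Lp_norm 2 w"
proof -
 obtain f where f: "represented_by u f" "lp_fun lborel 2 f" using LpE[OF assms(1)] by blast
 obtain g where "represented_by w g" "lp_fun lborel 2 g" using LpE[OF assms(2)] by blast
 note r = f this
 have "\<bar>ip u w\<bar> <= norm (LBINT x. f x * cnj (g x))" unfolding ip_eq[OF r(1,3)] by (rule abs_Re_le_cmod)
 also have "... <= lp_norm lborel 2 f * lp_norm lborel 2 (%x. cnj (g x))" by (intro cauchy_schwarz_L2 lp_fun_cnj r)
 also have "lp_norm lborel 2 (%x. cnj (g x)) = lp_norm lborel 2 g" by (rule lp_norm_cong_norm) simp
 finally show ?thesis by (simp add: Lp_norm_eq[OF r(1)] Lp_norm_eq[OF r(3)])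
qed

lemma ip_linear:
 assumes "u \<in> Lp 2" "v \<in> Lp 2" "w \<in> Lp 2"
 shows "ip (u + v) w = ip u w + ip v w" "ip (u - v) w = ip u w - ip v w" "ip (complex_of_real r *\<^sub>C u) w = r * ip u w"
proof -
 obtain f where f: "represented_by u f" "lp_fun lborel 2 f" using LpE[OF assms(1)] by blast
 obtain g where g: "represented_by v g" "lp_fun lborel 2 g" using LpE[OF assms(2)] by blast
 obtain h where h: "represented_by w h" "lp_fun lborel 2 h" using LpE[OF assms(3)] by blast
 note r = f(1) g(1) h(1) and l = f(2) g(2) h(2)
 note i = cauchy_schwarz_L2(1)[OF l(1) lp_fun_cnj[OF l(3)]] cauchy_schwarz_L2(1)[OF l(2) lp_fun_cnj[OF l(3)]]
 show "ip (u + v) w = ip u w + ip v w" "ip (u - v) w = ip u w - ip v w"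
  unfolding ip_eq[OF represented_by_add[OF r(1,2)] r(3)] ip_eq[OF represented_by_diff[OF r(1,2)] r(3)]
   ip_eq[OF r(1,3)] ip_eq[OF r(2,3)] using i by (simp_all add: ring_distribs)
 have "(LBINT x. (of_real r * f x) * cnj (h x)) = of_real r * (LBINT x. f x * cnj (h x))" by (simp add: mult.assoc)
 then show "ip (complex_of_real r *\<^sub>C u) w = r * ip u w"
  unfolding ip_eq[OF represented_by_scale[OF r(1)] r(3)] ip_eq[OF r(1,3)] by simp
qed

interpretation L2: banach_carrier "Lp 2 :: 'n::finite tempdist set" "Lp_norm 2"
 by (rule banach_carrier_Lp) simp

lemma ip_uminus: "u \<in> Lp 2 ==> w \<in> Lp 2 ==> ip (- u) w = - ip u w"
 using ip_linear(3)[of u u w "-1"] by (simp add: scaleC_minus_one)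

lemma L2_sum_mem: "(!!i. i \<in> I ==> f i \<in> Lp 2) ==> sum f I \<in> Lp 2"
 by (induction I rule: infinite_finite_induct) (auto simp: L2.zero_mem L2.add_mem)

lemma ip_scale: "u \<in> Lp 2 ==> w \<in> Lp 2 ==> ip (complex_of_real r *\<^sub>C u) w = r * ip u w"
 by (rule ip_linear(3))

lemma ip_sum:
 assumes "!!i. i \<in> I ==> f i \<in> Lp 2" "w \<in> Lp 2" shows "ip (sum f I) w = (\<Sum>i\<in>I. ip (f i) w)"
proof -
 have "ip 0 w = 0" using ip_linear(3)[OF L2.zero_mem L2.zero_mem assms(2), of 0] by (simp only: of_real_0 scaleC_zero_left mult_zero_left)
 then show ?thesis using assms(1)
  by (induction I rule: infinite_finite_induct) (auto simp: ip_linear(1) L2_sum_mem assms(2))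
qed

subsection \<open>Convolution operators\<close>

text \<open>
For such kernels the convolution operator is symmetric (\<open>s = 1\<close>) or skew-symmetric
(\<open>s = - 1\<close>); each derivative changes the sign.
\<close>

definition hermitian :: "real => 'n::finite schwartz => bool" where
 "hermitian s k \<longleftrightarrow> (\<forall>y. cnj (schwartz_fun k (- y)) = of_real s * schwartz_fun k y)"

lemma hermitian_deriv:
 assumes k: "hermitian s k" shows "hermitian (- s) (schwartz_deriv i k)"
 unfolding hermitian_def
proof
 fix y
 define f where "f = schwartz_fun k"
 note d = schwartz_has_derivative[OF is_schwartz_schwartz_fun[of k], folded f_def]
 have eq: "(%y. cnj (f (- y))) = (%y. of_real s * f y)" using k by (simp add: hermitian_def f_def fun_eq_iff)
 have 1: "partial_deriv i (%y. of_real s * f y) y = of_real s * (\<Sum>j\<in>UNIV. axis i 1 $ j *\<^sub>R partial_deriv j f y)"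
  by (rule partial_derivI) (rule has_derivative_mult_right[OF d])
 have "((%y. f (- y)) has_derivative (%h. \<Sum>j\<in>UNIV. (- h) $ j *\<^sub>R partial_deriv j f (- y))) (at y)"
  by (rule has_derivative_compose[OF _ d]) (auto intro: derivative_eq_intros)
 then have "((%y. cnj (f (- y))) has_derivative (%h. cnj (\<Sum>j\<in>UNIV. (- h) $ j *\<^sub>R partial_deriv j f (- y)))) (at y)"
  by (rule bounded_linear.has_derivative[OF bounded_linear_cnj])
 from partial_derivI[OF this, of i] have "partial_deriv i (%y. cnj (f (- y))) y = cnj (- (\<Sum>j\<in>UNIV. axis i 1 $ j *\<^sub>R partial_deriv j f (- y)))"
  by (simp add: sum_negf[symmetric])
 then have "- cnj (partial_deriv i f (- y)) = of_real s * partial_deriv i f y" using 1 unfolding eq sum_axis_scaleR by simp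
 then have "cnj (partial_deriv i f (- y)) = of_real (- s) * partial_deriv i f y" by (metis minus_minus mult_minus_left of_real_minus)
 then show "cnj (schwartz_fun (schwartz_deriv i k) (- y)) = of_real (- s) * schwartz_fun (schwartz_deriv i k) y"
  by (simp add: schwartz_deriv.rep_eq f_def)
qed

lemma dist_conv_L2:
 assumes "u \<in> Lp 2"
 shows "dist_conv k u \<in> Lp 2" "Lp_norm 2 (dist_conv k u) <= (LBINT y. norm (schwartz_fun k y)) * Lp_norm 2 u"
proof -
 obtain f where f: "represented_by u f" "lp_fun lborel 2 f" using LpE[OF assms] by blast
 note c = represented_by_dist_conv[OF f, of k] and n = convolution_L2[OF f(2) is_schwartz_schwartz_fun, of k]
 show "dist_conv k u \<in> Lp 2" by (rule LpI[OF c n(1)])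
 show "Lp_norm 2 (dist_conv k u) <= (LBINT y. norm (schwartz_fun k y)) * Lp_norm 2 u"
  unfolding Lp_norm_eq[OF c] Lp_norm_eq[OF f(1)] by (rule n(2))
qed

lemma ip_dist_conv:
 assumes u: "u \<in> Lp 2" and w: "w \<in> Lp 2" and k: "hermitian s k"
 shows "ip (dist_conv k u) w = s * ip u (dist_conv k w)"
proof -
 obtain f where f: "represented_by u f" "lp_fun lborel 2 f" using LpE[OF u] by blast
 obtain g where "represented_by w g" "lp_fun lborel 2 g" using LpE[OF w] by blast
 note r = f this
 let ?k = "schwartz_fun k"
 have corr: "correlation ?k (%x. cnj (g x)) x = of_real s * cnj (convolution ?k g x)" for x
 proof -
  have "correlation ?k (%x. cnj (g x)) x = (LBINT y. ?k (- y) * cnj (g (x - y)))"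
  proof -
   have [measurable]: "g \<in> borel_measurable borel" "?k \<in> borel_measurable borel"
    using r(4) schwartz_measurable[OF is_schwartz_schwartz_fun] by (auto simp: lp_fun_def)
   have "(%y. ?k y * cnj (g (x + y))) \<in> borel_measurable borel" by (intro borel_measurable_times measurable_cnj) measurable
   then show ?thesis unfolding correlation_def using integral_shift[of "-1" "%y. ?k y * cnj (g (x + y))" 0] by simp
  qed
  also have "... = (LBINT y. cnj (of_real s * (?k y * g (x - y))))"
  proof (rule Bochner_Integration.integral_cong[OF refl])
   fix y
   have "?k (- y) = cnj (of_real s * ?k y)" using k unfolding hermitian_def by (metis complex_cnj_cnj)
   then show "?k (- y) * cnj (g (x - y)) = cnj (of_real s * (?k y * g (x - y)))" by simp
  qed
  also have "... = of_real s * cnj (convolution ?k g x)" unfolding Bochner_Integration.integral_cnj convolution_def by simp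
  finally show ?thesis .
 qed
 have "ip (dist_conv k u) w = Re (LBINT x. f x * correlation ?k (%x. cnj (g x)) x)"
  unfolding ip_eq[OF represented_by_dist_conv[OF r(1,2)] r(3)]
  by (subst convolution_adjoint[OF r(2) lp_fun_cnj[OF r(4)] is_schwartz_schwartz_fun]) simp
 also have "(LBINT x. f x * correlation ?k (%x. cnj (g x)) x) = of_real s * (LBINT x. f x * cnj (convolution ?k g x))"
  unfolding corr by (simp add: mult.left_commute)
 finally show ?thesis unfolding ip_eq[OF r(1) represented_by_dist_conv[OF r(3,4)]] by simp
qed

lemma foldr_dist_deriv_conv: "foldr dist_deriv is (dist_conv k u) = dist_conv (foldr schwartz_deriv is k) u"
 by (induction "is") (simp_all add: dist_deriv_conv dist_conv_deriv_kernel)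

lemma foldr_dist_deriv_conv_inner: "foldr dist_deriv is (dist_conv k u) = dist_conv k (foldr dist_deriv is u)"
 by (induction "is") (simp_all add: dist_deriv_conv)

text \<open>
Derivatives commute behind a convolution, since one of them may be moved to the kernel and the
other one past it.
\<close>

lemma dist_conv_deriv_commute: "dist_conv k (dist_deriv i (dist_deriv j u)) = dist_conv k (dist_deriv j (dist_deriv i u))"
 by (metis dist_conv_deriv_kernel dist_deriv_conv)

definition kern :: "nat => 'n::finite schwartz" where
 "kern m = Schwartz (%x. of_real (mollifier m x))"

lemma kern: "schwartz_fun (kern m) = (%x. of_real (mollifier m x))"
 unfolding kern_def by (rule Schwartz_inverse) (simp add: is_schwartz_mollifier)

lemma hermitian_kern: "hermitian 1 (kern m)"
 by (simp add: hermitian_def kern mollifier_even)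

abbreviation moll :: "nat => 'n::finite tempdist => 'n tempdist" where
 "moll m \<equiv> dist_conv (kern m)"

lemma moll_contraction: "u \<in> Lp 2 ==> Lp_norm 2 (moll m u) <= Lp_norm 2 u"
 using dist_conv_L2(2)[of u "kern m"] by (simp add: kern mollifier_nonneg integral_mollifier)

lemma moll_tendsto:
 assumes "u \<in> Lp 2" shows "(%m. Lp_norm 2 (moll m u - u)) \<longlonglongrightarrow> 0"
proof -
 obtain f where f: "represented_by u f" "lp_fun lborel 2 f" using LpE[OF assms] by blast
 show ?thesis using mollification_L2[OF f(2)]
  by (simp add: Lp_norm_eq[OF represented_by_diff[OF represented_by_dist_conv[OF f] f(1)]] kern)
qed

lemma moll_deriv_mem:
 assumes "u \<in> Lp 2"
 shows "moll m u \<in> Lp 2" "moll m (dist_deriv i u) \<in> Lp 2" "moll m (dist_deriv i (dist_deriv j u)) \<in> Lp 2"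
  "moll m (dist_deriv i (dist_deriv i (dist_deriv j (dist_deriv j u)))) \<in> Lp 2"
 using dist_conv_L2(1)[OF assms] by (simp_all only: dist_conv_deriv_kernel[symmetric])

lemma moll_adjoint:
 assumes "u \<in> Lp 2" "w \<in> Lp 2"
 shows "ip (moll m u) w = ip u (moll m w)" "ip (moll m (dist_deriv i u)) w = - ip u (moll m (dist_deriv i w))"
  "ip (moll m (dist_deriv i (dist_deriv j u))) w = ip u (moll m (dist_deriv i (dist_deriv j w)))"
 using ip_dist_conv[OF assms hermitian_kern, of m] ip_dist_conv[OF assms hermitian_deriv[OF hermitian_kern], of i m]
  ip_dist_conv[OF assms hermitian_deriv[OF hermitian_deriv[OF hermitian_kern]], of j i m]
 by (simp_all add: dist_conv_deriv_kernel)

subsection \<open>The regularised operator\<close>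

definition moll_state :: "nat => 'n::finite state => 'n state" where
 "moll_state m = (%(u, v, \<theta>, q). (moll m u, moll m v, moll m \<theta>, \<chi> i. moll m (q $ i)))"

lemma state_linear:
 fixes U V :: "'n::finite state"
 shows "moll_state m (U + V) = moll_state m U + moll_state m V" "moll_state m (c *\<^sub>C U) = c *\<^sub>C moll_state m U"
  "plate_operator \<tau> (U + V) = plate_operator \<tau> U + plate_operator \<tau> V"
  "plate_operator \<tau> (c *\<^sub>C U) = c *\<^sub>C plate_operator \<tau> U"
 by (auto simp: moll_state_def plate_operator_def case_prod_unfold scaleC_prod_def prod_eq_iff vec_eq_iff
   dist_conv_linear dist_laplacian_linear dist_div_linear dist_grad_def dist_deriv_linear scaleC_vec_nth
   scaleC_add_right scaleC_diff_right scaleC_scaleC scaleC_minus_right mult.commute)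

lemma plate_operator_moll: "plate_operator \<tau> (moll_state m U) = moll_state m (plate_operator \<tau> (U :: 'n::finite state))"
 by (auto simp: moll_state_def plate_operator_def case_prod_unfold prod_eq_iff vec_eq_iff dist_laplacian_def dist_div_def
   dist_grad_def dist_deriv_conv dist_conv_linear dist_conv_sum dist_deriv_commute_sum scaleC_vec_nth)

lemma moll_state_commute: "moll_state m (moll_state l U) = moll_state l (moll_state m (U :: 'n::finite state))"
 by (auto simp: moll_state_def case_prod_unfold prod_eq_iff vec_eq_iff dist_conv_commute)

text \<open>
The full Hessian enters, not only the Laplacian; the weight \<open>\<tau>\<close> of the flux
balances the coupling \<open>- \<nabla> \<theta> / \<tau>\<close> against \<open>- div q\<close>.
\<close>

definition energy :: "real => 'n::finite state => 'n state => real" where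
 "energy \<tau> = (%(u, v, \<theta>, q) (u', v', \<theta>', q').
   (\<Sum>is\<in>words_upto 2. ip (foldr dist_deriv is u) (foldr dist_deriv is u'))
    + ip v v' + ip \<theta> \<theta>' + \<tau> * (\<Sum>i\<in>UNIV. ip (q $ i) (q' $ i)))"

lemma sum_words_2:
 fixes f :: "'n::finite list => real"
 shows "(\<Sum>is\<in>words_upto 2. f is) = f [] + (\<Sum>i\<in>UNIV. f [i]) + (\<Sum>i\<in>UNIV. \<Sum>j\<in>UNIV. f [i, j])"
proof -
 have eq: "(words_upto 2 :: 'n list set) = insert [] (range (%i. [i]) \<union> (%(i, j). [i, j]) ` (UNIV \<times> UNIV))"
  by (auto simp: numeral_2_eq_2 le_Suc_eq length_Suc_conv)
 have "(\<Sum>is\<in>words_upto 2. f is) = f [] + (\<Sum>is\<in>range (%i. [i]) \<union> (%(i, j). [i, j]) ` (UNIV \<times> UNIV). f is)"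
  unfolding eq by (subst sum.insert) auto
 also have "(\<Sum>is\<in>range (%i. [i]) \<union> (%(i, j). [i, j]) ` (UNIV \<times> UNIV). f is)
   = (\<Sum>is\<in>range (%i. [i]). f is) + (\<Sum>is\<in>(%(i, j). [i, j]) ` (UNIV \<times> UNIV). f is)"
  by (rule sum.union_disjoint) auto
 also have "(\<Sum>is\<in>range (%i. [i]). f is) = (\<Sum>i\<in>UNIV. f [i])" by (subst sum.reindex) (auto simp: inj_on_def)
 also have "(\<Sum>is\<in>(%(i, j). [i, j]) ` (UNIV \<times> UNIV). f is) = (\<Sum>i\<in>UNIV. \<Sum>j\<in>UNIV. f [i, j])"
  by (subst sum.reindex) (auto simp: inj_on_def sum.cartesian_product case_prod_unfold)
 finally show ?thesis by simp
qed

lemma energy_controls: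
 fixes q :: "'n::finite tempdist^'n"
 assumes \<tau>: "\<tau> > 0" and U: "(u, v, \<theta>, q) \<in> (plate_space 2 :: 'n state set)"
 defines "e \<equiv> energy \<tau> (u, v, \<theta>, q) (u, v, \<theta>, q)"
 shows "e >= 0" "length is <= 2 ==> (Lp_norm 2 (foldr dist_deriv is u))\<^sup>2 <= e" "(Lp_norm 2 v)\<^sup>2 <= e"
  "(Lp_norm 2 \<theta>)\<^sup>2 <= e" "\<tau> * (\<Sum>i\<in>UNIV. (Lp_norm 2 (q $ i))\<^sup>2) <= e" "\<tau> * (Lp_norm 2 (q $ i))\<^sup>2 <= e"
proof -
 have m: "!!is. length is <= 2 ==> foldr dist_deriv is u \<in> Lp 2" "v \<in> Lp 2" "\<theta> \<in> Lp 2" "!!i. q $ i \<in> Lp 2"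
  using U by (auto simp: plate_space_def intro: SobolevD Lp_vec_components(1))
 define a where "a = (\<Sum>is\<in>words_upto 2. (Lp_norm 2 (foldr dist_deriv is u))\<^sup>2)"
 define b where "b = (\<Sum>i\<in>UNIV. (Lp_norm 2 (q $ i))\<^sup>2)"
 have e: "e = a + (Lp_norm 2 v)\<^sup>2 + (Lp_norm 2 \<theta>)\<^sup>2 + \<tau> * b"
  unfolding e_def energy_def a_def b_def using m by (simp add: ip_self)
 have ab: "a >= 0" "b >= 0" by (auto simp: a_def b_def intro: sum_nonneg)
 then have \<tau>b: "\<tau> * b >= 0" using \<tau> by simp
 have sq: "(Lp_norm 2 v)\<^sup>2 >= 0" "(Lp_norm 2 \<theta>)\<^sup>2 >= 0" by simp_all
 show "e >= 0" "(Lp_norm 2 v)\<^sup>2 <= e" "(Lp_norm 2 \<theta>)\<^sup>2 <= e" using e ab \<tau>b sq by linarith+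
 show "\<tau> * (\<Sum>i\<in>UNIV. (Lp_norm 2 (q $ i))\<^sup>2) <= e" unfolding b_def[symmetric] using e ab \<tau>b sq by linarith
 have "(Lp_norm 2 (q $ i))\<^sup>2 <= b" unfolding b_def by (rule member_le_sum) auto
 then have "\<tau> * (Lp_norm 2 (q $ i))\<^sup>2 <= \<tau> * b" using \<tau> by (intro mult_left_mono) auto
 then show "\<tau> * (Lp_norm 2 (q $ i))\<^sup>2 <= e" using e ab sq by linarith
 assume "length is <= 2"
 then have "(Lp_norm 2 (foldr dist_deriv is u))\<^sup>2 <= a" unfolding a_def by (intro member_le_sum) (auto simp: finite_words_upto)
 then show "(Lp_norm 2 (foldr dist_deriv is u))\<^sup>2 <= e" using e \<tau>b sq by linarith
qed

text \<open>
The Hessian term cancels against the pairing of the bilaplacian of \<open>u\<close> with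
\<open>v\<close>, the two Laplacians of \<open>\<theta>\<close> and \<open>v\<close> cancel by
symmetry, and the divergence of \<open>q\<close> cancels against the gradient of
\<open>\<theta>\<close> by skew-symmetry. The damping of \<open>q\<close> and the lower
derivatives of \<open>u\<close> remain; since the mollifier is a contraction, they are bounded by
multiples of the energy independent of \<open>m\<close>.
\<close>

theorem energy_dissipative:
 fixes U :: "'n::finite state"
 assumes \<tau>: "\<tau> > 0" and U: "U \<in> plate_space 2"
 shows "energy \<tau> (plate_operator \<tau> (moll_state m U)) U <= (1 + real CARD('n) + 1 / \<tau>) * energy \<tau> U U"
proof -
 obtain u v \<theta> q where UU: "U = (u, v, \<theta>, q)" by (metis prod.exhaust)
 have mem: "!!is. length is <= 2 ==> foldr dist_deriv is u \<in> Lp 2" "v \<in> Lp 2" "\<theta> \<in> Lp 2" "!!i. q $ i \<in> Lp 2"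
  using U unfolding UU by (auto simp: plate_space_def intro: SobolevD Lp_vec_components(1))
 have um: "u \<in> Lp 2" "dist_deriv i u \<in> Lp 2" "dist_deriv i (dist_deriv j u) \<in> Lp 2" for i j
  using mem(1)[of "[]"] mem(1)[of "[i]"] mem(1)[of "[i, j]"] by auto
 define e where "e = energy \<tau> U U"
 note ec = energy_controls[OF \<tau> U[unfolded UU], folded e_def[unfolded UU]]
 have ev: "e = energy \<tau> (u, v, \<theta>, q) (u, v, \<theta>, q)" by (simp add: e_def UU)
 note ec = energy_controls[OF \<tau> U[unfolded UU], folded ev]
 have e0: "e >= 0" by (rule ec(1))
 have v: "Lp_norm 2 v <= sqrt e" by (rule real_le_rsqrt[OF ec(3)])
 have du: "Lp_norm 2 (foldr dist_deriv is u) <= sqrt e" if "length is <= 2" for "is"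
  by (rule real_le_rsqrt[OF ec(2)[OF that]])
 have "ip (moll m v) u <= Lp_norm 2 (moll m v) * Lp_norm 2 u" using ip_le[OF moll_deriv_mem(1)[OF mem(2)] um(1), of m] by linarith
 also have "... <= sqrt e * sqrt e" using du[of "[]"] v moll_contraction[OF mem(2), of m] e0 by (intro mult_mono) auto
 finally have t0: "ip (moll m v) u <= e" using e0 by simp
 have "ip (moll m (dist_deriv i v)) (dist_deriv i u) <= e" for i
 proof -
  have "ip (moll m (dist_deriv i v)) (dist_deriv i u) = - ip v (moll m (dist_deriv i (dist_deriv i u)))"
   by (rule moll_adjoint(2)[OF mem(2) um(2)])
  also have "... <= Lp_norm 2 v * Lp_norm 2 (moll m (dist_deriv i (dist_deriv i u)))"
   using ip_le[OF mem(2) moll_deriv_mem(1)[OF um(3)[of i i]], of m] by linarith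
  also have "... <= sqrt e * sqrt e" using du[of "[i, i]"] v moll_contraction[OF um(3)[of i i], of m] e0 by (intro mult_mono) auto
  finally show ?thesis using e0 by simp
 qed
 then have t1: "(\<Sum>i\<in>UNIV. ip (moll m (dist_deriv i v)) (dist_deriv i u)) <= real CARD('n) * e"
  using sum_bounded_above[of "UNIV :: 'n set" "%i. ip (moll m (dist_deriv i v)) (dist_deriv i u)" e] by simp
 let ?bi = "\<Sum>i\<in>UNIV. \<Sum>j\<in>UNIV. moll m (dist_deriv i (dist_deriv i (dist_deriv j (dist_deriv j u))))"
 have bi_mem: "?bi \<in> Lp 2" by (intro L2_sum_mem moll_deriv_mem um)
 have t2: "(\<Sum>i\<in>UNIV. \<Sum>j\<in>UNIV. ip (moll m (dist_deriv i (dist_deriv j v))) (dist_deriv i (dist_deriv j u))) = ip ?bi v"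
 proof -
  have "ip (moll m (dist_deriv i (dist_deriv j v))) (dist_deriv i (dist_deriv j u))
    = ip (moll m (dist_deriv i (dist_deriv i (dist_deriv j (dist_deriv j u))))) v" for i j
  proof -
   have "moll m (dist_deriv i (dist_deriv j (dist_deriv i (dist_deriv j u)))) = dist_deriv i (moll m (dist_deriv j (dist_deriv i (dist_deriv j u))))"
    by (simp only: dist_deriv_conv)
   also have "... = moll m (dist_deriv i (dist_deriv i (dist_deriv j (dist_deriv j u))))"
    unfolding dist_conv_deriv_commute[of _ j i] by (simp only: dist_deriv_conv)
   finally have sw: "moll m (dist_deriv i (dist_deriv j (dist_deriv i (dist_deriv j u)))) = moll m (dist_deriv i (dist_deriv i (dist_deriv j (dist_deriv j u))))" .
   show ?thesis unfolding moll_adjoint(3)[OF mem(2) um(3)] sw by (rule ip_commute[OF mem(2) moll_deriv_mem(4)[OF um(1)]])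
  qed
  then show ?thesis by (simp add: ip_sum L2_sum_mem moll_deriv_mem um mem)
 qed
 have lap: "dist_laplacian (moll m w) = (\<Sum>i\<in>UNIV. moll m (dist_deriv i (dist_deriv i w)))" for w :: "'n tempdist"
  by (simp add: dist_laplacian_def dist_deriv_conv)
 have bilap: "dist_laplacian (dist_laplacian (moll m u)) = ?bi"
  by (simp add: dist_laplacian_def dist_deriv_conv dist_deriv_commute_sum)
 let ?l = "%w. \<Sum>i\<in>UNIV. moll m (dist_deriv i (dist_deriv i w))"
 have lm: "?l w \<in> Lp 2" if "w \<in> Lp 2" for w :: "'n tempdist" by (intro L2_sum_mem moll_deriv_mem that)
 have l_sym: "ip (?l \<theta>) v = ip (?l v) \<theta>"
  by (simp add: ip_sum moll_deriv_mem mem moll_adjoint(3) ip_commute[OF mem(3) moll_deriv_mem(3)[OF mem(2)]])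
 let ?d = "\<Sum>i\<in>UNIV. moll m (dist_deriv i (q $ i))"
 have dm: "?d \<in> Lp 2" by (intro L2_sum_mem moll_deriv_mem mem)
 have v_part: "ip (- dist_laplacian (dist_laplacian (moll m u)) - dist_laplacian (moll m \<theta>)) v = - ip ?bi v - ip (?l v) \<theta>"
  unfolding bilap unfolding lap by (simp add: ip_linear(2) ip_uminus L2.uminus_mem bi_mem lm mem l_sym)
 have \<theta>_part: "ip (dist_laplacian (moll m v) - dist_div (\<chi> i. moll m (q $ i))) \<theta> = ip (?l v) \<theta> - ip ?d \<theta>"
  unfolding lap by (simp add: dist_div_def dist_deriv_conv ip_linear(2) lm dm mem)
 have q_part: "\<tau> * (\<Sum>i\<in>UNIV. ip ((- (complex_of_real (1 / \<tau>) *\<^sub>C dist_grad (moll m \<theta>)) - complex_of_real (1 / \<tau>) *\<^sub>C (\<chi> i. moll m (q $ i))) $ i) (q $ i))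
   = ip ?d \<theta> - (\<Sum>i\<in>UNIV. ip (moll m (q $ i)) (q $ i))"
 proof -
  have "\<tau> * ip ((- (complex_of_real (1 / \<tau>) *\<^sub>C dist_grad (moll m \<theta>)) - complex_of_real (1 / \<tau>) *\<^sub>C (\<chi> i. moll m (q $ i))) $ i) (q $ i)
    = ip (moll m (dist_deriv i (q $ i))) \<theta> - ip (moll m (q $ i)) (q $ i)" for i
  proof -
   have "(- (complex_of_real (1 / \<tau>) *\<^sub>C dist_grad (moll m \<theta>)) - complex_of_real (1 / \<tau>) *\<^sub>C (\<chi> i. moll m (q $ i))) $ i
     = - (complex_of_real (1 / \<tau>) *\<^sub>C moll m (dist_deriv i \<theta>)) - complex_of_real (1 / \<tau>) *\<^sub>C moll m (q $ i)"
    by (simp only: vector_minus_component vector_uminus_component scaleC_vec_nth dist_grad_def vec_lambda_beta dist_deriv_conv)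
   also have "ip ... (q $ i) = - (1 / \<tau>) * ip (moll m (dist_deriv i \<theta>)) (q $ i) - (1 / \<tau>) * ip (moll m (q $ i)) (q $ i)"
    by (simp only: ip_linear(2) ip_scale ip_uminus L2.uminus_mem L2.scale_mem moll_deriv_mem mem mult_minus_left)
   also have "ip (moll m (dist_deriv i \<theta>)) (q $ i) = - ip (moll m (dist_deriv i (q $ i))) \<theta>"
    unfolding moll_adjoint(2)[OF mem(3,4)] by (simp add: ip_commute[OF mem(3) moll_deriv_mem(2)[OF mem(4)]])
   finally show ?thesis using \<tau> by (simp add: field_simps)
  qed
  then show ?thesis by (simp add: sum_distrib_left ip_sum moll_deriv_mem mem sum_subtractf)
 qed
 have t3: "- (\<Sum>i\<in>UNIV. ip (moll m (q $ i)) (q $ i)) <= (1 / \<tau>) * e"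
 proof -
  have "- ip (moll m (q $ i)) (q $ i) <= (Lp_norm 2 (q $ i))\<^sup>2" for i
  proof -
   have "- ip (moll m (q $ i)) (q $ i) <= Lp_norm 2 (moll m (q $ i)) * Lp_norm 2 (q $ i)"
    using ip_le[OF moll_deriv_mem(1)[OF mem(4)] mem(4), of m i i] by linarith
   also have "... <= Lp_norm 2 (q $ i) * Lp_norm 2 (q $ i)" by (intro mult_right_mono moll_contraction mem) simp
   finally show ?thesis by (simp add: power2_eq_square)
  qed
  then have "- (\<Sum>i\<in>UNIV. ip (moll m (q $ i)) (q $ i)) <= (\<Sum>i\<in>UNIV. (Lp_norm 2 (q $ i))\<^sup>2)"
   unfolding sum_negf[symmetric] by (rule sum_mono)
  also have "... <= (1 / \<tau>) * e" using ec(5) \<tau> by (simp add: field_simps)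
  finally show ?thesis .
 qed
 have "energy \<tau> (plate_operator \<tau> (moll_state m U)) U
   = ip (moll m v) u + (\<Sum>i\<in>UNIV. ip (moll m (dist_deriv i v)) (dist_deriv i u)) + ip ?bi v
    + (- ip ?bi v - ip (?l v) \<theta>) + (ip (?l v) \<theta> - ip ?d \<theta>) + (ip ?d \<theta> - (\<Sum>i\<in>UNIV. ip (moll m (q $ i)) (q $ i)))"
  unfolding UU moll_state_def plate_operator_def energy_def prod.case sum_words_2 v_part \<theta>_part q_part t2[symmetric]
  by (simp add: dist_deriv_conv)
 also have "... <= (1 + real CARD('n) + 1 / \<tau>) * e" using t0 t1 t3 unfolding distrib_right by linarith
 finally show ?thesis by (simp only: e_def)
qed

section \<open>Generation on the energy space\<close>

interpretation plate: banach_carrier "plate_space 2 :: 'n::finite state set" "plate_norm 2"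
 by (rule banach_carrier_plate) simp

lemma plate_components:
 fixes U :: "'n::finite state"
 assumes "U \<in> plate_space 2"
 shows "length is <= 2 ==> foldr dist_deriv is (fst U) \<in> Lp 2" "fst (snd U) \<in> Lp 2" "fst (snd (snd U)) \<in> Lp 2"
   "snd (snd (snd U)) $ i \<in> Lp 2"
  and "length is <= 2 ==> Lp_norm 2 (foldr dist_deriv is (fst U)) <= plate_norm 2 U" "Lp_norm 2 (fst (snd U)) <= plate_norm 2 U"
   "Lp_norm 2 (fst (snd (snd U))) <= plate_norm 2 U" "Lp_norm 2 (snd (snd (snd U)) $ i) <= plate_norm 2 U"
proof -
 obtain u v \<theta> q where U: "U = (u, v, \<theta>, q)" by (metis prod.exhaust)
 have m: "u \<in> Sobolev 2 2" "v \<in> Lp 2" "\<theta> \<in> Lp 2" "q \<in> Lp_vec 2" using assms by (auto simp: U plate_space_def)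
 have n: "0 <= Sobolev_norm 2 2 u" by (simp add: Sobolev_norm_def)
 show "fst (snd U) \<in> Lp 2" "fst (snd (snd U)) \<in> Lp 2" "Lp_norm 2 (fst (snd U)) <= plate_norm 2 U"
  "Lp_norm 2 (fst (snd (snd U))) <= plate_norm 2 U" using m n by (simp_all add: U plate_norm_def)
 show "snd (snd (snd U)) $ i \<in> Lp 2" unfolding U using Lp_vec_components(1)[OF m(4)] by simp
 have "Lp_norm 2 (q $ i) <= Lp_vec_norm 2 q" by (rule Lp_vec_components(2)[OF m(4)]) simp
 then show "Lp_norm 2 (snd (snd (snd U)) $ i) <= plate_norm 2 U" using n Lp_norm_nonneg[of 2 v] Lp_norm_nonneg[of 2 \<theta>] unfolding U plate_norm_def prod.case fst_conv snd_conv by linarith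
 assume l: "length is <= 2"
 then show "foldr dist_deriv is (fst U) \<in> Lp 2" using SobolevD[OF m(1)] by (simp add: U)
 have "Lp_norm 2 (foldr dist_deriv is u) <= Sobolev_norm 2 2 u" by (rule Sobolev_norm_ge[OF l]) simp
 then show "Lp_norm 2 (foldr dist_deriv is (fst U)) <= plate_norm 2 U"
  using Lp_norm_nonneg[of 2 v] Lp_norm_nonneg[of 2 \<theta>] Lp_vec_norm_nonneg[of 2 q] unfolding U plate_norm_def prod.case fst_conv by linarith
qed

subsection \<open>Boundedness of the regularised operator\<close>

text \<open>
Boundedness relative to the norm of the state, with the constant hidden, so that boundedness of
composite maps follows by closure rules.
\<close>

definition dominated :: "('n::finite state => real) => bool" where
 "dominated N \<longleftrightarrow> (\<exists>C. \<forall>U\<in>plate_space 2. N U <= C * plate_norm 2 U)"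

lemma dominatedI: "(!!U. U \<in> plate_space 2 ==> N U <= C * plate_norm 2 U) ==> dominated N"
 unfolding dominated_def by blast

lemma dominated_mono: "dominated N ==> (!!U. U \<in> plate_space 2 ==> N' U <= N U) ==> dominated N'"
 unfolding dominated_def by (meson order_trans)

lemma dominated_add:
 assumes "dominated N" "dominated N'" shows "dominated (%U. N U + N' U)"
proof -
 obtain C C' where "\<forall>U\<in>plate_space 2. N U <= C * plate_norm 2 U" "\<forall>U\<in>plate_space 2. N' U <= C' * plate_norm 2 U"
  using assms unfolding dominated_def by blast
 then show ?thesis by (intro dominatedI[of _ "C + C'"]) (simp add: distrib_right add_mono)
qed

lemma dominated_scale:
 assumes "dominated N" "c >= 0" shows "dominated (%U. c * N U)"
proof -
 obtain C where "\<forall>U\<in>plate_space 2. N U <= C * plate_norm 2 U" using assms unfolding dominated_def by blast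
 then show ?thesis using assms(2) by (intro dominatedI[of _ "c * C"]) (simp add: mult.assoc mult_left_mono)
qed

lemma dominated_sum: "(!!i. i \<in> I ==> dominated (N i)) ==> dominated (%U. \<Sum>i\<in>I. N i U)"
 by (induction I rule: infinite_finite_induct) (auto intro: dominated_add dominatedI[where C = 0])

definition bdd :: "('n::finite state => 'n tempdist) => bool" where
 "bdd L \<longleftrightarrow> (\<forall>U\<in>plate_space 2. L U \<in> Lp 2) & dominated (%U. Lp_norm 2 (L U))"

lemma bddD: "bdd L ==> U \<in> plate_space 2 ==> L U \<in> Lp 2" "bdd L ==> dominated (%U. Lp_norm 2 (L U))"
 by (auto simp: bdd_def)

lemma bddI: "(!!U. U \<in> plate_space 2 ==> L U \<in> Lp 2) ==> dominated N
  ==> (!!U. U \<in> plate_space 2 ==> Lp_norm 2 (L U) <= N U) ==> bdd L"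
 unfolding bdd_def by (auto intro: dominated_mono)

lemma bdd_diff: "bdd L ==> bdd K ==> bdd (%U. L U - K U)"
 by (rule bddI[OF _ dominated_add[OF bddD(2)[of L] bddD(2)[of K]]]) (simp_all add: L2.diff_mem L2.nrm_diff_le bddD(1))

lemma bdd_scale: "bdd L ==> bdd (%U. c *\<^sub>C L U)"
 by (rule bddI[OF _ dominated_scale[OF bddD(2), of L "norm c"]]) (simp_all add: L2.scale_mem L2.nrm_scale bddD(1))

lemma bdd_uminus: "bdd L ==> bdd (%U. - L U)"
 using bdd_scale[of L "-1"] by (simp add: scaleC_minus_one)

lemma bdd_sum:
 assumes "!!i. i \<in> I ==> bdd (L i)" shows "bdd (%U. \<Sum>i\<in>I. L i U)"
proof -
 have "Lp_norm 2 (\<Sum>i\<in>I. L i U) <= (\<Sum>i\<in>I. Lp_norm 2 (L i U))" if "U \<in> plate_space 2" for U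
  using assms
 proof (induction I rule: infinite_finite_induct)
  case (insert i I)
  have "Lp_norm 2 (L i U + (\<Sum>i\<in>I. L i U)) <= Lp_norm 2 (L i U) + Lp_norm 2 (\<Sum>i\<in>I. L i U)"
   by (intro L2.nrm_triangle L2_sum_mem bddD(1)[OF _ that] insert.prems) auto
  then show ?case using insert by simp
 qed simp_all
 then show ?thesis by (intro bddI[OF _ dominated_sum[OF bddD(2)[OF assms]]]) (auto intro!: L2_sum_mem bddD(1) assms)
qed

lemma bdd_moll:
 assumes L: "bdd L" shows "bdd (%U. foldr dist_deriv is (moll m (L U)))"
proof -
 let ?k = "foldr schwartz_deriv is (kern m)"
 have "(LBINT y. norm (schwartz_fun ?k y)) >= 0" by simp
 note b = bddI[OF _ dominated_scale[OF bddD(2)[OF L] this]]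
 show ?thesis unfolding foldr_dist_deriv_conv by (rule b) (rule dist_conv_L2[OF bddD(1)[OF L]], assumption)+
qed

lemma bdd_laplacian: "bdd L ==> bdd (%U. dist_laplacian (moll m (L U)))"
 unfolding dist_laplacian_def using bdd_moll[of L "[i, i]" m for i] by (intro bdd_sum) simp

lemma bdd_bilaplacian: "bdd L ==> bdd (%U. dist_laplacian (dist_laplacian (moll m (L U))))"
 unfolding dist_laplacian_def dist_deriv_commute_sum using bdd_moll[of L "[i, i, j, j]" m for i j] by (intro bdd_sum) simp

lemma bdd_components:
 fixes i :: "'n::finite"
 shows "bdd (%U :: 'n state. fst U)" "bdd (%U :: 'n state. fst (snd U))" "bdd (%U :: 'n state. fst (snd (snd U)))"
 "bdd (%U :: 'n state. snd (snd (snd U)) $ i)"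
proof -
 have 0: "fst U \<in> Lp 2" "Lp_norm 2 (fst U) <= plate_norm 2 U" if "U \<in> plate_space 2" for U :: "'n state"
  using plate_components(1,5)[OF that, of "[]"] by simp_all
 have "dominated (plate_norm 2 :: 'n state => real)" by (rule dominatedI[where C = 1]) simp
 note b = bddI[OF _ this]
 show "bdd (%U :: 'n state. fst U)" by (rule b[OF 0])
 show "bdd (%U :: 'n state. fst (snd U))" by (rule b[OF plate_components(2,6)])
 show "bdd (%U :: 'n state. fst (snd (snd U)))" by (rule b[OF plate_components(3,7)])
 show "bdd (%U :: 'n state. snd (snd (snd U)) $ i)" by (rule b[OF plate_components(4,8)])
qed

lemma bounded_state_map:
 fixes f :: "'n::finite state => 'n state"
 assumes 1: "!!is. length is <= 2 ==> bdd (%U. foldr dist_deriv is (fst (f U)))" and 2: "bdd (%U. fst (snd (f U)))"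
  and 3: "bdd (%U. fst (snd (snd (f U))))" and 4: "!!i. bdd (%U. snd (snd (snd (f U))) $ i)"
  and lin: "!!U V. f (U + V) = f U + f V" "!!c U. f (c *\<^sub>C U) = c *\<^sub>C f U"
 shows "bounded_operator_on (plate_space 2) (plate_norm 2) f"
proof -
 have mem: "f U \<in> plate_space 2" if "U \<in> plate_space 2" for U
  using bddD(1)[OF 1 that] bddD(1)[OF 2 that] bddD(1)[OF 3 that] bddD(1)[OF 4 that]
  by (auto simp: plate_space_def Sobolev_def mem_Times_iff intro!: Lp_vecI(1))
 have "dominated (%U. (\<Sum>is\<in>words_upto 2. Lp_norm 2 (foldr dist_deriv is (fst (f U)))) + Lp_norm 2 (fst (snd (f U)))
   + Lp_norm 2 (fst (snd (snd (f U)))) + (\<Sum>i\<in>UNIV. Lp_norm 2 (snd (snd (snd (f U))) $ i)))"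
  by (intro dominated_add dominated_sum bddD(2) 1 2 3 4) simp
 moreover have "plate_norm 2 (f U) <= (\<Sum>is\<in>words_upto 2. Lp_norm 2 (foldr dist_deriv is (fst (f U)))) + Lp_norm 2 (fst (snd (f U)))
   + Lp_norm 2 (fst (snd (snd (f U)))) + (\<Sum>i\<in>UNIV. Lp_norm 2 (snd (snd (snd (f U))) $ i))" if "U \<in> plate_space 2" for U
  unfolding plate_norm_def case_prod_unfold
  by (intro add_mono order_refl Sobolev_norm_le_sum Lp_vecI(2) bddD(1)[OF 4 that]) auto
 ultimately have "dominated (%U. plate_norm 2 (f U))" by (rule dominated_mono)
 then show ?thesis using mem lin unfolding bounded_operator_on_def dominated_def by blast
qed

lemma bounded_moll_state: "bounded_operator_on (plate_space 2) (plate_norm 2) (moll_state m :: 'n::finite state => _)"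
proof (rule bounded_state_map)
 show "bdd (%U. foldr dist_deriv is (fst (moll_state m U :: 'n state)))" for "is"
  using bdd_moll[OF bdd_components(1)] by (simp add: moll_state_def case_prod_unfold)
 show "moll_state m (U + V) = moll_state m U + moll_state m V" "moll_state m (c *\<^sub>C U) = c *\<^sub>C moll_state m U"
  for U V :: "'n state" and c by (rule state_linear)+
qed (use bdd_moll[OF bdd_components(2), of "[]"] bdd_moll[OF bdd_components(3), of "[]"] bdd_moll[OF bdd_components(4), of "[]"] in
  \<open>simp_all add: moll_state_def case_prod_unfold\<close>)

lemma bounded_regularised:
 "bounded_operator_on (plate_space 2) (plate_norm 2) (%U :: 'n::finite state. plate_operator \<tau> (moll_state m U))"
proof (rule bounded_state_map)
 show "bdd (%U. foldr dist_deriv is (fst (plate_operator \<tau> (moll_state m U) :: 'n state)))" for "is"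
  using bdd_moll[OF bdd_components(2)] by (simp add: moll_state_def plate_operator_def case_prod_unfold)
 show "bdd (%U. fst (snd (plate_operator \<tau> (moll_state m U) :: 'n state)))"
  using bdd_diff[OF bdd_uminus[OF bdd_bilaplacian[OF bdd_components(1)]] bdd_laplacian[OF bdd_components(3)]]
  by (simp add: moll_state_def plate_operator_def case_prod_unfold)
 have "bdd (%U :: 'n state. dist_div (\<chi> i. moll m (snd (snd (snd U)) $ i)))"
  unfolding dist_div_def using bdd_moll[OF bdd_components(4), of "[i]" m i for i] by (intro bdd_sum) simp
 from bdd_diff[OF bdd_laplacian[OF bdd_components(2)] this]
 show "bdd (%U. fst (snd (snd (plate_operator \<tau> (moll_state m U) :: 'n state))))"
  by (simp add: moll_state_def plate_operator_def case_prod_unfold)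
 show "bdd (%U. snd (snd (snd (plate_operator \<tau> (moll_state m U) :: 'n state))) $ i)" for i
  using bdd_diff[OF bdd_uminus[OF bdd_scale[OF bdd_moll[OF bdd_components(3), of "[i]"]]] bdd_scale[OF bdd_moll[OF bdd_components(4), of "[]"]]]
  by (simp add: moll_state_def plate_operator_def case_prod_unfold scaleC_vec_nth dist_grad_def)
qed (simp_all add: state_linear)

lemma moll_state_tendsto:
 fixes U :: "'n::finite state"
 assumes U: "U \<in> plate_space 2" shows "(%m. plate_norm 2 (moll_state m U - U)) \<longlonglongrightarrow> 0"
proof -
 note m = plate_components(1-4)[OF U]
 have 1: "(%m. Sobolev_norm 2 2 (moll m (fst U) - fst U)) \<longlonglongrightarrow> 0"
  by (rule Sobolev_norm_tendsto_zero) (simp_all add: foldr_dist_deriv_linear foldr_dist_deriv_conv_inner moll_tendsto m)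
 have 4: "(%k. Lp_vec_norm 2 ((\<chi> i. moll k (snd (snd (snd U)) $ i)) - snd (snd (snd U)))) \<longlonglongrightarrow> 0"
  by (rule Lp_vec_norm_tendsto_zero) (simp_all add: moll_tendsto m L2.diff_mem dist_conv_L2(1))
 from tendsto_add[OF tendsto_add[OF tendsto_add[OF 1 moll_tendsto[OF m(2)]] moll_tendsto[OF m(3)]] 4]
 show ?thesis by (simp add: plate_norm_def moll_state_def case_prod_unfold)
qed

text \<open>
Convergence of the mollifications as distributions. It passes to derivatives, hence holds for
everything that the plate operator produces from square-integrable components.
\<close>

definition weakly_approximated :: "'n::finite tempdist => bool" where
 "weakly_approximated T \<longleftrightarrow> (\<forall>\<phi>. (%m. pairing (moll m T) \<phi>) \<longlonglongrightarrow> pairing T \<phi>)"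

lemma weakly_approximated_L2: "u \<in> Lp 2 ==> weakly_approximated u"
 unfolding weakly_approximated_def
 using Lp_tendsto_pairing[of 2 "%m. moll m u" u, OF _ dist_conv_L2(1) _ moll_tendsto] by simp

lemma weakly_approximated_diff:
 assumes "weakly_approximated S" "weakly_approximated T" shows "weakly_approximated (S - T)"
 using assms unfolding weakly_approximated_def dist_conv_linear minus_tempdist.rep_eq by (intro allI tendsto_diff; blast)

lemma weakly_approximated_uminus: "weakly_approximated T ==> weakly_approximated (- T)"
 unfolding weakly_approximated_def dist_conv_linear uminus_tempdist.rep_eq by (intro allI tendsto_minus; blast)

lemma weakly_approximated_scaleC: "weakly_approximated T ==> weakly_approximated (c *\<^sub>C T)"
 unfolding weakly_approximated_def dist_conv_linear scaleC_tempdist.rep_eq by (intro allI tendsto_mult tendsto_const; blast)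

lemma weakly_approximated_deriv: "weakly_approximated T ==> weakly_approximated (dist_deriv i T)"
 unfolding weakly_approximated_def dist_deriv_conv[symmetric] dist_deriv.rep_eq by (intro allI tendsto_minus; blast)

lemma weakly_approximated_sum: "(!!i. i \<in> I ==> weakly_approximated (F i)) ==> weakly_approximated (sum F I)"
proof (induction I rule: infinite_finite_induct)
 case (insert i I)
 then have "weakly_approximated (F i)" "weakly_approximated (sum F I)" by auto
 then have "weakly_approximated (F i + sum F I)"
  unfolding weakly_approximated_def dist_conv_linear plus_tempdist.rep_eq by (intro allI tendsto_add; blast)
 then show ?case using insert by simp
qed (simp_all add: weakly_approximated_def dist_conv_linear)

lemmas weakly_approximated_intros = weakly_approximated_diff weakly_approximated_uminus weakly_approximated_scaleC
 weakly_approximated_deriv weakly_approximated_sum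

lemma weakly_approximated_inject:
 assumes "weakly_approximated S" "weakly_approximated T" "!!m. moll m S = moll m T" shows "S = T"
proof (rule tempdist_eqI)
 fix \<phi> show "pairing S \<phi> = pairing T \<phi>"
  using assms(1,2)[unfolded weakly_approximated_def, rule_format, of \<phi>] unfolding assms(3) by (rule LIMSEQ_unique)
qed

text \<open>
Both \<open>plate_operator \<tau> U\<close> and \<open>V\<close> are weak limits of their
mollifications, which agree.
\<close>

lemma regularised_graph_closed:
 fixes U V :: "'n::finite state"
 assumes U: "U \<in> plate_space 2" and V: "V \<in> plate_space 2" and eq: "!!m. plate_operator \<tau> (moll_state m U) = moll_state m V"
 shows "plate_operator \<tau> U = V"
proof -
 note u = plate_components(1)[OF U, of "[]", simplified] plate_components(2-4)[OF U] and v = plate_components(1)[OF V, of "[]", simplified] plate_components(2-4)[OF V]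
 note wu = u[THEN weakly_approximated_L2] and wv = v[THEN weakly_approximated_L2]
 let ?W = "plate_operator \<tau> U"
 have "moll_state m ?W = moll_state m V" for m using eq[of m] by (simp add: plate_operator_moll)
 then have eq': "moll m (fst ?W) = moll m (fst V)" "moll m (fst (snd ?W)) = moll m (fst (snd V))"
  "moll m (fst (snd (snd ?W))) = moll m (fst (snd (snd V)))"
  "moll m (snd (snd (snd ?W)) $ i) = moll m (snd (snd (snd V)) $ i)" for m i
  unfolding moll_state_def case_prod_unfold by (simp_all add: vec_eq_iff)
 note comp = plate_operator_def case_prod_unfold dist_laplacian_def dist_div_def dist_grad_def fst_conv snd_conv
  vector_minus_component vector_uminus_component scaleC_vec_nth vec_lambda_beta
 have "weakly_approximated (fst ?W)" unfolding comp by (rule wu)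
 from weakly_approximated_inject[OF this wv(1) eq'(1)] have 1: "fst ?W = fst V" .
 have "weakly_approximated (fst (snd ?W))" unfolding comp by (intro weakly_approximated_intros wu)
 from weakly_approximated_inject[OF this wv(2) eq'(2)] have 2: "fst (snd ?W) = fst (snd V)" .
 have "weakly_approximated (fst (snd (snd ?W)))" unfolding comp by (intro weakly_approximated_intros wu)
 from weakly_approximated_inject[OF this wv(3) eq'(3)] have 3: "fst (snd (snd ?W)) = fst (snd (snd V))" .
 have "weakly_approximated (snd (snd (snd ?W)) $ i)" for i unfolding comp by (intro weakly_approximated_intros wu)
 from weakly_approximated_inject[OF this wv(4) eq'(4)] have 4: "snd (snd (snd ?W)) $ i = snd (snd (snd V)) $ i" for i .
 show ?thesis using 1 2 3 4 unfolding prod_eq_iff vec_eq_iff by blast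
qed

subsection \<open>The energy as an inner product\<close>

lemma energy_unfold:
 "energy \<tau> U W = (\<Sum>is\<in>words_upto 2. ip (foldr dist_deriv is (fst U)) (foldr dist_deriv is (fst W)))
   + ip (fst (snd U)) (fst (snd W)) + ip (fst (snd (snd U))) (fst (snd (snd W)))
   + \<tau> * (\<Sum>i\<in>UNIV. ip (snd (snd (snd U)) $ i) (snd (snd (snd W)) $ i))"
 by (simp add: energy_def case_prod_unfold)

lemma energy_bilinear:
 fixes U V W :: "'n::finite state"
 assumes "U \<in> plate_space 2" "V \<in> plate_space 2" "W \<in> plate_space 2"
 shows "energy \<tau> (U + V) W = energy \<tau> U W + energy \<tau> V W" "energy \<tau> (complex_of_real r *\<^sub>C U) W = r * energy \<tau> U W"
  "energy \<tau> U W = energy \<tau> W U"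
proof -
 note u = plate_components(1-4)[OF assms(1)] and v = plate_components(1-4)[OF assms(2)] and w = plate_components(1-4)[OF assms(3)]
 show "energy \<tau> (U + V) W = energy \<tau> U W + energy \<tau> V W"
  unfolding energy_unfold fst_add snd_add foldr_dist_deriv_linear vector_add_component
  by (simp add: ip_linear(1) u v w sum.distrib distrib_left)
 show "energy \<tau> (complex_of_real r *\<^sub>C U) W = r * energy \<tau> U W"
  unfolding energy_unfold scaleC_prod_def fst_conv snd_conv foldr_dist_deriv_linear scaleC_vec_nth
  by (simp add: u w ip_scale sum_distrib_left distrib_left mult.left_commute)
 show "energy \<tau> U W = energy \<tau> W U"
  unfolding energy_unfold by (intro arg_cong2[where f = "(+)"] arg_cong[where f = "(*) \<tau>"] sum.cong refl ip_commute u w) auto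
qed

lemma energy_bound:
 fixes U W :: "'n::finite state"
 assumes U: "U \<in> plate_space 2" and W: "W \<in> plate_space 2" and \<tau>: "\<tau> > 0"
 shows "\<bar>energy \<tau> U W\<bar> <= (real (card (words_upto 2 :: 'n list set)) + 2 + \<tau> * real CARD('n)) * (plate_norm 2 U * plate_norm 2 W)"
proof -
 note u = plate_components[OF U] and w = plate_components[OF W]
 let ?P = "plate_norm 2 U * plate_norm 2 W"
 have b: "\<bar>ip a c\<bar> <= ?P" if "a \<in> Lp 2" "c \<in> Lp 2" "Lp_norm 2 a <= plate_norm 2 U" "Lp_norm 2 c <= plate_norm 2 W" for a c :: "'n tempdist"
  by (rule order_trans[OF ip_le[OF that(1,2)]]) (use that plate.nrm_nonneg[OF U] in \<open>intro mult_mono, auto\<close>)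
 have 1: "\<bar>\<Sum>is\<in>words_upto 2. ip (foldr dist_deriv is (fst U)) (foldr dist_deriv is (fst W))\<bar> <= real (card (words_upto 2 :: 'n list set)) * ?P"
  by (rule order_trans[OF sum_abs sum_bounded_above]) (auto intro!: b u w)
 have 2: "\<bar>ip (fst (snd U)) (fst (snd W))\<bar> <= ?P" "\<bar>ip (fst (snd (snd U))) (fst (snd (snd W)))\<bar> <= ?P" by (intro b u w)+
 have "\<bar>\<Sum>i\<in>UNIV. ip (snd (snd (snd U)) $ i) (snd (snd (snd W)) $ i)\<bar> <= real CARD('n) * ?P"
  by (rule order_trans[OF sum_abs sum_bounded_above]) (auto intro!: b u w)
 from mult_left_mono[OF this, of \<tau>] \<tau>
 have 3: "\<bar>\<tau> * (\<Sum>i\<in>UNIV. ip (snd (snd (snd U)) $ i) (snd (snd (snd W)) $ i))\<bar> <= \<tau> * real CARD('n) * ?P" by (simp add: abs_mult mult.assoc)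
 show ?thesis unfolding energy_unfold distrib_right using 1 2 3 by linarith
qed

text \<open>
Each component of the norm is bounded by a multiple of the square root of the energy.
\<close>

lemma energy_coercive:
 assumes \<tau>: "\<tau> > 0"
 shows "\<exists>c>0. \<forall>U\<in>plate_space 2. c * (plate_norm 2 (U :: 'n::finite state))\<^sup>2 <= energy \<tau> U U"
proof -
 define C where "C = real (card (words_upto 2 :: 'n list set)) + 2 + real CARD('n) / sqrt \<tau>"
 have C: "C > 0" unfolding C_def using \<tau> by (intro add_pos_nonneg add_nonneg_pos) auto
 have "(1 / C\<^sup>2) * (plate_norm 2 U)\<^sup>2 <= energy \<tau> U U" if U: "U \<in> plate_space 2" for U :: "'n state"
 proof -
  obtain u v \<theta> q where UU: "U = (u, v, \<theta>, q)" by (metis prod.exhaust)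
  define e where "e = energy \<tau> (u, v, \<theta>, q) (u, v, \<theta>, q)"
  note ec = energy_controls[OF \<tau> U[unfolded UU], folded e_def]
  have "Sobolev_norm 2 2 u <= (\<Sum>is\<in>words_upto 2. Lp_norm 2 (foldr dist_deriv is u))" by (rule Sobolev_norm_le_sum) simp
  also have "... <= real (card (words_upto 2 :: 'n list set)) * sqrt e"
   by (rule sum_bounded_above) (auto intro: real_le_rsqrt ec)
  finally have 1: "Sobolev_norm 2 2 u <= real (card (words_upto 2 :: 'n list set)) * sqrt e" .
  have 2: "Lp_norm 2 v <= sqrt e" "Lp_norm 2 \<theta> <= sqrt e" by (auto intro: real_le_rsqrt ec)
  have "Lp_vec_norm 2 q <= (\<Sum>i\<in>UNIV. Lp_norm 2 (q $ i))"
   by (rule Lp_vecI(2)) (use plate_components(4)[OF U] in \<open>auto simp: UU\<close>)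
  also have "... <= real CARD('n) * sqrt (e / \<tau>)"
  proof (rule sum_bounded_above)
   show "Lp_norm 2 (q $ i) <= sqrt (e / \<tau>)" for i
    by (rule real_le_rsqrt) (use ec(6)[of i] \<tau> in \<open>simp add: pos_le_divide_eq mult.commute\<close>)
  qed
  finally have 3: "Lp_vec_norm 2 q <= real CARD('n) / sqrt \<tau> * sqrt e" by (simp add: real_sqrt_divide)
  have "plate_norm 2 U <= C * sqrt e" unfolding UU plate_norm_def prod.case C_def distrib_right using 1 2 3 by linarith
  then have "(plate_norm 2 U)\<^sup>2 <= (C * sqrt e)\<^sup>2" using plate.nrm_nonneg[OF U] by (rule power_mono)
  also have "... = C\<^sup>2 * e" using ec(1) by (simp add: power_mult_distrib)
  finally show ?thesis using C by (simp add: UU e_def pos_divide_le_eq mult.commute)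
 qed
 then show ?thesis using C by (intro exI[of _ "1 / C\<^sup>2"]) auto
qed

subsection \<open>The energy space as a type\<close>

text \<open>
For \<open>p = 2\<close> the space does not depend on a parameter, so it can be a type; it then is
an instance of the class of Banach spaces, to which the exponential of operators applies.
\<close>

typedef 'n plate = "plate_space 2 :: 'n::finite state set" morphisms state_of Plate
 using plate.zero_mem by blast

setup_lifting type_definition_plate

instantiation plate :: (finite) real_normed_vector
begin

lift_definition zero_plate :: "'a plate" is 0 by (rule plate.zero_mem)
lift_definition plus_plate :: "'a plate => 'a plate => 'a plate" is "(+)" by (rule plate.add_mem)
lift_definition minus_plate :: "'a plate => 'a plate => 'a plate" is "(-)" by (rule plate.diff_mem)
lift_definition uminus_plate :: "'a plate => 'a plate" is uminus by (rule plate.uminus_mem)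
lift_definition scaleR_plate :: "real => 'a plate => 'a plate" is "%r U. complex_of_real r *\<^sub>C U" by (rule plate.scale_mem)
lift_definition norm_plate :: "'a plate => real" is "plate_norm 2" .
definition dist_plate :: "'a plate => 'a plate => real" where "dist_plate x y = norm (x - y)"
definition sgn_plate :: "'a plate => 'a plate" where "sgn_plate x = inverse (norm x) *\<^sub>R x"
definition uniformity_plate :: "('a plate \<times> 'a plate) filter" where
 "uniformity_plate = (INF e\<in>{0<..}. principal {(x, y). dist x y < e})"
definition open_plate :: "'a plate set => bool" where
 "open_plate U = (\<forall>x\<in>U. \<forall>\<^sub>F (x', y) in uniformity. x' = x --> y \<in> U)"

instance
proof
 show "norm x = 0 \<longleftrightarrow> x = 0" for x :: "'a plate" by transfer (auto dest: plate.nrm_eq_0)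
 show "norm (x + y) <= norm x + norm y" for x y :: "'a plate" by transfer (rule plate.nrm_triangle)
 show "norm (r *\<^sub>R x) = \<bar>r\<bar> * norm x" for r and x :: "'a plate" by transfer (simp add: plate.nrm_scale)
qed (simp_all add: dist_plate_def sgn_plate_def uniformity_plate_def open_plate_def,
  (transfer; simp add: scaleC_add_right scaleC_add_left scaleC_scaleC scaleC_one algebra_simps)+)

end

instance plate :: (finite) banach
proof
 fix s :: "nat => 'a plate" assume "Cauchy s"
 then have "\<exists>y\<in>plate_space 2. (%k. plate_norm 2 (state_of (s k) - y)) \<longlonglongrightarrow> 0"
  by (intro plate.complete state_of) (auto simp: Cauchy_def dist_norm norm_plate.rep_eq minus_plate.rep_eq)
 then obtain y where y: "y \<in> plate_space 2" "(%k. plate_norm 2 (state_of (s k) - y)) \<longlonglongrightarrow> 0" by blast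
 then have "(%k. norm (s k - Plate y)) \<longlonglongrightarrow> 0" by (simp add: norm_plate.rep_eq minus_plate.rep_eq Plate_inverse)
 then have "s \<longlonglongrightarrow> Plate y" by (rule LIM_zero_cancel[OF tendsto_norm_zero_cancel])
 then show "convergent s" by (rule convergentI)
qed

lemma plate_nontrivial: "\<exists>x :: 'n::finite plate. x ~= 0"
proof -
 define w :: "'n tempdist" where "w = D P1 (Complex 1 1) - D P1 (Complex 1 0)"
 have z: "Re (Complex 1 1) > 0" "Re (Complex 1 0) > 0" by simp_all
 have w: "w \<in> Lp 2" unfolding w_def by (intro L2.diff_mem D_Lp z) auto
 have "represented_by w (%x. E P1 (Complex 1 1) x - E P1 (Complex 1 0) x)"
  unfolding w_def D_def by (intro represented_by_diff represented_by_schwartz is_schwartz_E z)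
 from Lp_norm_eq[OF this, of 2] have "w ~= 0" using beam_moves[where 'n = 'n] by auto
 moreover have m: "(0, w, 0, 0) \<in> plate_space 2" using plate.zero_mem[where 'n = 'n] w by (auto simp: plate_space_def zero_prod_def)
 ultimately have "Plate (0, w, 0, 0) ~= 0"
  using Plate_inverse[OF m] by (metis fst_conv prod.sel snd_conv zero_plate.rep_eq zero_prod_def)
 then show ?thesis by blast
qed

instance plate :: (finite) perfect_space
proof
 fix x :: "'a plate"
 obtain y :: "'a plate" where y: "y ~= 0" using plate_nontrivial by blast
 show "\<not> open {x}"
 proof
  assume "open {x}"
  then obtain e where e: "e > 0" "!!z. dist z x < e ==> z = x" unfolding open_dist by auto
  have "x + (e / (2 * norm y)) *\<^sub>R y = x" by (rule e(2)) (use y e(1) in \<open>simp add: dist_norm\<close>)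
  then show False using y e(1) by simp
 qed
qed

lemma plate_eqI: "state_of x = state_of y ==> x = y"
 by (simp add: state_of_inject)

definition plate_op :: "('n::finite state => 'n state) => 'n plate endo" where
 "plate_op f = Endo (Blinfun (%x. Plate (f (state_of x))))"

lemma state_of_plate_op:
 fixes f :: "'n::finite state => 'n state"
 assumes f: "bounded_operator_on (plate_space 2) (plate_norm 2) f"
 shows "state_of (app (plate_op f) x) = f (state_of x)"
proof -
 note d = plate.bounded_operatorD[OF f]
 obtain C where C: "!!U. U \<in> plate_space 2 ==> plate_norm 2 (f U) <= C * plate_norm 2 U"
  using f unfolding bounded_operator_on_def by blast
 have r: "state_of (Plate (f (state_of x))) = f (state_of x)" for x by (rule Plate_inverse[OF d(1)[OF state_of]])
 have "bounded_linear (%x. Plate (f (state_of x)))"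
 proof (rule bounded_linear_intro[where K = C])
  show "Plate (f (state_of (x + y))) = Plate (f (state_of x)) + Plate (f (state_of y))" for x y
   by (rule plate_eqI) (simp only: r plus_plate.rep_eq d(2)[OF state_of state_of] Plate_inverse plate.add_mem d(1)[OF state_of])
  show "Plate (f (state_of (c *\<^sub>R x))) = c *\<^sub>R Plate (f (state_of x))" for c x
   by (rule plate_eqI) (simp only: r scaleR_plate.rep_eq d(4)[OF state_of] Plate_inverse plate.scale_mem d(1)[OF state_of])
  show "norm (Plate (f (state_of x))) <= norm x * C" for x
   unfolding norm_plate.rep_eq r by (rule ord_le_eq_trans[OF C[OF state_of] mult.commute])
 qed
 then show ?thesis by (simp add: plate_op_def app_Endo r)
qed

lemma bounded_scaleC: "bounded_operator_on (plate_space 2) (plate_norm 2) (%U :: 'n::finite state. c *\<^sub>C U)"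
 unfolding bounded_operator_on_def
 by (auto simp: plate.scale_mem scaleC_add_right scaleC_scaleC mult.commute plate.nrm_scale intro!: exI[of _ "norm c"])

text \<open>
The abstract generation result, applied to the energy space and read back on states. Complex
linearity of the semigroup holds because multiplication by a complex number commutes with all
\<open>B m\<close>.
\<close>

theorem generates_semigroup:
 assumes \<tau>: "\<tau> > 0"
 shows "generates_C0_semigroup (plate_space 2 :: 'n::finite state set) (plate_norm 2) (plate_domain \<tau> 2) (plate_operator \<tau>)"
proof -
 define B where "B m = (plate_op (%U. plate_operator \<tau> (moll_state m U)) :: 'n plate endo)" for m
 define J where "J m = (plate_op (moll_state m) :: 'n plate endo)" for m
 have Bs: "state_of (app (B m) x) = plate_operator \<tau> (moll_state m (state_of x))" for m x
  unfolding B_def by (rule state_of_plate_op[OF bounded_regularised])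
 have Js: "state_of (app (J m) x) = moll_state m (state_of x)" for m x
  unfolding J_def by (rule state_of_plate_op[OF bounded_moll_state])
 define graph where "graph x y \<longleftrightarrow> plate_operator \<tau> (state_of x) = state_of y" for x y :: "'n plate"
 define Q where "Q x y = energy \<tau> (state_of x) (state_of y)" for x y :: "'n plate"
 obtain c where c: "c > 0" "!!U. U \<in> plate_space 2 ==> c * (plate_norm 2 (U :: 'n state))\<^sup>2 <= energy \<tau> U U"
  using energy_coercive[OF \<tau>, where 'n = 'n] by blast
 interpret R: regularised_operator B J graph Q c "1 + real CARD('n) + 1 / \<tau>"
 proof (rule regularised_operator.intro)
  note bil = energy_bilinear[OF state_of state_of state_of, of \<tau>]
  show sym: "Q x y = Q y x" for x y unfolding Q_def by (rule bil(3))
  show "bounded_bilinear Q"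
  proof
   show 1: "Q (x + y) z = Q x z + Q y z" for x y z unfolding Q_def plus_plate.rep_eq by (rule bil(1))
   show 2: "Q (r *\<^sub>R x) z = r *\<^sub>R Q x z" for r x z unfolding Q_def scaleR_plate.rep_eq real_scaleR_def by (rule bil(2))
   show "Q z (x + y) = Q z x + Q z y" for x y z by (simp only: sym[of z] 1)
   show "Q z (r *\<^sub>R x) = r *\<^sub>R Q z x" for r x z by (simp only: sym[of z] 2)
   show "\<exists>K. \<forall>x y. norm (Q x y) <= norm x * norm y * K"
    proof (intro exI allI)
     show "norm (Q x y) <= norm x * norm y * (real (card (words_upto 2 :: 'n list set)) + 2 + \<tau> * real CARD('n))" for x y
      unfolding Q_def norm_plate.rep_eq real_norm_def
      by (rule ord_le_eq_trans[OF energy_bound[OF state_of state_of \<tau>] mult.commute])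
    qed
  qed
  show "c > 0" by (rule c(1))
  show "c * (norm x)\<^sup>2 <= Q x x" for x unfolding Q_def norm_plate.rep_eq by (rule c(2)[OF state_of])
  show "0 <= 1 + real CARD('n) + 1 / \<tau>" using \<tau> by simp
  show "Q (app (B m) x) x <= (1 + real CARD('n) + 1 / \<tau>) * Q x x" for m x
   unfolding Q_def Bs by (rule energy_dissipative[OF \<tau> state_of])
  show "B m * B k = B k * B m" for m k
   by (rule endo_eqI, rule plate_eqI) (simp only: app_times Bs plate_operator_moll moll_state_commute[of m k])
  show "J k * B m = B m * J k" for m k
   by (rule endo_eqI, rule plate_eqI) (simp only: app_times Bs Js plate_operator_moll moll_state_commute[of m k])
  show "(%m. app (J m) x) \<longlonglongrightarrow> x" for x
  proof -
   have "(%m. norm (app (J m) x - x)) \<longlonglongrightarrow> 0"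
    using moll_state_tendsto[OF state_of[of x]] by (simp only: norm_plate.rep_eq minus_plate.rep_eq Js)
   then show ?thesis by (rule LIM_zero_cancel[OF tendsto_norm_zero_cancel])
  qed
  show "app (B m) x = app (J m) y" if "graph x y" for x y m
   by (rule plate_eqI) (simp only: Bs Js plate_operator_moll that[unfolded graph_def])
  show "graph (app (J m) x) (app (B m) x)" for m x by (simp add: graph_def Bs Js)
  show "graph x y" if "!!m. app (B m) x = app (J m) y" for x y
   unfolding graph_def
   by (rule regularised_graph_closed[OF state_of state_of]) (use arg_cong[OF that, of state_of] in \<open>simp only: Bs Js\<close>)
 qed
 define T where "T t U = state_of (R.T t (Plate U))" for t and U :: "'n state"
 have Pl: "Plate (U + V) = Plate U + Plate V" "Plate (c *\<^sub>C U) = app (plate_op ((*\<^sub>C) c)) (Plate U)"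
  if "U \<in> plate_space 2" "V \<in> plate_space 2" for U V :: "'n state" and c
  by (rule plate_eqI, simp only: plus_plate.rep_eq Plate_inverse plate.add_mem that)
    (rule plate_eqI, simp only: state_of_plate_op[OF bounded_scaleC] Plate_inverse plate.scale_mem that)
 have comm: "plate_op ((*\<^sub>C) c) * B m = B m * plate_op ((*\<^sub>C) c)" for c m
  by (rule endo_eqI, rule plate_eqI) (simp only: app_times Bs state_of_plate_op[OF bounded_scaleC] state_linear)
 have C0: "C0_semigroup_on (plate_space 2) (plate_norm 2) T"
  unfolding C0_semigroup_on_def bounded_operator_on_def
 proof (intro conjI allI impI ballI)
  fix t :: real assume t: "0 <= t"
  show "T t U \<in> plate_space 2" for U unfolding T_def by (rule state_of)
  show "T t (U + V) = T t U + T t V" if "U \<in> plate_space 2" "V \<in> plate_space 2" for U V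
   by (simp add: T_def Pl[OF that] R.T_add[OF t] plus_plate.rep_eq)
  show "T t (c *\<^sub>C U) = c *\<^sub>C T t U" if "U \<in> plate_space 2" for c U
   by (simp add: T_def Pl[OF that that] R.T_commute[OF t comm] state_of_plate_op[OF bounded_scaleC])
  have "plate_norm 2 (T t U) <= R.G t * plate_norm 2 U" if "U \<in> plate_space 2" for U
   using R.T_bound[OF t, of "Plate U"] by (simp add: T_def norm_plate.rep_eq Plate_inverse[OF that])
  then show "\<exists>C. \<forall>U\<in>plate_space 2. plate_norm 2 (T t U) <= C * plate_norm 2 U" by blast
 next
  show "T 0 U = U" if "U \<in> plate_space 2" for U by (simp add: T_def R.T_zero Plate_inverse[OF that])
  show "T (s + t) U = T s (T t U)" if "0 <= s" "0 <= t" for s t U by (simp add: T_def R.T_semigroup[OF that] state_of_inverse)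
  show "((%t. plate_norm 2 (T t U - U)) \<longlongrightarrow> 0) (at_right 0)" if "U \<in> plate_space 2" for U
   using tendsto_norm_zero[OF LIM_zero[OF R.T_continuous[of "Plate U"]]]
   by (simp add: T_def norm_plate.rep_eq minus_plate.rep_eq Plate_inverse[OF that])
 qed
 have gen: "has_generator_value (plate_norm 2) T U V \<longleftrightarrow> plate_operator \<tau> U = V"
  if U: "U \<in> plate_space 2" and V: "V \<in> plate_space 2" for U V
 proof -
  have "has_generator_value (plate_norm 2) T U V \<longleftrightarrow> ((%h. norm ((1 / h) *\<^sub>R (R.T h (Plate U) - Plate U) - Plate V)) \<longlongrightarrow> 0) (at_right 0)"
   by (simp add: has_generator_value_def T_def norm_plate.rep_eq minus_plate.rep_eq scaleR_plate.rep_eq Plate_inverse[OF U] Plate_inverse[OF V])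
  also have "... \<longleftrightarrow> ((%h. (1 / h) *\<^sub>R (R.T h (Plate U) - Plate U)) \<longlongrightarrow> Plate V) (at_right 0)"
   unfolding tendsto_norm_zero_iff LIM_zero_iff ..
  also have "... \<longleftrightarrow> graph (Plate U) (Plate V)" using R.T_derivative R.derivative_in_graph by blast
  finally show ?thesis by (simp add: graph_def Plate_inverse[OF U] Plate_inverse[OF V])
 qed
 have "is_generator_of (plate_space 2) (plate_norm 2) T (plate_domain \<tau> 2) (plate_operator \<tau>)"
  unfolding is_generator_of_def
 proof (intro conjI ballI)
  show "(plate_domain \<tau> 2 :: 'n state set) = {U \<in> plate_space 2. \<exists>V\<in>plate_space 2. has_generator_value (plate_norm 2) T U V}"
   unfolding plate_domain_def by (rule Collect_cong) (metis gen)
  fix U :: "'n state" assume "U \<in> plate_domain \<tau> 2"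
  then have U: "U \<in> plate_space 2" "plate_operator \<tau> U \<in> plate_space 2" unfolding plate_domain_def by simp_all
  then show "plate_operator \<tau> U \<in> plate_space 2" "has_generator_value (plate_norm 2) T U (plate_operator \<tau> U)"
   using gen[OF U] by blast+
 qed
 then show ?thesis using C0 unfolding generates_C0_semigroup_def by blast
qed

theorem theorem4p4:
  fixes \<tau> :: real
  assumes "\<tau> > 0"
  shows "(generates_C0_semigroup (plate_space 2 :: 'n::finite state set) (plate_norm 2)
            (plate_domain \<tau> 2) (plate_operator \<tau>) \<and>
          \<not> generates_analytic_semigroup (plate_space 2 :: 'n::finite state set) (plate_norm 2)
            (plate_domain \<tau> 2) (plate_operator \<tau>)) \<and>
         (\<forall>p. 1 < p \<and> p \<noteq> 2 \<longrightarrow>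
           \<not> generates_C0_semigroup (plate_space p :: 'n::finite state set) (plate_norm p)
              (plate_domain \<tau> p) (plate_operator \<tau>))"
proof (intro conjI allI impI)
  show "generates_C0_semigroup (plate_space 2 :: 'n state set) (plate_norm 2) (plate_domain \<tau> 2) (plate_operator \<tau>)"
    by (rule generates_semigroup[OF assms])
  show "\<not> generates_analytic_semigroup (plate_space 2 :: 'n state set) (plate_norm 2) (plate_domain \<tau> 2) (plate_operator \<tau>)"
    by (rule no_analytic_semigroup[OF assms])
  show "\<not> generates_C0_semigroup (plate_space p :: 'n state set) (plate_norm p) (plate_domain \<tau> p) (plate_operator \<tau>)"
    if "1 < p \<and> p \<noteq> 2" for p
    using no_C0_semigroup[OF assms, of p] that by simp
qed

end
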